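(* Let $(\mathcal C,\circ,I,\bullet,J)$ be a $\bullet$-braided duoidal category with a reversion. If $A$ and $B$ are Hopf monoids in it, then so is $A\bullet B$. As a consequence, the category $\mathrm{Hopf}(\mathcal C,\circ,\bullet)$ of Hopf monoids is a monoidal category with tensor product $\bullet$ and unit object $J$.
   Context: Conventions: composition is juxtaposition (right to left), an object also denotes its identity morphism, associativity constraints are suppressed. Duoidal category $(\mathcal C,\circ,I,\bullet,J)$: a category with monoidal structures $(\mathcal C,\circ,I)$, $(\mathcal C,\bullet,J)$ (left/right unit constraints $l^\circ,r^\circ$, resp. $l^\bullet,r^\bullet$), a natural transformation $\zeta_{A,B,C,D}:(A\bullet B)\circ(C\bullet D)\to(A\circ C)\bullet(B\circ D)$ and morphisms $\Delta_I:I\to I\bullet I$, $m_J:J\circ J\to J$, $\varepsilon_I=u_J:I\to J$ such that $(J,m_J,u_J)$ is a monoid in $(\mathcal C,\circ,I)$, $(I,\Delta_I,\varepsilon_I)$ is a comonoid in $(\mathcal C,\bullet,J)$, and $\zeta_{A,B,C\circ E,D\circ F}((A\bullet B)\circ\zeta_{C,D,E,F})=\zeta_{A\circ C,B\circ D,E,F}(\zeta_{A,B,C,D}\circ(E\bullet F))$, $((A\circ D)\bullet\zeta_{B,C,E,F})\zeta_{A,B\bullet C,D,E\bullet F}=(\zeta_{A,B,D,E}\bullet(C\circ F))\zeta_{A\bullet B,C,D\bullet E,F}$, $(l^\circ_A\bullet l^\circ_B)\zeta_{I,I,A,B}(\Delta_I\circ(A\bullet B))=l^\circ_{A\bullet B}$,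 $(r^\circ_A\bullet r^\circ_B)\zeta_{A,B,I,I}((A\bullet B)\circ\Delta_I)=r^\circ_{A\bullet B}$, $l^\bullet_{A\circ B}(m_J\bullet(A\circ B))\zeta_{J,A,J,B}=l^\bullet_A\circ l^\bullet_B$, $r^\bullet_{A\circ B}((A\circ B)\bullet m_J)\zeta_{A,J,B,J}=r^\bullet_A\circ r^\bullet_B$. It is $\bullet$-braided if $(\mathcal C,\bullet,J)$ has a braiding $\sigma_{X,Y}:X\bullet Y\to Y\bullet X$ with $\sigma_{A\circ C,B\circ D}\zeta_{A,B,C,D}=\zeta_{B,A,D,C}(\sigma_{A,B}\circ\sigma_{C,D})$ and $\sigma_{I,I}\Delta_I=\Delta_I$. Bimonoid: $(H,m_H,u_H,\Delta_H,\varepsilon_H)$ with $(H,m_H,u_H)$ a monoid in $(\mathcal C,\circ,I)$, $(H,\Delta_H,\varepsilon_H)$ a comonoid in $(\mathcal C,\bullet,J)$ and $\Delta_Hm_H=(m_H\bullet m_H)\zeta_{H,H,H,H}(\Delta_H\circ\Delta_H)$, $\varepsilon_Hm_H=m_J(\varepsilon_H\circ\varepsilon_H)$, $\Delta_Hu_H=(u_H\bullet u_H)\Delta_I$, $\varepsilon_Hu_H=\varepsilon_I$; morphisms are morphisms of monoids and comonoids. In a $\bullet$-braided duoidal category, for bimonoids $A,B$ the object $A\bullet B$ is a bimonoid with $m_{A\bullet B}=(m_A\bullet m_B)\zeta_{A,B,A,B}$, $u_{A\bullet B}=(u_A\bullet u_B)\Delta_I$, $\Delta_{A\bullet B}=(A\bullet\sigma_{A,B}\bullet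 B)(\Delta_A\bullet\Delta_B)$, $\varepsilon_{A\bullet B}=l^\bullet_J(\varepsilon_A\bullet\varepsilon_B)$; bimonoids form a monoidal category under $\bullet$ with unit $J$. Reversion: a functor $(-)^-:\mathcal C\to\mathcal C$ with lax monoidal structures $(\phi^\circ_{X,Y}:X^-\circ Y^-\to(Y\circ X)^-,\ \phi^\circ_0:I\to I^-)$ from $(\mathcal C,\circ^{\mathrm{rev}})$ to $(\mathcal C,\circ)$ and $(\phi^\bullet_{X,Y}:X^-\bullet Y^-\to(Y\bullet X)^-,\ \phi^\bullet_0:J\to J^-)$ from $(\mathcal C,\bullet^{\mathrm{rev}})$ to $(\mathcal C,\bullet)$ ($\mathrm{rev}$ = reversed tensor product), forming a double lax monoidal functor $(\mathcal C,\circ^{\mathrm{rev}},\bullet^{\mathrm{rev}})\to(\mathcal C,\circ,\bullet)$, i.e. $\phi^\bullet_{C\circ A,D\circ B}(\phi^\circ_{A,C}\bullet\phi^\circ_{B,D})\zeta_{A^-,B^-,C^-,D^-}=(\zeta_{D,C,B,A})^-\phi^\circ_{B\bullet A,D\bullet C}(\phi^\bullet_{A,B}\circ\phi^\bullet_{C,D})$, $\phi^\bullet_{I,I}(\phi^\circ_0\bullet\phi^\circ_0)\Delta_I=(\Delta_I)^-\phi^\circ_0$, $(m_J)^-\phi^\circ_{J,J}(\phi^\bullet_0\circ\phi^\bullet_0)=\phi^\bullet_0m_J$, $\phi^\bullet_0\varepsilon_I=(\varepsilon_I)^-\phi^\circ_0$; together with natural transformations $\gamma_{X,Y,Z,T}:((X\bullet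 Y^-)\circ Z)\bullet T\to X\circ(Z\bullet(Y\circ T))$, $\delta_{X,Y,Z,T}:X\bullet(Y\circ(Z^-\bullet T))\to((X\circ Z)\bullet Y)\circ T$, $\widetilde\gamma_{X,Y,Z,T}:X^-\bullet((Y\bullet Z)\circ T)\to Z\circ((X\circ Y)^-\bullet T)$, $\widetilde\delta_{X,Y,Z,T}:(X\circ(Y\bullet Z))\bullet T^-\to(X\bullet(Z\circ T)^-)\circ Y$. Put $\psi_{X,Y}=\gamma_{J,X,I,Y}(((l^\bullet_{X^-})^{-1}\circ I)\bullet Y)((r^\circ_{X^-})^{-1}\bullet Y):X^-\bullet Y\to J\circ(I\bullet(X\circ Y))$, $\varphi_{X,Y}=\delta_{X,I,Y,J}(X\bullet(I\circ(r^\bullet_{Y^-})^{-1}))(X\bullet(l^\circ_{Y^-})^{-1}):X\bullet Y^-\to((X\circ Y)\bullet I)\circ J$, $\widetilde\psi_{X,Y}=l^\circ_{(X\circ Y)^-}(I\circ r^\bullet_{(X\circ Y)^-})\widetilde\gamma_{X,Y,I,J}:X^-\bullet((Y\bullet I)\circ J)\to(X\circ Y)^-$, $\widetilde\varphi_{X,Y}=r^\circ_{(X\circ Y)^-}(l^\bullet_{(X\circ Y)^-}\circ I)\widetilde\delta_{J,I,X,Y}:(J\circ(I\bullet X))\bullet Y^-\to(X\circ Y)^-$. Axioms, for all objects ($\Delta_J:J\to J\bullet J$ is the inverse unit constraint): (R1) $\gamma_{X,Y,Z\circ U,T\circ V}\zeta_{(X\bullet Y^-)\circ Z,T,U,V}=(X\circ\zeta_{Z,Y\circ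 T,U,V})(\gamma_{X,Y,Z,T}\circ(U\bullet V))$. (R2) $((X\circ T)\bullet\gamma_{Y,Z,U,V})(\zeta_{X,Y\bullet Z^-,T,U}\bullet V)=\zeta_{X,Y,T,U\bullet(Z\circ V)}\gamma_{X\bullet Y,Z,T\bullet U,V}$. (R3) $\delta_{X\circ Z,Y\circ T,U,V}\zeta_{X,Y,Z,T\circ(U^-\bullet V)}=(\zeta_{X,Y,Z\circ U,T}\circ V)((X\bullet Y)\circ\delta_{Z,T,U,V})$. (R4) $(\delta_{X,Y,T,U}\bullet(Z\circ V))(X\bullet\zeta_{Y,Z,T^-\bullet U,V})=\zeta_{(X\circ T)\bullet Y,Z,U,V}\delta_{X,Y\bullet Z,T,U\bullet V}$. (R5) $\delta_{X,Y,T,U\bullet(Z\circ V)}(X\bullet\gamma_{Y,Z,T^-\bullet U,V})=\gamma_{(X\circ T)\bullet Y,Z,U,V}(\delta_{X,Y\bullet Z^-,T,U}\bullet V)$. (R6) $l^\circ_{I\bullet I}(I\circ(I\bullet l^\circ_I))\gamma_{I,I,I,I}(((I\bullet\phi^\circ_0)\Delta_I\circ I)\bullet I)=l^\circ_I\bullet I$. (R7) $r^\circ_{I\bullet I}((r^\circ_I\bullet I)\circ I)\delta_{I,I,I,I}(I\bullet(I\circ(\phi^\circ_0\bullet I)\Delta_I))=I\bullet r^\circ_I$. (R8) $\gamma_{X\circ Z,Y,J\circ J,U}((\delta_{X,Y^-,Z,J}\circ J)\bullet U)(((X\bullet(Y^-\circ(r^\bullet_{Z^-})^{-1}))\circ J)\bullet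 U)=(X\circ Z\circ\zeta_{J,Y,J,U})(X\circ Z\circ(l^\bullet_Y)^{-1}\circ(l^\bullet_U)^{-1})(X\circ l^\bullet_{Z\circ Y\circ U})\gamma_{X,Z\circ Y,J,U}(((X\bullet\phi^\circ_{Y,Z})\circ J)\bullet U)$. (R9) $\delta_{X,J\circ J,Z,Y\circ U}(X\bullet(J\circ\gamma_{J,Y,Z^-,U}))(X\bullet(J\circ(((l^\bullet_{Y^-})^{-1}\circ Z^-)\bullet U)))=(\zeta_{X,J,Z,J}\circ Y\circ U)((r^\bullet_X)^{-1}\circ(r^\bullet_Z)^{-1}\circ Y\circ U)(r^\bullet_{X\circ Z\circ Y}\circ U)\delta_{X,J,Z\circ Y,U}(X\bullet(J\circ(\phi^\circ_{Y,Z}\bullet U)))$. (R10) $\widetilde\varphi_{X\circ Y,Z}(\psi_{X,Y}\bullet Z^-)=\widetilde\psi_{X,Y\circ Z}(X^-\bullet\varphi_{Y,Z})$. (R11) $(r^\circ_X)^-l^\circ_{(X\circ I)^-}(I\circ r^\bullet_{(X\circ I)^-})\widetilde\gamma_{X,I,I,J}(X^-\bullet(\Delta_I\circ J))=r^\bullet_{X^-}(X^-\bullet l^\circ_J)$. (R12) $(l^\circ_X)^-r^\circ_{(I\circ X)^-}(l^\bullet_{(I\circ X)^-}\circ I)\widetilde\delta_{J,I,I,X}((J\circ\Delta_I)\bullet X^-)=l^\bullet_{X^-}(r^\circ_J\bullet X^-)$. (R13) $\gamma_{X,Y,T\bullet(Z\circ U),V}(\gamma_{X\bullet Y^-,Z,T,U}\bullet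 V)=(X\circ(T\bullet\zeta_{Z,Y,U,V}))\gamma_{X,Z\bullet Y,T,U\bullet V}(((X\bullet\phi^\bullet_{Y,Z})\circ T)\bullet U\bullet V)$. (R14) $\delta_{X,(Y\circ T)\bullet Z,U,V}(X\bullet\delta_{Y,Z,T,U^-\bullet V})=((\zeta_{X,Y,U,T}\bullet Z)\circ V)\delta_{X\bullet Y,Z,U\bullet T,V}(X\bullet Y\bullet(Z\circ(\phi^\bullet_{T,U}\bullet V)))$. (R15) $(X\circ\gamma_{Z,T,U,Y\circ V})\gamma_{X,Y,(Z\bullet T^-)\circ U,V}=\gamma_{X\circ Z,T\circ Y,U,V}((((X\circ Z)\bullet\phi^\circ_{Y,T})\circ U)\bullet V)((\zeta_{X,Y^-,Z,T^-}\circ U)\bullet V)$. (R16) $(\delta_{X\circ U,Y,Z,T}\circ V)\delta_{X,Y\circ(Z^-\bullet T),U,V}=\delta_{X,Y,U\circ Z,T\circ V}(X\bullet(Y\circ(\phi^\circ_{Z,U}\bullet(T\circ V))))(X\bullet(Y\circ\zeta_{Z^-,T,U^-,V}))$. (R17) $r^\circ_J(J\circ r^\bullet_I)(J\circ(I\bullet m_J))\gamma_{J,J,I,J}(((J\bullet\phi^\bullet_0)\Delta_J\circ I)\bullet J)=r^\bullet_J(r^\circ_J\bullet J)$. (R18) $l^\circ_J(l^\bullet_I\circ J)((m_J\bullet I)\circ J)\delta_{J,I,J,J}(J\bullet(I\circ(\phi^\bullet_0\bullet J)\Delta_J))=l^\bullet_J(J\bullet l^\circ_J)$. Hopf monoid: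 a bimonoid $H$ with an antipode, i.e. a morphism $\Sigma_H:H\to H^-$ in $\mathcal C$ such that $((m_H\bullet I)\circ J)\varphi_{H,H}(H\bullet\Sigma_H)\Delta_H=((u_H\bullet I)\circ J)(\Delta_I\circ J)(l^\circ_J)^{-1}\varepsilon_H$ and $(J\circ(I\bullet m_H))\psi_{H,H}(\Sigma_H\bullet H)\Delta_H=(J\circ(I\bullet u_H))(J\circ\Delta_I)(r^\circ_J)^{-1}\varepsilon_H$. $\mathrm{Hopf}(\mathcal C,\circ,\bullet)$ is the full subcategory of the category of bimonoids given by Hopf monoids. *)

theory Defs
  imports Main
begin

section \<open>Categories and monoidal structures\<close>

record ('o, 'm) category_data =
  Ob :: "'o set"
  Arr :: "'m set"
  Dom :: "'m \<Rightarrow> 'o"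
  Cod :: "'m \<Rightarrow> 'o"
  Ident :: "'o \<Rightarrow> 'm"
  Comp :: "'m \<Rightarrow> 'm \<Rightarrow> 'm"  (infixr "\<cdot>\<index>" 60)

definition hom :: "('o, 'm) category_data \<Rightarrow> 'o \<Rightarrow> 'o \<Rightarrow> 'm set" where
  "hom C X Y = {f \<in> Arr C. Dom C f = X \<and> Cod C f = Y}"

locale category =
  fixes C :: "('o, 'm) category_data"
  assumes dom_ob: "f \<in> Arr C \<Longrightarrow> Dom C f \<in> Ob C"
    and cod_ob: "f \<in> Arr C \<Longrightarrow> Cod C f \<in> Ob C"
    and ident_hom: "X \<in> Ob C \<Longrightarrow> Ident C X \<in> hom C X X"
    and comp_hom: "\<lbrakk>f \<in> hom C X Y; g \<in> hom C Y Z\<rbrakk> \<Longrightarrow> g \<cdot>\<^bsub>C\<^esub> f \<in> hom C X Z"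
    and ident_comp: "f \<in> hom C X Y \<Longrightarrow> Ident C Y \<cdot>\<^bsub>C\<^esub> f = f"
    and comp_ident: "f \<in> hom C X Y \<Longrightarrow> f \<cdot>\<^bsub>C\<^esub> Ident C X = f"
    and comp_assoc: "\<lbrakk>f \<in> hom C X Y; g \<in> hom C Y Z; h \<in> hom C Z W\<rbrakk>
      \<Longrightarrow> (h \<cdot>\<^bsub>C\<^esub> g) \<cdot>\<^bsub>C\<^esub> f = h \<cdot>\<^bsub>C\<^esub> (g \<cdot>\<^bsub>C\<^esub> f)"

definition inverse_arrows :: "('o, 'm) category_data \<Rightarrow> 'm \<Rightarrow> 'm \<Rightarrow> bool" where
  "inverse_arrows C f g \<longleftrightarrow> f \<in> Arr C \<and> g \<in> hom C (Cod C f) (Dom C f)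
     \<and> g \<cdot>\<^bsub>C\<^esub> f = Ident C (Dom C f) \<and> f \<cdot>\<^bsub>C\<^esub> g = Ident C (Cod C f)"

definition iso_arrow :: "('o, 'm) category_data \<Rightarrow> 'm \<Rightarrow> bool" where
  "iso_arrow C f \<longleftrightarrow> (\<exists>g. inverse_arrows C f g)"

definition inv_arrow :: "('o, 'm) category_data \<Rightarrow> 'm \<Rightarrow> 'm" where
  "inv_arrow C f = (THE g. inverse_arrows C f g)"

definition full_subcategory ::
    "('o, 'm) category_data \<Rightarrow> 'o set \<Rightarrow> ('o, 'm) category_data" where
  "full_subcategory C S = C\<lparr>Ob := Ob C \<inter> S, Arr := {f \<in> Arr C. Dom C f \<in> S \<and> Cod C f \<in> S}\<rparr>"

text \<open>Associators go from \<open>(X \<otimes> Y) \<otimes> Z\<close> to \<open>X \<otimes> (Y \<otimes> Z)\<close>; unit constraints go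
  from \<open>I \<otimes> X\<close> and \<open>X \<otimes> I\<close> to \<open>X\<close>.\<close>

record ('o, 'm) tensor_data =
  Tob :: "'o \<Rightarrow> 'o \<Rightarrow> 'o"  (infixl "\<otimes>\<index>" 80)
  Tar :: "'m \<Rightarrow> 'm \<Rightarrow> 'm"  (infixl "\<boxtimes>\<index>" 80)
  Unit :: 'o
  Assoc :: "'o \<Rightarrow> 'o \<Rightarrow> 'o \<Rightarrow> 'm"
  LUnit :: "'o \<Rightarrow> 'm"
  RUnit :: "'o \<Rightarrow> 'm"

locale monoidal_category = category C
  for C :: "('o, 'm) category_data" +
  fixes T :: "('o, 'm) tensor_data"
  assumes tensor_ob: "\<lbrakk>X \<in> Ob C; Y \<in> Ob C\<rbrakk> \<Longrightarrow> X \<otimes>\<^bsub>T\<^esub> Y \<in> Ob C"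
    and tensor_hom: "\<lbrakk>f \<in> hom C X X'; g \<in> hom C Y Y'\<rbrakk>
      \<Longrightarrow> f \<boxtimes>\<^bsub>T\<^esub> g \<in> hom C (X \<otimes>\<^bsub>T\<^esub> Y) (X' \<otimes>\<^bsub>T\<^esub> Y')"
    and tensor_ident: "\<lbrakk>X \<in> Ob C; Y \<in> Ob C\<rbrakk>
      \<Longrightarrow> Ident C X \<boxtimes>\<^bsub>T\<^esub> Ident C Y = Ident C (X \<otimes>\<^bsub>T\<^esub> Y)"
    and tensor_comp: "\<lbrakk>f \<in> hom C X X'; f' \<in> hom C X' X''; g \<in> hom C Y Y'; g' \<in> hom C Y' Y''\<rbrakk>
      \<Longrightarrow> (f' \<cdot>\<^bsub>C\<^esub> f) \<boxtimes>\<^bsub>T\<^esub> (g' \<cdot>\<^bsub>C\<^esub> g) = (f' \<boxtimes>\<^bsub>T\<^esub> g') \<cdot>\<^bsub>C\<^esub> (f \<boxtimes>\<^bsub>T\<^esub> g)"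
    and unit_ob: "Unit T \<in> Ob C"
    and assoc_hom: "\<lbrakk>X \<in> Ob C; Y \<in> Ob C; Z \<in> Ob C\<rbrakk>
      \<Longrightarrow> Assoc T X Y Z \<in> hom C (X \<otimes>\<^bsub>T\<^esub> Y \<otimes>\<^bsub>T\<^esub> Z) (X \<otimes>\<^bsub>T\<^esub> (Y \<otimes>\<^bsub>T\<^esub> Z))"
    and assoc_iso: "\<lbrakk>X \<in> Ob C; Y \<in> Ob C; Z \<in> Ob C\<rbrakk> \<Longrightarrow> iso_arrow C (Assoc T X Y Z)"
    and assoc_natural: "\<lbrakk>f \<in> hom C X X'; g \<in> hom C Y Y'; h \<in> hom C Z Z'\<rbrakk>
      \<Longrightarrow> Assoc T X' Y' Z' \<cdot>\<^bsub>C\<^esub> (f \<boxtimes>\<^bsub>T\<^esub> g \<boxtimes>\<^bsub>T\<^esub> h) = (f \<boxtimes>\<^bsub>T\<^esub> (g \<boxtimes>\<^bsub>T\<^esub> h)) \<cdot>\<^bsub>C\<^esub> Assoc T X Y Z"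
    and lunit_hom: "X \<in> Ob C \<Longrightarrow> LUnit T X \<in> hom C (Unit T \<otimes>\<^bsub>T\<^esub> X) X"
    and lunit_iso: "X \<in> Ob C \<Longrightarrow> iso_arrow C (LUnit T X)"
    and lunit_natural: "f \<in> hom C X X'
      \<Longrightarrow> LUnit T X' \<cdot>\<^bsub>C\<^esub> (Ident C (Unit T) \<boxtimes>\<^bsub>T\<^esub> f) = f \<cdot>\<^bsub>C\<^esub> LUnit T X"
    and runit_hom: "X \<in> Ob C \<Longrightarrow> RUnit T X \<in> hom C (X \<otimes>\<^bsub>T\<^esub> Unit T) X"
    and runit_iso: "X \<in> Ob C \<Longrightarrow> iso_arrow C (RUnit T X)"
    and runit_natural: "f \<in> hom C X X'
      \<Longrightarrow> RUnit T X' \<cdot>\<^bsub>C\<^esub> (f \<boxtimes>\<^bsub>T\<^esub> Ident C (Unit T)) = f \<cdot>\<^bsub>C\<^esub> RUnit T X"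
    and pentagon: "\<lbrakk>X \<in> Ob C; Y \<in> Ob C; Z \<in> Ob C; W \<in> Ob C\<rbrakk>
      \<Longrightarrow> (Ident C X \<boxtimes>\<^bsub>T\<^esub> Assoc T Y Z W) \<cdot>\<^bsub>C\<^esub> Assoc T X (Y \<otimes>\<^bsub>T\<^esub> Z) W
            \<cdot>\<^bsub>C\<^esub> (Assoc T X Y Z \<boxtimes>\<^bsub>T\<^esub> Ident C W)
          = Assoc T X Y (Z \<otimes>\<^bsub>T\<^esub> W) \<cdot>\<^bsub>C\<^esub> Assoc T (X \<otimes>\<^bsub>T\<^esub> Y) Z W"
    and triangle: "\<lbrakk>X \<in> Ob C; Y \<in> Ob C\<rbrakk>
      \<Longrightarrow> (Ident C X \<boxtimes>\<^bsub>T\<^esub> LUnit T Y) \<cdot>\<^bsub>C\<^esub> Assoc T X (Unit T) Y = RUnit T X \<boxtimes>\<^bsub>T\<^esub> Ident C Y"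

locale braided_monoidal_category = monoidal_category C T
  for C :: "('o, 'm) category_data" and T :: "('o, 'm) tensor_data" +
  fixes s :: "'o \<Rightarrow> 'o \<Rightarrow> 'm"
  assumes braiding_hom: "\<lbrakk>X \<in> Ob C; Y \<in> Ob C\<rbrakk> \<Longrightarrow> s X Y \<in> hom C (X \<otimes>\<^bsub>T\<^esub> Y) (Y \<otimes>\<^bsub>T\<^esub> X)"
    and braiding_iso: "\<lbrakk>X \<in> Ob C; Y \<in> Ob C\<rbrakk> \<Longrightarrow> iso_arrow C (s X Y)"
    and braiding_natural: "\<lbrakk>f \<in> hom C X X'; g \<in> hom C Y Y'\<rbrakk>
      \<Longrightarrow> s X' Y' \<cdot>\<^bsub>C\<^esub> (f \<boxtimes>\<^bsub>T\<^esub> g) = (g \<boxtimes>\<^bsub>T\<^esub> f) \<cdot>\<^bsub>C\<^esub> s X Y"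
    and hexagon1: "\<lbrakk>X \<in> Ob C; Y \<in> Ob C; Z \<in> Ob C\<rbrakk>
      \<Longrightarrow> Assoc T Y Z X \<cdot>\<^bsub>C\<^esub> s X (Y \<otimes>\<^bsub>T\<^esub> Z) \<cdot>\<^bsub>C\<^esub> Assoc T X Y Z
          = (Ident C Y \<boxtimes>\<^bsub>T\<^esub> s X Z) \<cdot>\<^bsub>C\<^esub> Assoc T Y X Z \<cdot>\<^bsub>C\<^esub> (s X Y \<boxtimes>\<^bsub>T\<^esub> Ident C Z)"
    and hexagon2: "\<lbrakk>X \<in> Ob C; Y \<in> Ob C; Z \<in> Ob C\<rbrakk>
      \<Longrightarrow> inv_arrow C (Assoc T Z X Y) \<cdot>\<^bsub>C\<^esub> s (X \<otimes>\<^bsub>T\<^esub> Y) Z \<cdot>\<^bsub>C\<^esub> inv_arrow C (Assoc T X Y Z)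
          = (s X Z \<boxtimes>\<^bsub>T\<^esub> Ident C Y) \<cdot>\<^bsub>C\<^esub> inv_arrow C (Assoc T X Z Y) \<cdot>\<^bsub>C\<^esub> (Ident C X \<boxtimes>\<^bsub>T\<^esub> s Y Z)"

definition rev_tensor ::
    "('o, 'm) category_data \<Rightarrow> ('o, 'm) tensor_data \<Rightarrow> ('o, 'm) tensor_data" where
  "rev_tensor C T = \<lparr>Tob = (\<lambda>X Y. Y \<otimes>\<^bsub>T\<^esub> X), Tar = (\<lambda>f g. g \<boxtimes>\<^bsub>T\<^esub> f), Unit = Unit T,
     Assoc = (\<lambda>X Y Z. inv_arrow C (Assoc T Z Y X)), LUnit = RUnit T, RUnit = LUnit T\<rparr>"

definition monoid_in ::
    "('o, 'm) category_data \<Rightarrow> ('o, 'm) tensor_data \<Rightarrow> 'o \<Rightarrow> 'm \<Rightarrow> 'm \<Rightarrow> bool" where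
  "monoid_in C T M m u \<longleftrightarrow> M \<in> Ob C \<and> m \<in> hom C (M \<otimes>\<^bsub>T\<^esub> M) M \<and> u \<in> hom C (Unit T) M
     \<and> m \<cdot>\<^bsub>C\<^esub> (m \<boxtimes>\<^bsub>T\<^esub> Ident C M) = m \<cdot>\<^bsub>C\<^esub> (Ident C M \<boxtimes>\<^bsub>T\<^esub> m) \<cdot>\<^bsub>C\<^esub> Assoc T M M M
     \<and> m \<cdot>\<^bsub>C\<^esub> (u \<boxtimes>\<^bsub>T\<^esub> Ident C M) = LUnit T M
     \<and> m \<cdot>\<^bsub>C\<^esub> (Ident C M \<boxtimes>\<^bsub>T\<^esub> u) = RUnit T M"

definition comonoid_in ::
    "('o, 'm) category_data \<Rightarrow> ('o, 'm) tensor_data \<Rightarrow> 'o \<Rightarrow> 'm \<Rightarrow> 'm \<Rightarrow> bool" where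
  "comonoid_in C T M d e \<longleftrightarrow> M \<in> Ob C \<and> d \<in> hom C M (M \<otimes>\<^bsub>T\<^esub> M) \<and> e \<in> hom C M (Unit T)
     \<and> Assoc T M M M \<cdot>\<^bsub>C\<^esub> (d \<boxtimes>\<^bsub>T\<^esub> Ident C M) \<cdot>\<^bsub>C\<^esub> d = (Ident C M \<boxtimes>\<^bsub>T\<^esub> d) \<cdot>\<^bsub>C\<^esub> d
     \<and> LUnit T M \<cdot>\<^bsub>C\<^esub> (e \<boxtimes>\<^bsub>T\<^esub> Ident C M) \<cdot>\<^bsub>C\<^esub> d = Ident C M
     \<and> RUnit T M \<cdot>\<^bsub>C\<^esub> (Ident C M \<boxtimes>\<^bsub>T\<^esub> e) \<cdot>\<^bsub>C\<^esub> d = Ident C M"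

locale endofunctor = category C
  for C :: "('o, 'm) category_data" +
  fixes Fo :: "'o \<Rightarrow> 'o" and Fa :: "'m \<Rightarrow> 'm"
  assumes map_ob: "X \<in> Ob C \<Longrightarrow> Fo X \<in> Ob C"
    and map_hom: "f \<in> hom C X Y \<Longrightarrow> Fa f \<in> hom C (Fo X) (Fo Y)"
    and map_ident: "X \<in> Ob C \<Longrightarrow> Fa (Ident C X) = Ident C (Fo X)"
    and map_comp: "\<lbrakk>f \<in> hom C X Y; g \<in> hom C Y Z\<rbrakk> \<Longrightarrow> Fa (g \<cdot>\<^bsub>C\<^esub> f) = Fa g \<cdot>\<^bsub>C\<^esub> Fa f"

text \<open>A lax monoidal structure on an endofunctor of \<open>C\<close>, seen as a functor from
  \<open>(C, S)\<close> to \<open>(C, T)\<close> for two monoidal structures \<open>S\<close> and \<open>T\<close> on \<open>C\<close>.\<close>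

locale lax_monoidal_endofunctor = endofunctor C Fo Fa
  for C :: "('o, 'm) category_data" and Fo :: "'o \<Rightarrow> 'o" and Fa :: "'m \<Rightarrow> 'm" +
  fixes S T :: "('o, 'm) tensor_data" and p :: "'o \<Rightarrow> 'o \<Rightarrow> 'm" and p0 :: 'm
  assumes lax_hom: "\<lbrakk>X \<in> Ob C; Y \<in> Ob C\<rbrakk> \<Longrightarrow> p X Y \<in> hom C (Fo X \<otimes>\<^bsub>T\<^esub> Fo Y) (Fo (X \<otimes>\<^bsub>S\<^esub> Y))"
    and lax_natural: "\<lbrakk>f \<in> hom C X X'; g \<in> hom C Y Y'\<rbrakk>
      \<Longrightarrow> p X' Y' \<cdot>\<^bsub>C\<^esub> (Fa f \<boxtimes>\<^bsub>T\<^esub> Fa g) = Fa (f \<boxtimes>\<^bsub>S\<^esub> g) \<cdot>\<^bsub>C\<^esub> p X Y"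
    and lax_unit_hom: "p0 \<in> hom C (Unit T) (Fo (Unit S))"
    and lax_assoc: "\<lbrakk>X \<in> Ob C; Y \<in> Ob C; Z \<in> Ob C\<rbrakk>
      \<Longrightarrow> Fa (Assoc S X Y Z) \<cdot>\<^bsub>C\<^esub> p (X \<otimes>\<^bsub>S\<^esub> Y) Z \<cdot>\<^bsub>C\<^esub> (p X Y \<boxtimes>\<^bsub>T\<^esub> Ident C (Fo Z))
          = p X (Y \<otimes>\<^bsub>S\<^esub> Z) \<cdot>\<^bsub>C\<^esub> (Ident C (Fo X) \<boxtimes>\<^bsub>T\<^esub> p Y Z) \<cdot>\<^bsub>C\<^esub> Assoc T (Fo X) (Fo Y) (Fo Z)"
    and lax_lunit: "X \<in> Ob C \<Longrightarrow>
      Fa (LUnit S X) \<cdot>\<^bsub>C\<^esub> p (Unit S) X \<cdot>\<^bsub>C\<^esub> (p0 \<boxtimes>\<^bsub>T\<^esub> Ident C (Fo X)) = LUnit T (Fo X)"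
    and lax_runit: "X \<in> Ob C \<Longrightarrow>
      Fa (RUnit S X) \<cdot>\<^bsub>C\<^esub> p X (Unit S) \<cdot>\<^bsub>C\<^esub> (Ident C (Fo X) \<boxtimes>\<^bsub>T\<^esub> p0) = RUnit T (Fo X)"


section \<open>Duoidal categories\<close>

text \<open>\<open>EpsI\<close> is both the counit of the comonoid \<open>I\<close> and the unit of the monoid \<open>J\<close>.\<close>

record ('o, 'm) duoidal_data =
  Cat :: "('o, 'm) category_data"
  Circ :: "('o, 'm) tensor_data"
  Bul :: "('o, 'm) tensor_data"
  Zeta :: "'o \<Rightarrow> 'o \<Rightarrow> 'o \<Rightarrow> 'o \<Rightarrow> 'm"
  DeltaI :: 'm
  MJ :: 'm
  EpsI :: 'm

record ('o, 'm) bimonoid_data =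
  Carrier :: 'o
  Mult :: 'm
  Uni :: 'm
  Comult :: 'm
  Counit :: 'm

text \<open>Notation: \<open>\<circle>\<close> and \<open>\<bullet>\<close> are the two tensor products on objects, the same symbols with
  subscript \<open>a\<close> are their action on arrows, \<open>\<langle>X\<rangle>\<close> is the identity arrow of \<open>X\<close>, and the
  subscripts \<open>c\<close> and \<open>b\<close> mark the constraints of the two monoidal structures. Associators are
  written out everywhere.\<close>

locale duoidal_ops =
  fixes D :: "('o, 'm) duoidal_data"
begin

abbreviation ob :: "'o \<Rightarrow> bool" where "ob X \<equiv> X \<in> Ob (Cat D)"
abbreviation hm :: "'o \<Rightarrow> 'o \<Rightarrow> 'm set" where "hm \<equiv> hom (Cat D)"
abbreviation ident :: "'o \<Rightarrow> 'm"  ("\<langle>_\<rangle>") where "\<langle>X\<rangle> \<equiv> Ident (Cat D) X"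
abbreviation comp :: "'m \<Rightarrow> 'm \<Rightarrow> 'm"  (infixr "\<cdot>" 60) where "g \<cdot> f \<equiv> Comp (Cat D) g f"
abbreviation inv\<^sub>a :: "'m \<Rightarrow> 'm" where "inv\<^sub>a \<equiv> inv_arrow (Cat D)"
abbreviation circ_ob :: "'o \<Rightarrow> 'o \<Rightarrow> 'o"  (infix "\<circle>" 80) where "X \<circle> Y \<equiv> Tob (Circ D) X Y"
abbreviation circ_ar :: "'m \<Rightarrow> 'm \<Rightarrow> 'm"  (infix "\<circle>\<^sub>a" 80) where "f \<circle>\<^sub>a g \<equiv> Tar (Circ D) f g"
abbreviation bul_ob :: "'o \<Rightarrow> 'o \<Rightarrow> 'o"  (infix "\<bullet>" 80) where "X \<bullet> Y \<equiv> Tob (Bul D) X Y"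
abbreviation bul_ar :: "'m \<Rightarrow> 'm \<Rightarrow> 'm"  (infix "\<bullet>\<^sub>a" 80) where "f \<bullet>\<^sub>a g \<equiv> Tar (Bul D) f g"
abbreviation I :: 'o where "I \<equiv> Unit (Circ D)"
abbreviation J :: 'o where "J \<equiv> Unit (Bul D)"
abbreviation a\<^sub>c :: "'o \<Rightarrow> 'o \<Rightarrow> 'o \<Rightarrow> 'm" where "a\<^sub>c \<equiv> Assoc (Circ D)"
abbreviation l\<^sub>c :: "'o \<Rightarrow> 'm" where "l\<^sub>c \<equiv> LUnit (Circ D)"
abbreviation r\<^sub>c :: "'o \<Rightarrow> 'm" where "r\<^sub>c \<equiv> RUnit (Circ D)"
abbreviation a\<^sub>b :: "'o \<Rightarrow> 'o \<Rightarrow> 'o \<Rightarrow> 'm" where "a\<^sub>b \<equiv> Assoc (Bul D)"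
abbreviation l\<^sub>b :: "'o \<Rightarrow> 'm" where "l\<^sub>b \<equiv> LUnit (Bul D)"
abbreviation r\<^sub>b :: "'o \<Rightarrow> 'm" where "r\<^sub>b \<equiv> RUnit (Bul D)"
abbreviation \<zeta> :: "'o \<Rightarrow> 'o \<Rightarrow> 'o \<Rightarrow> 'o \<Rightarrow> 'm" where "\<zeta> \<equiv> Zeta D"
abbreviation \<Delta>\<^sub>I :: 'm where "\<Delta>\<^sub>I \<equiv> DeltaI D"
abbreviation m\<^sub>J :: 'm where "m\<^sub>J \<equiv> MJ D"
abbreviation \<epsilon>\<^sub>I :: 'm where "\<epsilon>\<^sub>I \<equiv> EpsI D"
abbreviation \<Delta>\<^sub>J :: 'm where "\<Delta>\<^sub>J \<equiv> inv\<^sub>a (l\<^sub>b J)"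

definition bimonoid :: "('o, 'm) bimonoid_data \<Rightarrow> bool" where
  "bimonoid A \<longleftrightarrow>
     monoid_in (Cat D) (Circ D) (Carrier A) (Mult A) (Uni A)
   \<and> comonoid_in (Cat D) (Bul D) (Carrier A) (Comult A) (Counit A)
   \<and> Comult A \<cdot> Mult A
       = (Mult A \<bullet>\<^sub>a Mult A) \<cdot> \<zeta> (Carrier A) (Carrier A) (Carrier A) (Carrier A)
           \<cdot> (Comult A \<circle>\<^sub>a Comult A)
   \<and> Counit A \<cdot> Mult A = m\<^sub>J \<cdot> (Counit A \<circle>\<^sub>a Counit A)
   \<and> Comult A \<cdot> Uni A = (Uni A \<bullet>\<^sub>a Uni A) \<cdot> \<Delta>\<^sub>I
   \<and> Counit A \<cdot> Uni A = \<epsilon>\<^sub>I"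

definition bimonoid_morphism ::
    "('o, 'm) bimonoid_data \<Rightarrow> ('o, 'm) bimonoid_data \<Rightarrow> 'm \<Rightarrow> bool" where
  "bimonoid_morphism A B f \<longleftrightarrow> f \<in> hm (Carrier A) (Carrier B)
   \<and> f \<cdot> Mult A = Mult B \<cdot> (f \<circle>\<^sub>a f) \<and> f \<cdot> Uni A = Uni B
   \<and> Comult B \<cdot> f = (f \<bullet>\<^sub>a f) \<cdot> Comult A \<and> Counit B \<cdot> f = Counit A"

text \<open>An arrow of the category of bimonoids is a triple consisting of its source, the
  underlying arrow and its target.\<close>

definition bimonoid_category ::
    "(('o, 'm) bimonoid_data,
      ('o, 'm) bimonoid_data \<times> 'm \<times> ('o, 'm) bimonoid_data) category_data" where
  "bimonoid_category = \<lparr>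
     Ob = {A. bimonoid A},
     Arr = {(A, f, B). bimonoid A \<and> bimonoid B \<and> bimonoid_morphism A B f},
     Dom = (\<lambda>(A, f, B). A),
     Cod = (\<lambda>(A, f, B). B),
     Ident = (\<lambda>A. (A, \<langle>Carrier A\<rangle>, A)),
     Comp = (\<lambda>(B', g, E) (A, f, B). (A, g \<cdot> f, E))\<rparr>"

definition unit_bimonoid :: "('o, 'm) bimonoid_data" where
  "unit_bimonoid = \<lparr>Carrier = J, Mult = m\<^sub>J, Uni = \<epsilon>\<^sub>I, Comult = \<Delta>\<^sub>J, Counit = \<langle>J\<rangle>\<rparr>"

end

locale duoidal_category = duoidal_ops D
  for D :: "('o, 'm) duoidal_data" +
  assumes circ_monoidal: "monoidal_category (Cat D) (Circ D)"
    and bul_monoidal: "monoidal_category (Cat D) (Bul D)"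
    and zeta_hom: "\<lbrakk>ob A; ob B; ob C; ob E\<rbrakk>
      \<Longrightarrow> \<zeta> A B C E \<in> hm ((A \<bullet> B) \<circle> (C \<bullet> E)) ((A \<circle> C) \<bullet> (B \<circle> E))"
    and zeta_natural: "\<lbrakk>f \<in> hm A A'; g \<in> hm B B'; h \<in> hm C C'; k \<in> hm E E'\<rbrakk>
      \<Longrightarrow> \<zeta> A' B' C' E' \<cdot> ((f \<bullet>\<^sub>a g) \<circle>\<^sub>a (h \<bullet>\<^sub>a k)) = ((f \<circle>\<^sub>a h) \<bullet>\<^sub>a (g \<circle>\<^sub>a k)) \<cdot> \<zeta> A B C E"
    and J_monoid: "monoid_in (Cat D) (Circ D) J m\<^sub>J \<epsilon>\<^sub>I"
    and I_comonoid: "comonoid_in (Cat D) (Bul D) I \<Delta>\<^sub>I \<epsilon>\<^sub>I"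
    and zeta_circ_assoc: "\<lbrakk>ob A; ob B; ob C; ob E; ob F; ob G\<rbrakk>
      \<Longrightarrow> \<zeta> A B (C \<circle> F) (E \<circle> G) \<cdot> (\<langle>A \<bullet> B\<rangle> \<circle>\<^sub>a \<zeta> C E F G) \<cdot> a\<^sub>c (A \<bullet> B) (C \<bullet> E) (F \<bullet> G)
          = (a\<^sub>c A C F \<bullet>\<^sub>a a\<^sub>c B E G) \<cdot> \<zeta> (A \<circle> C) (B \<circle> E) F G \<cdot> (\<zeta> A B C E \<circle>\<^sub>a \<langle>F \<bullet> G\<rangle>)"
    and zeta_bul_assoc: "\<lbrakk>ob A; ob B; ob C; ob E; ob F; ob G\<rbrakk>
      \<Longrightarrow> (\<langle>A \<circle> E\<rangle> \<bullet>\<^sub>a \<zeta> B C F G) \<cdot> \<zeta> A (B \<bullet> C) E (F \<bullet> G) \<cdot> (a\<^sub>b A B C \<circle>\<^sub>a a\<^sub>b E F G)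
          = a\<^sub>b (A \<circle> E) (B \<circle> F) (C \<circle> G) \<cdot> (\<zeta> A B E F \<bullet>\<^sub>a \<langle>C \<circle> G\<rangle>) \<cdot> \<zeta> (A \<bullet> B) C (E \<bullet> F) G"
    and zeta_circ_lunit: "\<lbrakk>ob A; ob B\<rbrakk>
      \<Longrightarrow> (l\<^sub>c A \<bullet>\<^sub>a l\<^sub>c B) \<cdot> \<zeta> I I A B \<cdot> (\<Delta>\<^sub>I \<circle>\<^sub>a \<langle>A \<bullet> B\<rangle>) = l\<^sub>c (A \<bullet> B)"
    and zeta_circ_runit: "\<lbrakk>ob A; ob B\<rbrakk>
      \<Longrightarrow> (r\<^sub>c A \<bullet>\<^sub>a r\<^sub>c B) \<cdot> \<zeta> A B I I \<cdot> (\<langle>A \<bullet> B\<rangle> \<circle>\<^sub>a \<Delta>\<^sub>I) = r\<^sub>c (A \<bullet> B)"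
    and zeta_bul_lunit: "\<lbrakk>ob A; ob B\<rbrakk>
      \<Longrightarrow> l\<^sub>b (A \<circle> B) \<cdot> (m\<^sub>J \<bullet>\<^sub>a \<langle>A \<circle> B\<rangle>) \<cdot> \<zeta> J A J B = l\<^sub>b A \<circle>\<^sub>a l\<^sub>b B"
    and zeta_bul_runit: "\<lbrakk>ob A; ob B\<rbrakk>
      \<Longrightarrow> r\<^sub>b (A \<circle> B) \<cdot> (\<langle>A \<circle> B\<rangle> \<bullet>\<^sub>a m\<^sub>J) \<cdot> \<zeta> A J B J = r\<^sub>b A \<circle>\<^sub>a r\<^sub>b B"

locale duoidal_braiding_ops = duoidal_ops D
  for D :: "('o, 'm) duoidal_data" +
  fixes \<sigma> :: "'o \<Rightarrow> 'o \<Rightarrow> 'm"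
begin

text \<open>In \<open>Comult\<close>, all factors except \<open>\<sigma>\<close> and the two comultiplications only rebracket.\<close>

definition bimonoid_tensor ::
    "('o, 'm) bimonoid_data \<Rightarrow> ('o, 'm) bimonoid_data \<Rightarrow> ('o, 'm) bimonoid_data" where
  "bimonoid_tensor P Q = (let A = Carrier P; B = Carrier Q in \<lparr>
     Carrier = A \<bullet> B,
     Mult = (Mult P \<bullet>\<^sub>a Mult Q) \<cdot> \<zeta> A B A B,
     Uni = (Uni P \<bullet>\<^sub>a Uni Q) \<cdot> \<Delta>\<^sub>I,
     Comult = inv\<^sub>a (a\<^sub>b A B (A \<bullet> B)) \<cdot> (\<langle>A\<rangle> \<bullet>\<^sub>a a\<^sub>b B A B)
       \<cdot> (\<langle>A\<rangle> \<bullet>\<^sub>a (\<sigma> A B \<bullet>\<^sub>a \<langle>B\<rangle>))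
       \<cdot> (\<langle>A\<rangle> \<bullet>\<^sub>a inv\<^sub>a (a\<^sub>b A B B)) \<cdot> a\<^sub>b A A (B \<bullet> B) \<cdot> (Comult P \<bullet>\<^sub>a Comult Q),
     Counit = l\<^sub>b J \<cdot> (Counit P \<bullet>\<^sub>a Counit Q)\<rparr>)"

definition bimonoid_tensor_data ::
    "(('o, 'm) bimonoid_data,
      ('o, 'm) bimonoid_data \<times> 'm \<times> ('o, 'm) bimonoid_data) tensor_data" where
  "bimonoid_tensor_data = \<lparr>
     Tob = bimonoid_tensor,
     Tar = (\<lambda>(A, f, A') (B, g, B'). (bimonoid_tensor A B, f \<bullet>\<^sub>a g, bimonoid_tensor A' B')),
     Unit = unit_bimonoid,
     Assoc = (\<lambda>A B E. (bimonoid_tensor (bimonoid_tensor A B) E,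
                       a\<^sub>b (Carrier A) (Carrier B) (Carrier E),
                       bimonoid_tensor A (bimonoid_tensor B E))),
     LUnit = (\<lambda>A. (bimonoid_tensor unit_bimonoid A, l\<^sub>b (Carrier A), A)),
     RUnit = (\<lambda>A. (bimonoid_tensor A unit_bimonoid, r\<^sub>b (Carrier A), A))\<rparr>"

end

locale bullet_braided_duoidal_category =
  duoidal_category D + duoidal_braiding_ops D \<sigma>
  for D :: "('o, 'm) duoidal_data" and \<sigma> :: "'o \<Rightarrow> 'o \<Rightarrow> 'm" +
  assumes bul_braided: "braided_monoidal_category (Cat D) (Bul D) \<sigma>"
    and braiding_zeta: "\<lbrakk>ob A; ob B; ob C; ob E\<rbrakk>
      \<Longrightarrow> \<sigma> (A \<circle> C) (B \<circle> E) \<cdot> \<zeta> A B C E = \<zeta> B A E C \<cdot> (\<sigma> A B \<circle>\<^sub>a \<sigma> C E)"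
    and braiding_DeltaI: "\<sigma> I I \<cdot> \<Delta>\<^sub>I = \<Delta>\<^sub>I"


section \<open>Reversions and Hopf monoids\<close>

record ('o, 'm) reversion_data =
  Rob :: "'o \<Rightarrow> 'o"
  Rar :: "'m \<Rightarrow> 'm"
  PhiCirc :: "'o \<Rightarrow> 'o \<Rightarrow> 'm"
  PhiCirc0 :: 'm
  PhiBul :: "'o \<Rightarrow> 'o \<Rightarrow> 'm"
  PhiBul0 :: 'm
  Gamma :: "'o \<Rightarrow> 'o \<Rightarrow> 'o \<Rightarrow> 'o \<Rightarrow> 'm"
  Delta :: "'o \<Rightarrow> 'o \<Rightarrow> 'o \<Rightarrow> 'o \<Rightarrow> 'm"
  GammaTilde :: "'o \<Rightarrow> 'o \<Rightarrow> 'o \<Rightarrow> 'o \<Rightarrow> 'm"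
  DeltaTilde :: "'o \<Rightarrow> 'o \<Rightarrow> 'o \<Rightarrow> 'o \<Rightarrow> 'm"

text \<open>\<open>X\<^sup>-\<close> is the reversion functor on objects and \<open>f\<^sup>-\<^sub>a\<close> is the same functor on arrows.\<close>

locale reversion_ops = duoidal_ops D
  for D :: "('o, 'm) duoidal_data" +
  fixes R :: "('o, 'm) reversion_data"
begin

abbreviation rev_ob :: "'o \<Rightarrow> 'o"  ("_\<^sup>-" [1000] 1000) where "X\<^sup>- \<equiv> Rob R X"
abbreviation rev_ar :: "'m \<Rightarrow> 'm"  ("_\<^sup>-\<^sub>a" [1000] 1000) where "f\<^sup>-\<^sub>a \<equiv> Rar R f"
abbreviation \<phi>\<^sub>c :: "'o \<Rightarrow> 'o \<Rightarrow> 'm" where "\<phi>\<^sub>c \<equiv> PhiCirc R"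
abbreviation \<phi>\<^sub>c\<^sub>0 :: 'm where "\<phi>\<^sub>c\<^sub>0 \<equiv> PhiCirc0 R"
abbreviation \<phi>\<^sub>b :: "'o \<Rightarrow> 'o \<Rightarrow> 'm" where "\<phi>\<^sub>b \<equiv> PhiBul R"
abbreviation \<phi>\<^sub>b\<^sub>0 :: 'm where "\<phi>\<^sub>b\<^sub>0 \<equiv> PhiBul0 R"
abbreviation \<gamma> :: "'o \<Rightarrow> 'o \<Rightarrow> 'o \<Rightarrow> 'o \<Rightarrow> 'm" where "\<gamma> \<equiv> Gamma R"
abbreviation \<delta> :: "'o \<Rightarrow> 'o \<Rightarrow> 'o \<Rightarrow> 'o \<Rightarrow> 'm" where "\<delta> \<equiv> Delta R"
abbreviation \<gamma>\<^sub>t :: "'o \<Rightarrow> 'o \<Rightarrow> 'o \<Rightarrow> 'o \<Rightarrow> 'm" where "\<gamma>\<^sub>t \<equiv> GammaTilde R"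
abbreviation \<delta>\<^sub>t :: "'o \<Rightarrow> 'o \<Rightarrow> 'o \<Rightarrow> 'o \<Rightarrow> 'm" where "\<delta>\<^sub>t \<equiv> DeltaTilde R"

definition \<psi> :: "'o \<Rightarrow> 'o \<Rightarrow> 'm" where
  "\<psi> X Y = \<gamma> J X I Y \<cdot> ((inv\<^sub>a (l\<^sub>b (X\<^sup>-)) \<circle>\<^sub>a \<langle>I\<rangle>) \<bullet>\<^sub>a \<langle>Y\<rangle>) \<cdot> (inv\<^sub>a (r\<^sub>c (X\<^sup>-)) \<bullet>\<^sub>a \<langle>Y\<rangle>)"

definition \<phi> :: "'o \<Rightarrow> 'o \<Rightarrow> 'm" where
  "\<phi> X Y = \<delta> X I Y J \<cdot> (\<langle>X\<rangle> \<bullet>\<^sub>a (\<langle>I\<rangle> \<circle>\<^sub>a inv\<^sub>a (r\<^sub>b (Y\<^sup>-)))) \<cdot> (\<langle>X\<rangle> \<bullet>\<^sub>a inv\<^sub>a (l\<^sub>c (Y\<^sup>-)))"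

definition \<psi>\<^sub>t :: "'o \<Rightarrow> 'o \<Rightarrow> 'm" where
  "\<psi>\<^sub>t X Y = l\<^sub>c ((X \<circle> Y)\<^sup>-) \<cdot> (\<langle>I\<rangle> \<circle>\<^sub>a r\<^sub>b ((X \<circle> Y)\<^sup>-)) \<cdot> \<gamma>\<^sub>t X Y I J"

definition \<phi>\<^sub>t :: "'o \<Rightarrow> 'o \<Rightarrow> 'm" where
  "\<phi>\<^sub>t X Y = r\<^sub>c ((X \<circle> Y)\<^sup>-) \<cdot> (l\<^sub>b ((X \<circle> Y)\<^sup>-) \<circle>\<^sub>a \<langle>I\<rangle>) \<cdot> \<delta>\<^sub>t J I X Y"

definition antipode :: "('o, 'm) bimonoid_data \<Rightarrow> 'm \<Rightarrow> bool" where
  "antipode A S \<longleftrightarrow> (let H = Carrier A in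
     S \<in> hm H (H\<^sup>-)
   \<and> ((Mult A \<bullet>\<^sub>a \<langle>I\<rangle>) \<circle>\<^sub>a \<langle>J\<rangle>) \<cdot> \<phi> H H \<cdot> (\<langle>H\<rangle> \<bullet>\<^sub>a S) \<cdot> Comult A
       = ((Uni A \<bullet>\<^sub>a \<langle>I\<rangle>) \<circle>\<^sub>a \<langle>J\<rangle>) \<cdot> (\<Delta>\<^sub>I \<circle>\<^sub>a \<langle>J\<rangle>) \<cdot> inv\<^sub>a (l\<^sub>c J) \<cdot> Counit A
   \<and> (\<langle>J\<rangle> \<circle>\<^sub>a (\<langle>I\<rangle> \<bullet>\<^sub>a Mult A)) \<cdot> \<psi> H H \<cdot> (S \<bullet>\<^sub>a \<langle>H\<rangle>) \<cdot> Comult A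
       = (\<langle>J\<rangle> \<circle>\<^sub>a (\<langle>I\<rangle> \<bullet>\<^sub>a Uni A)) \<cdot> (\<langle>J\<rangle> \<circle>\<^sub>a \<Delta>\<^sub>I) \<cdot> inv\<^sub>a (r\<^sub>c J) \<cdot> Counit A)"

definition hopf_monoid :: "('o, 'm) bimonoid_data \<Rightarrow> bool" where
  "hopf_monoid A \<longleftrightarrow> bimonoid A \<and> (\<exists>S. antipode A S)"

definition hopf_category ::
    "(('o, 'm) bimonoid_data,
      ('o, 'm) bimonoid_data \<times> 'm \<times> ('o, 'm) bimonoid_data) category_data" where
  "hopf_category = full_subcategory bimonoid_category {A. hopf_monoid A}"

end

locale duoidal_reversion = duoidal_category D + reversion_ops D R
  for D :: "('o, 'm) duoidal_data" and R :: "('o, 'm) reversion_data" +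
  assumes rev_lax_circ:
      "lax_monoidal_endofunctor (Cat D) (Rob R) (Rar R) (rev_tensor (Cat D) (Circ D)) (Circ D) \<phi>\<^sub>c \<phi>\<^sub>c\<^sub>0"
    and rev_lax_bul:
      "lax_monoidal_endofunctor (Cat D) (Rob R) (Rar R) (rev_tensor (Cat D) (Bul D)) (Bul D) \<phi>\<^sub>b \<phi>\<^sub>b\<^sub>0"
    and rev_zeta: "\<lbrakk>ob A; ob B; ob C; ob E\<rbrakk>
      \<Longrightarrow> \<phi>\<^sub>b (C \<circle> A) (E \<circle> B) \<cdot> (\<phi>\<^sub>c A C \<bullet>\<^sub>a \<phi>\<^sub>c B E) \<cdot> \<zeta> (A\<^sup>-) (B\<^sup>-) (C\<^sup>-) (E\<^sup>-)
          = (\<zeta> E C B A)\<^sup>-\<^sub>a \<cdot> \<phi>\<^sub>c (B \<bullet> A) (E \<bullet> C) \<cdot> (\<phi>\<^sub>b A B \<circle>\<^sub>a \<phi>\<^sub>b C E)"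
    and rev_DeltaI: "\<phi>\<^sub>b I I \<cdot> (\<phi>\<^sub>c\<^sub>0 \<bullet>\<^sub>a \<phi>\<^sub>c\<^sub>0) \<cdot> \<Delta>\<^sub>I = \<Delta>\<^sub>I\<^sup>-\<^sub>a \<cdot> \<phi>\<^sub>c\<^sub>0"
    and rev_mJ: "m\<^sub>J\<^sup>-\<^sub>a \<cdot> \<phi>\<^sub>c J J \<cdot> (\<phi>\<^sub>b\<^sub>0 \<circle>\<^sub>a \<phi>\<^sub>b\<^sub>0) = \<phi>\<^sub>b\<^sub>0 \<cdot> m\<^sub>J"
    and rev_epsI: "\<phi>\<^sub>b\<^sub>0 \<cdot> \<epsilon>\<^sub>I = \<epsilon>\<^sub>I\<^sup>-\<^sub>a \<cdot> \<phi>\<^sub>c\<^sub>0"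
    and gamma_hom: "\<lbrakk>ob X; ob Y; ob Z; ob T\<rbrakk>
      \<Longrightarrow> \<gamma> X Y Z T \<in> hm (((X \<bullet> Y\<^sup>-) \<circle> Z) \<bullet> T) (X \<circle> (Z \<bullet> (Y \<circle> T)))"
    and gamma_natural: "\<lbrakk>x \<in> hm X X'; y \<in> hm Y Y'; z \<in> hm Z Z'; t \<in> hm T T'\<rbrakk>
      \<Longrightarrow> \<gamma> X' Y' Z' T' \<cdot> (((x \<bullet>\<^sub>a y\<^sup>-\<^sub>a) \<circle>\<^sub>a z) \<bullet>\<^sub>a t)
          = (x \<circle>\<^sub>a (z \<bullet>\<^sub>a (y \<circle>\<^sub>a t))) \<cdot> \<gamma> X Y Z T"
    and delta_hom: "\<lbrakk>ob X; ob Y; ob Z; ob T\<rbrakk>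
      \<Longrightarrow> \<delta> X Y Z T \<in> hm (X \<bullet> (Y \<circle> (Z\<^sup>- \<bullet> T))) (((X \<circle> Z) \<bullet> Y) \<circle> T)"
    and delta_natural: "\<lbrakk>x \<in> hm X X'; y \<in> hm Y Y'; z \<in> hm Z Z'; t \<in> hm T T'\<rbrakk>
      \<Longrightarrow> \<delta> X' Y' Z' T' \<cdot> (x \<bullet>\<^sub>a (y \<circle>\<^sub>a (z\<^sup>-\<^sub>a \<bullet>\<^sub>a t)))
          = (((x \<circle>\<^sub>a z) \<bullet>\<^sub>a y) \<circle>\<^sub>a t) \<cdot> \<delta> X Y Z T"
    and gamma_tilde_hom: "\<lbrakk>ob X; ob Y; ob Z; ob T\<rbrakk>
      \<Longrightarrow> \<gamma>\<^sub>t X Y Z T \<in> hm (X\<^sup>- \<bullet> ((Y \<bullet> Z) \<circle> T)) (Z \<circle> ((X \<circle> Y)\<^sup>- \<bullet> T))"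
    and gamma_tilde_natural: "\<lbrakk>x \<in> hm X X'; y \<in> hm Y Y'; z \<in> hm Z Z'; t \<in> hm T T'\<rbrakk>
      \<Longrightarrow> \<gamma>\<^sub>t X' Y' Z' T' \<cdot> (x\<^sup>-\<^sub>a \<bullet>\<^sub>a ((y \<bullet>\<^sub>a z) \<circle>\<^sub>a t))
          = (z \<circle>\<^sub>a ((x \<circle>\<^sub>a y)\<^sup>-\<^sub>a \<bullet>\<^sub>a t)) \<cdot> \<gamma>\<^sub>t X Y Z T"
    and delta_tilde_hom: "\<lbrakk>ob X; ob Y; ob Z; ob T\<rbrakk>
      \<Longrightarrow> \<delta>\<^sub>t X Y Z T \<in> hm ((X \<circle> (Y \<bullet> Z)) \<bullet> T\<^sup>-) ((X \<bullet> (Z \<circle> T)\<^sup>-) \<circle> Y)"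
    and delta_tilde_natural: "\<lbrakk>x \<in> hm X X'; y \<in> hm Y Y'; z \<in> hm Z Z'; t \<in> hm T T'\<rbrakk>
      \<Longrightarrow> \<delta>\<^sub>t X' Y' Z' T' \<cdot> ((x \<circle>\<^sub>a (y \<bullet>\<^sub>a z)) \<bullet>\<^sub>a t\<^sup>-\<^sub>a)
          = ((x \<bullet>\<^sub>a (z \<circle>\<^sub>a t)\<^sup>-\<^sub>a) \<circle>\<^sub>a y) \<cdot> \<delta>\<^sub>t X Y Z T"
    and R1: "\<lbrakk>ob X; ob Y; ob Z; ob T; ob U; ob V\<rbrakk> \<Longrightarrow>
      \<gamma> X Y (Z \<circle> U) (T \<circle> V) \<cdot> (a\<^sub>c (X \<bullet> Y\<^sup>-) Z U \<bullet>\<^sub>a \<langle>T \<circle> V\<rangle>) \<cdot> \<zeta> ((X \<bullet> Y\<^sup>-) \<circle> Z) T U V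
      = (\<langle>X\<rangle> \<circle>\<^sub>a (\<langle>Z \<circle> U\<rangle> \<bullet>\<^sub>a a\<^sub>c Y T V)) \<cdot> (\<langle>X\<rangle> \<circle>\<^sub>a \<zeta> Z (Y \<circle> T) U V)
          \<cdot> a\<^sub>c X (Z \<bullet> (Y \<circle> T)) (U \<bullet> V) \<cdot> (\<gamma> X Y Z T \<circle>\<^sub>a \<langle>U \<bullet> V\<rangle>)"
    and R2: "\<lbrakk>ob X; ob Y; ob Z; ob T; ob U; ob V\<rbrakk> \<Longrightarrow>
      (\<langle>X \<circle> T\<rangle> \<bullet>\<^sub>a \<gamma> Y Z U V) \<cdot> a\<^sub>b (X \<circle> T) ((Y \<bullet> Z\<^sup>-) \<circle> U) V
          \<cdot> (\<zeta> X (Y \<bullet> Z\<^sup>-) T U \<bullet>\<^sub>a \<langle>V\<rangle>) \<cdot> ((a\<^sub>b X Y (Z\<^sup>-) \<circle>\<^sub>a \<langle>T \<bullet> U\<rangle>) \<bullet>\<^sub>a \<langle>V\<rangle>)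
      = \<zeta> X Y T (U \<bullet> (Z \<circle> V)) \<cdot> (\<langle>X \<bullet> Y\<rangle> \<circle>\<^sub>a a\<^sub>b T U (Z \<circle> V)) \<cdot> \<gamma> (X \<bullet> Y) Z (T \<bullet> U) V"
    and R3: "\<lbrakk>ob X; ob Y; ob Z; ob T; ob U; ob V\<rbrakk> \<Longrightarrow>
      ((a\<^sub>c X Z U \<bullet>\<^sub>a \<langle>Y \<circle> T\<rangle>) \<circle>\<^sub>a \<langle>V\<rangle>) \<cdot> \<delta> (X \<circle> Z) (Y \<circle> T) U V
          \<cdot> (\<langle>X \<circle> Z\<rangle> \<bullet>\<^sub>a inv\<^sub>a (a\<^sub>c Y T (U\<^sup>- \<bullet> V))) \<cdot> \<zeta> X Y Z (T \<circle> (U\<^sup>- \<bullet> V))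
      = (\<zeta> X Y (Z \<circle> U) T \<circle>\<^sub>a \<langle>V\<rangle>) \<cdot> inv\<^sub>a (a\<^sub>c (X \<bullet> Y) ((Z \<circle> U) \<bullet> T) V)
          \<cdot> (\<langle>X \<bullet> Y\<rangle> \<circle>\<^sub>a \<delta> Z T U V)"
    and R4: "\<lbrakk>ob X; ob Y; ob Z; ob T; ob U; ob V\<rbrakk> \<Longrightarrow>
      (\<delta> X Y T U \<bullet>\<^sub>a \<langle>Z \<circle> V\<rangle>) \<cdot> inv\<^sub>a (a\<^sub>b X (Y \<circle> (T\<^sup>- \<bullet> U)) (Z \<circle> V))
          \<cdot> (\<langle>X\<rangle> \<bullet>\<^sub>a \<zeta> Y Z (T\<^sup>- \<bullet> U) V)
      = \<zeta> ((X \<circle> T) \<bullet> Y) Z U V \<cdot> (inv\<^sub>a (a\<^sub>b (X \<circle> T) Y Z) \<circle>\<^sub>a \<langle>U \<bullet> V\<rangle>)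
          \<cdot> \<delta> X (Y \<bullet> Z) T (U \<bullet> V) \<cdot> (\<langle>X\<rangle> \<bullet>\<^sub>a (\<langle>Y \<bullet> Z\<rangle> \<circle>\<^sub>a a\<^sub>b (T\<^sup>-) U V))"
    and R5: "\<lbrakk>ob X; ob Y; ob Z; ob T; ob U; ob V\<rbrakk> \<Longrightarrow>
      \<delta> X Y T (U \<bullet> (Z \<circle> V)) \<cdot> (\<langle>X\<rangle> \<bullet>\<^sub>a (\<langle>Y\<rangle> \<circle>\<^sub>a a\<^sub>b (T\<^sup>-) U (Z \<circle> V)))
          \<cdot> (\<langle>X\<rangle> \<bullet>\<^sub>a \<gamma> Y Z (T\<^sup>- \<bullet> U) V) \<cdot> a\<^sub>b X ((Y \<bullet> Z\<^sup>-) \<circle> (T\<^sup>- \<bullet> U)) V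
      = \<gamma> ((X \<circle> T) \<bullet> Y) Z U V \<cdot> ((inv\<^sub>a (a\<^sub>b (X \<circle> T) Y (Z\<^sup>-)) \<circle>\<^sub>a \<langle>U\<rangle>) \<bullet>\<^sub>a \<langle>V\<rangle>)
          \<cdot> (\<delta> X (Y \<bullet> Z\<^sup>-) T U \<bullet>\<^sub>a \<langle>V\<rangle>)"
    and R6: "l\<^sub>c (I \<bullet> I) \<cdot> (\<langle>I\<rangle> \<circle>\<^sub>a (\<langle>I\<rangle> \<bullet>\<^sub>a l\<^sub>c I)) \<cdot> \<gamma> I I I I
          \<cdot> ((((\<langle>I\<rangle> \<bullet>\<^sub>a \<phi>\<^sub>c\<^sub>0) \<cdot> \<Delta>\<^sub>I) \<circle>\<^sub>a \<langle>I\<rangle>) \<bullet>\<^sub>a \<langle>I\<rangle>)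
      = l\<^sub>c I \<bullet>\<^sub>a \<langle>I\<rangle>"
    and R7: "r\<^sub>c (I \<bullet> I) \<cdot> ((r\<^sub>c I \<bullet>\<^sub>a \<langle>I\<rangle>) \<circle>\<^sub>a \<langle>I\<rangle>) \<cdot> \<delta> I I I I
          \<cdot> (\<langle>I\<rangle> \<bullet>\<^sub>a (\<langle>I\<rangle> \<circle>\<^sub>a ((\<phi>\<^sub>c\<^sub>0 \<bullet>\<^sub>a \<langle>I\<rangle>) \<cdot> \<Delta>\<^sub>I)))
      = \<langle>I\<rangle> \<bullet>\<^sub>a r\<^sub>c I"
    and R8: "\<lbrakk>ob X; ob Y; ob Z; ob U\<rbrakk> \<Longrightarrow>
      \<gamma> (X \<circle> Z) Y (J \<circle> J) U \<cdot> (a\<^sub>c ((X \<circle> Z) \<bullet> Y\<^sup>-) J J \<bullet>\<^sub>a \<langle>U\<rangle>)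
          \<cdot> ((\<delta> X (Y\<^sup>-) Z J \<circle>\<^sub>a \<langle>J\<rangle>) \<bullet>\<^sub>a \<langle>U\<rangle>)
          \<cdot> (((\<langle>X\<rangle> \<bullet>\<^sub>a (\<langle>Y\<^sup>-\<rangle> \<circle>\<^sub>a inv\<^sub>a (r\<^sub>b (Z\<^sup>-)))) \<circle>\<^sub>a \<langle>J\<rangle>) \<bullet>\<^sub>a \<langle>U\<rangle>)
      = (\<langle>X \<circle> Z\<rangle> \<circle>\<^sub>a \<zeta> J Y J U) \<cdot> (\<langle>X \<circle> Z\<rangle> \<circle>\<^sub>a (inv\<^sub>a (l\<^sub>b Y) \<circle>\<^sub>a inv\<^sub>a (l\<^sub>b U)))
          \<cdot> inv\<^sub>a (a\<^sub>c X Z (Y \<circle> U)) \<cdot> (\<langle>X\<rangle> \<circle>\<^sub>a a\<^sub>c Z Y U)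
          \<cdot> (\<langle>X\<rangle> \<circle>\<^sub>a l\<^sub>b ((Z \<circle> Y) \<circle> U)) \<cdot> \<gamma> X (Z \<circle> Y) J U
          \<cdot> (((\<langle>X\<rangle> \<bullet>\<^sub>a \<phi>\<^sub>c Y Z) \<circle>\<^sub>a \<langle>J\<rangle>) \<bullet>\<^sub>a \<langle>U\<rangle>)"
    and R9: "\<lbrakk>ob X; ob Y; ob Z; ob U\<rbrakk> \<Longrightarrow>
      \<delta> X (J \<circle> J) Z (Y \<circle> U) \<cdot> (\<langle>X\<rangle> \<bullet>\<^sub>a inv\<^sub>a (a\<^sub>c J J (Z\<^sup>- \<bullet> (Y \<circle> U))))
          \<cdot> (\<langle>X\<rangle> \<bullet>\<^sub>a (\<langle>J\<rangle> \<circle>\<^sub>a \<gamma> J Y (Z\<^sup>-) U))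
          \<cdot> (\<langle>X\<rangle> \<bullet>\<^sub>a (\<langle>J\<rangle> \<circle>\<^sub>a ((inv\<^sub>a (l\<^sub>b (Y\<^sup>-)) \<circle>\<^sub>a \<langle>Z\<^sup>-\<rangle>) \<bullet>\<^sub>a \<langle>U\<rangle>)))
      = (\<zeta> X J Z J \<circle>\<^sub>a \<langle>Y \<circle> U\<rangle>) \<cdot> ((inv\<^sub>a (r\<^sub>b X) \<circle>\<^sub>a inv\<^sub>a (r\<^sub>b Z)) \<circle>\<^sub>a \<langle>Y \<circle> U\<rangle>)
          \<cdot> a\<^sub>c (X \<circle> Z) Y U \<cdot> (inv\<^sub>a (a\<^sub>c X Z Y) \<circle>\<^sub>a \<langle>U\<rangle>)
          \<cdot> (r\<^sub>b (X \<circle> (Z \<circle> Y)) \<circle>\<^sub>a \<langle>U\<rangle>) \<cdot> \<delta> X J (Z \<circle> Y) U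
          \<cdot> (\<langle>X\<rangle> \<bullet>\<^sub>a (\<langle>J\<rangle> \<circle>\<^sub>a (\<phi>\<^sub>c Y Z \<bullet>\<^sub>a \<langle>U\<rangle>)))"
    and R10: "\<lbrakk>ob X; ob Y; ob Z\<rbrakk> \<Longrightarrow>
      (a\<^sub>c X Y Z)\<^sup>-\<^sub>a \<cdot> \<phi>\<^sub>t (X \<circle> Y) Z \<cdot> (\<psi> X Y \<bullet>\<^sub>a \<langle>Z\<^sup>-\<rangle>)
      = \<psi>\<^sub>t X (Y \<circle> Z) \<cdot> (\<langle>X\<^sup>-\<rangle> \<bullet>\<^sub>a \<phi> Y Z) \<cdot> a\<^sub>b (X\<^sup>-) Y (Z\<^sup>-)"
    and R11: "ob X \<Longrightarrow>
      (r\<^sub>c X)\<^sup>-\<^sub>a \<cdot> l\<^sub>c ((X \<circle> I)\<^sup>-) \<cdot> (\<langle>I\<rangle> \<circle>\<^sub>a r\<^sub>b ((X \<circle> I)\<^sup>-)) \<cdot> \<gamma>\<^sub>t X I I J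
          \<cdot> (\<langle>X\<^sup>-\<rangle> \<bullet>\<^sub>a (\<Delta>\<^sub>I \<circle>\<^sub>a \<langle>J\<rangle>))
      = r\<^sub>b (X\<^sup>-) \<cdot> (\<langle>X\<^sup>-\<rangle> \<bullet>\<^sub>a l\<^sub>c J)"
    and R12: "ob X \<Longrightarrow>
      (l\<^sub>c X)\<^sup>-\<^sub>a \<cdot> r\<^sub>c ((I \<circle> X)\<^sup>-) \<cdot> (l\<^sub>b ((I \<circle> X)\<^sup>-) \<circle>\<^sub>a \<langle>I\<rangle>) \<cdot> \<delta>\<^sub>t J I I X
          \<cdot> ((\<langle>J\<rangle> \<circle>\<^sub>a \<Delta>\<^sub>I) \<bullet>\<^sub>a \<langle>X\<^sup>-\<rangle>)
      = l\<^sub>b (X\<^sup>-) \<cdot> (r\<^sub>c J \<bullet>\<^sub>a \<langle>X\<^sup>-\<rangle>)"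
    and R13: "\<lbrakk>ob X; ob Y; ob Z; ob T; ob U; ob V\<rbrakk> \<Longrightarrow>
      (\<langle>X\<rangle> \<circle>\<^sub>a a\<^sub>b T (Z \<circle> U) (Y \<circle> V)) \<cdot> \<gamma> X Y (T \<bullet> (Z \<circle> U)) V \<cdot> (\<gamma> (X \<bullet> Y\<^sup>-) Z T U \<bullet>\<^sub>a \<langle>V\<rangle>)
      = (\<langle>X\<rangle> \<circle>\<^sub>a (\<langle>T\<rangle> \<bullet>\<^sub>a \<zeta> Z Y U V)) \<cdot> \<gamma> X (Z \<bullet> Y) T (U \<bullet> V)
          \<cdot> (((\<langle>X\<rangle> \<bullet>\<^sub>a \<phi>\<^sub>b Y Z) \<circle>\<^sub>a \<langle>T\<rangle>) \<bullet>\<^sub>a \<langle>U \<bullet> V\<rangle>)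
          \<cdot> ((a\<^sub>b X (Y\<^sup>-) (Z\<^sup>-) \<circle>\<^sub>a \<langle>T\<rangle>) \<bullet>\<^sub>a \<langle>U \<bullet> V\<rangle>) \<cdot> a\<^sub>b (((X \<bullet> Y\<^sup>-) \<bullet> Z\<^sup>-) \<circle> T) U V"
    and R14: "\<lbrakk>ob X; ob Y; ob Z; ob T; ob U; ob V\<rbrakk> \<Longrightarrow>
      \<delta> X ((Y \<circle> T) \<bullet> Z) U V \<cdot> (\<langle>X\<rangle> \<bullet>\<^sub>a \<delta> Y Z T (U\<^sup>- \<bullet> V))
      = (a\<^sub>b (X \<circle> U) (Y \<circle> T) Z \<circle>\<^sub>a \<langle>V\<rangle>) \<cdot> ((\<zeta> X Y U T \<bullet>\<^sub>a \<langle>Z\<rangle>) \<circle>\<^sub>a \<langle>V\<rangle>)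
          \<cdot> \<delta> (X \<bullet> Y) Z (U \<bullet> T) V \<cdot> (\<langle>X \<bullet> Y\<rangle> \<bullet>\<^sub>a (\<langle>Z\<rangle> \<circle>\<^sub>a (\<phi>\<^sub>b T U \<bullet>\<^sub>a \<langle>V\<rangle>)))
          \<cdot> (\<langle>X \<bullet> Y\<rangle> \<bullet>\<^sub>a (\<langle>Z\<rangle> \<circle>\<^sub>a inv\<^sub>a (a\<^sub>b (T\<^sup>-) (U\<^sup>-) V)))
          \<cdot> inv\<^sub>a (a\<^sub>b X Y (Z \<circle> (T\<^sup>- \<bullet> (U\<^sup>- \<bullet> V))))"
    and R15: "\<lbrakk>ob X; ob Y; ob Z; ob T; ob U; ob V\<rbrakk> \<Longrightarrow>
      (\<langle>X\<rangle> \<circle>\<^sub>a \<gamma> Z T U (Y \<circle> V)) \<cdot> \<gamma> X Y ((Z \<bullet> T\<^sup>-) \<circle> U) V \<cdot> (a\<^sub>c (X \<bullet> Y\<^sup>-) (Z \<bullet> T\<^sup>-) U \<bullet>\<^sub>a \<langle>V\<rangle>)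
      = a\<^sub>c X Z (U \<bullet> (T \<circle> (Y \<circle> V))) \<cdot> (\<langle>X \<circle> Z\<rangle> \<circle>\<^sub>a (\<langle>U\<rangle> \<bullet>\<^sub>a a\<^sub>c T Y V))
          \<cdot> \<gamma> (X \<circle> Z) (T \<circle> Y) U V \<cdot> (((\<langle>X \<circle> Z\<rangle> \<bullet>\<^sub>a \<phi>\<^sub>c Y T) \<circle>\<^sub>a \<langle>U\<rangle>) \<bullet>\<^sub>a \<langle>V\<rangle>)
          \<cdot> ((\<zeta> X (Y\<^sup>-) Z (T\<^sup>-) \<circle>\<^sub>a \<langle>U\<rangle>) \<bullet>\<^sub>a \<langle>V\<rangle>)"
    and R16: "\<lbrakk>ob X; ob Y; ob Z; ob T; ob U; ob V\<rbrakk> \<Longrightarrow>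
      ((a\<^sub>c X U Z \<bullet>\<^sub>a \<langle>Y\<rangle>) \<circle>\<^sub>a \<langle>T \<circle> V\<rangle>) \<cdot> a\<^sub>c (((X \<circle> U) \<circle> Z) \<bullet> Y) T V
          \<cdot> (\<delta> (X \<circle> U) Y Z T \<circle>\<^sub>a \<langle>V\<rangle>) \<cdot> \<delta> X (Y \<circle> (Z\<^sup>- \<bullet> T)) U V
      = \<delta> X Y (U \<circle> Z) (T \<circle> V) \<cdot> (\<langle>X\<rangle> \<bullet>\<^sub>a (\<langle>Y\<rangle> \<circle>\<^sub>a (\<phi>\<^sub>c Z U \<bullet>\<^sub>a \<langle>T \<circle> V\<rangle>)))
          \<cdot> (\<langle>X\<rangle> \<bullet>\<^sub>a (\<langle>Y\<rangle> \<circle>\<^sub>a \<zeta> (Z\<^sup>-) T (U\<^sup>-) V)) \<cdot> (\<langle>X\<rangle> \<bullet>\<^sub>a a\<^sub>c Y (Z\<^sup>- \<bullet> T) (U\<^sup>- \<bullet> V))"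
    and R17: "r\<^sub>c J \<cdot> (\<langle>J\<rangle> \<circle>\<^sub>a r\<^sub>b I) \<cdot> (\<langle>J\<rangle> \<circle>\<^sub>a (\<langle>I\<rangle> \<bullet>\<^sub>a m\<^sub>J)) \<cdot> \<gamma> J J I J
          \<cdot> ((((\<langle>J\<rangle> \<bullet>\<^sub>a \<phi>\<^sub>b\<^sub>0) \<cdot> \<Delta>\<^sub>J) \<circle>\<^sub>a \<langle>I\<rangle>) \<bullet>\<^sub>a \<langle>J\<rangle>)
      = r\<^sub>b J \<cdot> (r\<^sub>c J \<bullet>\<^sub>a \<langle>J\<rangle>)"
    and R18: "l\<^sub>c J \<cdot> (l\<^sub>b I \<circle>\<^sub>a \<langle>J\<rangle>) \<cdot> ((m\<^sub>J \<bullet>\<^sub>a \<langle>I\<rangle>) \<circle>\<^sub>a \<langle>J\<rangle>) \<cdot> \<delta> J I J J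
          \<cdot> (\<langle>J\<rangle> \<bullet>\<^sub>a (\<langle>I\<rangle> \<circle>\<^sub>a ((\<phi>\<^sub>b\<^sub>0 \<bullet>\<^sub>a \<langle>J\<rangle>) \<cdot> \<Delta>\<^sub>J)))
      = l\<^sub>b J \<cdot> (\<langle>J\<rangle> \<bullet>\<^sub>a l\<^sub>c J)"

end

theory Submission
  imports Defs
begin

text \<open>
  The antipode of \<open>A \<bullet> B\<close> is \<open>\<phi>\<^sub>b B A \<cdot> \<sigma> (A\<^sup>-) (B\<^sup>-) \<cdot> (S\<^sub>A \<bullet> S\<^sub>B)\<close>. By R14, the left-hand side of its first
  equation is obtained by first applying \<open>\<delta>\<close> to \<open>B\<close>, with \<open>A\<^sup>- \<bullet> J\<close> as a spectator in the last
  argument, and then \<open>\<delta>\<close> to \<open>A\<close>; naturality of the braiding moves \<open>A\<^sup>-\<close> past \<open>B \<bullet> B\<^sup>-\<close>. By R5, R6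
  and R1, \<open>\<delta>\<close> with a spectator factorises through \<open>\<phi>\<close>, so that the antipode equation of \<open>B\<close>, and
  then that of \<open>A\<close>, can be used. The second equation is the first one in the duoidal category in
  which both tensor products are reversed; this exchanges \<open>\<gamma>\<close> with \<open>\<delta>\<close>, R1 with R3, R6 with R7,
  R13 with R14 and R17 with R18. The antipode of \<open>J\<close> is \<open>\<phi>\<^sub>b\<^sub>0\<close>.

  Coherence is handled by strictification: arrows built from rebracketings, unit constraints and
  generators are encoded as words of whiskered generators between lists of objects.
\<close>

text \<open>Three features of the axioms shape the argument. \<open>\<phi>\<^sub>b\<close> reverses
  its factors, mapping \<open>B\<^sup>- \<bullet> A\<^sup>-\<close> to
  \<open>(A \<bullet> B)\<^sup>-\<close>, so the values of the two antipodes must be crossed before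
  it applies; this crossing also puts \<open>B\<close> next to \<open>B\<^sup>-\<close>, where the
  inner \<open>\<delta>\<close> can act. The antipode equation of \<open>B\<close>, however, speaks
  about \<open>\<delta>\<close> with last argument \<open>J\<close>, whereas the inner
  \<open>\<delta>\<close> ends in \<open>A\<^sup>- \<bullet> J\<close>. As \<open>\<gamma>\<close>
  and \<open>\<delta>\<close> are not assumed invertible, the equation cannot be transported by
  cancellation; it is extended along an absorption arrow from
  \<open>((P \<bullet> I) \<circle> J) \<bullet> V\<close> to
  \<open>(P \<bullet> I) \<circle> V\<close> cut out of R5. Finally, R6 fixes
  \<open>\<gamma>\<close> at \<open>I\<close> only, while the absorption arrow involves arbitrary
  last arguments, so R6 has to be spread to them.\<close>

text \<open>Locale \<open>duoidal_ops\<close> reuses this symbol, and terms with many compositions would have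
  exponentially many parses.\<close>

no_notation Comp (infixr "\<cdot>\<index>" 60)

section \<open>Isomorphisms\<close>

context category
begin

abbreviation (input) cmp :: "'m \<Rightarrow> 'm \<Rightarrow> 'm"  (infixr "\<odot>" 60) where "g \<odot> f \<equiv> Comp C g f"
abbreviation (input) idt :: "'o \<Rightarrow> 'm" where "idt X \<equiv> Ident C X"
abbreviation (input) inv_of :: "'m \<Rightarrow> 'm" where "inv_of f \<equiv> inv_arrow C f"

lemma in_hom_iff: "f \<in> hom C X Y \<longleftrightarrow> f \<in> Arr C \<and> Dom C f = X \<and> Cod C f = Y"
  by (simp add: hom_def)

lemma homI: "f \<in> Arr C \<Longrightarrow> f \<in> hom C (Dom C f) (Cod C f)"
  by (simp add: hom_def)

lemma ident_arr [simp]: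
  assumes "X \<in> Ob C"
  shows "idt X \<in> Arr C" "Dom C (idt X) = X" "Cod C (idt X) = X"
  using ident_hom[OF assms] by (simp_all add: hom_def)

lemma comp_arr [simp]:
  assumes "f \<in> Arr C" "g \<in> Arr C" "Dom C g = Cod C f"
  shows "g \<odot> f \<in> Arr C" "Dom C (g \<odot> f) = Dom C f" "Cod C (g \<odot> f) = Cod C g"
proof -
  have "g \<odot> f \<in> hom C (Dom C f) (Cod C g)"
    using assms by (intro comp_hom[of f _ "Cod C f"]) (simp_all add: hom_def)
  then show "g \<odot> f \<in> Arr C" "Dom C (g \<odot> f) = Dom C f" "Cod C (g \<odot> f) = Cod C g"
    by (simp_all add: hom_def)
qed

lemma dom_cod_ob [simp]: "f \<in> Arr C \<Longrightarrow> Dom C f \<in> Ob C" "f \<in> Arr C \<Longrightarrow> Cod C f \<in> Ob C"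
  by (simp_all add: dom_ob cod_ob)

lemma ident_comp' [simp]: "\<lbrakk>f \<in> Arr C; Cod C f = Y\<rbrakk> \<Longrightarrow> idt Y \<odot> f = f"
  using ident_comp by (auto simp: hom_def)

lemma comp_ident' [simp]: "\<lbrakk>f \<in> Arr C; Dom C f = X\<rbrakk> \<Longrightarrow> f \<odot> idt X = f"
  using comp_ident by (auto simp: hom_def)

lemma comp_assoc':
  "\<lbrakk>f \<in> Arr C; g \<in> Arr C; h \<in> Arr C; Dom C g = Cod C f; Dom C h = Cod C g\<rbrakk>
    \<Longrightarrow> (h \<odot> g) \<odot> f = h \<odot> g \<odot> f"
  using comp_assoc[of f "Dom C f" "Cod C f" g "Cod C g" h "Cod C h"] by (simp add: hom_def)

text \<open>Pasting of two commutative squares. Iterated, it carries an arrow through a composite of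
  several factors while each square is proved separately; naturality of \<open>mid\<close> and its
  exchange with \<open>\<zeta>\<close> are assembled in this way.\<close>

lemma comp_square:
  assumes "g \<odot> x = y \<odot> g'" "f \<odot> y = z \<odot> f'" "x \<in> Arr C" "y \<in> Arr C" "z \<in> Arr C"
    "f \<in> Arr C" "g \<in> Arr C" "f' \<in> Arr C" "g' \<in> Arr C" "Dom C g = Cod C x" "Dom C y = Cod C g'"
    "Dom C f = Cod C g" "Dom C f = Cod C y" "Dom C z = Cod C f'" "Dom C f' = Cod C g'"
  shows "(f \<odot> g) \<odot> x = z \<odot> f' \<odot> g'"
proof -
  have "(f \<odot> g) \<odot> x = f \<odot> g \<odot> x"
    using assms(3-) by (intro comp_assoc') simp_all
  also have "\<dots> = (f \<odot> y) \<odot> g'"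
    unfolding assms(1) using assms(3-) by (intro comp_assoc'[symmetric]) simp_all
  also have "\<dots> = z \<odot> f' \<odot> g'"
    unfolding assms(2) using assms(3-) by (intro comp_assoc') simp_all
  finally show ?thesis .
qed

lemma inverse_arrows_unique:
  assumes "inverse_arrows C f g" "inverse_arrows C f h"
  shows "g = h"
proof -
  have t: "f \<in> Arr C" "g \<in> Arr C" "h \<in> Arr C" "Dom C g = Cod C f" "Dom C h = Cod C f"
    "Cod C g = Dom C f" "Cod C h = Dom C f"
    using assms by (auto simp: inverse_arrows_def hom_def)
  have "g = g \<odot> (f \<odot> h)"
    using assms t by (simp add: inverse_arrows_def)
  also have "\<dots> = (g \<odot> f) \<odot> h"
    using t by (simp add: comp_assoc')
  also have "\<dots> = h"
    using assms t by (simp add: inverse_arrows_def)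
  finally show ?thesis .
qed

lemma inv_arrow_eqI: "inverse_arrows C f g \<Longrightarrow> inv_of f = g"
  unfolding inv_arrow_def using inverse_arrows_unique by blast

lemma inverse_arrowsI:
  "\<lbrakk>f \<in> Arr C; g \<in> Arr C; Dom C g = Cod C f; Cod C g = Dom C f;
    g \<odot> f = idt (Dom C f); f \<odot> g = idt (Cod C f)\<rbrakk> \<Longrightarrow> inverse_arrows C f g"
  by (simp add: inverse_arrows_def hom_def)

lemma iso_inverse: "iso_arrow C f \<Longrightarrow> inverse_arrows C f (inv_of f)"
  unfolding iso_arrow_def using inv_arrow_eqI by blast

lemma iso_arr: "iso_arrow C f \<Longrightarrow> f \<in> Arr C"
  by (auto simp: iso_arrow_def inverse_arrows_def)

lemma inv_arr [simp]:
  assumes "iso_arrow C f"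
  shows "inv_of f \<in> Arr C" "Dom C (inv_of f) = Cod C f" "Cod C (inv_of f) = Dom C f"
    "inv_of f \<odot> f = idt (Dom C f)" "f \<odot> inv_of f = idt (Cod C f)"
  using iso_inverse[OF assms] by (auto simp: inverse_arrows_def hom_def)

lemma inv_comp_cancel [simp]:
  assumes "iso_arrow C f" "x \<in> Arr C"
  shows "Cod C x = Dom C f \<Longrightarrow> inv_of f \<odot> f \<odot> x = x"
    "Cod C x = Cod C f \<Longrightarrow> f \<odot> inv_of f \<odot> x = x"
proof -
  note [simp] = assms iso_arr[OF assms(1)]
  show "inv_of f \<odot> f \<odot> x = x" if x: "Cod C x = Dom C f"
    by (subst comp_assoc'[symmetric]) (simp_all add: x)
  show "f \<odot> inv_of f \<odot> x = x" if x: "Cod C x = Cod C f"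
    by (subst comp_assoc'[symmetric]) (simp_all add: x)
qed

lemma inverse_arrows_sym: "inverse_arrows C f g \<Longrightarrow> inverse_arrows C g f"
  by (auto simp: inverse_arrows_def hom_def)

lemma inverse_arrows_iso: "inverse_arrows C f g \<Longrightarrow> iso_arrow C f \<and> iso_arrow C g"
  using inverse_arrows_sym by (auto simp: iso_arrow_def)

lemma iso_inv [simp]: "iso_arrow C f \<Longrightarrow> iso_arrow C (inv_of f)"
  using iso_inverse inverse_arrows_iso by blast

lemma inv_inv [simp]: "iso_arrow C f \<Longrightarrow> inv_of (inv_of f) = f"
  using iso_inverse inverse_arrows_sym inv_arrow_eqI by blast

lemma iso_ident [simp]: "X \<in> Ob C \<Longrightarrow> iso_arrow C (idt X)"
  using inverse_arrowsI[of "idt X" "idt X"] by (auto simp: iso_arrow_def)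

lemma inv_ident [simp]: "X \<in> Ob C \<Longrightarrow> inv_of (idt X) = idt X"
  by (rule inv_arrow_eqI) (rule inverse_arrowsI, simp_all)

lemma inverse_comp:
  assumes "iso_arrow C f" "iso_arrow C g" "Dom C g = Cod C f"
  shows "inverse_arrows C (g \<odot> f) (inv_of f \<odot> inv_of g)"
  using assms iso_arr[OF assms(1)] iso_arr[OF assms(2)]
  by (intro inverse_arrowsI) (simp_all add: comp_assoc')

lemma iso_comp [simp]: "\<lbrakk>iso_arrow C f; iso_arrow C g; Dom C g = Cod C f\<rbrakk> \<Longrightarrow> iso_arrow C (g \<odot> f)"
  using inverse_comp inverse_arrows_iso by blast

lemma inv_comp: "\<lbrakk>iso_arrow C f; iso_arrow C g; Dom C g = Cod C f\<rbrakk>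
    \<Longrightarrow> inv_of (g \<odot> f) = inv_of f \<odot> inv_of g"
  using inverse_comp inv_arrow_eqI by blast

lemma iso_cancel_left:
  assumes "iso_arrow C h" "h \<odot> f = h \<odot> g" "f \<in> Arr C" "g \<in> Arr C" "Cod C f = Dom C h" "Cod C g = Dom C h"
  shows "f = g"
proof -
  have "f = inv_of h \<odot> h \<odot> f"
    using assms(1,3,5) by simp
  also have "\<dots> = inv_of h \<odot> h \<odot> g"
    by (simp only: assms(2))
  also have "\<dots> = g"
    using assms(1,4,6) by simp
  finally show ?thesis .
qed

lemma iso_cancel_right:
  assumes "iso_arrow C h" "f \<odot> h = g \<odot> h" "f \<in> Arr C" "g \<in> Arr C" "Dom C f = Cod C h" "Dom C g = Cod C h"
  shows "f = g"
proof -
  note h = iso_arr[OF assms(1)]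
  have "f = (f \<odot> h) \<odot> inv_of h"
    using assms(1,3,5) h by (simp add: comp_assoc')
  also have "\<dots> = (g \<odot> h) \<odot> inv_of h"
    by (simp only: assms(2))
  also have "\<dots> = g"
    using assms(1,4,6) h by (simp add: comp_assoc')
  finally show ?thesis .
qed

lemma move_inv_right:
  assumes "iso_arrow C h" "f \<odot> h = g" "f \<in> Arr C" "Dom C f = Cod C h"
  shows "f = g \<odot> inv_of h"
  using assms iso_arr[OF assms(1)] by (auto simp: comp_assoc')

text \<open>Inverting two parallel sides turns a commutative square around; naturality of the
  inverse constraints is obtained like this.\<close>

lemma inv_natural:
  assumes "iso_arrow C h" "iso_arrow C k" "k \<odot> f = g \<odot> h" "f \<in> Arr C" "g \<in> Arr C"
    "Dom C k = Cod C f" "Dom C g = Cod C h" "Dom C f = Dom C h" "Cod C g = Cod C k"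
  shows "inv_of k \<odot> g = f \<odot> inv_of h"
proof -
  have h: "h \<in> Arr C" and k: "k \<in> Arr C"
    using assms iso_arr by auto
  have "inv_of k \<odot> g = inv_of k \<odot> (g \<odot> h) \<odot> inv_of h"
    using assms(1,2,4-) h k by (simp add: comp_assoc')
  also have "\<dots> = inv_of k \<odot> (k \<odot> f) \<odot> inv_of h"
    using assms by simp
  also have "\<dots> = f \<odot> inv_of h"
    using assms(1,2,4-) h k by (simp add: comp_assoc')
  finally show ?thesis .
qed

end


section \<open>Coherence for monoidal categories\<close>

context monoidal_category
begin

abbreviation (input) tob :: "'o \<Rightarrow> 'o \<Rightarrow> 'o"  (infixl "\<otimes>\<^sub>o" 80) where "X \<otimes>\<^sub>o Y \<equiv> Tob T X Y"
abbreviation (input) tar :: "'m \<Rightarrow> 'm \<Rightarrow> 'm"  (infixl "\<otimes>\<^sub>a" 80) where "f \<otimes>\<^sub>a g \<equiv> Tar T f g"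

lemmas tensor_ob' [simp] = tensor_ob
lemmas unit_ob' [simp] = unit_ob

lemma tensor_arr [simp]:
  assumes "f \<in> Arr C" "g \<in> Arr C"
  shows "f \<otimes>\<^sub>a g \<in> Arr C" "Dom C (f \<otimes>\<^sub>a g) = Dom C f \<otimes>\<^sub>o Dom C g"
    "Cod C (f \<otimes>\<^sub>a g) = Cod C f \<otimes>\<^sub>o Cod C g"
  using tensor_hom[OF homI[OF assms(1)] homI[OF assms(2)]] by (simp_all add: hom_def)

lemmas tensor_ident' [simp] = tensor_ident

lemma tensor_comp':
  assumes "f \<in> Arr C" "f' \<in> Arr C" "g \<in> Arr C" "g' \<in> Arr C" "Dom C f' = Cod C f" "Dom C g' = Cod C g"
  shows "(f' \<otimes>\<^sub>a g') \<odot> (f \<otimes>\<^sub>a g) = (f' \<odot> f) \<otimes>\<^sub>a (g' \<odot> g)"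
  using tensor_comp[of f _ "Cod C f" f' _ g _ "Cod C g" g'] assms by (simp add: hom_def)

text \<open>Composites are kept right-nested, where two adjacent tensor products with a further
  factor behind them do not form a subterm. This variant matches there, so that \<open>merge\<close>
  fuses neighbouring tensor products wherever they occur.\<close>

lemma tensor_comp_extend:
  assumes "f \<in> Arr C" "f' \<in> Arr C" "g \<in> Arr C" "g' \<in> Arr C" "Dom C f' = Cod C f" "Dom C g' = Cod C g"
    "x \<in> Arr C" "Cod C x = Dom C f \<otimes>\<^sub>o Dom C g"
  shows "(f' \<otimes>\<^sub>a g') \<odot> (f \<otimes>\<^sub>a g) \<odot> x = ((f' \<odot> f) \<otimes>\<^sub>a (g' \<odot> g)) \<odot> x"
  using assms comp_assoc'[of x "f \<otimes>\<^sub>a g" "f' \<otimes>\<^sub>a g'"] by (simp add: tensor_comp')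

lemmas merge = tensor_comp' tensor_comp_extend comp_assoc'

lemma assoc_arr [simp]:
  assumes "X \<in> Ob C" "Y \<in> Ob C" "Z \<in> Ob C"
  shows "Assoc T X Y Z \<in> Arr C" "Dom C (Assoc T X Y Z) = X \<otimes>\<^sub>o Y \<otimes>\<^sub>o Z"
    "Cod C (Assoc T X Y Z) = X \<otimes>\<^sub>o (Y \<otimes>\<^sub>o Z)" "iso_arrow C (Assoc T X Y Z)"
  using assoc_hom[OF assms] assoc_iso[OF assms] by (simp_all add: hom_def)

lemma unit_arr [simp]:
  assumes "X \<in> Ob C"
  shows "LUnit T X \<in> Arr C" "Dom C (LUnit T X) = Unit T \<otimes>\<^sub>o X" "Cod C (LUnit T X) = X" "iso_arrow C (LUnit T X)"
    "RUnit T X \<in> Arr C" "Dom C (RUnit T X) = X \<otimes>\<^sub>o Unit T" "Cod C (RUnit T X) = X" "iso_arrow C (RUnit T X)"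
  using lunit_hom[OF assms] runit_hom[OF assms] lunit_iso[OF assms] runit_iso[OF assms] by (simp_all add: hom_def)

lemma assoc_natural':
  assumes "f \<in> Arr C" "g \<in> Arr C" "h \<in> Arr C" "Cod C f = X" "Cod C g = Y" "Cod C h = Z"
  shows "Assoc T X Y Z \<odot> (f \<otimes>\<^sub>a g \<otimes>\<^sub>a h) = (f \<otimes>\<^sub>a (g \<otimes>\<^sub>a h)) \<odot> Assoc T (Dom C f) (Dom C g) (Dom C h)"
  using assoc_natural[of f "Dom C f" "Cod C f" g "Dom C g" "Cod C g" h "Dom C h" "Cod C h"] assms by (simp add: hom_def)

lemma assoc_inv_natural:
  assumes "f \<in> Arr C" "g \<in> Arr C" "h \<in> Arr C" "Cod C f = X" "Cod C g = Y" "Cod C h = Z"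
  shows "inv_of (Assoc T X Y Z) \<odot> (f \<otimes>\<^sub>a (g \<otimes>\<^sub>a h))
    = (f \<otimes>\<^sub>a g \<otimes>\<^sub>a h) \<odot> inv_of (Assoc T (Dom C f) (Dom C g) (Dom C h))"
  using assms by (intro inv_natural) (auto simp: assoc_natural')

lemma lunit_natural':
  assumes "f \<in> Arr C" "Cod C f = Y"
  shows "LUnit T Y \<odot> (idt (Unit T) \<otimes>\<^sub>a f) = f \<odot> LUnit T (Dom C f)"
  using lunit_natural[of f "Dom C f" "Cod C f"] assms by (simp add: hom_def)

lemma runit_natural':
  assumes "f \<in> Arr C" "Cod C f = Y"
  shows "RUnit T Y \<odot> (f \<otimes>\<^sub>a idt (Unit T)) = f \<odot> RUnit T (Dom C f)"
  using runit_natural[of f "Dom C f" "Cod C f"] assms by (simp add: hom_def)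

lemma lunit_inv_natural:
  assumes "f \<in> Arr C" "Cod C f = Y"
  shows "inv_of (LUnit T Y) \<odot> f = (idt (Unit T) \<otimes>\<^sub>a f) \<odot> inv_of (LUnit T (Dom C f))"
  using assms by (intro inv_natural) (auto simp: lunit_natural')

lemma runit_inv_natural:
  assumes "f \<in> Arr C" "Cod C f = Y"
  shows "inv_of (RUnit T Y) \<odot> f = (f \<otimes>\<^sub>a idt (Unit T)) \<odot> inv_of (RUnit T (Dom C f))"
  using assms by (intro inv_natural) (auto simp: runit_natural')

lemma tensor_inverse:
  assumes "iso_arrow C f" "iso_arrow C g"
  shows "inverse_arrows C (f \<otimes>\<^sub>a g) (inv_of f \<otimes>\<^sub>a inv_of g)"
  using assms iso_arr[OF assms(1)] iso_arr[OF assms(2)]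
  by (intro inverse_arrowsI) (simp_all add: tensor_comp')

lemma iso_tensor [simp]: "\<lbrakk>iso_arrow C f; iso_arrow C g\<rbrakk> \<Longrightarrow> iso_arrow C (f \<otimes>\<^sub>a g)"
  using tensor_inverse inverse_arrows_iso by blast

lemma inv_tensor: "\<lbrakk>iso_arrow C f; iso_arrow C g\<rbrakk> \<Longrightarrow> inv_of (f \<otimes>\<^sub>a g) = inv_of f \<otimes>\<^sub>a inv_of g"
  using tensor_inverse inv_arrow_eqI by blast

text \<open>\<open>LUnit\<close> is a natural isomorphism from tensoring with the unit to the
  identity functor, and a functor isomorphic to the identity is faithful.\<close>

lemma lunit_faithful:
  assumes "idt (Unit T) \<otimes>\<^sub>a f = idt (Unit T) \<otimes>\<^sub>a g" "f \<in> Arr C" "g \<in> Arr C" "Dom C f = Dom C g" "Cod C f = Cod C g"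
  shows "f = g"
proof -
  have eq: "f \<odot> LUnit T (Dom C f) = g \<odot> LUnit T (Dom C f)"
    using assms lunit_natural'[of f "Cod C f"] lunit_natural'[of g "Cod C f"] by simp
  show ?thesis
    using assms by (intro iso_cancel_right[OF _ eq]) simp_all
qed

lemma runit_faithful:
  assumes "f \<otimes>\<^sub>a idt (Unit T) = g \<otimes>\<^sub>a idt (Unit T)" "f \<in> Arr C" "g \<in> Arr C" "Dom C f = Dom C g" "Cod C f = Cod C g"
  shows "f = g"
proof -
  have eq: "f \<odot> RUnit T (Dom C f) = g \<odot> RUnit T (Dom C f)"
    using assms runit_natural'[of f "Cod C f"] runit_natural'[of g "Cod C f"] by simp
  show ?thesis
    using assms by (intro iso_cancel_right[OF _ eq]) simp_all
qed

text \<open>The next three lemmas are Kelly's redundancies among the coherence axioms.\<close>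

lemma lunit_tensor:
  assumes [simp]: "X \<in> Ob C" "Y \<in> Ob C"
  shows "LUnit T (X \<otimes>\<^sub>o Y) \<odot> Assoc T (Unit T) X Y = LUnit T X \<otimes>\<^sub>a idt Y"
proof -
  let ?I = "Unit T"
  let ?a = "Assoc T"
  have "(idt ?I \<otimes>\<^sub>a (LUnit T (X \<otimes>\<^sub>o Y) \<odot> ?a ?I X Y)) \<odot> ?a ?I (?I \<otimes>\<^sub>o X) Y \<odot> (?a ?I ?I X \<otimes>\<^sub>a idt Y)
    = (idt ?I \<otimes>\<^sub>a LUnit T (X \<otimes>\<^sub>o Y)) \<odot> (idt ?I \<otimes>\<^sub>a ?a ?I X Y) \<odot> ?a ?I (?I \<otimes>\<^sub>o X) Y \<odot> (?a ?I ?I X \<otimes>\<^sub>a idt Y)"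
    by (simp add: merge)
  also have "\<dots> = ((idt ?I \<otimes>\<^sub>a LUnit T (X \<otimes>\<^sub>o Y)) \<odot> ?a ?I ?I (X \<otimes>\<^sub>o Y)) \<odot> ?a (?I \<otimes>\<^sub>o ?I) X Y"
    by (simp add: pentagon comp_assoc')
  also have "\<dots> = (RUnit T ?I \<otimes>\<^sub>a (idt X \<otimes>\<^sub>a idt Y)) \<odot> ?a (?I \<otimes>\<^sub>o ?I) X Y"
    by (simp add: triangle)
  also have "\<dots> = ?a ?I X Y \<odot> (RUnit T ?I \<otimes>\<^sub>a idt X \<otimes>\<^sub>a idt Y)"
    by (subst assoc_natural') (simp_all del: tensor_ident')
  also have "\<dots> = ?a ?I X Y \<odot> (((idt ?I \<otimes>\<^sub>a LUnit T X) \<odot> ?a ?I ?I X) \<otimes>\<^sub>a idt Y)"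
    by (simp add: triangle)
  also have "\<dots> = (?a ?I X Y \<odot> (idt ?I \<otimes>\<^sub>a LUnit T X \<otimes>\<^sub>a idt Y)) \<odot> (?a ?I ?I X \<otimes>\<^sub>a idt Y)"
    by (simp add: merge)
  also have "\<dots> = (idt ?I \<otimes>\<^sub>a (LUnit T X \<otimes>\<^sub>a idt Y)) \<odot> ?a ?I (?I \<otimes>\<^sub>o X) Y \<odot> (?a ?I ?I X \<otimes>\<^sub>a idt Y)"
    by (subst assoc_natural') (simp_all add: comp_assoc')
  finally have eq: "(idt ?I \<otimes>\<^sub>a (LUnit T (X \<otimes>\<^sub>o Y) \<odot> ?a ?I X Y)) \<odot> ?a ?I (?I \<otimes>\<^sub>o X) Y \<odot> (?a ?I ?I X \<otimes>\<^sub>a idt Y)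
    = (idt ?I \<otimes>\<^sub>a (LUnit T X \<otimes>\<^sub>a idt Y)) \<odot> ?a ?I (?I \<otimes>\<^sub>o X) Y \<odot> (?a ?I ?I X \<otimes>\<^sub>a idt Y)" .
  show ?thesis
    by (rule lunit_faithful, rule iso_cancel_right[OF _ eq]) simp_all
qed

lemma runit_tensor:
  assumes [simp]: "X \<in> Ob C" "Y \<in> Ob C"
  shows "(idt X \<otimes>\<^sub>a RUnit T Y) \<odot> Assoc T X Y (Unit T) = RUnit T (X \<otimes>\<^sub>o Y)"
proof -
  let ?I = "Unit T"
  let ?a = "Assoc T"
  have "?a X Y ?I \<odot> (((idt X \<otimes>\<^sub>a RUnit T Y) \<odot> ?a X Y ?I) \<otimes>\<^sub>a idt ?I)
    = (?a X Y ?I \<odot> (idt X \<otimes>\<^sub>a RUnit T Y \<otimes>\<^sub>a idt ?I)) \<odot> (?a X Y ?I \<otimes>\<^sub>a idt ?I)"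
    by (simp add: merge)
  also have "\<dots> = (idt X \<otimes>\<^sub>a (RUnit T Y \<otimes>\<^sub>a idt ?I)) \<odot> ?a X (Y \<otimes>\<^sub>o ?I) ?I \<odot> (?a X Y ?I \<otimes>\<^sub>a idt ?I)"
    by (subst assoc_natural') (simp_all add: comp_assoc')
  also have "\<dots> = (idt X \<otimes>\<^sub>a ((idt Y \<otimes>\<^sub>a LUnit T ?I) \<odot> ?a Y ?I ?I)) \<odot> ?a X (Y \<otimes>\<^sub>o ?I) ?I \<odot> (?a X Y ?I \<otimes>\<^sub>a idt ?I)"
    by (simp add: triangle)
  also have "\<dots> = (idt X \<otimes>\<^sub>a (idt Y \<otimes>\<^sub>a LUnit T ?I)) \<odot> (idt X \<otimes>\<^sub>a ?a Y ?I ?I) \<odot> ?a X (Y \<otimes>\<^sub>o ?I) ?I \<odot> (?a X Y ?I \<otimes>\<^sub>a idt ?I)"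
    by (simp add: merge)
  also have "\<dots> = ((idt X \<otimes>\<^sub>a (idt Y \<otimes>\<^sub>a LUnit T ?I)) \<odot> ?a X Y (?I \<otimes>\<^sub>o ?I)) \<odot> ?a (X \<otimes>\<^sub>o Y) ?I ?I"
    by (simp add: pentagon comp_assoc')
  also have "\<dots> = (?a X Y ?I \<odot> (idt X \<otimes>\<^sub>a idt Y \<otimes>\<^sub>a LUnit T ?I)) \<odot> ?a (X \<otimes>\<^sub>o Y) ?I ?I"
    by (subst assoc_natural') (simp_all)
  also have "\<dots> = ?a X Y ?I \<odot> (RUnit T (X \<otimes>\<^sub>o Y) \<otimes>\<^sub>a idt ?I)"
    by (simp add: comp_assoc' triangle)
  finally have eq: "?a X Y ?I \<odot> (((idt X \<otimes>\<^sub>a RUnit T Y) \<odot> ?a X Y ?I) \<otimes>\<^sub>a idt ?I)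
    = ?a X Y ?I \<odot> (RUnit T (X \<otimes>\<^sub>o Y) \<otimes>\<^sub>a idt ?I)" .
  show ?thesis
    by (rule runit_faithful, rule iso_cancel_left[OF _ eq]) simp_all
qed

lemma lunit_unit: "LUnit T (Unit T) = RUnit T (Unit T)"
proof -
  let ?I = "Unit T"
  have l: "LUnit T (?I \<otimes>\<^sub>o ?I) = idt ?I \<otimes>\<^sub>a LUnit T ?I"
  proof -
    have eq: "LUnit T ?I \<odot> LUnit T (?I \<otimes>\<^sub>o ?I) = LUnit T ?I \<odot> (idt ?I \<otimes>\<^sub>a LUnit T ?I)"
      by (simp add: lunit_natural')
    show ?thesis
      by (rule iso_cancel_left[OF _ eq]) simp_all
  qed
  have "LUnit T ?I \<otimes>\<^sub>a idt ?I = RUnit T ?I \<otimes>\<^sub>a idt ?I"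
    using lunit_tensor[of ?I ?I] triangle[of ?I ?I] by (simp add: l)
  then show ?thesis
    by (rule runit_faithful) simp_all
qed

end


section \<open>Formal bracketings, formal arrows and words\<close>

datatype 'o tree = Lf 'o | Em | Nd "'o tree" "'o tree"

text \<open>Flattening drops \<open>Em\<close> but keeps a leaf \<open>Lf (Unit T)\<close> as an
  entry. A tree thus records more than the object it denotes: it marks the occurrences of the unit
  that may be erased.\<close>

primrec leaves :: "'o tree \<Rightarrow> 'o list" where
  "leaves (Lf X) = [X]"
| "leaves Em = []"
| "leaves (Nd s t) = leaves s @ leaves t"

text \<open>Sources and targets must be trees, since an object does not determine its bracketing.
  \<open>Gn\<close> embeds an arbitrary arrow with chosen bracketings. The inverse constraints get
  constructors of their own because they, too, leave no trace in a word.\<close>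

datatype ('o, 'm) tm =
    IdT "'o tree"
  | Cm "('o, 'm) tm" "('o, 'm) tm"  (infixr "\<oslash>" 60)
  | Tn "('o, 'm) tm" "('o, 'm) tm"  (infix "\<otimes>\<^sub>t" 80)
  | As "'o tree" "'o tree" "'o tree"
  | AsI "'o tree" "'o tree" "'o tree"
  | LU "'o tree"
  | LUI "'o tree"
  | RU "'o tree"
  | RUI "'o tree"
  | Gn "'o tree" 'm "'o tree"

primrec src :: "('o, 'm) tm \<Rightarrow> 'o tree" where
  "src (IdT t) = t"
| "src (a \<oslash> b) = src b"
| "src (a \<otimes>\<^sub>t b) = Nd (src a) (src b)"
| "src (As r s t) = Nd (Nd r s) t"
| "src (AsI r s t) = Nd r (Nd s t)"
| "src (LU t) = Nd Em t"
| "src (LUI t) = t"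
| "src (RU t) = Nd t Em"
| "src (RUI t) = t"
| "src (Gn s f t) = s"

primrec tgt :: "('o, 'm) tm \<Rightarrow> 'o tree" where
  "tgt (IdT t) = t"
| "tgt (a \<oslash> b) = tgt a"
| "tgt (a \<otimes>\<^sub>t b) = Nd (tgt a) (tgt b)"
| "tgt (As r s t) = Nd r (Nd s t)"
| "tgt (AsI r s t) = Nd (Nd r s) t"
| "tgt (LU t) = t"
| "tgt (LUI t) = Nd Em t"
| "tgt (RU t) = t"
| "tgt (RUI t) = Nd t Em"
| "tgt (Gn s f t) = t"

text \<open>A letter \<open>(ls, xs, f, ys, rs)\<close> stands for the arrow \<open>f\<close> from \<open>xs\<close> to \<open>ys\<close>, whiskered by
  \<open>ls\<close> and \<open>rs\<close>. Words are written in the order of composition.\<close>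

type_synonym ('o, 'm) letter = "'o list \<times> 'o list \<times> 'm \<times> 'o list \<times> 'o list"

primrec word_cod :: "'o list \<Rightarrow> ('o, 'm) letter list \<Rightarrow> 'o list" where
  "word_cod xs [] = xs"
| "word_cod xs (l # w) = (case l of (ls, as, f, bs, rs) \<Rightarrow> ls @ bs @ rs)"

definition whisker :: "'o list \<Rightarrow> 'o list \<Rightarrow> ('o, 'm) letter list \<Rightarrow> ('o, 'm) letter list" where
  "whisker ls rs = map (\<lambda>(l, as, f, bs, r). (ls @ l, as, f, bs, r @ rs))"

lemma whisker_simps [simp]:
  "whisker ls rs [] = []"
  "whisker ls rs ((l, as, f, bs, r) # w) = (ls @ l, as, f, bs, r @ rs) # whisker ls rs w"
  "whisker ls rs (w @ w') = whisker ls rs w @ whisker ls rs w'"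
  by (simp_all add: whisker_def)

lemma word_cod_append [simp]: "word_cod xs (u @ v) = word_cod (word_cod xs v) u"
  by (cases u) auto

lemma word_cod_whisker [simp]: "word_cod (ls @ xs @ rs) (whisker ls rs w) = ls @ word_cod xs w @ rs"
  by (cases w) auto

section \<open>Iterated tensor products over lists, concatenation and whiskering\<close>

context monoidal_category
begin

primrec tree_ob :: "'o tree \<Rightarrow> 'o" where
  "tree_ob (Lf X) = X"
| "tree_ob Em = Unit T"
| "tree_ob (Nd s t) = tree_ob s \<otimes>\<^sub>o tree_ob t"

primrec list_ob :: "'o list \<Rightarrow> 'o" where
  "list_ob [] = Unit T"
| "list_ob (x # xs) = x \<otimes>\<^sub>o list_ob xs"

text \<open>The canonical isomorphism from \<open>list_ob xs \<otimes>\<^sub>o list_ob ys\<close> to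
  \<open>list_ob (xs @ ys)\<close>. Its recursion follows \<open>list_ob\<close>, which brackets to
  the right and ends in the unit.\<close>

primrec mu :: "'o list \<Rightarrow> 'o list \<Rightarrow> 'm" where
  "mu [] ys = LUnit T (list_ob ys)"
| "mu (x # xs) ys = (idt x \<otimes>\<^sub>a mu xs ys) \<odot> Assoc T x (list_ob xs) (list_ob ys)"

lemma list_ob_ob [simp]: "set xs \<subseteq> Ob C \<Longrightarrow> list_ob xs \<in> Ob C"
  by (induction xs) auto

lemma mu_arr:
  assumes "set xs \<subseteq> Ob C" "set ys \<subseteq> Ob C"
  shows "iso_arrow C (mu xs ys) \<and> mu xs ys \<in> Arr C
    \<and> Dom C (mu xs ys) = list_ob xs \<otimes>\<^sub>o list_ob ys \<and> Cod C (mu xs ys) = list_ob (xs @ ys)"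
  using assms by (induction xs) auto

lemma mu_simps [simp]:
  assumes "set xs \<subseteq> Ob C" "set ys \<subseteq> Ob C"
  shows "iso_arrow C (mu xs ys)" "mu xs ys \<in> Arr C"
    "Dom C (mu xs ys) = list_ob xs \<otimes>\<^sub>o list_ob ys" "Cod C (mu xs ys) = list_ob (xs @ ys)"
  using mu_arr[OF assms] by auto

text \<open>Concatenation of lists is strictly associative and \<open>mu\<close> respects this. In
  the induction on \<open>xs\<close> the empty list is \<open>lunit_tensor\<close> and the step is
  the pentagon.\<close>

lemma mu_assoc:
  assumes "set xs \<subseteq> Ob C" "set ys \<subseteq> Ob C" "set zs \<subseteq> Ob C"
  shows "mu (xs @ ys) zs \<odot> (mu xs ys \<otimes>\<^sub>a idt (list_ob zs))
    = mu xs (ys @ zs) \<odot> (idt (list_ob xs) \<otimes>\<^sub>a mu ys zs) \<odot> Assoc T (list_ob xs) (list_ob ys) (list_ob zs)"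
  using assms
proof (induction xs)
  case Nil
  then show ?case
    by (simp add: lunit_tensor[symmetric] comp_assoc'[symmetric] lunit_natural')
next
  case (Cons x xs)
  note [simp] = Cons.prems
  have [simp]: "x \<in> Ob C" "set xs \<subseteq> Ob C"
    using Cons.prems by auto
  let ?X = "list_ob xs" and ?Y = "list_ob ys" and ?Z = "list_ob zs" and ?a = "Assoc T"
  have "mu ((x # xs) @ ys) zs \<odot> (mu (x # xs) ys \<otimes>\<^sub>a idt ?Z)
    = (idt x \<otimes>\<^sub>a mu (xs @ ys) zs) \<odot> (?a x (list_ob (xs @ ys)) ?Z \<odot> (idt x \<otimes>\<^sub>a mu xs ys \<otimes>\<^sub>a idt ?Z)) \<odot> (?a x ?X ?Y \<otimes>\<^sub>a idt ?Z)"
    by (simp add: merge)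
  also have "\<dots> = (idt x \<otimes>\<^sub>a (mu (xs @ ys) zs \<odot> (mu xs ys \<otimes>\<^sub>a idt ?Z))) \<odot> ?a x (?X \<otimes>\<^sub>o ?Y) ?Z \<odot> (?a x ?X ?Y \<otimes>\<^sub>a idt ?Z)"
    by (subst assoc_natural') (simp_all add: merge)
  also have "\<dots> = (idt x \<otimes>\<^sub>a (mu xs (ys @ zs) \<odot> (idt ?X \<otimes>\<^sub>a mu ys zs) \<odot> ?a ?X ?Y ?Z)) \<odot> ?a x (?X \<otimes>\<^sub>o ?Y) ?Z \<odot> (?a x ?X ?Y \<otimes>\<^sub>a idt ?Z)"
    by (simp add: Cons.IH)
  also have "\<dots> = (idt x \<otimes>\<^sub>a (mu xs (ys @ zs) \<odot> (idt ?X \<otimes>\<^sub>a mu ys zs))) \<odot> (idt x \<otimes>\<^sub>a ?a ?X ?Y ?Z) \<odot> ?a x (?X \<otimes>\<^sub>o ?Y) ?Z \<odot> (?a x ?X ?Y \<otimes>\<^sub>a idt ?Z)"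
    by (simp add: merge)
  also have "\<dots> = (idt x \<otimes>\<^sub>a mu xs (ys @ zs)) \<odot> ((idt x \<otimes>\<^sub>a (idt ?X \<otimes>\<^sub>a mu ys zs)) \<odot> ?a x ?X (?Y \<otimes>\<^sub>o ?Z)) \<odot> ?a (x \<otimes>\<^sub>o ?X) ?Y ?Z"
    by (simp add: merge pentagon)
  also have "\<dots> = (idt x \<otimes>\<^sub>a mu xs (ys @ zs)) \<odot> (?a x ?X (list_ob (ys @ zs)) \<odot> (idt x \<otimes>\<^sub>a idt ?X \<otimes>\<^sub>a mu ys zs)) \<odot> ?a (x \<otimes>\<^sub>o ?X) ?Y ?Z"
    by (subst assoc_natural') simp_all
  finally show ?case
    by (simp add: comp_assoc')
qed

text \<open>The induction step is \<open>runit_tensor\<close>; the left and right unit constraints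
  meet at the empty list, where \<open>lunit_unit\<close> identifies them.\<close>

lemma mu_Nil: "set xs \<subseteq> Ob C \<Longrightarrow> mu xs [] = RUnit T (list_ob xs)"
proof (induction xs)
  case (Cons x xs)
  then show ?case
    by (simp add: runit_tensor)
qed (simp add: lunit_unit)

primrec whl :: "'o list \<Rightarrow> 'm \<Rightarrow> 'm" where
  "whl [] f = f"
| "whl (x # xs) f = idt x \<otimes>\<^sub>a whl xs f"

text \<open>Because \<open>list_ob\<close> brackets to the right, whiskering on the left is
  literally tensoring with identities, whereas on the right the arrow is conjugated by
  \<open>mu\<close>. The lists \<open>as\<close> and \<open>bs\<close> are arguments since they
  cannot be recovered from \<open>f\<close>.\<close>

definition whr :: "'o list \<Rightarrow> 'o list \<Rightarrow> 'm \<Rightarrow> 'o list \<Rightarrow> 'm" where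
  "whr as bs f rs = mu bs rs \<odot> (f \<otimes>\<^sub>a idt (list_ob rs)) \<odot> inv_of (mu as rs)"

lemma whl_arr:
  assumes "set ls \<subseteq> Ob C" "f \<in> hom C (list_ob as) (list_ob bs)"
  shows "whl ls f \<in> Arr C \<and> Dom C (whl ls f) = list_ob (ls @ as) \<and> Cod C (whl ls f) = list_ob (ls @ bs)"
  using assms by (induction ls) (auto simp: in_hom_iff)

lemma whr_arr:
  assumes "set rs \<subseteq> Ob C" "set as \<subseteq> Ob C" "set bs \<subseteq> Ob C" "f \<in> hom C (list_ob as) (list_ob bs)"
  shows "whr as bs f rs \<in> hom C (list_ob (as @ rs)) (list_ob (bs @ rs))"
  using assms by (auto simp: in_hom_iff whr_def)

lemma whl_hom: "\<lbrakk>set ls \<subseteq> Ob C; f \<in> hom C (list_ob as) (list_ob bs)\<rbrakk>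
    \<Longrightarrow> whl ls f \<in> hom C (list_ob (ls @ as)) (list_ob (ls @ bs))"
  using whl_arr by (auto simp: in_hom_iff)

lemma whl_append: "whl (ls @ ls') f = whl ls (whl ls' f)"
  by (induction ls) auto

lemma whl_ident: "\<lbrakk>set ls \<subseteq> Ob C; set as \<subseteq> Ob C\<rbrakk> \<Longrightarrow> whl ls (idt (list_ob as)) = idt (list_ob (ls @ as))"
  by (induction ls) auto

lemma whl_comp:
  assumes "set ls \<subseteq> Ob C" "f \<in> hom C (list_ob as) (list_ob bs)" "g \<in> hom C (list_ob bs) (list_ob cs)"
  shows "whl ls (g \<odot> f) = whl ls g \<odot> whl ls f"
  using assms(1)
proof (induction ls)
  case (Cons x ls)
  then show ?case
    using whl_arr[of ls f as bs] whl_arr[of ls g bs cs] assms(2,3) by (simp add: tensor_comp')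
qed simp

lemma whr_ident: "\<lbrakk>set rs \<subseteq> Ob C; set as \<subseteq> Ob C\<rbrakk> \<Longrightarrow> whr as as (idt (list_ob as)) rs = idt (list_ob (as @ rs))"
  by (simp add: whr_def)

lemma whr_comp:
  assumes "set rs \<subseteq> Ob C" "set as \<subseteq> Ob C" "set bs \<subseteq> Ob C" "set cs \<subseteq> Ob C"
    "f \<in> hom C (list_ob as) (list_ob bs)" "g \<in> hom C (list_ob bs) (list_ob cs)"
  shows "whr as cs (g \<odot> f) rs = whr bs cs g rs \<odot> whr as bs f rs"
  using assms by (simp add: whr_def in_hom_iff merge)

lemma whr_Nil:
  assumes "set as \<subseteq> Ob C" "set bs \<subseteq> Ob C" "f \<in> hom C (list_ob as) (list_ob bs)"
  shows "whr as bs f [] = f"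
proof -
  have [simp]: "f \<in> Arr C" "Dom C f = list_ob as" "Cod C f = list_ob bs"
    using assms by (auto simp: in_hom_iff)
  have "whr as bs f [] = (RUnit T (list_ob bs) \<odot> (f \<otimes>\<^sub>a idt (Unit T))) \<odot> inv_of (RUnit T (list_ob as))"
    using assms by (simp add: whr_def mu_Nil comp_assoc')
  also have "\<dots> = f"
    using assms by (simp add: runit_natural' comp_assoc')
  finally show ?thesis .
qed

lemma whr_mu:
  assumes "set rs \<subseteq> Ob C" "set as \<subseteq> Ob C" "set bs \<subseteq> Ob C" "f \<in> hom C (list_ob as) (list_ob bs)"
  shows "whr as bs f rs \<odot> mu as rs = mu bs rs \<odot> (f \<otimes>\<^sub>a idt (list_ob rs))"
  using assms by (simp add: whr_def in_hom_iff comp_assoc')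

text \<open>\<open>mu\<close> is invertible, so a right whiskering is determined by its square with
  \<open>mu\<close>; this keeps the inverse out of the proofs of the whiskering laws.\<close>

lemma whr_eqI:
  assumes "set rs \<subseteq> Ob C" "set as \<subseteq> Ob C" "set bs \<subseteq> Ob C" "f \<in> hom C (list_ob as) (list_ob bs)"
    "g \<in> hom C (list_ob (as @ rs)) (list_ob (bs @ rs))"
    "g \<odot> mu as rs = mu bs rs \<odot> (f \<otimes>\<^sub>a idt (list_ob rs))"
  shows "whr as bs f rs = g"
proof -
  have eq: "whr as bs f rs \<odot> mu as rs = g \<odot> mu as rs"
    using assms by (simp add: whr_mu)
  show ?thesis
    using assms whr_arr[OF assms(1-4)] by (intro iso_cancel_right[OF _ eq]) (simp_all add: in_hom_iff)
qed

text \<open>\<open>mu_assoc\<close> compares the two ways of attaching \<open>rs\<close> and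
  \<open>rs'\<close>. The comparison is made after precomposing with the isomorphism
  \<open>mu as rs \<otimes>\<^sub>a idt (list_ob rs')\<close>, which is cancelled at the
  end.\<close>

lemma whr_append:
  assumes [simp]: "set rs \<subseteq> Ob C" "set rs' \<subseteq> Ob C" "set as \<subseteq> Ob C" "set bs \<subseteq> Ob C"
    and f: "f \<in> hom C (list_ob as) (list_ob bs)"
  shows "whr (as @ rs) (bs @ rs) (whr as bs f rs) rs' = whr as bs f (rs @ rs')"
proof (rule whr_eqI)
  have [simp]: "f \<in> Arr C" "Dom C f = list_ob as" "Cod C f = list_ob bs"
    using f by (auto simp: in_hom_iff)
  have w [simp]: "whr as bs f rs \<in> Arr C" "Dom C (whr as bs f rs) = list_ob (as @ rs)"
      "Cod C (whr as bs f rs) = list_ob (bs @ rs)"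
    if "set rs \<subseteq> Ob C" for rs
    using whr_arr[OF that _ _ f] by (auto simp: in_hom_iff)
  let ?R = "list_ob rs" and ?S = "list_ob rs'" and ?A = "list_ob as" and ?B = "list_ob bs"
  show "whr as bs f rs \<in> hom C (list_ob (as @ rs)) (list_ob (bs @ rs))"
    "whr as bs f (rs @ rs') \<in> hom C (list_ob ((as @ rs) @ rs')) (list_ob ((bs @ rs) @ rs'))"
    by (simp_all add: in_hom_iff)
  have "(whr as bs f (rs @ rs') \<odot> mu (as @ rs) rs') \<odot> (mu as rs \<otimes>\<^sub>a idt ?S)
    = (whr as bs f (rs @ rs') \<odot> mu as (rs @ rs')) \<odot> (idt ?A \<otimes>\<^sub>a mu rs rs') \<odot> Assoc T ?A ?R ?S"
    by (simp add: comp_assoc' mu_assoc)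
  also have "\<dots> = mu bs (rs @ rs') \<odot> (f \<otimes>\<^sub>a mu rs rs') \<odot> Assoc T ?A ?R ?S"
    by (simp add: whr_mu f merge)
  also have "\<dots> = mu bs (rs @ rs') \<odot> (idt ?B \<otimes>\<^sub>a mu rs rs') \<odot> (f \<otimes>\<^sub>a (idt ?R \<otimes>\<^sub>a idt ?S)) \<odot> Assoc T ?A ?R ?S"
    by (simp add: merge del: tensor_ident') (simp)
  also have "\<dots> = mu bs (rs @ rs') \<odot> (idt ?B \<otimes>\<^sub>a mu rs rs') \<odot> Assoc T ?B ?R ?S \<odot> (f \<otimes>\<^sub>a idt ?R \<otimes>\<^sub>a idt ?S)"
    by (subst assoc_natural') simp_all
  also have "\<dots> = (mu (bs @ rs) rs' \<odot> (mu bs rs \<otimes>\<^sub>a idt ?S)) \<odot> (f \<otimes>\<^sub>a idt ?R \<otimes>\<^sub>a idt ?S)"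
    by (simp add: mu_assoc comp_assoc')
  also have "\<dots> = mu (bs @ rs) rs' \<odot> ((mu bs rs \<odot> (f \<otimes>\<^sub>a idt ?R)) \<otimes>\<^sub>a idt ?S)"
    by (simp add: merge)
  also have "\<dots> = (mu (bs @ rs) rs' \<odot> (whr as bs f rs \<otimes>\<^sub>a idt ?S)) \<odot> (mu as rs \<otimes>\<^sub>a idt ?S)"
    by (simp add: merge whr_mu[OF _ _ _ f, symmetric])
  finally have eq: "(whr as bs f (rs @ rs') \<odot> mu (as @ rs) rs') \<odot> (mu as rs \<otimes>\<^sub>a idt ?S)
    = (mu (bs @ rs) rs' \<odot> (whr as bs f rs \<otimes>\<^sub>a idt ?S)) \<odot> (mu as rs \<otimes>\<^sub>a idt ?S)" .
  show "whr as bs f (rs @ rs') \<odot> mu (as @ rs) rs' = mu (bs @ rs) rs' \<odot> (whr as bs f rs \<otimes>\<^sub>a idt ?S)"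
    by (rule iso_cancel_right[OF _ eq]) simp_all
qed simp_all

text \<open>Each object of \<open>ls\<close> passes \<open>rs\<close> by naturality of the
  associator in the recursion of \<open>mu\<close>; hence the order of left and right whiskering
  does not matter.\<close>

lemma whr_whl:
  assumes "set ls \<subseteq> Ob C" "set rs \<subseteq> Ob C" "set as \<subseteq> Ob C" "set bs \<subseteq> Ob C"
    "f \<in> hom C (list_ob as) (list_ob bs)"
  shows "whr (ls @ as) (ls @ bs) (whl ls f) rs = whl ls (whr as bs f rs)"
  using assms(1)
proof (induction ls)
  case (Cons x ls)
  let ?R = "list_ob rs" and ?A = "list_ob (ls @ as)" and ?B = "list_ob (ls @ bs)"
  let ?g = "whl ls f"
  have [simp]: "x \<in> Ob C" "set ls \<subseteq> Ob C" "set (ls @ as) \<subseteq> Ob C" "set (ls @ bs) \<subseteq> Ob C"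
    "set as \<subseteq> Ob C" "set bs \<subseteq> Ob C" "set rs \<subseteq> Ob C"
    using Cons.prems assms by auto
  have g: "?g \<in> hom C ?A ?B"
    using assms by (intro whl_hom) auto
  then have [simp]: "?g \<in> Arr C" "Dom C ?g = ?A" "Cod C ?g = ?B"
    by (auto simp: in_hom_iff)
  have w [simp]: "whr (ls @ as) (ls @ bs) ?g rs \<in> Arr C" "Dom C (whr (ls @ as) (ls @ bs) ?g rs) = list_ob ((ls @ as) @ rs)"
      "Cod C (whr (ls @ as) (ls @ bs) ?g rs) = list_ob ((ls @ bs) @ rs)"
    using whr_arr[OF _ _ _ g, of rs] by (auto simp: in_hom_iff)
  have "whr (x # (ls @ as)) (x # (ls @ bs)) (idt x \<otimes>\<^sub>a ?g) rs = idt x \<otimes>\<^sub>a whr (ls @ as) (ls @ bs) ?g rs"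
  proof (rule whr_eqI)
    have "(idt x \<otimes>\<^sub>a whr (ls @ as) (ls @ bs) ?g rs) \<odot> mu (x # ls @ as) rs
      = (idt x \<otimes>\<^sub>a (mu (ls @ bs) rs \<odot> (?g \<otimes>\<^sub>a idt ?R))) \<odot> Assoc T x ?A ?R"
      using assms by (simp add: merge whr_mu[OF _ _ _ g, symmetric] del: append_assoc)
    also have "\<dots> = (idt x \<otimes>\<^sub>a mu (ls @ bs) rs) \<odot> (idt x \<otimes>\<^sub>a (?g \<otimes>\<^sub>a idt ?R)) \<odot> Assoc T x ?A ?R"
      by (simp add: merge)
    also have "\<dots> = (idt x \<otimes>\<^sub>a mu (ls @ bs) rs) \<odot> Assoc T x ?B ?R \<odot> (idt x \<otimes>\<^sub>a ?g \<otimes>\<^sub>a idt ?R)"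
      by (subst assoc_natural') simp_all
    finally show "(idt x \<otimes>\<^sub>a whr (ls @ as) (ls @ bs) ?g rs) \<odot> mu (x # ls @ as) rs
      = mu (x # ls @ bs) rs \<odot> (idt x \<otimes>\<^sub>a ?g \<otimes>\<^sub>a idt ?R)"
      by (simp add: comp_assoc')
  qed (simp_all add: in_hom_iff)
  then show ?case
    using Cons by simp
qed simp

lemma mu_whl:
  assumes "set xs \<subseteq> Ob C" "set ys \<subseteq> Ob C" "set ys' \<subseteq> Ob C" "g \<in> hom C (list_ob ys) (list_ob ys')"
  shows "mu xs ys' \<odot> (idt (list_ob xs) \<otimes>\<^sub>a g) = whl xs g \<odot> mu xs ys"
  using assms(1)
proof (induction xs)
  case Nil
  then show ?case
    using assms by (simp add: lunit_natural' in_hom_iff)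
next
  case (Cons x xs)
  let ?X = "list_ob xs"
  have [simp]: "x \<in> Ob C" "set xs \<subseteq> Ob C" "set ys \<subseteq> Ob C" "set ys' \<subseteq> Ob C"
    "g \<in> Arr C" "Dom C g = list_ob ys" "Cod C g = list_ob ys'"
    using Cons.prems assms by (auto simp: in_hom_iff)
  have [simp]: "whl xs g \<in> Arr C" "Dom C (whl xs g) = list_ob (xs @ ys)" "Cod C (whl xs g) = list_ob (xs @ ys')"
    using whl_arr[OF _ assms(4), of xs] by auto
  have "mu (x # xs) ys' \<odot> (idt (list_ob (x # xs)) \<otimes>\<^sub>a g)
    = (idt x \<otimes>\<^sub>a mu xs ys') \<odot> Assoc T x ?X (list_ob ys') \<odot> (idt x \<otimes>\<^sub>a idt ?X \<otimes>\<^sub>a g)"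
    by (simp add: comp_assoc')
  also have "\<dots> = (idt x \<otimes>\<^sub>a (mu xs ys' \<odot> (idt ?X \<otimes>\<^sub>a g))) \<odot> Assoc T x ?X (list_ob ys)"
    by (subst assoc_natural') (simp_all add: merge)
  also have "\<dots> = (idt x \<otimes>\<^sub>a (whl xs g \<odot> mu xs ys)) \<odot> Assoc T x ?X (list_ob ys)"
    using Cons.IH by simp
  finally show ?case
    by (simp add: merge)
qed

text \<open>The arrow \<open>f \<otimes>\<^sub>a g\<close> can be performed with \<open>g\<close>
  first or with \<open>f\<close> first. Computing it both ways and cancelling
  \<open>mu xs ys\<close> gives the interchange law of the second claim.\<close>

lemma mu_tensor:
  assumes [simp]: "set xs \<subseteq> Ob C" "set xs' \<subseteq> Ob C" "set ys \<subseteq> Ob C" "set ys' \<subseteq> Ob C"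
    and f: "f \<in> hom C (list_ob xs) (list_ob xs')" and g: "g \<in> hom C (list_ob ys) (list_ob ys')"
  shows "mu xs' ys' \<odot> (f \<otimes>\<^sub>a g) = whr xs xs' f ys' \<odot> whl xs g \<odot> mu xs ys" (is ?th1)
    and "whr xs xs' f ys' \<odot> whl xs g = whl xs' g \<odot> whr xs xs' f ys" (is ?th2)
proof -
  have [simp]: "f \<in> Arr C" "Dom C f = list_ob xs" "Cod C f = list_ob xs'"
    "g \<in> Arr C" "Dom C g = list_ob ys" "Cod C g = list_ob ys'"
    using f g by (auto simp: in_hom_iff)
  have [simp]: "whl zs g \<in> Arr C" "Dom C (whl zs g) = list_ob (zs @ ys)" "Cod C (whl zs g) = list_ob (zs @ ys')"
    if "set zs \<subseteq> Ob C" for zs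
    using whl_arr[OF that g] by auto
  have [simp]: "whr xs xs' f zs \<in> Arr C" "Dom C (whr xs xs' f zs) = list_ob (xs @ zs)" "Cod C (whr xs xs' f zs) = list_ob (xs' @ zs)"
    if "set zs \<subseteq> Ob C" for zs
    using whr_arr[OF that _ _ f] by (auto simp: in_hom_iff)
  have m1: "mu xs' ys' \<odot> (f \<otimes>\<^sub>a g) = (whr xs xs' f ys' \<odot> whl xs g) \<odot> mu xs ys"
  proof -
    have "(whr xs xs' f ys' \<odot> whl xs g) \<odot> mu xs ys = whr xs xs' f ys' \<odot> mu xs ys' \<odot> (idt (list_ob xs) \<otimes>\<^sub>a g)"
      using mu_whl[OF _ _ _ g, of xs] by (simp add: comp_assoc')
    also have "\<dots> = (whr xs xs' f ys' \<odot> mu xs ys') \<odot> (idt (list_ob xs) \<otimes>\<^sub>a g)"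
      by (simp add: comp_assoc')
    also have "\<dots> = mu xs' ys' \<odot> (f \<otimes>\<^sub>a g)"
      by (simp add: whr_mu[OF _ _ _ f] merge)
    finally show ?thesis by simp
  qed
  have m2: "mu xs' ys' \<odot> (f \<otimes>\<^sub>a g) = (whl xs' g \<odot> whr xs xs' f ys) \<odot> mu xs ys"
  proof -
    have "(whl xs' g \<odot> whr xs xs' f ys) \<odot> mu xs ys = (whl xs' g \<odot> mu xs' ys) \<odot> (f \<otimes>\<^sub>a idt (list_ob ys))"
      by (simp add: comp_assoc' whr_mu[OF _ _ _ f])
    also have "\<dots> = mu xs' ys' \<odot> (f \<otimes>\<^sub>a g)"
      by (simp add: mu_whl[OF _ _ _ g, symmetric] merge)
    finally show ?thesis by simp
  qed
  show ?th1
    using m1 by (simp add: comp_assoc')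
  show ?th2
    by (rule iso_cancel_right[OF _ trans[OF m1[symmetric] m2]]) simp_all
qed

section \<open>Interpretation of words and rewriting in context\<close>

primrec word_ok :: "'o list \<Rightarrow> ('o, 'm) letter list \<Rightarrow> bool" where
  "word_ok xs [] \<longleftrightarrow> set xs \<subseteq> Ob C"
| "word_ok xs (l # w) \<longleftrightarrow> word_ok xs w \<and> (case l of (ls, as, f, bs, rs) \<Rightarrow>
     word_cod xs w = ls @ as @ rs \<and> set bs \<subseteq> Ob C \<and> f \<in> hom C (list_ob as) (list_ob bs))"

primrec word_ar :: "'o list \<Rightarrow> ('o, 'm) letter list \<Rightarrow> 'm" where
  "word_ar xs [] = idt (list_ob xs)"
| "word_ar xs (l # w) = (case l of (ls, as, f, bs, rs) \<Rightarrow> whl ls (whr as bs f rs)) \<odot> word_ar xs w"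

lemma word_ok_obs: "word_ok xs w \<Longrightarrow> set xs \<subseteq> Ob C \<and> set (word_cod xs w) \<subseteq> Ob C"
proof (induction w)
  case (Cons l w)
  then show ?case
    by (cases l) auto
qed simp

lemma letter_hom:
  assumes "word_ok xs ((ls, as, f, bs, rs) # w)"
  shows "whl ls (whr as bs f rs) \<in> hom C (list_ob (ls @ as @ rs)) (list_ob (ls @ bs @ rs))"
  using assms word_ok_obs[of xs w] by (auto intro!: whl_hom whr_arr)

lemma word_hom: "word_ok xs w \<Longrightarrow> word_ar xs w \<in> hom C (list_ob xs) (list_ob (word_cod xs w))"
proof (induction w)
  case (Cons l w)
  obtain ls as f bs rs where l: "l = (ls, as, f, bs, rs)"
    by (cases l) auto
  show ?case
    using Cons letter_hom[of xs ls as f bs rs w] by (simp add: l in_hom_iff)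
qed (simp add: in_hom_iff)

lemma word_ok_append: "word_ok xs (u @ v) \<longleftrightarrow> word_ok xs v \<and> word_ok (word_cod xs v) u"
proof (induction u)
  case Nil
  then show ?case
    using word_ok_obs by auto
next
  case (Cons l u)
  then show ?case
    by (cases l) auto
qed

lemma word_ar_append:
  "word_ok xs (u @ v) \<Longrightarrow> word_ar xs (u @ v) = word_ar (word_cod xs v) u \<odot> word_ar xs v"
proof (induction u)
  case Nil
  then show ?case
    using word_hom[of xs v] by (simp add: in_hom_iff)
next
  case (Cons l u)
  obtain ls as f bs rs where l: "l = (ls, as, f, bs, rs)"
    by (cases l) auto
  have ok: "word_ok xs v" "word_ok (word_cod xs v) (l # u)" "word_ok (word_cod xs v) u"
    using Cons.prems word_ok_append[of xs "l # u" v] word_ok_append[of xs u v] by auto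
  show ?case
    using Cons ok word_hom[OF ok(1)] word_hom[OF ok(3)] letter_hom[of "word_cod xs v" ls as f bs rs u]
    by (simp add: l in_hom_iff comp_assoc')
qed

text \<open>Functoriality of whiskering, extended to words by induction. A letter that carries its
  own context is whiskered a second time, and \<open>whr_whl\<close> together with
  \<open>whr_append\<close> merges the two contexts into concatenated lists.\<close>

lemma word_whisker:
  assumes "word_ok xs w" "set ls \<subseteq> Ob C" "set rs \<subseteq> Ob C"
  shows "word_ok (ls @ xs @ rs) (whisker ls rs w)
    \<and> word_ar (ls @ xs @ rs) (whisker ls rs w) = whl ls (whr xs (word_cod xs w) (word_ar xs w) rs)"
  using assms(1)
proof (induction w)
  case Nil
  then show ?case
    using assms by (simp add: whr_ident whl_ident del: append_assoc)
next
  case (Cons l w)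
  obtain l1 as f bs l2 where l: "l = (l1, as, f, bs, l2)"
    by (cases l) auto
  let ?zs = "word_cod xs w"
  have ok: "word_ok xs w" and zs: "?zs = l1 @ as @ l2" and f: "f \<in> hom C (list_ob as) (list_ob bs)"
    using Cons.prems by (auto simp: l)
  have obs: "set xs \<subseteq> Ob C" "set ?zs \<subseteq> Ob C" "set l1 \<subseteq> Ob C" "set as \<subseteq> Ob C" "set l2 \<subseteq> Ob C" "set bs \<subseteq> Ob C"
    using word_ok_obs[OF ok] zs Cons.prems l by auto
  have IH: "word_ok (ls @ xs @ rs) (whisker ls rs w)"
    "word_ar (ls @ xs @ rs) (whisker ls rs w) = whl ls (whr xs ?zs (word_ar xs w) rs)"
    using Cons.IH ok by auto
  have h: "whl l1 (whr as bs f l2) \<in> hom C (list_ob ?zs) (list_ob (l1 @ bs @ l2))"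
    using f obs zs by (auto intro!: whl_hom whr_arr)
  have wh: "word_ar xs w \<in> hom C (list_ob xs) (list_ob ?zs)"
    by (rule word_hom[OF ok])
  have "whl ls (whr xs (l1 @ bs @ l2) (whl l1 (whr as bs f l2) \<odot> word_ar xs w) rs)
    = whl ls (whr ?zs (l1 @ bs @ l2) (whl l1 (whr as bs f l2)) rs \<odot> whr xs ?zs (word_ar xs w) rs)"
    using obs assms h wh by (subst whr_comp[of rs xs ?zs]) auto
  also have "\<dots> = whl ls (whr ?zs (l1 @ bs @ l2) (whl l1 (whr as bs f l2)) rs) \<odot> whl ls (whr xs ?zs (word_ar xs w) rs)"
    using obs assms h wh by (intro whl_comp[of _ _ "xs @ rs" "?zs @ rs" _ "(l1 @ bs @ l2) @ rs"] whr_arr) auto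
  also have "whr ?zs (l1 @ bs @ l2) (whl l1 (whr as bs f l2)) rs = whl l1 (whr as bs f (l2 @ rs))"
  proof -
    have "whr (l1 @ (as @ l2)) (l1 @ (bs @ l2)) (whl l1 (whr as bs f l2)) rs
      = whl l1 (whr (as @ l2) (bs @ l2) (whr as bs f l2) rs)"
      using obs assms f by (intro whr_whl whr_arr) auto
    also have "\<dots> = whl l1 (whr as bs f (l2 @ rs))"
      using obs assms f by (subst whr_append) auto
    finally show ?thesis
      by (simp add: zs)
  qed
  finally have "whl ls (whr xs (l1 @ bs @ l2) (whl l1 (whr as bs f l2) \<odot> word_ar xs w) rs)
    = whl (ls @ l1) (whr as bs f (l2 @ rs)) \<odot> word_ar (ls @ xs @ rs) (whisker ls rs w)"
    by (simp add: IH whl_append)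
  then show ?case
    using IH zs obs f by (simp add: l)
qed

text \<open>Typing and equality of the targets are included, so that rewriting steps can be chained
  without side conditions.\<close>

definition word_eq :: "'o list \<Rightarrow> ('o, 'm) letter list \<Rightarrow> ('o, 'm) letter list \<Rightarrow> bool" where
  "word_eq xs w w' \<longleftrightarrow> word_ok xs w \<and> word_ok xs w' \<and> word_cod xs w = word_cod xs w'
    \<and> word_ar xs w = word_ar xs w'"

lemma word_eq_refl: "word_ok xs w \<Longrightarrow> word_eq xs w w"
  by (simp add: word_eq_def)

lemma word_eq_sym: "word_eq xs w w' \<Longrightarrow> word_eq xs w' w"
  by (auto simp: word_eq_def)

lemma word_eq_trans [trans]: "word_eq xs u v \<Longrightarrow> word_eq xs v w \<Longrightarrow> word_eq xs u w"
  by (auto simp: word_eq_def)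

text \<open>Rewriting inside a longer word: \<open>v\<close> acts before and \<open>u\<close> after
  the replaced part, and \<open>ls\<close>, \<open>rs\<close> are the strands beside it. An equation
  between short words thereby becomes a rule for any position.\<close>

lemma word_eq_context:
  assumes "word_eq ys w w'" "word_cod xs v = ls @ ys @ rs" "word_ok xs (u @ whisker ls rs w @ v)"
  shows "word_eq xs (u @ whisker ls rs w @ v) (u @ whisker ls rs w' @ v)"
proof -
  have v: "word_ok xs v" and obs: "set ls \<subseteq> Ob C" "set rs \<subseteq> Ob C"
    and u: "word_ok (ls @ word_cod ys w @ rs) u"
    using assms word_ok_obs[of xs v] by (auto simp: word_ok_append)
  have w: "word_ok ys w" "word_ok ys w'" "word_cod ys w = word_cod ys w'" "word_ar ys w = word_ar ys w'"
    using assms by (auto simp: word_eq_def)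
  have W: "word_ok (ls @ ys @ rs) (whisker ls rs w)" "word_ok (ls @ ys @ rs) (whisker ls rs w')"
    "word_ar (ls @ ys @ rs) (whisker ls rs w) = word_ar (ls @ ys @ rs) (whisker ls rs w')"
    using word_whisker[OF w(1) obs] word_whisker[OF w(2) obs] w by auto
  have ok: "word_ok xs (u @ whisker ls rs w @ v)" "word_ok xs (u @ whisker ls rs w' @ v)"
    using v u w W assms by (auto simp: word_ok_append)
  moreover have "word_ok xs (whisker ls rs w @ v)" "word_ok xs (whisker ls rs w' @ v)"
    using v W assms by (auto simp: word_ok_append)
  ultimately show ?thesis
    using w W assms by (simp add: word_eq_def word_ar_append)
qed

text \<open>Interchange from \<open>mu_tensor\<close>, applied below the common left context
  \<open>ls\<close>; \<open>ms\<close> is the stretch of objects between the two letters.\<close>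

lemma word_eq_exchange:
  assumes "word_ok xs [(ls, as, f, bs, ms @ bs' @ rs), (ls @ as @ ms, as', f', bs', rs)]"
  shows "word_eq xs [(ls, as, f, bs, ms @ bs' @ rs), (ls @ as @ ms, as', f', bs', rs)]
    [(ls @ bs @ ms, as', f', bs', rs), (ls, as, f, bs, ms @ as' @ rs)]"
proof -
  have xs: "xs = ls @ as @ ms @ as' @ rs" and f: "f \<in> hom C (list_ob as) (list_ob bs)" "f' \<in> hom C (list_ob as') (list_ob bs')"
    and obs: "set ls \<subseteq> Ob C" "set as \<subseteq> Ob C" "set bs \<subseteq> Ob C" "set ms \<subseteq> Ob C" "set as' \<subseteq> Ob C" "set bs' \<subseteq> Ob C" "set rs \<subseteq> Ob C"
    using assms by auto
  \<comment> \<open>With the prefix \<open>ls @ as\<close> removed, the second letter is an arrow on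
    everything to the right of \<open>as\<close>, which is the form that \<open>mu_tensor\<close>
    requires.\<close>
  let ?G = "whl ms (whr as' bs' f' rs)"
  have G: "?G \<in> hom C (list_ob (ms @ as' @ rs)) (list_ob (ms @ bs' @ rs))"
    using f obs by (auto intro!: whl_hom whr_arr)
  have h: "whr as bs f zs \<in> hom C (list_ob (as @ zs)) (list_ob (bs @ zs))" if "set zs \<subseteq> Ob C" for zs
    using f obs that by (auto intro!: whr_arr)
  have k: "whl zs ?G \<in> hom C (list_ob (zs @ ms @ as' @ rs)) (list_ob (zs @ ms @ bs' @ rs))" if "set zs \<subseteq> Ob C" for zs
    using whl_hom[OF that G] .
  have "whl ls (whr as bs f (ms @ bs' @ rs)) \<odot> whl (ls @ as @ ms) (whr as' bs' f' rs)
    = whl ls (whr as bs f (ms @ bs' @ rs) \<odot> whl as ?G)"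
    using obs h k by (subst whl_comp[where as = "as @ ms @ as' @ rs" and bs = "as @ ms @ bs' @ rs" and cs = "bs @ ms @ bs' @ rs"])
      (auto simp: whl_append)
  also have "\<dots> = whl ls (whl bs ?G \<odot> whr as bs f (ms @ as' @ rs))"
    using mu_tensor(2)[of as bs "ms @ as' @ rs" "ms @ bs' @ rs" f ?G] f G obs by simp
  also have "\<dots> = whl (ls @ bs @ ms) (whr as' bs' f' rs) \<odot> whl ls (whr as bs f (ms @ as' @ rs))"
    using obs h k by (subst whl_comp[where as = "as @ ms @ as' @ rs" and bs = "bs @ ms @ as' @ rs" and cs = "bs @ ms @ bs' @ rs"])
      (auto simp: whl_append)
  finally have eq: "whl ls (whr as bs f (ms @ bs' @ rs)) \<odot> whl (ls @ as @ ms) (whr as' bs' f' rs)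
    = whl (ls @ bs @ ms) (whr as' bs' f' rs) \<odot> whl ls (whr as bs f (ms @ as' @ rs))" .
  have "whl (ls @ as @ ms) (whr as' bs' f' rs) \<in> hom C (list_ob xs) (list_ob (ls @ as @ ms @ bs' @ rs))"
    "whl ls (whr as bs f (ms @ as' @ rs)) \<in> hom C (list_ob xs) (list_ob (ls @ bs @ ms @ as' @ rs))"
    using whl_hom[OF obs(1) k[OF obs(2)]] whl_hom[OF obs(1) h[of "ms @ as' @ rs"]] obs
    by (simp_all add: xs whl_append)
  then show ?thesis
    using assms eq obs by (simp add: word_eq_def xs in_hom_iff)
qed

section \<open>Translation of formal arrows into words\<close>

primrec tm_ar :: "('o, 'm) tm \<Rightarrow> 'm" where
  "tm_ar (IdT t) = idt (tree_ob t)"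
| "tm_ar (a \<oslash> b) = tm_ar a \<odot> tm_ar b"
| "tm_ar (a \<otimes>\<^sub>t b) = tm_ar a \<otimes>\<^sub>a tm_ar b"
| "tm_ar (As r s t) = Assoc T (tree_ob r) (tree_ob s) (tree_ob t)"
| "tm_ar (AsI r s t) = inv_of (Assoc T (tree_ob r) (tree_ob s) (tree_ob t))"
| "tm_ar (LU t) = LUnit T (tree_ob t)"
| "tm_ar (LUI t) = inv_of (LUnit T (tree_ob t))"
| "tm_ar (RU t) = RUnit T (tree_ob t)"
| "tm_ar (RUI t) = inv_of (RUnit T (tree_ob t))"
| "tm_ar (Gn s f t) = f"

primrec tree_ok :: "'o tree \<Rightarrow> bool" where
  "tree_ok (Lf X) \<longleftrightarrow> X \<in> Ob C"
| "tree_ok Em \<longleftrightarrow> True"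
| "tree_ok (Nd s t) \<longleftrightarrow> tree_ok s \<and> tree_ok t"

primrec tm_ok :: "('o, 'm) tm \<Rightarrow> bool" where
  "tm_ok (IdT t) \<longleftrightarrow> tree_ok t"
| "tm_ok (a \<oslash> b) \<longleftrightarrow> tm_ok a \<and> tm_ok b \<and> src a = tgt b"
| "tm_ok (a \<otimes>\<^sub>t b) \<longleftrightarrow> tm_ok a \<and> tm_ok b"
| "tm_ok (As r s t) \<longleftrightarrow> tree_ok r \<and> tree_ok s \<and> tree_ok t"
| "tm_ok (AsI r s t) \<longleftrightarrow> tree_ok r \<and> tree_ok s \<and> tree_ok t"
| "tm_ok (LU t) \<longleftrightarrow> tree_ok t"
| "tm_ok (LUI t) \<longleftrightarrow> tree_ok t"
| "tm_ok (RU t) \<longleftrightarrow> tree_ok t"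
| "tm_ok (RUI t) \<longleftrightarrow> tree_ok t"
| "tm_ok (Gn s f t) \<longleftrightarrow> tree_ok s \<and> tree_ok t \<and> f \<in> hom C (tree_ob s) (tree_ob t)"

text \<open>The canonical isomorphism from \<open>tree_ob t\<close> to
  \<open>list_ob (leaves t)\<close>. A single leaf needs an inverse right unit constraint because
  \<open>list_ob [X]\<close> is \<open>X \<otimes>\<^sub>o Unit T\<close>.\<close>

primrec flat :: "'o tree \<Rightarrow> 'm" where
  "flat (Lf X) = inv_of (RUnit T X)"
| "flat Em = idt (Unit T)"
| "flat (Nd s t) = mu (leaves s) (leaves t) \<odot> (flat s \<otimes>\<^sub>a flat t)"

definition strict :: "'o tree \<Rightarrow> 'm \<Rightarrow> 'o tree \<Rightarrow> 'm" where
  "strict s f t = flat t \<odot> f \<odot> inv_of (flat s)"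

text \<open>Constraints contribute no letters. In a tensor product the right factor acts first,
  beside the source of the left one; this matches the first claim of
  \<open>mu_tensor\<close>.\<close>

primrec tm_word :: "('o, 'm) tm \<Rightarrow> ('o, 'm) letter list" where
  "tm_word (IdT t) = []"
| "tm_word (a \<oslash> b) = tm_word a @ tm_word b"
| "tm_word (a \<otimes>\<^sub>t b) = whisker [] (leaves (tgt b)) (tm_word a) @ whisker (leaves (src a)) [] (tm_word b)"
| "tm_word (As r s t) = []"
| "tm_word (AsI r s t) = []"
| "tm_word (LU t) = []"
| "tm_word (LUI t) = []"
| "tm_word (RU t) = []"
| "tm_word (RUI t) = []"
| "tm_word (Gn s f t) = [([], leaves s, strict s f t, leaves t, [])]"

lemma tree_ok_ob [simp]: "tree_ok t \<Longrightarrow> tree_ob t \<in> Ob C"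
  by (induction t) auto

lemma tree_ok_leaves [simp]: "tree_ok t \<Longrightarrow> set (leaves t) \<subseteq> Ob C"
  by (induction t) auto

lemma flat_arr: "tree_ok t \<Longrightarrow> iso_arrow C (flat t) \<and> flat t \<in> Arr C
    \<and> Dom C (flat t) = tree_ob t \<and> Cod C (flat t) = list_ob (leaves t)"
  by (induction t) (auto simp: iso_arr)

lemma flat_simps [simp]:
  assumes "tree_ok t"
  shows "iso_arrow C (flat t)" "flat t \<in> Arr C" "Dom C (flat t) = tree_ob t" "Cod C (flat t) = list_ob (leaves t)"
  using flat_arr[OF assms] by auto

lemma strict_hom [simp]:
  assumes "tree_ok s" "tree_ok t" "f \<in> hom C (tree_ob s) (tree_ob t)"
    "X = list_ob (leaves s)" "Y = list_ob (leaves t)"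
  shows "strict s f t \<in> hom C X Y"
  using assms by (simp add: strict_def in_hom_iff)

lemma tm_hom: "tm_ok a \<Longrightarrow> tree_ok (src a) \<and> tree_ok (tgt a) \<and> tm_ar a \<in> Arr C
    \<and> Dom C (tm_ar a) = tree_ob (src a) \<and> Cod C (tm_ar a) = tree_ob (tgt a)"
  by (induction a) (auto simp: in_hom_iff)

text \<open>\<open>mu_assoc\<close> transported along the flattenings of the three trees: both
  bracketings have the same leaves, so the associator turns into an identity.\<close>

lemma flat_assoc:
  assumes [simp]: "tree_ok r" "tree_ok s" "tree_ok t"
  shows "flat (Nd r (Nd s t)) \<odot> Assoc T (tree_ob r) (tree_ob s) (tree_ob t) = flat (Nd (Nd r s) t)"
proof -
  let ?r = "leaves r" and ?s = "leaves s" and ?t = "leaves t"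
  have "flat (Nd r (Nd s t)) \<odot> Assoc T (tree_ob r) (tree_ob s) (tree_ob t)
    = mu ?r (?s @ ?t) \<odot> (idt (list_ob ?r) \<otimes>\<^sub>a mu ?s ?t) \<odot> (flat r \<otimes>\<^sub>a (flat s \<otimes>\<^sub>a flat t)) \<odot> Assoc T (tree_ob r) (tree_ob s) (tree_ob t)"
    by (simp add: merge)
  also have "\<dots> = mu ?r (?s @ ?t) \<odot> (idt (list_ob ?r) \<otimes>\<^sub>a mu ?s ?t) \<odot> Assoc T (list_ob ?r) (list_ob ?s) (list_ob ?t) \<odot> (flat r \<otimes>\<^sub>a flat s \<otimes>\<^sub>a flat t)"
    by (subst assoc_natural') simp_all
  also have "\<dots> = (mu (?r @ ?s) ?t \<odot> (mu ?r ?s \<otimes>\<^sub>a idt (list_ob ?t))) \<odot> (flat r \<otimes>\<^sub>a flat s \<otimes>\<^sub>a flat t)"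
    by (simp add: mu_assoc comp_assoc')
  finally show ?thesis
    by (simp add: merge)
qed

text \<open>Rebracketing and unit arrows become invisible in the strictification, so an equation between
  arrows built from them and from generators can be checked on words.\<close>

lemma tm_word_sound:
  "tm_ok a \<Longrightarrow> word_ok (leaves (src a)) (tm_word a) \<and> word_cod (leaves (src a)) (tm_word a) = leaves (tgt a)
    \<and> word_ar (leaves (src a)) (tm_word a) \<odot> flat (src a) = flat (tgt a) \<odot> tm_ar a"
proof (induction a)
  case (Cm a b)
  then have ok: "tm_ok a" "tm_ok b" "src a = tgt b"
    by auto
  note IH = Cm.IH(1)[OF ok(1)] Cm.IH(2)[OF ok(2)]
  have w: "word_ok (leaves (src b)) (tm_word a @ tm_word b)"
    using IH ok by (auto simp: word_ok_append)
  have h: "word_ar (leaves (src a)) (tm_word a) \<in> hom C (list_ob (leaves (src a))) (list_ob (leaves (tgt a)))"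
    "word_ar (leaves (src b)) (tm_word b) \<in> hom C (list_ob (leaves (src b))) (list_ob (leaves (tgt b)))"
    using word_hom[of "leaves (src a)" "tm_word a"] word_hom[of "leaves (src b)" "tm_word b"] IH by auto
  have "(word_ar (leaves (src a)) (tm_word a) \<odot> word_ar (leaves (src b)) (tm_word b)) \<odot> flat (src b)
    = word_ar (leaves (src a)) (tm_word a) \<odot> word_ar (leaves (src b)) (tm_word b) \<odot> flat (src b)"
    using h ok tm_hom[OF ok(1)] tm_hom[OF ok(2)] by (simp add: comp_assoc' in_hom_iff)
  also have "\<dots> = word_ar (leaves (src a)) (tm_word a) \<odot> flat (src a) \<odot> tm_ar b"
    using IH ok by simp
  also have "\<dots> = (word_ar (leaves (src a)) (tm_word a) \<odot> flat (src a)) \<odot> tm_ar b"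
    using h ok tm_hom[OF ok(1)] tm_hom[OF ok(2)] by (simp add: comp_assoc' in_hom_iff)
  also have "\<dots> = (flat (tgt a) \<odot> tm_ar a) \<odot> tm_ar b"
    using IH by simp
  also have "\<dots> = flat (tgt a) \<odot> tm_ar a \<odot> tm_ar b"
    using ok tm_hom[OF ok(1)] tm_hom[OF ok(2)] by (simp add: comp_assoc')
  finally show ?case
    using w IH ok by (simp add: word_ar_append)
next
  case (Tn a b)
  then have ok: "tm_ok a" "tm_ok b"
    by auto
  note IH = Tn.IH(1)[OF ok(1)] Tn.IH(2)[OF ok(2)]
  note ta = tm_hom[OF ok(1)] and tb = tm_hom[OF ok(2)]
  let ?a = "leaves (src a)" and ?a' = "leaves (tgt a)" and ?b = "leaves (src b)" and ?b' = "leaves (tgt b)"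
  let ?f = "word_ar ?a (tm_word a)" and ?g = "word_ar ?b (tm_word b)"
  have h: "?f \<in> hom C (list_ob ?a) (list_ob ?a')" "?g \<in> hom C (list_ob ?b) (list_ob ?b')"
    using word_hom[of ?a "tm_word a"] word_hom[of ?b "tm_word b"] IH by auto
  have obs [simp]: "set ?a \<subseteq> Ob C" "set ?b \<subseteq> Ob C" "set ?a' \<subseteq> Ob C" "set ?b' \<subseteq> Ob C"
    using ta tb by auto
  have wa: "word_ok (?a @ ?b') (whisker [] ?b' (tm_word a))" "word_ar (?a @ ?b') (whisker [] ?b' (tm_word a)) = whr ?a ?a' ?f ?b'"
    using word_whisker[of ?a "tm_word a" "[]" ?b'] IH by auto
  have wb: "word_ok (?a @ ?b) (whisker ?a [] (tm_word b))" "word_ar (?a @ ?b) (whisker ?a [] (tm_word b)) = whl ?a ?g"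
    using word_whisker[of ?b "tm_word b" ?a "[]"] IH h by (auto simp: whr_Nil)
  have cod: "word_cod (?a @ ?b) (whisker ?a [] (tm_word b)) = ?a @ ?b'"
    "word_cod (?a @ ?b') (whisker [] ?b' (tm_word a)) = ?a' @ ?b'"
    using word_cod_whisker[of ?a ?b "[]" "tm_word b"] word_cod_whisker[of "[]" ?a ?b' "tm_word a"] IH by auto
  have ok2: "word_ok (?a @ ?b) (whisker [] ?b' (tm_word a) @ whisker ?a [] (tm_word b))"
    using wa wb cod by (simp add: word_ok_append)
  have l: "whl ?a ?g \<in> hom C (list_ob (?a @ ?b)) (list_ob (?a @ ?b'))" "whr ?a ?a' ?f ?b' \<in> hom C (list_ob (?a @ ?b')) (list_ob (?a' @ ?b'))"
    using whl_hom[OF obs(1) h(2)] whr_arr[OF obs(4) obs(1) obs(3) h(1)] .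
  have "word_ar (?a @ ?b) (whisker [] ?b' (tm_word a) @ whisker ?a [] (tm_word b)) \<odot> flat (Nd (src a) (src b))
    = (whr ?a ?a' ?f ?b' \<odot> whl ?a ?g \<odot> mu ?a ?b) \<odot> (flat (src a) \<otimes>\<^sub>a flat (src b))"
    using ok2 wa wb cod l ta tb by (simp add: word_ar_append comp_assoc' in_hom_iff)
  also have "\<dots> = (mu ?a' ?b' \<odot> (?f \<otimes>\<^sub>a ?g)) \<odot> (flat (src a) \<otimes>\<^sub>a flat (src b))"
    using mu_tensor(1)[of ?a ?a' ?b ?b' ?f ?g] h by simp
  also have "\<dots> = mu ?a' ?b' \<odot> ((?f \<odot> flat (src a)) \<otimes>\<^sub>a (?g \<odot> flat (src b)))"
    using h ta tb by (simp add: merge in_hom_iff)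
  also have "\<dots> = mu ?a' ?b' \<odot> ((flat (tgt a) \<odot> tm_ar a) \<otimes>\<^sub>a (flat (tgt b) \<odot> tm_ar b))"
    using IH by simp
  also have "\<dots> = flat (Nd (tgt a) (tgt b)) \<odot> (tm_ar a \<otimes>\<^sub>a tm_ar b)"
    using h ta tb by (simp add: merge in_hom_iff)
  finally show ?case
    using ok2 cod by simp
next
  case (As r s t)
  then show ?case
    using flat_assoc[of r s t] flat_simps[of "Nd (Nd r s) t"] flat_simps[of "Nd r (Nd s t)"]
    by (simp del: flat.simps flat_simps)
next
  case (AsI r s t)
  then have [simp]: "tree_ok r" "tree_ok s" "tree_ok t"
    by auto
  have "flat (Nd r (Nd s t)) = flat (Nd (Nd r s) t) \<odot> inv_of (Assoc T (tree_ob r) (tree_ob s) (tree_ob t))"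
    using flat_assoc[of r s t] flat_simps[of "Nd r (Nd s t)"] by (intro move_inv_right) (auto simp del: flat.simps flat_simps)
  then show ?case
    using flat_simps[of "Nd r (Nd s t)"] by (simp del: flat.simps flat_simps)
next
  case (LU t)
  then show ?case
    by (simp add: lunit_natural')
next
  case (LUI t)
  then have [simp]: "tree_ok t"
    by simp
  have "flat t \<odot> LUnit T (tree_ob t) = flat (Nd Em t)"
    by (simp add: lunit_natural')
  then have "flat t = flat (Nd Em t) \<odot> inv_of (LUnit T (tree_ob t))"
    by (intro move_inv_right) (auto simp del: flat.simps)
  then show ?case
    by (simp del: flat.simps)
next
  case (RU t)
  then show ?case
    by (simp add: runit_natural' mu_Nil)
next
  case (RUI t)
  then have [simp]: "tree_ok t"
    by simp
  have "flat t \<odot> RUnit T (tree_ob t) = flat (Nd t Em)"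
    by (simp add: runit_natural' mu_Nil)
  then have "flat t = flat (Nd t Em) \<odot> inv_of (RUnit T (tree_ob t))"
    by (intro move_inv_right) (auto simp del: flat.simps)
  then show ?case
    by (simp del: flat.simps)
next
  case (Gn s f t)
  then have [simp]: "tree_ok s" "tree_ok t" "f \<in> Arr C" "Dom C f = tree_ob s" "Cod C f = tree_ob t"
    by (auto simp: in_hom_iff)
  have h: "strict s f t \<in> hom C (list_ob (leaves s)) (list_ob (leaves t))"
    using Gn by simp
  show ?case
    using h whr_Nil[OF _ _ h] by (simp add: in_hom_iff strict_def comp_assoc')
qed simp_all

text \<open>Flattening is invertible, so passing to words loses nothing. The equivalence serves in
  both directions: an axiom with associators becomes a rewriting rule for words, and an equation
  derived for words is read back as one between arrows.\<close>

theorem tm_eq_iff_word_eq: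
  assumes "tm_ok a" "tm_ok b" "src a = src b" "tgt a = tgt b"
  shows "tm_ar a = tm_ar b \<longleftrightarrow> word_eq (leaves (src a)) (tm_word a) (tm_word b)"
proof -
  note A = tm_word_sound[OF assms(1)] and B = tm_word_sound[OF assms(2)]
  note ha = tm_hom[OF assms(1)] and hb = tm_hom[OF assms(2)]
  let ?xs = "leaves (src a)"
  have wa: "word_ar ?xs (tm_word a) \<in> hom C (list_ob ?xs) (list_ob (leaves (tgt a)))"
    using A word_hom[of ?xs "tm_word a"] by simp
  have wb: "word_ar ?xs (tm_word b) \<in> hom C (list_ob ?xs) (list_ob (leaves (tgt a)))"
    using B assms word_hom[of ?xs "tm_word b"] by simp
  have "word_ar ?xs (tm_word a) = word_ar ?xs (tm_word b)" if eq: "tm_ar a = tm_ar b"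
  proof (rule iso_cancel_right)
    show "word_ar ?xs (tm_word a) \<odot> flat (src a) = word_ar ?xs (tm_word b) \<odot> flat (src a)"
      using A B assms that by simp
  qed (use wa wb ha in \<open>auto simp: in_hom_iff\<close>)
  moreover have "tm_ar a = tm_ar b" if "word_ar ?xs (tm_word a) = word_ar ?xs (tm_word b)"
  proof (rule iso_cancel_left)
    show "flat (tgt a) \<odot> tm_ar a = flat (tgt a) \<odot> tm_ar b"
      using A B assms that by metis
  qed (use ha hb assms in auto)
  ultimately show ?thesis
    using A B assms by (auto simp: word_eq_def)
qed

end


section \<open>Braided monoidal categories\<close>

context braided_monoidal_category
begin

text \<open>A braiding of compound trees is a generator of its own, which the hexagons relate to
  braidings of smaller pieces. \<open>sbr\<close> below is the arrow stored in its letter.\<close>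

abbreviation (input) br :: "'o tree \<Rightarrow> 'o tree \<Rightarrow> ('o, 'm) tm" where
  "br t u \<equiv> Gn (Nd t u) (s (tree_ob t) (tree_ob u)) (Nd u t)"

abbreviation (input) sbr :: "'o tree \<Rightarrow> 'o tree \<Rightarrow> 'm" where
  "sbr t u \<equiv> strict (Nd t u) (s (tree_ob t) (tree_ob u)) (Nd u t)"

lemmas braiding_hom' [simp] = braiding_hom

lemma braiding_arr [simp]:
  assumes "X \<in> Ob C" "Y \<in> Ob C"
  shows "s X Y \<in> Arr C" "Dom C (s X Y) = X \<otimes>\<^sub>o Y" "Cod C (s X Y) = Y \<otimes>\<^sub>o X" "iso_arrow C (s X Y)"
  using braiding_hom[OF assms] braiding_iso[OF assms] by (simp_all add: hom_def)

lemma braiding_natural':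
  assumes "f \<in> Arr C" "g \<in> Arr C" "Cod C f = X" "Cod C g = Y"
  shows "s X Y \<odot> (f \<otimes>\<^sub>a g) = (g \<otimes>\<^sub>a f) \<odot> s (Dom C f) (Dom C g)"
  using braiding_natural[of f "Dom C f" "Cod C f" g "Dom C g" "Cod C g"] assms by (simp add: hom_def)

text \<open>With the associators gone, the hexagon says that crossing two strands at once is
  crossing them one after the other. Read backwards, it joins two crossings.\<close>

lemma word_hexagon1:
  assumes [simp]: "tree_ok r" "tree_ok t" "tree_ok u"
  shows "word_eq (leaves r @ leaves t @ leaves u)
    [([], leaves r @ leaves t @ leaves u, sbr r (Nd t u), leaves t @ leaves u @ leaves r, [])]
    [(leaves t, leaves r @ leaves u, sbr r u, leaves u @ leaves r, []),
     ([], leaves r @ leaves t, sbr r t, leaves t @ leaves r, leaves u)]"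
proof -
  have "tm_ar (As t u r \<oslash> br r (Nd t u) \<oslash> As r t u) = tm_ar (IdT t \<otimes>\<^sub>t br r u \<oslash> As t r u \<oslash> br r t \<otimes>\<^sub>t IdT u)"
    using hexagon1[of "tree_ob r" "tree_ob t" "tree_ob u"] by simp
  then show ?thesis
    by (subst (asm) tm_eq_iff_word_eq) simp_all
qed

lemma word_hexagon2:
  assumes [simp]: "tree_ok r" "tree_ok t" "tree_ok u"
  shows "word_eq (leaves r @ leaves t @ leaves u)
    [([], leaves r @ leaves t @ leaves u, sbr (Nd r t) u, leaves u @ leaves r @ leaves t, [])]
    [([], leaves r @ leaves u, sbr r u, leaves u @ leaves r, leaves t),
     (leaves r, leaves t @ leaves u, sbr t u, leaves u @ leaves t, [])]"
proof -
  have "tm_ar (AsI u r t \<oslash> br (Nd r t) u \<oslash> AsI r t u) = tm_ar (br r u \<otimes>\<^sub>t IdT t \<oslash> AsI r u t \<oslash> IdT r \<otimes>\<^sub>t br t u)"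
    using hexagon2[of "tree_ob r" "tree_ob t" "tree_ob u"] by simp
  then show ?thesis
    by (subst (asm) tm_eq_iff_word_eq) simp_all
qed

text \<open>A hexagon in which two of the three objects are the unit shows that the braiding with
  the unit is idempotent; being invertible, it is trivial.\<close>

lemma word_braiding_unit:
  assumes [simp]: "X \<in> Ob C"
  shows "word_eq [X] [([], [X], sbr (Lf X) Em, [X], [])] []"
    and "word_eq [X] [([], [X], sbr Em (Lf X), [X], [])] []"
proof -
  \<comment> \<open>\<open>b\<close> is the braiding with \<open>Em\<close>, \<open>b'\<close> the
    one with \<open>Nd Em Em\<close>, and \<open>i\<close> the inverse of \<open>b\<close>.
    Naturality along \<open>LU Em\<close> identifies \<open>b'\<close> with \<open>b\<close>, the
    hexagon splits \<open>b'\<close> into \<open>b, b\<close>, and \<open>i\<close> cancels one of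
    the two.\<close>
  have *: "word_eq [X] [b] []"
    if inv: "word_eq [X] [i, b] []" and nat: "word_eq [X] [b'] [b]" and hex: "word_eq [X] [b'] [b, b]"
      and b: "b = ([], [X], f, [X], [])" and i: "i = ([], [X], g, [X], [])" for b b' i f g
  proof -
    have bb: "word_eq [X] [b] [b, b]"
      using nat hex word_eq_sym word_eq_trans by blast
    have ok: "word_ok [X] [i, b]"
      using inv by (simp add: word_eq_def)
    have "word_eq [X] [i, b, b] [b]"
      using word_eq_context[OF inv, of "[X]" "[b]" "[]" "[]" "[]"] ok by (simp add: b i)
    moreover have "word_eq [X] [i, b] [i, b, b]"
      using word_eq_context[OF bb, of "[X]" "[]" "[]" "[]" "[i]"] ok by (simp add: b i)
    ultimately show ?thesis
      using inv word_eq_sym word_eq_trans by meson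
  qed
  have [simp]: "inv_of (s X (Unit T)) \<in> hom C (Unit T \<otimes>\<^sub>o X) (X \<otimes>\<^sub>o Unit T)"
    "inv_of (s (Unit T) X) \<in> hom C (X \<otimes>\<^sub>o Unit T) (Unit T \<otimes>\<^sub>o X)"
    by (simp_all add: in_hom_iff)
  have 1: "tm_ar (Gn (Nd Em (Lf X)) (inv_of (s X (Unit T))) (Nd (Lf X) Em) \<oslash> br (Lf X) Em) = tm_ar (IdT (Nd (Lf X) Em))"
    "tm_ar (Gn (Nd (Lf X) Em) (inv_of (s (Unit T) X)) (Nd Em (Lf X)) \<oslash> br Em (Lf X)) = tm_ar (IdT (Nd Em (Lf X)))"
    by simp_all
  have 2: "tm_ar (LU Em \<otimes>\<^sub>t IdT (Lf X) \<oslash> br (Lf X) (Nd Em Em)) = tm_ar (br (Lf X) Em \<oslash> IdT (Lf X) \<otimes>\<^sub>t LU Em)"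
    "tm_ar (IdT (Lf X) \<otimes>\<^sub>t LU Em \<oslash> br (Nd Em Em) (Lf X)) = tm_ar (br Em (Lf X) \<oslash> LU Em \<otimes>\<^sub>t IdT (Lf X))"
    by (simp_all add: braiding_natural')
  have w1: "word_eq [X] [([], [X], strict (Nd Em (Lf X)) (inv_of (s X (Unit T))) (Nd (Lf X) Em), [X], []), ([], [X], sbr (Lf X) Em, [X], [])] []"
    "word_eq [X] [([], [X], strict (Nd (Lf X) Em) (inv_of (s (Unit T) X)) (Nd Em (Lf X)), [X], []), ([], [X], sbr Em (Lf X), [X], [])] []"
    by (use 1(1) in \<open>subst (asm) tm_eq_iff_word_eq, simp_all\<close>) (use 1(2) in \<open>subst (asm) tm_eq_iff_word_eq, simp_all\<close>)
  have w2: "word_eq [X] [([], [X], sbr (Lf X) (Nd Em Em), [X], [])] [([], [X], sbr (Lf X) Em, [X], [])]"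
    "word_eq [X] [([], [X], sbr (Nd Em Em) (Lf X), [X], [])] [([], [X], sbr Em (Lf X), [X], [])]"
    by (use 2(1) in \<open>subst (asm) tm_eq_iff_word_eq, simp_all\<close>) (use 2(2) in \<open>subst (asm) tm_eq_iff_word_eq, simp_all\<close>)
  show "word_eq [X] [([], [X], sbr (Lf X) Em, [X], [])] []"
    using word_hexagon1[of "Lf X" Em Em] by (intro *[OF w1(1) w2(1)]) simp_all
  show "word_eq [X] [([], [X], sbr Em (Lf X), [X], [])] []"
    using word_hexagon2[of Em Em "Lf X"] by (intro *[OF w1(2) w2(2)]) simp_all
qed

lemma braiding_unit:
  assumes [simp]: "X \<in> Ob C"
  shows "LUnit T X \<odot> s X (Unit T) = RUnit T X" "RUnit T X \<odot> s (Unit T) X = LUnit T X"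
proof -
  have "tm_ar (LU (Lf X) \<oslash> br (Lf X) Em) = tm_ar (RU (Lf X))"
    using word_braiding_unit(1)[of X] by (subst tm_eq_iff_word_eq) simp_all
  then show "LUnit T X \<odot> s X (Unit T) = RUnit T X"
    by simp
  have "tm_ar (RU (Lf X) \<oslash> br Em (Lf X)) = tm_ar (LU (Lf X))"
    using word_braiding_unit(2)[of X] by (subst tm_eq_iff_word_eq) simp_all
  then show "RUnit T X \<odot> s (Unit T) X = LUnit T X"
    by simp
qed

text \<open>The middle-four interchange from \<open>(A A')(B B')\<close> to
  \<open>(A B)(A' B')\<close>. At \<open>A = A'\<close> and \<open>B = B'\<close> it is the
  structural part of the comultiplication in \<open>bimonoid_tensor\<close>; its naturality and
  coherence laws require independent arguments.\<close>

definition mid :: "'o \<Rightarrow> 'o \<Rightarrow> 'o \<Rightarrow> 'o \<Rightarrow> 'm" where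
  "mid A A' B B' = inv_of (Assoc T A B (A' \<otimes>\<^sub>o B')) \<odot> (idt A \<otimes>\<^sub>a Assoc T B A' B')
     \<odot> (idt A \<otimes>\<^sub>a (s A' B \<otimes>\<^sub>a idt B')) \<odot> (idt A \<otimes>\<^sub>a inv_of (Assoc T A' B B')) \<odot> Assoc T A A' (B \<otimes>\<^sub>o B')"

definition midt :: "'o tree \<Rightarrow> 'o tree \<Rightarrow> 'o tree \<Rightarrow> 'o tree \<Rightarrow> ('o, 'm) tm" where
  "midt A A' B B' = AsI A B (Nd A' B') \<oslash> IdT A \<otimes>\<^sub>t As B A' B'
     \<oslash> IdT A \<otimes>\<^sub>t (br A' B \<otimes>\<^sub>t IdT B') \<oslash> IdT A \<otimes>\<^sub>t AsI A' B B' \<oslash> As A A' (Nd B B')"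

lemma midt_simps [simp]:
  "src (midt A A' B B') = Nd (Nd A A') (Nd B B')"
  "tgt (midt A A' B B') = Nd (Nd A B) (Nd A' B')"
  "tm_ar (midt A A' B B') = mid (tree_ob A) (tree_ob A') (tree_ob B) (tree_ob B')"
  "tm_word (midt A A' B B') = [(leaves A, leaves A' @ leaves B, sbr A' B, leaves B @ leaves A', leaves B')]"
  "tm_ok (midt A A' B B') \<longleftrightarrow> tree_ok A \<and> tree_ok A' \<and> tree_ok B \<and> tree_ok B'"
  by (auto simp: midt_def mid_def)

lemma mid_arr [simp]:
  assumes "A \<in> Ob C" "A' \<in> Ob C" "B \<in> Ob C" "B' \<in> Ob C"
  shows "mid A A' B B' \<in> Arr C" "Dom C (mid A A' B B') = (A \<otimes>\<^sub>o A') \<otimes>\<^sub>o (B \<otimes>\<^sub>o B')"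
    "Cod C (mid A A' B B') = (A \<otimes>\<^sub>o B) \<otimes>\<^sub>o (A' \<otimes>\<^sub>o B')"
  using assms by (simp_all add: mid_def)

lemma mid_natural:
  assumes "f \<in> Arr C" "f' \<in> Arr C" "g \<in> Arr C" "g' \<in> Arr C" "Cod C f = A" "Cod C f' = A'" "Cod C g = B" "Cod C g' = B'"
  shows "mid A A' B B' \<odot> ((f \<otimes>\<^sub>a f') \<otimes>\<^sub>a (g \<otimes>\<^sub>a g'))
    = ((f \<otimes>\<^sub>a g) \<otimes>\<^sub>a (f' \<otimes>\<^sub>a g')) \<odot> mid (Dom C f) (Dom C f') (Dom C g) (Dom C g')"
proof -
  note [simp] = assms(1-4) assms(5-8)[symmetric]
  let ?D = "Dom C"
  have a: "Assoc T A A' (B \<otimes>\<^sub>o B') \<odot> ((f \<otimes>\<^sub>a f') \<otimes>\<^sub>a (g \<otimes>\<^sub>a g'))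
      = (f \<otimes>\<^sub>a (f' \<otimes>\<^sub>a (g \<otimes>\<^sub>a g'))) \<odot> Assoc T (?D f) (?D f') (?D g \<otimes>\<^sub>o ?D g')"
    by (simp add: assoc_natural')
  have b: "(idt A \<otimes>\<^sub>a inv_of (Assoc T A' B B')) \<odot> (f \<otimes>\<^sub>a (f' \<otimes>\<^sub>a (g \<otimes>\<^sub>a g')))
      = (f \<otimes>\<^sub>a ((f' \<otimes>\<^sub>a g) \<otimes>\<^sub>a g')) \<odot> (idt (?D f) \<otimes>\<^sub>a inv_of (Assoc T (?D f') (?D g) (?D g')))"
    by (simp add: merge assoc_inv_natural)
  have c: "(idt A \<otimes>\<^sub>a (s A' B \<otimes>\<^sub>a idt B')) \<odot> (f \<otimes>\<^sub>a ((f' \<otimes>\<^sub>a g) \<otimes>\<^sub>a g'))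
      = (f \<otimes>\<^sub>a ((g \<otimes>\<^sub>a f') \<otimes>\<^sub>a g')) \<odot> (idt (?D f) \<otimes>\<^sub>a (s (?D f') (?D g) \<otimes>\<^sub>a idt (?D g')))"
    by (simp add: merge braiding_natural')
  have d: "(idt A \<otimes>\<^sub>a Assoc T B A' B') \<odot> (f \<otimes>\<^sub>a ((g \<otimes>\<^sub>a f') \<otimes>\<^sub>a g'))
      = (f \<otimes>\<^sub>a (g \<otimes>\<^sub>a (f' \<otimes>\<^sub>a g'))) \<odot> (idt (?D f) \<otimes>\<^sub>a Assoc T (?D g) (?D f') (?D g'))"
    by (simp add: merge assoc_natural')
  have e: "inv_of (Assoc T A B (A' \<otimes>\<^sub>o B')) \<odot> (f \<otimes>\<^sub>a (g \<otimes>\<^sub>a (f' \<otimes>\<^sub>a g')))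
      = ((f \<otimes>\<^sub>a g) \<otimes>\<^sub>a (f' \<otimes>\<^sub>a g')) \<odot> inv_of (Assoc T (?D f) (?D g) (?D f' \<otimes>\<^sub>o ?D g'))"
    by (simp add: assoc_inv_natural)
  show ?thesis
    unfolding mid_def
    by (rule comp_square[OF comp_square[OF comp_square[OF comp_square[OF a b] c] d] e]) simp_all
qed

text \<open>Coassociativity of a tensor product of comonoids rests on this law. Both sides amount to
  the crossings of \<open>A'\<close> with \<open>B\<close>, \<open>A''\<close> with \<open>B\<close>
  and \<open>A''\<close> with \<open>B'\<close>: one hexagon splits the joint crossing of
  \<open>A'\<close> and \<open>A''\<close> with \<open>B\<close>, the crossings of \<open>A'\<close>
  with \<open>B\<close> and of \<open>A''\<close> with \<open>B'\<close> are exchanged, and the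
  other hexagon joins the two crossings of \<open>A''\<close>.\<close>

lemma mid_assoc:
  assumes [simp]: "A \<in> Ob C" "A' \<in> Ob C" "A'' \<in> Ob C" "B \<in> Ob C" "B' \<in> Ob C" "B'' \<in> Ob C"
  shows "(idt (A \<otimes>\<^sub>o B) \<otimes>\<^sub>a mid A' A'' B' B'') \<odot> mid A (A' \<otimes>\<^sub>o A'') B (B' \<otimes>\<^sub>o B'') \<odot> (Assoc T A A' A'' \<otimes>\<^sub>a Assoc T B B' B'')
    = Assoc T (A \<otimes>\<^sub>o B) (A' \<otimes>\<^sub>o B') (A'' \<otimes>\<^sub>o B'') \<odot> (mid A A' B B' \<otimes>\<^sub>a idt (A'' \<otimes>\<^sub>o B'')) \<odot> mid (A \<otimes>\<^sub>o A') A'' (B \<otimes>\<^sub>o B') B''"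
proof -
  let ?a = "Lf A" and ?a' = "Lf A'" and ?a'' = "Lf A''" and ?b = "Lf B" and ?b' = "Lf B'" and ?b'' = "Lf B''"
  have "word_eq [A, A', A'', B, B', B'']
     [([A, B, A'], [A'', B'], sbr ?a'' ?b', [B', A''], [B'']), ([A], [A', A'', B], sbr (Nd ?a' ?a'') ?b, [B, A', A''], [B', B''])]
     [([A, B, A'], [A'', B'], sbr ?a'' ?b', [B', A''], [B'']), ([A], [A', B], sbr ?a' ?b, [B, A'], [A'', B', B'']), ([A, A'], [A'', B], sbr ?a'' ?b, [B, A''], [B', B''])]"
    using word_eq_context[OF word_hexagon2[of ?a' ?a'' ?b], of "[A, A', A'', B, B', B'']" "[]" "[A]" "[B', B'']"
      "[([A, B, A'], [A'', B'], sbr ?a'' ?b', [B', A''], [B''])]"] by simp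
  also have "word_eq [A, A', A'', B, B', B''] \<dots>
    [([A], [A', B], sbr ?a' ?b, [B, A'], [B', A'', B'']), ([A, A', B], [A'', B'], sbr ?a'' ?b', [B', A''], [B'']), ([A, A'], [A'', B], sbr ?a'' ?b, [B, A''], [B', B''])]"
    using word_eq_context[OF word_eq_sym[OF word_eq_exchange[of "[A, A', B, A'', B', B'']" "[A]" "[A', B]" "sbr ?a' ?b" "[B, A']" "[]" "[B', A'']" "[B'']" "[A'', B']" "sbr ?a'' ?b'"]],
      of "[A, A', A'', B, B', B'']" "[([A, A'], [A'', B], sbr ?a'' ?b, [B, A''], [B', B''])]" "[]" "[]" "[]"] by simp
  also have "word_eq [A, A', A'', B, B', B''] \<dots>
    [([A], [A', B], sbr ?a' ?b, [B, A'], [B', A'', B'']), ([A, A'], [A'', B, B'], sbr ?a'' (Nd ?b ?b'), [B, B', A''], [B''])]"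
    using word_eq_context[OF word_eq_sym[OF word_hexagon1[of ?a'' ?b ?b']], of "[A, A', A'', B, B', B'']" "[]" "[A, A']" "[B'']"
      "[([A], [A', B], sbr ?a' ?b, [B, A'], [B', A'', B''])]"] by simp
  finally have "tm_ar (IdT (Nd ?a ?b) \<otimes>\<^sub>t midt ?a' ?a'' ?b' ?b'' \<oslash> midt ?a (Nd ?a' ?a'') ?b (Nd ?b' ?b'') \<oslash> As ?a ?a' ?a'' \<otimes>\<^sub>t As ?b ?b' ?b'')
    = tm_ar (As (Nd ?a ?b) (Nd ?a' ?b') (Nd ?a'' ?b'') \<oslash> midt ?a ?a' ?b ?b' \<otimes>\<^sub>t IdT (Nd ?a'' ?b'') \<oslash> midt (Nd ?a ?a') ?a'' (Nd ?b ?b') ?b'')"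
    by (subst tm_eq_iff_word_eq) simp_all
  then show ?thesis
    by simp
qed

text \<open>This makes the associator a morphism of comonoids. The method is that of
  \<open>mid_assoc\<close>, for the crossings of \<open>A'\<close> with \<open>B\<close> and
  \<open>E\<close> and of \<open>B'\<close> with \<open>E\<close>.\<close>

lemma mid_tensor_assoc:
  assumes [simp]: "A \<in> Ob C" "A' \<in> Ob C" "B \<in> Ob C" "B' \<in> Ob C" "E \<in> Ob C" "E' \<in> Ob C"
  shows "mid A A' (B \<otimes>\<^sub>o E) (B' \<otimes>\<^sub>o E') \<odot> (idt (A \<otimes>\<^sub>o A') \<otimes>\<^sub>a mid B B' E E') \<odot> Assoc T (A \<otimes>\<^sub>o A') (B \<otimes>\<^sub>o B') (E \<otimes>\<^sub>o E')
    = (Assoc T A B E \<otimes>\<^sub>a Assoc T A' B' E') \<odot> mid (A \<otimes>\<^sub>o B) (A' \<otimes>\<^sub>o B') E E' \<odot> (mid A A' B B' \<otimes>\<^sub>a idt (E \<otimes>\<^sub>o E'))"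
proof -
  let ?a = "Lf A" and ?a' = "Lf A'" and ?b = "Lf B" and ?b' = "Lf B'" and ?e = "Lf E" and ?e' = "Lf E'"
  let ?xs = "[A, A', B, B', E, E']"
  have "word_eq ?xs
     [([A], [A', B, E], sbr ?a' (Nd ?b ?e), [B, E, A'], [B', E']), ([A, A', B], [B', E], sbr ?b' ?e, [E, B'], [E'])]
     [([A, B], [A', E], sbr ?a' ?e, [E, A'], [B', E']), ([A], [A', B], sbr ?a' ?b, [B, A'], [E, B', E']), ([A, A', B], [B', E], sbr ?b' ?e, [E, B'], [E'])]"
    using word_eq_context[OF word_hexagon1[of ?a' ?b ?e], of ?xs "[([A, A', B], [B', E], sbr ?b' ?e, [E, B'], [E'])]" "[A]" "[B', E']" "[]"] by simp
  also have "word_eq ?xs \<dots>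
     [([A, B], [A', E], sbr ?a' ?e, [E, A'], [B', E']), ([A, B, A'], [B', E], sbr ?b' ?e, [E, B'], [E']), ([A], [A', B], sbr ?a' ?b, [B, A'], [B', E, E'])]"
    using word_eq_context[OF word_eq_exchange[of ?xs "[A]" "[A', B]" "sbr ?a' ?b" "[B, A']" "[]" "[E, B']" "[E']" "[B', E]" "sbr ?b' ?e"],
      of ?xs "[]" "[]" "[]" "[([A, B], [A', E], sbr ?a' ?e, [E, A'], [B', E'])]"] by simp
  also have "word_eq ?xs \<dots>
     [([A, B], [A', B', E], sbr (Nd ?a' ?b') ?e, [E, A', B'], [E']), ([A], [A', B], sbr ?a' ?b, [B, A'], [B', E, E'])]"
    using word_eq_context[OF word_eq_sym[OF word_hexagon2[of ?a' ?b' ?e]], of ?xs "[([A], [A', B], sbr ?a' ?b, [B, A'], [B', E, E'])]" "[A, B]" "[E']" "[]"] by simp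
  finally have "tm_ar (midt ?a ?a' (Nd ?b ?e) (Nd ?b' ?e') \<oslash> IdT (Nd ?a ?a') \<otimes>\<^sub>t midt ?b ?b' ?e ?e' \<oslash> As (Nd ?a ?a') (Nd ?b ?b') (Nd ?e ?e'))
    = tm_ar (As ?a ?b ?e \<otimes>\<^sub>t As ?a' ?b' ?e' \<oslash> midt (Nd ?a ?b) (Nd ?a' ?b') ?e ?e' \<oslash> midt ?a ?a' ?b ?b' \<otimes>\<^sub>t IdT (Nd ?e ?e'))"
    by (subst tm_eq_iff_word_eq) simp_all
  then show ?thesis
    by simp
qed

text \<open>In each case one of the crossing strands is the unit, so
  \<open>word_braiding_unit\<close> erases the crossing. The first two laws give the counit axioms
  of a tensor product of comonoids, the last two make the unit constraints morphisms of
  comonoids.\<close>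

lemma mid_units:
  assumes [simp]: "A \<in> Ob C" "B \<in> Ob C"
  shows "LUnit T (A \<otimes>\<^sub>o B) \<odot> (LUnit T (Unit T) \<otimes>\<^sub>a idt (A \<otimes>\<^sub>o B)) \<odot> mid (Unit T) A (Unit T) B = LUnit T A \<otimes>\<^sub>a LUnit T B"
    and "RUnit T (A \<otimes>\<^sub>o B) \<odot> (idt (A \<otimes>\<^sub>o B) \<otimes>\<^sub>a LUnit T (Unit T)) \<odot> mid A (Unit T) B (Unit T) = RUnit T A \<otimes>\<^sub>a RUnit T B"
    and "(LUnit T A \<otimes>\<^sub>a LUnit T B) \<odot> mid (Unit T) (Unit T) A B \<odot> (inv_of (LUnit T (Unit T)) \<otimes>\<^sub>a idt (A \<otimes>\<^sub>o B)) = LUnit T (A \<otimes>\<^sub>o B)"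
    and "(RUnit T A \<otimes>\<^sub>a RUnit T B) \<odot> mid A B (Unit T) (Unit T) \<odot> (idt (A \<otimes>\<^sub>o B) \<otimes>\<^sub>a inv_of (LUnit T (Unit T))) = RUnit T (A \<otimes>\<^sub>o B)"
proof -
  let ?a = "Lf A" and ?b = "Lf B"
  have l: "word_eq [A, B] [([], [A], sbr ?a Em, [A], [B])] []" "word_eq [A, B] [([A], [B], sbr ?b Em, [B], [])] []"
    using word_eq_context[OF word_braiding_unit(1)[of A], of "[A, B]" "[]" "[]" "[B]" "[]"]
      word_eq_context[OF word_braiding_unit(1)[of B], of "[A, B]" "[]" "[A]" "[]" "[]"] by simp_all
  have r: "word_eq [A, B] [([], [A], sbr Em ?a, [A], [B])] []" "word_eq [A, B] [([A], [B], sbr Em ?b, [B], [])] []"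
    using word_eq_context[OF word_braiding_unit(2)[of A], of "[A, B]" "[]" "[]" "[B]" "[]"]
      word_eq_context[OF word_braiding_unit(2)[of B], of "[A, B]" "[]" "[A]" "[]" "[]"] by simp_all
  have "tm_ar (LU (Nd ?a ?b) \<oslash> LU Em \<otimes>\<^sub>t IdT (Nd ?a ?b) \<oslash> midt Em ?a Em ?b) = tm_ar (LU ?a \<otimes>\<^sub>t LU ?b)"
    using l by (subst tm_eq_iff_word_eq) simp_all
  then show "LUnit T (A \<otimes>\<^sub>o B) \<odot> (LUnit T (Unit T) \<otimes>\<^sub>a idt (A \<otimes>\<^sub>o B)) \<odot> mid (Unit T) A (Unit T) B = LUnit T A \<otimes>\<^sub>a LUnit T B"
    by simp
  have "tm_ar (RU (Nd ?a ?b) \<oslash> IdT (Nd ?a ?b) \<otimes>\<^sub>t LU Em \<oslash> midt ?a Em ?b Em) = tm_ar (RU ?a \<otimes>\<^sub>t RU ?b)"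
    using r by (subst tm_eq_iff_word_eq) simp_all
  then show "RUnit T (A \<otimes>\<^sub>o B) \<odot> (idt (A \<otimes>\<^sub>o B) \<otimes>\<^sub>a LUnit T (Unit T)) \<odot> mid A (Unit T) B (Unit T) = RUnit T A \<otimes>\<^sub>a RUnit T B"
    by simp
  have "tm_ar (LU ?a \<otimes>\<^sub>t LU ?b \<oslash> midt Em Em ?a ?b \<oslash> LUI Em \<otimes>\<^sub>t IdT (Nd ?a ?b)) = tm_ar (LU (Nd ?a ?b))"
    using r by (subst tm_eq_iff_word_eq) simp_all
  then show "(LUnit T A \<otimes>\<^sub>a LUnit T B) \<odot> mid (Unit T) (Unit T) A B \<odot> (inv_of (LUnit T (Unit T)) \<otimes>\<^sub>a idt (A \<otimes>\<^sub>o B)) = LUnit T (A \<otimes>\<^sub>o B)"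
    by simp
  have "tm_ar (RU ?a \<otimes>\<^sub>t RU ?b \<oslash> midt ?a ?b Em Em \<oslash> IdT (Nd ?a ?b) \<otimes>\<^sub>t LUI Em) = tm_ar (RU (Nd ?a ?b))"
    using l by (subst tm_eq_iff_word_eq) simp_all
  then show "(RUnit T A \<otimes>\<^sub>a RUnit T B) \<odot> mid A B (Unit T) (Unit T) \<odot> (idt (A \<otimes>\<^sub>o B) \<otimes>\<^sub>a inv_of (LUnit T (Unit T))) = RUnit T (A \<otimes>\<^sub>o B)"
    by simp
qed

text \<open>By the hexagon, crossing \<open>P\<close> first with \<open>B\<close> and then with
  \<open>Q\<close> is a single crossing with \<open>B \<otimes>\<^sub>o Q\<close>. For the antipode
  of a tensor product, this merges the braiding in the comultiplication with the one in the
  antipode.\<close>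

lemma mid_braiding:
  assumes [simp]: "A \<in> Ob C" "B \<in> Ob C" "P \<in> Ob C" "Q \<in> Ob C"
  shows "Assoc T A B (Q \<otimes>\<^sub>o P) \<odot> (idt (A \<otimes>\<^sub>o B) \<otimes>\<^sub>a s P Q) \<odot> mid A P B Q
    = (idt A \<otimes>\<^sub>a Assoc T B Q P) \<odot> (idt A \<otimes>\<^sub>a s P (B \<otimes>\<^sub>o Q)) \<odot> Assoc T A P (B \<otimes>\<^sub>o Q)"
proof -
  let ?a = "Lf A" and ?b = "Lf B" and ?p = "Lf P" and ?q = "Lf Q"
  have "word_eq [A, P, B, Q] [([A], [P, B, Q], sbr ?p (Nd ?b ?q), [B, Q, P], [])]
      [([A, B], [P, Q], sbr ?p ?q, [Q, P], []), ([A], [P, B], sbr ?p ?b, [B, P], [Q])]"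
    using word_eq_context[OF word_hexagon1[of ?p ?b ?q], of "[A, P, B, Q]" "[]" "[A]" "[]" "[]"] by simp
  then have "tm_ar (As ?a ?b (Nd ?q ?p) \<oslash> IdT (Nd ?a ?b) \<otimes>\<^sub>t br ?p ?q \<oslash> midt ?a ?p ?b ?q)
    = tm_ar (IdT ?a \<otimes>\<^sub>t As ?b ?q ?p \<oslash> IdT ?a \<otimes>\<^sub>t br ?p (Nd ?b ?q) \<oslash> As ?a ?p (Nd ?b ?q))"
    by (subst tm_eq_iff_word_eq) (simp_all add: word_eq_sym)
  then show ?thesis
    by simp
qed

end


section \<open>Tensor products of bimonoids\<close>

context braided_monoidal_category
begin

text \<open>Naturality of \<open>mid\<close> moves the comultiplications and counits of the factors
  past it, so that each axiom separates into a law of \<open>mid\<close> and the same axiom for both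
  factors.\<close>

lemma comonoid_tensor:
  assumes "comonoid_in C T A d e" "comonoid_in C T B d' e'"
  shows "comonoid_in C T (A \<otimes>\<^sub>o B) (mid A A B B \<odot> (d \<otimes>\<^sub>a d')) (LUnit T (Unit T) \<odot> (e \<otimes>\<^sub>a e'))"
proof -
  have [simp]: "A \<in> Ob C" "B \<in> Ob C" "d \<in> Arr C" "Dom C d = A" "Cod C d = A \<otimes>\<^sub>o A"
    "e \<in> Arr C" "Dom C e = A" "Cod C e = Unit T" "d' \<in> Arr C" "Dom C d' = B" "Cod C d' = B \<otimes>\<^sub>o B"
    "e' \<in> Arr C" "Dom C e' = B" "Cod C e' = Unit T"
    using assms by (auto simp: comonoid_in_def in_hom_iff)
  have A: "Assoc T A A A \<odot> (d \<otimes>\<^sub>a idt A) \<odot> d = (idt A \<otimes>\<^sub>a d) \<odot> d"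
      "LUnit T A \<odot> (e \<otimes>\<^sub>a idt A) \<odot> d = idt A" "RUnit T A \<odot> (idt A \<otimes>\<^sub>a e) \<odot> d = idt A"
    and B: "Assoc T B B B \<odot> (d' \<otimes>\<^sub>a idt B) \<odot> d' = (idt B \<otimes>\<^sub>a d') \<odot> d'"
      "LUnit T B \<odot> (e' \<otimes>\<^sub>a idt B) \<odot> d' = idt B" "RUnit T B \<odot> (idt B \<otimes>\<^sub>a e') \<odot> d' = idt B"
    using assms by (auto simp: comonoid_in_def)
  let ?d = "mid A A B B \<odot> (d \<otimes>\<^sub>a d')" and ?e = "LUnit T (Unit T) \<odot> (e \<otimes>\<^sub>a e')"
  let ?AB = "A \<otimes>\<^sub>o B"
  have n1: "((d \<otimes>\<^sub>a d') \<otimes>\<^sub>a idt ?AB) \<odot> mid A A B B = mid (A \<otimes>\<^sub>o A) A (B \<otimes>\<^sub>o B) B \<odot> ((d \<otimes>\<^sub>a idt A) \<otimes>\<^sub>a (d' \<otimes>\<^sub>a idt B))"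
    by (subst mid_natural) simp_all
  have n2: "(idt ?AB \<otimes>\<^sub>a (d \<otimes>\<^sub>a d')) \<odot> mid A A B B = mid A (A \<otimes>\<^sub>o A) B (B \<otimes>\<^sub>o B) \<odot> ((idt A \<otimes>\<^sub>a d) \<otimes>\<^sub>a (idt B \<otimes>\<^sub>a d'))"
    by (subst mid_natural) simp_all
  have n3: "((e \<otimes>\<^sub>a e') \<otimes>\<^sub>a idt ?AB) \<odot> mid A A B B = mid (Unit T) A (Unit T) B \<odot> ((e \<otimes>\<^sub>a idt A) \<otimes>\<^sub>a (e' \<otimes>\<^sub>a idt B))"
    by (subst mid_natural) simp_all
  have n4: "(idt ?AB \<otimes>\<^sub>a (e \<otimes>\<^sub>a e')) \<odot> mid A A B B = mid A (Unit T) B (Unit T) \<odot> ((idt A \<otimes>\<^sub>a e) \<otimes>\<^sub>a (idt B \<otimes>\<^sub>a e'))"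
    by (subst mid_natural) simp_all
  have "Assoc T ?AB ?AB ?AB \<odot> (?d \<otimes>\<^sub>a idt ?AB) \<odot> ?d
    = Assoc T ?AB ?AB ?AB \<odot> (mid A A B B \<otimes>\<^sub>a idt ?AB) \<odot> (((d \<otimes>\<^sub>a d') \<otimes>\<^sub>a idt ?AB) \<odot> mid A A B B) \<odot> (d \<otimes>\<^sub>a d')"
    by (simp add: merge)
  also have "\<dots> = (Assoc T ?AB ?AB ?AB \<odot> (mid A A B B \<otimes>\<^sub>a idt ?AB) \<odot> mid (A \<otimes>\<^sub>o A) A (B \<otimes>\<^sub>o B) B)
      \<odot> (((d \<otimes>\<^sub>a idt A) \<odot> d) \<otimes>\<^sub>a ((d' \<otimes>\<^sub>a idt B) \<odot> d'))"
    unfolding n1 by (simp add: merge)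
  also have "\<dots> = ((idt ?AB \<otimes>\<^sub>a mid A A B B) \<odot> mid A (A \<otimes>\<^sub>o A) B (B \<otimes>\<^sub>o B) \<odot> (Assoc T A A A \<otimes>\<^sub>a Assoc T B B B))
      \<odot> (((d \<otimes>\<^sub>a idt A) \<odot> d) \<otimes>\<^sub>a ((d' \<otimes>\<^sub>a idt B) \<odot> d'))"
    by (simp only: mid_assoc \<open>A \<in> Ob C\<close> \<open>B \<in> Ob C\<close>)
  also have "\<dots> = (idt ?AB \<otimes>\<^sub>a mid A A B B) \<odot> mid A (A \<otimes>\<^sub>o A) B (B \<otimes>\<^sub>o B) \<odot> (((idt A \<otimes>\<^sub>a d) \<odot> d) \<otimes>\<^sub>a ((idt B \<otimes>\<^sub>a d') \<odot> d'))"
    by (simp add: merge A B)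
  also have "\<dots> = (idt ?AB \<otimes>\<^sub>a mid A A B B) \<odot> (mid A (A \<otimes>\<^sub>o A) B (B \<otimes>\<^sub>o B) \<odot> ((idt A \<otimes>\<^sub>a d) \<otimes>\<^sub>a (idt B \<otimes>\<^sub>a d'))) \<odot> (d \<otimes>\<^sub>a d')"
    by (simp add: merge)
  also have "\<dots> = (idt ?AB \<otimes>\<^sub>a ?d) \<odot> ?d"
    unfolding n2[symmetric] by (simp add: merge)
  finally have 1: "Assoc T ?AB ?AB ?AB \<odot> (?d \<otimes>\<^sub>a idt ?AB) \<odot> ?d = (idt ?AB \<otimes>\<^sub>a ?d) \<odot> ?d" .
  have "LUnit T ?AB \<odot> (?e \<otimes>\<^sub>a idt ?AB) \<odot> ?d
    = LUnit T ?AB \<odot> (LUnit T (Unit T) \<otimes>\<^sub>a idt ?AB) \<odot> (((e \<otimes>\<^sub>a e') \<otimes>\<^sub>a idt ?AB) \<odot> mid A A B B) \<odot> (d \<otimes>\<^sub>a d')"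
    by (simp add: merge)
  also have "\<dots> = (LUnit T ?AB \<odot> (LUnit T (Unit T) \<otimes>\<^sub>a idt ?AB) \<odot> mid (Unit T) A (Unit T) B) \<odot> (((e \<otimes>\<^sub>a idt A) \<odot> d) \<otimes>\<^sub>a ((e' \<otimes>\<^sub>a idt B) \<odot> d'))"
    unfolding n3 by (simp add: merge)
  also have "\<dots> = idt ?AB"
    by (simp only: mid_units \<open>A \<in> Ob C\<close> \<open>B \<in> Ob C\<close>) (simp add: merge A B)
  finally have 2: "LUnit T ?AB \<odot> (?e \<otimes>\<^sub>a idt ?AB) \<odot> ?d = idt ?AB" .
  have "RUnit T ?AB \<odot> (idt ?AB \<otimes>\<^sub>a ?e) \<odot> ?d
    = RUnit T ?AB \<odot> (idt ?AB \<otimes>\<^sub>a LUnit T (Unit T)) \<odot> ((idt ?AB \<otimes>\<^sub>a (e \<otimes>\<^sub>a e')) \<odot> mid A A B B) \<odot> (d \<otimes>\<^sub>a d')"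
    by (simp add: merge)
  also have "\<dots> = (RUnit T ?AB \<odot> (idt ?AB \<otimes>\<^sub>a LUnit T (Unit T)) \<odot> mid A (Unit T) B (Unit T)) \<odot> (((idt A \<otimes>\<^sub>a e) \<odot> d) \<otimes>\<^sub>a ((idt B \<otimes>\<^sub>a e') \<odot> d'))"
    unfolding n4 by (simp add: merge)
  also have "\<dots> = idt ?AB"
    by (simp only: mid_units \<open>A \<in> Ob C\<close> \<open>B \<in> Ob C\<close>) (simp add: merge A B)
  finally have 3: "RUnit T ?AB \<odot> (idt ?AB \<otimes>\<^sub>a ?e) \<odot> ?d = idt ?AB" .
  show ?thesis
    unfolding comonoid_in_def using 1 2 3 by (simp add: in_hom_iff)
qed

end

section \<open>Monoid structures on tensor products, and the interchange law against rebracketing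
  and crossing\<close>

context duoidal_category
begin

sublocale circ: monoidal_category "Cat D" "Circ D"
  by (rule circ_monoidal)

sublocale bul: monoidal_category "Cat D" "Bul D"
  by (rule bul_monoidal)

lemmas merges = circ.merge bul.tensor_comp' bul.tensor_comp_extend

lemma zeta_arr [simp]:
  assumes "ob A" "ob B" "ob A'" "ob B'"
  shows "\<zeta> A B A' B' \<in> Arr (Cat D)" "Dom (Cat D) (\<zeta> A B A' B') = (A \<bullet> B) \<circle> (A' \<bullet> B')"
    "Cod (Cat D) (\<zeta> A B A' B') = (A \<circle> A') \<bullet> (B \<circle> B')"
  using zeta_hom[OF assms] by (simp_all add: hom_def)

lemma zeta_natural':
  assumes "f \<in> Arr (Cat D)" "g \<in> Arr (Cat D)" "h \<in> Arr (Cat D)" "k \<in> Arr (Cat D)"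
    "Cod (Cat D) f = A" "Cod (Cat D) g = B" "Cod (Cat D) h = A'" "Cod (Cat D) k = B'"
  shows "\<zeta> A B A' B' \<cdot> ((f \<bullet>\<^sub>a g) \<circle>\<^sub>a (h \<bullet>\<^sub>a k))
    = ((f \<circle>\<^sub>a h) \<bullet>\<^sub>a (g \<circle>\<^sub>a k)) \<cdot> \<zeta> (Dom (Cat D) f) (Dom (Cat D) g) (Dom (Cat D) h) (Dom (Cat D) k)"
  using zeta_natural[OF circ.homI circ.homI circ.homI circ.homI, of f g h k] assms by simp

lemma DeltaI_arr [simp]:
  "\<Delta>\<^sub>I \<in> Arr (Cat D)" "Dom (Cat D) \<Delta>\<^sub>I = I" "Cod (Cat D) \<Delta>\<^sub>I = I \<bullet> I"
  "\<epsilon>\<^sub>I \<in> Arr (Cat D)" "Dom (Cat D) \<epsilon>\<^sub>I = I" "Cod (Cat D) \<epsilon>\<^sub>I = J"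
  "m\<^sub>J \<in> Arr (Cat D)" "Dom (Cat D) m\<^sub>J = J \<circle> J" "Cod (Cat D) m\<^sub>J = J"
  using I_comonoid J_monoid by (auto simp: comonoid_in_def monoid_in_def circ.in_hom_iff)

text \<open>\<open>\<zeta>\<close> and \<open>\<Delta>\<^sub>I\<close> make \<open>\<bullet>\<close>
  a lax monoidal functor for \<open>\<circle>\<close>, and such a functor carries a pair of monoids
  to a monoid.\<close>

lemma monoid_tensor:
  assumes "monoid_in (Cat D) (Circ D) A m u" "monoid_in (Cat D) (Circ D) B n v"
  shows "monoid_in (Cat D) (Circ D) (A \<bullet> B) ((m \<bullet>\<^sub>a n) \<cdot> \<zeta> A B A B) ((u \<bullet>\<^sub>a v) \<cdot> \<Delta>\<^sub>I)"
proof -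
  let ?C = "Cat D"
  have [simp]: "ob A" "ob B" "m \<in> Arr ?C" "Dom ?C m = A \<circle> A" "Cod ?C m = A" "u \<in> Arr ?C" "Dom ?C u = I" "Cod ?C u = A"
    "n \<in> Arr ?C" "Dom ?C n = B \<circle> B" "Cod ?C n = B" "v \<in> Arr ?C" "Dom ?C v = I" "Cod ?C v = B"
    using assms by (auto simp: monoid_in_def circ.in_hom_iff)
  have A: "m \<cdot> (m \<circle>\<^sub>a \<langle>A\<rangle>) = m \<cdot> (\<langle>A\<rangle> \<circle>\<^sub>a m) \<cdot> a\<^sub>c A A A" "m \<cdot> (u \<circle>\<^sub>a \<langle>A\<rangle>) = l\<^sub>c A" "m \<cdot> (\<langle>A\<rangle> \<circle>\<^sub>a u) = r\<^sub>c A"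
    and B: "n \<cdot> (n \<circle>\<^sub>a \<langle>B\<rangle>) = n \<cdot> (\<langle>B\<rangle> \<circle>\<^sub>a n) \<cdot> a\<^sub>c B B B" "n \<cdot> (v \<circle>\<^sub>a \<langle>B\<rangle>) = l\<^sub>c B" "n \<cdot> (\<langle>B\<rangle> \<circle>\<^sub>a v) = r\<^sub>c B"
    using assms by (auto simp: monoid_in_def)
  let ?m = "(m \<bullet>\<^sub>a n) \<cdot> \<zeta> A B A B" and ?u = "(u \<bullet>\<^sub>a v) \<cdot> \<Delta>\<^sub>I" and ?AB = "A \<bullet> B"
  have n1: "\<zeta> A B A B \<cdot> ((m \<bullet>\<^sub>a n) \<circle>\<^sub>a \<langle>?AB\<rangle>) = ((m \<circle>\<^sub>a \<langle>A\<rangle>) \<bullet>\<^sub>a (n \<circle>\<^sub>a \<langle>B\<rangle>)) \<cdot> \<zeta> (A \<circle> A) (B \<circle> B) A B"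
    using zeta_natural'[of m n "\<langle>A\<rangle>" "\<langle>B\<rangle>" A B A B] by simp
  have n2: "\<zeta> A B A B \<cdot> (\<langle>?AB\<rangle> \<circle>\<^sub>a (m \<bullet>\<^sub>a n)) = ((\<langle>A\<rangle> \<circle>\<^sub>a m) \<bullet>\<^sub>a (\<langle>B\<rangle> \<circle>\<^sub>a n)) \<cdot> \<zeta> A B (A \<circle> A) (B \<circle> B)"
    using zeta_natural'[of "\<langle>A\<rangle>" "\<langle>B\<rangle>" m n A B A B] by simp
  have n3: "\<zeta> A B A B \<cdot> ((u \<bullet>\<^sub>a v) \<circle>\<^sub>a \<langle>?AB\<rangle>) = ((u \<circle>\<^sub>a \<langle>A\<rangle>) \<bullet>\<^sub>a (v \<circle>\<^sub>a \<langle>B\<rangle>)) \<cdot> \<zeta> I I A B"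
    using zeta_natural'[of u v "\<langle>A\<rangle>" "\<langle>B\<rangle>" A B A B] by simp
  have n4: "\<zeta> A B A B \<cdot> (\<langle>?AB\<rangle> \<circle>\<^sub>a (u \<bullet>\<^sub>a v)) = ((\<langle>A\<rangle> \<circle>\<^sub>a u) \<bullet>\<^sub>a (\<langle>B\<rangle> \<circle>\<^sub>a v)) \<cdot> \<zeta> A B I I"
    using zeta_natural'[of "\<langle>A\<rangle>" "\<langle>B\<rangle>" u v A B A B] by simp
  have "?m \<cdot> (?m \<circle>\<^sub>a \<langle>?AB\<rangle>) = (m \<bullet>\<^sub>a n) \<cdot> (\<zeta> A B A B \<cdot> ((m \<bullet>\<^sub>a n) \<circle>\<^sub>a \<langle>?AB\<rangle>)) \<cdot> (\<zeta> A B A B \<circle>\<^sub>a \<langle>?AB\<rangle>)"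
    by (simp add: merges)
  also have "\<dots> = ((m \<cdot> (m \<circle>\<^sub>a \<langle>A\<rangle>)) \<bullet>\<^sub>a (n \<cdot> (n \<circle>\<^sub>a \<langle>B\<rangle>))) \<cdot> \<zeta> (A \<circle> A) (B \<circle> B) A B \<cdot> (\<zeta> A B A B \<circle>\<^sub>a \<langle>?AB\<rangle>)"
    unfolding n1 by (simp add: merges)
  also have "\<dots> = ((m \<cdot> (\<langle>A\<rangle> \<circle>\<^sub>a m)) \<bullet>\<^sub>a (n \<cdot> (\<langle>B\<rangle> \<circle>\<^sub>a n))) \<cdot> (a\<^sub>c A A A \<bullet>\<^sub>a a\<^sub>c B B B) \<cdot> \<zeta> (A \<circle> A) (B \<circle> B) A B \<cdot> (\<zeta> A B A B \<circle>\<^sub>a \<langle>?AB\<rangle>)"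
    by (simp add: merges A B)
  also have "\<dots> = ((m \<cdot> (\<langle>A\<rangle> \<circle>\<^sub>a m)) \<bullet>\<^sub>a (n \<cdot> (\<langle>B\<rangle> \<circle>\<^sub>a n))) \<cdot> \<zeta> A B (A \<circle> A) (B \<circle> B) \<cdot> (\<langle>?AB\<rangle> \<circle>\<^sub>a \<zeta> A B A B) \<cdot> a\<^sub>c ?AB ?AB ?AB"
    by (simp only: zeta_circ_assoc \<open>ob A\<close> \<open>ob B\<close>)
  also have "\<dots> = (m \<bullet>\<^sub>a n) \<cdot> (((\<langle>A\<rangle> \<circle>\<^sub>a m) \<bullet>\<^sub>a (\<langle>B\<rangle> \<circle>\<^sub>a n)) \<cdot> \<zeta> A B (A \<circle> A) (B \<circle> B)) \<cdot> (\<langle>?AB\<rangle> \<circle>\<^sub>a \<zeta> A B A B) \<cdot> a\<^sub>c ?AB ?AB ?AB"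
    by (simp add: merges)
  also have "\<dots> = ?m \<cdot> (\<langle>?AB\<rangle> \<circle>\<^sub>a ?m) \<cdot> a\<^sub>c ?AB ?AB ?AB"
    unfolding n2[symmetric] by (simp add: merges)
  finally have 1: "?m \<cdot> (?m \<circle>\<^sub>a \<langle>?AB\<rangle>) = ?m \<cdot> (\<langle>?AB\<rangle> \<circle>\<^sub>a ?m) \<cdot> a\<^sub>c ?AB ?AB ?AB" .
  have "?m \<cdot> (?u \<circle>\<^sub>a \<langle>?AB\<rangle>) = (m \<bullet>\<^sub>a n) \<cdot> (\<zeta> A B A B \<cdot> ((u \<bullet>\<^sub>a v) \<circle>\<^sub>a \<langle>?AB\<rangle>)) \<cdot> (\<Delta>\<^sub>I \<circle>\<^sub>a \<langle>?AB\<rangle>)"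
    by (simp add: merges)
  also have "\<dots> = (l\<^sub>c A \<bullet>\<^sub>a l\<^sub>c B) \<cdot> \<zeta> I I A B \<cdot> (\<Delta>\<^sub>I \<circle>\<^sub>a \<langle>?AB\<rangle>)"
    unfolding n3 by (simp add: merges A B)
  also have "\<dots> = l\<^sub>c ?AB"
    by (simp only: zeta_circ_lunit \<open>ob A\<close> \<open>ob B\<close>)
  finally have 2: "?m \<cdot> (?u \<circle>\<^sub>a \<langle>?AB\<rangle>) = l\<^sub>c ?AB" .
  have "?m \<cdot> (\<langle>?AB\<rangle> \<circle>\<^sub>a ?u) = (m \<bullet>\<^sub>a n) \<cdot> (\<zeta> A B A B \<cdot> (\<langle>?AB\<rangle> \<circle>\<^sub>a (u \<bullet>\<^sub>a v))) \<cdot> (\<langle>?AB\<rangle> \<circle>\<^sub>a \<Delta>\<^sub>I)"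
    by (simp add: merges)
  also have "\<dots> = (r\<^sub>c A \<bullet>\<^sub>a r\<^sub>c B) \<cdot> \<zeta> A B I I \<cdot> (\<langle>?AB\<rangle> \<circle>\<^sub>a \<Delta>\<^sub>I)"
    unfolding n4 by (simp add: merges A B)
  also have "\<dots> = r\<^sub>c ?AB"
    by (simp only: zeta_circ_runit \<open>ob A\<close> \<open>ob B\<close>)
  finally have 3: "?m \<cdot> (\<langle>?AB\<rangle> \<circle>\<^sub>a ?u) = r\<^sub>c ?AB" .
  show ?thesis
    unfolding monoid_in_def using 1 2 3 by (simp add: circ.in_hom_iff)
qed

text \<open>\<open>\<zeta>\<close> makes \<open>\<circle>\<close> an opmonoidal functor for \<open>\<bullet>\<close>, so its iterates commute with rebracketing.\<close>

lemma zeta_assoc4: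
  assumes [simp]: "ob A" "ob A'" "ob B" "ob B'" "ob C" "ob C'" "ob E" "ob E'"
  shows "a\<^sub>b (A \<circle> C) (A' \<circle> C') ((B \<circle> E) \<bullet> (B' \<circle> E'))
      \<cdot> ((\<zeta> A A' C C' \<bullet>\<^sub>a \<zeta> B B' E E') \<cdot> \<zeta> (A \<bullet> A') (B \<bullet> B') (C \<bullet> C') (E \<bullet> E'))
    = ((\<langle>A \<circle> C\<rangle> \<bullet>\<^sub>a ((\<langle>A' \<circle> C'\<rangle> \<bullet>\<^sub>a \<zeta> B B' E E') \<cdot> \<zeta> A' (B \<bullet> B') C' (E \<bullet> E')))
        \<cdot> \<zeta> A (A' \<bullet> (B \<bullet> B')) C (C' \<bullet> (E \<bullet> E')))
      \<cdot> (a\<^sub>b A A' (B \<bullet> B') \<circle>\<^sub>a a\<^sub>b C C' (E \<bullet> E'))"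
proof -
  let ?AC = "A \<circle> C" and ?AC' = "A' \<circle> C'" and ?BE = "B \<circle> E" and ?BE' = "B' \<circle> E'"
  have "a\<^sub>b ?AC ?AC' (?BE \<bullet> ?BE') \<cdot> ((\<zeta> A A' C C' \<bullet>\<^sub>a \<zeta> B B' E E') \<cdot> \<zeta> (A \<bullet> A') (B \<bullet> B') (C \<bullet> C') (E \<bullet> E'))
    = (a\<^sub>b ?AC ?AC' (?BE \<bullet> ?BE') \<cdot> ((\<langle>?AC\<rangle> \<bullet>\<^sub>a \<langle>?AC'\<rangle>) \<bullet>\<^sub>a \<zeta> B B' E E'))
      \<cdot> ((\<zeta> A A' C C' \<bullet>\<^sub>a \<langle>(B \<bullet> B') \<circle> (E \<bullet> E')\<rangle>) \<cdot> \<zeta> (A \<bullet> A') (B \<bullet> B') (C \<bullet> C') (E \<bullet> E'))"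
    by (simp add: merges)
  also have "\<dots> = (\<langle>?AC\<rangle> \<bullet>\<^sub>a (\<langle>?AC'\<rangle> \<bullet>\<^sub>a \<zeta> B B' E E'))
      \<cdot> (a\<^sub>b ?AC ?AC' ((B \<bullet> B') \<circle> (E \<bullet> E')) \<cdot> (\<zeta> A A' C C' \<bullet>\<^sub>a \<langle>(B \<bullet> B') \<circle> (E \<bullet> E')\<rangle>) \<cdot> \<zeta> (A \<bullet> A') (B \<bullet> B') (C \<bullet> C') (E \<bullet> E'))"
    by (subst bul.assoc_natural') (simp_all add: merges)
  also have "\<dots> = (\<langle>?AC\<rangle> \<bullet>\<^sub>a (\<langle>?AC'\<rangle> \<bullet>\<^sub>a \<zeta> B B' E E'))
      \<cdot> ((\<langle>?AC\<rangle> \<bullet>\<^sub>a \<zeta> A' (B \<bullet> B') C' (E \<bullet> E')) \<cdot> \<zeta> A (A' \<bullet> (B \<bullet> B')) C (C' \<bullet> (E \<bullet> E')) \<cdot> (a\<^sub>b A A' (B \<bullet> B') \<circle>\<^sub>a a\<^sub>b C C' (E \<bullet> E')))"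
    by (subst zeta_bul_assoc) simp_all
  finally show ?thesis
    by (simp add: merges)
qed

lemma zeta_assoc_inv:
  assumes [simp]: "ob A" "ob B" "ob C" "ob E" "ob F" "ob G"
  shows "inv\<^sub>a (a\<^sub>b (A \<circle> E) (B \<circle> F) (C \<circle> G)) \<cdot> (\<langle>A \<circle> E\<rangle> \<bullet>\<^sub>a \<zeta> B C F G) \<cdot> \<zeta> A (B \<bullet> C) E (F \<bullet> G)
    = ((\<zeta> A B E F \<bullet>\<^sub>a \<langle>C \<circle> G\<rangle>) \<cdot> \<zeta> (A \<bullet> B) C (E \<bullet> F) G) \<cdot> (inv\<^sub>a (a\<^sub>b A B C) \<circle>\<^sub>a inv\<^sub>a (a\<^sub>b E F G))"
proof -
  have "inv\<^sub>a (a\<^sub>b (A \<circle> E) (B \<circle> F) (C \<circle> G)) \<cdot> (\<langle>A \<circle> E\<rangle> \<bullet>\<^sub>a \<zeta> B C F G) \<cdot> \<zeta> A (B \<bullet> C) E (F \<bullet> G)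
    = ((\<zeta> A B E F \<bullet>\<^sub>a \<langle>C \<circle> G\<rangle>) \<cdot> \<zeta> (A \<bullet> B) C (E \<bullet> F) G) \<cdot> inv\<^sub>a (a\<^sub>b A B C \<circle>\<^sub>a a\<^sub>b E F G)"
    by (rule circ.inv_natural) (simp_all add: zeta_bul_assoc circ.comp_assoc')
  then show ?thesis
    by (simp add: circ.inv_tensor)
qed

end

context bullet_braided_duoidal_category
begin

sublocale bul: braided_monoidal_category "Cat D" "Bul D" \<sigma>
  by (rule bul_braided)

lemma bimonoid_tensor_simps [simp]:
  "Carrier (bimonoid_tensor A B) = Carrier A \<bullet> Carrier B"
  "Mult (bimonoid_tensor A B) = (Mult A \<bullet>\<^sub>a Mult B) \<cdot> \<zeta> (Carrier A) (Carrier B) (Carrier A) (Carrier B)"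
  "Uni (bimonoid_tensor A B) = (Uni A \<bullet>\<^sub>a Uni B) \<cdot> \<Delta>\<^sub>I"
  "Counit (bimonoid_tensor A B) = l\<^sub>b J \<cdot> (Counit A \<bullet>\<^sub>a Counit B)"
  by (simp_all add: bimonoid_tensor_def Let_def)

text \<open>Each of the five factors of \<open>mid\<close> is compatible with
  \<open>\<zeta>\<close>: the four rebracketings by associativity of \<open>\<zeta>\<close>, the
  crossing by \<open>braiding_zeta\<close>. This is what makes multiplication and comultiplication
  of a tensor product compatible.\<close>

lemma zeta_mid:
  assumes [simp]: "ob A" "ob A'" "ob B" "ob B'" "ob C" "ob C'" "ob E" "ob E'"
  shows "bul.mid (A \<circle> C) (A' \<circle> C') (B \<circle> E) (B' \<circle> E')
      \<cdot> (\<zeta> A A' C C' \<bullet>\<^sub>a \<zeta> B B' E E') \<cdot> \<zeta> (A \<bullet> A') (B \<bullet> B') (C \<bullet> C') (E \<bullet> E')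
    = ((\<zeta> A B C E \<bullet>\<^sub>a \<zeta> A' B' C' E') \<cdot> \<zeta> (A \<bullet> B) (A' \<bullet> B') (C \<bullet> E) (C' \<bullet> E'))
      \<cdot> (bul.mid A A' B B' \<circle>\<^sub>a bul.mid C C' E E')"
proof -
  let ?AC = "A \<circle> C" and ?AC' = "A' \<circle> C'" and ?BE = "B \<circle> E" and ?BE' = "B' \<circle> E'"
  \<comment> \<open>\<open>?Z2\<close> and \<open>?Z3\<close> are the iterated
    \<open>\<zeta>\<close> on left-bracketed triples just before and just after the
    crossing.\<close>
  let ?Z2 = "(\<zeta> A' B C' E \<bullet>\<^sub>a \<langle>?BE'\<rangle>) \<cdot> \<zeta> (A' \<bullet> B) B' (C' \<bullet> E) E'"
  let ?Z3 = "(\<zeta> B A' E C' \<bullet>\<^sub>a \<langle>?BE'\<rangle>) \<cdot> \<zeta> (B \<bullet> A') B' (E \<bullet> C') E'"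
  note s1 = zeta_assoc4[OF assms]
  have s2: "(\<langle>?AC\<rangle> \<bullet>\<^sub>a inv\<^sub>a (a\<^sub>b ?AC' ?BE ?BE'))
      \<cdot> ((\<langle>?AC\<rangle> \<bullet>\<^sub>a ((\<langle>?AC'\<rangle> \<bullet>\<^sub>a \<zeta> B B' E E') \<cdot> \<zeta> A' (B \<bullet> B') C' (E \<bullet> E'))) \<cdot> \<zeta> A (A' \<bullet> (B \<bullet> B')) C (C' \<bullet> (E \<bullet> E')))
    = ((\<langle>?AC\<rangle> \<bullet>\<^sub>a ?Z2) \<cdot> \<zeta> A ((A' \<bullet> B) \<bullet> B') C ((C' \<bullet> E) \<bullet> E'))
      \<cdot> ((\<langle>A\<rangle> \<bullet>\<^sub>a inv\<^sub>a (a\<^sub>b A' B B')) \<circle>\<^sub>a (\<langle>C\<rangle> \<bullet>\<^sub>a inv\<^sub>a (a\<^sub>b C' E E')))"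
    by (simp add: merges zeta_natural' zeta_assoc_inv)
  have s3: "(\<langle>?AC\<rangle> \<bullet>\<^sub>a (\<sigma> ?AC' ?BE \<bullet>\<^sub>a \<langle>?BE'\<rangle>)) \<cdot> ((\<langle>?AC\<rangle> \<bullet>\<^sub>a ?Z2) \<cdot> \<zeta> A ((A' \<bullet> B) \<bullet> B') C ((C' \<bullet> E) \<bullet> E'))
    = ((\<langle>?AC\<rangle> \<bullet>\<^sub>a ?Z3) \<cdot> \<zeta> A ((B \<bullet> A') \<bullet> B') C ((E \<bullet> C') \<bullet> E'))
      \<cdot> ((\<langle>A\<rangle> \<bullet>\<^sub>a (\<sigma> A' B \<bullet>\<^sub>a \<langle>B'\<rangle>)) \<circle>\<^sub>a (\<langle>C\<rangle> \<bullet>\<^sub>a (\<sigma> C' E \<bullet>\<^sub>a \<langle>E'\<rangle>)))"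
    by (simp add: merges zeta_natural' braiding_zeta)
  have s4: "(\<langle>?AC\<rangle> \<bullet>\<^sub>a a\<^sub>b ?BE ?AC' ?BE') \<cdot> ((\<langle>?AC\<rangle> \<bullet>\<^sub>a ?Z3) \<cdot> \<zeta> A ((B \<bullet> A') \<bullet> B') C ((E \<bullet> C') \<bullet> E'))
    = ((\<langle>?AC\<rangle> \<bullet>\<^sub>a ((\<langle>?BE\<rangle> \<bullet>\<^sub>a \<zeta> A' B' C' E') \<cdot> \<zeta> B (A' \<bullet> B') E (C' \<bullet> E'))) \<cdot> \<zeta> A (B \<bullet> (A' \<bullet> B')) C (E \<bullet> (C' \<bullet> E')))
      \<cdot> ((\<langle>A\<rangle> \<bullet>\<^sub>a a\<^sub>b B A' B') \<circle>\<^sub>a (\<langle>C\<rangle> \<bullet>\<^sub>a a\<^sub>b E C' E'))"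
    by (simp add: merges zeta_natural' zeta_bul_assoc)
  have s5: "inv\<^sub>a (a\<^sub>b ?AC ?BE (?AC' \<bullet> ?BE'))
      \<cdot> ((\<langle>?AC\<rangle> \<bullet>\<^sub>a ((\<langle>?BE\<rangle> \<bullet>\<^sub>a \<zeta> A' B' C' E') \<cdot> \<zeta> B (A' \<bullet> B') E (C' \<bullet> E'))) \<cdot> \<zeta> A (B \<bullet> (A' \<bullet> B')) C (E \<bullet> (C' \<bullet> E')))
    = ((\<zeta> A B C E \<bullet>\<^sub>a \<zeta> A' B' C' E') \<cdot> \<zeta> (A \<bullet> B) (A' \<bullet> B') (C \<bullet> E) (C' \<bullet> E'))
      \<cdot> inv\<^sub>a (a\<^sub>b A B (A' \<bullet> B') \<circle>\<^sub>a a\<^sub>b C E (C' \<bullet> E'))"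
    using zeta_assoc4[of A B A' B' C E C' E'] by (intro circ.inv_natural) (simp_all del: circ.iso_comp)
  have m: "bul.mid A A' B B' \<circle>\<^sub>a bul.mid C C' E E'
    = inv\<^sub>a (a\<^sub>b A B (A' \<bullet> B') \<circle>\<^sub>a a\<^sub>b C E (C' \<bullet> E')) \<cdot> ((\<langle>A\<rangle> \<bullet>\<^sub>a a\<^sub>b B A' B') \<circle>\<^sub>a (\<langle>C\<rangle> \<bullet>\<^sub>a a\<^sub>b E C' E'))
      \<cdot> ((\<langle>A\<rangle> \<bullet>\<^sub>a (\<sigma> A' B \<bullet>\<^sub>a \<langle>B'\<rangle>)) \<circle>\<^sub>a (\<langle>C\<rangle> \<bullet>\<^sub>a (\<sigma> C' E \<bullet>\<^sub>a \<langle>E'\<rangle>)))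
      \<cdot> ((\<langle>A\<rangle> \<bullet>\<^sub>a inv\<^sub>a (a\<^sub>b A' B B')) \<circle>\<^sub>a (\<langle>C\<rangle> \<bullet>\<^sub>a inv\<^sub>a (a\<^sub>b C' E E'))) \<cdot> (a\<^sub>b A A' (B \<bullet> B') \<circle>\<^sub>a a\<^sub>b C C' (E \<bullet> E'))"
    by (simp add: bul.mid_def circ.inv_tensor merges)
  show ?thesis
    unfolding m unfolding bul.mid_def
    by (rule circ.comp_square[OF circ.comp_square[OF circ.comp_square[OF circ.comp_square[OF s1 s2] s3] s4] s5])
      simp_all
qed

end


section \<open>The monoidal category of bimonoids\<close>

lemma hom_full_subcategory:
  "hom (full_subcategory C S) X Y = (if X \<in> S \<and> Y \<in> S then hom C X Y else {})"
  by (auto simp: hom_def full_subcategory_def)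

lemma full_subcategory_simps [simp]:
  "Ob (full_subcategory C S) = Ob C \<inter> S"
  "Arr (full_subcategory C S) = {f \<in> Arr C. Dom C f \<in> S \<and> Cod C f \<in> S}"
  "Dom (full_subcategory C S) = Dom C" "Cod (full_subcategory C S) = Cod C"
  "Ident (full_subcategory C S) = Ident C" "Comp (full_subcategory C S) = Comp C"
  by (simp_all add: full_subcategory_def)

lemma (in category) category_full_subcategory: "category (full_subcategory C S)"
proof
  show "Dom (full_subcategory C S) f \<in> Ob (full_subcategory C S)" if "f \<in> Arr (full_subcategory C S)" for f
    using that by (auto simp: full_subcategory_def)
  show "Cod (full_subcategory C S) f \<in> Ob (full_subcategory C S)" if "f \<in> Arr (full_subcategory C S)" for f
    using that by (auto simp: full_subcategory_def)
qed (auto simp: hom_full_subcategory ident_hom comp_hom ident_comp comp_ident comp_assoc split: if_splits)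

lemma (in category) iso_arrow_full_subcategory:
  assumes "iso_arrow C f" "Dom C f \<in> S" "Cod C f \<in> S"
  shows "iso_arrow (full_subcategory C S) f"
proof -
  have "inverse_arrows (full_subcategory C S) f (inv_of f)"
    using iso_inverse[OF assms(1)] assms(2,3)
    by (auto simp: inverse_arrows_def hom_full_subcategory)
  then show ?thesis
    by (auto simp: iso_arrow_def)
qed

lemma (in category) hom_obs: "f \<in> hom C X Y \<Longrightarrow> X \<in> Ob C" "f \<in> hom C X Y \<Longrightarrow> Y \<in> Ob C"
  by (auto simp: in_hom_iff)

text \<open>Closure of \<open>S\<close> puts the sources and targets of the constraints into the
  subcategory, and fullness then supplies the constraints with their inverses.\<close>

lemma (in monoidal_category) monoidal_full_subcategory:
  assumes "\<And>X Y. \<lbrakk>X \<in> S; Y \<in> S; X \<in> Ob C; Y \<in> Ob C\<rbrakk> \<Longrightarrow> X \<otimes>\<^sub>o Y \<in> S" "Unit T \<in> S"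
  shows "monoidal_category (full_subcategory C S) T"
proof -
  interpret S: category "full_subcategory C S"
    by (rule category_full_subcategory)
  show ?thesis
    by unfold_locales
      (auto simp: hom_full_subcategory assms(2) tensor_hom tensor_comp assoc_hom lunit_hom runit_hom
        assoc_natural lunit_natural runit_natural pentagon triangle
        intro!: iso_arrow_full_subcategory assms(1) intro: hom_obs split: if_splits)
qed

section \<open>Bimonoids in a duoidal category and their morphisms\<close>

context duoidal_category
begin

lemma bimonoid_simps [simp]:
  assumes "bimonoid A"
  shows "ob (Carrier A)"
    "Mult A \<in> Arr (Cat D)" "Dom (Cat D) (Mult A) = Carrier A \<circle> Carrier A" "Cod (Cat D) (Mult A) = Carrier A"
    "Uni A \<in> Arr (Cat D)" "Dom (Cat D) (Uni A) = I" "Cod (Cat D) (Uni A) = Carrier A"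
    "Comult A \<in> Arr (Cat D)" "Dom (Cat D) (Comult A) = Carrier A" "Cod (Cat D) (Comult A) = Carrier A \<bullet> Carrier A"
    "Counit A \<in> Arr (Cat D)" "Dom (Cat D) (Counit A) = Carrier A" "Cod (Cat D) (Counit A) = J"
  using assms by (auto simp: bimonoid_def monoid_in_def comonoid_in_def circ.in_hom_iff)

lemma bimonoid_compat:
  assumes "bimonoid A"
  shows "Comult A \<cdot> Mult A = (Mult A \<bullet>\<^sub>a Mult A) \<cdot> \<zeta> (Carrier A) (Carrier A) (Carrier A) (Carrier A) \<cdot> (Comult A \<circle>\<^sub>a Comult A)"
    "Counit A \<cdot> Mult A = m\<^sub>J \<cdot> (Counit A \<circle>\<^sub>a Counit A)"
    "Comult A \<cdot> Uni A = (Uni A \<bullet>\<^sub>a Uni A) \<cdot> \<Delta>\<^sub>I" "Counit A \<cdot> Uni A = \<epsilon>\<^sub>I"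
  using assms by (auto simp: bimonoid_def)

lemma DeltaI_coassoc: "a\<^sub>b I I I \<cdot> (\<Delta>\<^sub>I \<bullet>\<^sub>a \<langle>I\<rangle>) \<cdot> \<Delta>\<^sub>I = (\<langle>I\<rangle> \<bullet>\<^sub>a \<Delta>\<^sub>I) \<cdot> \<Delta>\<^sub>I"
  and DeltaI_counit: "l\<^sub>b I \<cdot> (\<epsilon>\<^sub>I \<bullet>\<^sub>a \<langle>I\<rangle>) \<cdot> \<Delta>\<^sub>I = \<langle>I\<rangle>" "r\<^sub>b I \<cdot> (\<langle>I\<rangle> \<bullet>\<^sub>a \<epsilon>\<^sub>I) \<cdot> \<Delta>\<^sub>I = \<langle>I\<rangle>"
  using I_comonoid by (auto simp: comonoid_in_def)

text \<open>The counit law of \<open>I\<close>, after naturality of \<open>l\<^sub>b\<close> has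
  pulled one \<open>\<epsilon>\<^sub>I\<close> to the front. It yields the axiom on counit and unit
  for a tensor product and the axiom on comultiplication and unit for \<open>J\<close>.\<close>

lemma epsI_epsI: "l\<^sub>b J \<cdot> (\<epsilon>\<^sub>I \<bullet>\<^sub>a \<epsilon>\<^sub>I) \<cdot> \<Delta>\<^sub>I = \<epsilon>\<^sub>I"
proof -
  have "l\<^sub>b J \<cdot> (\<epsilon>\<^sub>I \<bullet>\<^sub>a \<epsilon>\<^sub>I) \<cdot> \<Delta>\<^sub>I = (l\<^sub>b J \<cdot> (\<langle>J\<rangle> \<bullet>\<^sub>a \<epsilon>\<^sub>I)) \<cdot> (\<epsilon>\<^sub>I \<bullet>\<^sub>a \<langle>I\<rangle>) \<cdot> \<Delta>\<^sub>I"
    by (simp add: merges)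
  also have "\<dots> = \<epsilon>\<^sub>I"
    by (simp add: bul.lunit_natural' merges DeltaI_counit)
  finally show ?thesis .
qed

text \<open>The left unit axiom of \<open>\<zeta>\<close> at \<open>J\<close> and \<open>J\<close>:
  it expresses that \<open>m\<^sub>J\<close> commutes with the identification of
  \<open>J \<bullet> J\<close> with \<open>J\<close>, and hence with
  \<open>\<Delta>\<^sub>J\<close>.\<close>

lemma lunit_mJ: "m\<^sub>J \<cdot> (l\<^sub>b J \<circle>\<^sub>a l\<^sub>b J) = l\<^sub>b J \<cdot> (m\<^sub>J \<bullet>\<^sub>a m\<^sub>J) \<cdot> \<zeta> J J J J"
proof -
  have "m\<^sub>J \<cdot> (l\<^sub>b J \<circle>\<^sub>a l\<^sub>b J) = (m\<^sub>J \<cdot> l\<^sub>b (J \<circle> J)) \<cdot> (m\<^sub>J \<bullet>\<^sub>a \<langle>J \<circle> J\<rangle>) \<cdot> \<zeta> J J J J"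
    by (simp add: zeta_bul_lunit merges)
  also have "m\<^sub>J \<cdot> l\<^sub>b (J \<circle> J) = l\<^sub>b J \<cdot> (\<langle>J\<rangle> \<bullet>\<^sub>a m\<^sub>J)"
    by (simp add: bul.lunit_natural')
  also have "(l\<^sub>b J \<cdot> (\<langle>J\<rangle> \<bullet>\<^sub>a m\<^sub>J)) \<cdot> (m\<^sub>J \<bullet>\<^sub>a \<langle>J \<circle> J\<rangle>) \<cdot> \<zeta> J J J J = l\<^sub>b J \<cdot> (m\<^sub>J \<bullet>\<^sub>a m\<^sub>J) \<cdot> \<zeta> J J J J"
    by (simp add: merges)
  finally show ?thesis .
qed

lemma unit_comonoid: "comonoid_in (Cat D) (Bul D) J \<Delta>\<^sub>J \<langle>J\<rangle>"
proof -
  \<comment> \<open>Both sides are built from constraints alone, so both words are empty.\<close>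
  have "bul.tm_ar (As Em Em Em \<oslash> LUI Em \<otimes>\<^sub>t IdT Em \<oslash> LUI Em) = bul.tm_ar (IdT Em \<otimes>\<^sub>t LUI Em \<oslash> LUI Em)"
    by (subst bul.tm_eq_iff_word_eq) (simp_all add: bul.word_eq_refl)
  then have "a\<^sub>b J J J \<cdot> (\<Delta>\<^sub>J \<bullet>\<^sub>a \<langle>J\<rangle>) \<cdot> \<Delta>\<^sub>J = (\<langle>J\<rangle> \<bullet>\<^sub>a \<Delta>\<^sub>J) \<cdot> \<Delta>\<^sub>J"
    by simp
  then show ?thesis
    by (simp add: comonoid_in_def circ.in_hom_iff bul.lunit_unit[symmetric])
qed

lemma bimonoid_unit: "bimonoid unit_bimonoid"
proof -
  have "(m\<^sub>J \<bullet>\<^sub>a m\<^sub>J) \<cdot> \<zeta> J J J J \<cdot> (\<Delta>\<^sub>J \<circle>\<^sub>a \<Delta>\<^sub>J) = \<Delta>\<^sub>J \<cdot> (l\<^sub>b J \<cdot> (m\<^sub>J \<bullet>\<^sub>a m\<^sub>J) \<cdot> \<zeta> J J J J) \<cdot> (\<Delta>\<^sub>J \<circle>\<^sub>a \<Delta>\<^sub>J)"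
    by (simp add: circ.comp_assoc')
  also have "\<dots> = \<Delta>\<^sub>J \<cdot> m\<^sub>J"
    unfolding lunit_mJ[symmetric] by (simp add: merges)
  finally have 1: "\<Delta>\<^sub>J \<cdot> m\<^sub>J = (m\<^sub>J \<bullet>\<^sub>a m\<^sub>J) \<cdot> \<zeta> J J J J \<cdot> (\<Delta>\<^sub>J \<circle>\<^sub>a \<Delta>\<^sub>J)"
    by simp
  have "\<Delta>\<^sub>J \<cdot> \<epsilon>\<^sub>I = \<Delta>\<^sub>J \<cdot> l\<^sub>b J \<cdot> (\<epsilon>\<^sub>I \<bullet>\<^sub>a \<epsilon>\<^sub>I) \<cdot> \<Delta>\<^sub>I"
    by (simp only: epsI_epsI)
  also have "\<dots> = (\<epsilon>\<^sub>I \<bullet>\<^sub>a \<epsilon>\<^sub>I) \<cdot> \<Delta>\<^sub>I"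
    by simp
  finally have 2: "\<Delta>\<^sub>J \<cdot> \<epsilon>\<^sub>I = (\<epsilon>\<^sub>I \<bullet>\<^sub>a \<epsilon>\<^sub>I) \<cdot> \<Delta>\<^sub>I" .
  show ?thesis
    using 1 2 J_monoid unit_comonoid by (simp add: bimonoid_def unit_bimonoid_def)
qed

lemma unit_bimonoid_simps [simp]:
  "Carrier unit_bimonoid = J" "Mult unit_bimonoid = m\<^sub>J" "Uni unit_bimonoid = \<epsilon>\<^sub>I"
  "Comult unit_bimonoid = \<Delta>\<^sub>J" "Counit unit_bimonoid = \<langle>J\<rangle>"
  by (simp_all add: unit_bimonoid_def)

lemma bimonoid_morphism_arr:
  "bimonoid_morphism A B f \<Longrightarrow> f \<in> Arr (Cat D) \<and> Dom (Cat D) f = Carrier A \<and> Cod (Cat D) f = Carrier B"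
  by (simp add: bimonoid_morphism_def circ.in_hom_iff)

lemma bimonoid_morphism_hom: "bimonoid_morphism A B f \<Longrightarrow> f \<in> hm (Carrier A) (Carrier B)"
  by (simp add: bimonoid_morphism_def)

lemma bimonoid_morphism_ident: "bimonoid A \<Longrightarrow> bimonoid_morphism A A \<langle>Carrier A\<rangle>"
  by (simp add: bimonoid_morphism_def circ.in_hom_iff)

lemma bimonoid_morphism_comp:
  assumes "bimonoid A" "bimonoid B" "bimonoid E" "bimonoid_morphism A B f" "bimonoid_morphism B E g"
  shows "bimonoid_morphism A E (g \<cdot> f)"
proof -
  note [simp] = assms(1-3)
  have [simp]: "f \<in> Arr (Cat D)" "Dom (Cat D) f = Carrier A" "Cod (Cat D) f = Carrier B"
    "g \<in> Arr (Cat D)" "Dom (Cat D) g = Carrier B" "Cod (Cat D) g = Carrier E"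
    using assms bimonoid_morphism_arr by auto
  have F: "f \<cdot> Mult A = Mult B \<cdot> (f \<circle>\<^sub>a f)" "f \<cdot> Uni A = Uni B" "Comult B \<cdot> f = (f \<bullet>\<^sub>a f) \<cdot> Comult A" "Counit B \<cdot> f = Counit A"
    and G: "g \<cdot> Mult B = Mult E \<cdot> (g \<circle>\<^sub>a g)" "g \<cdot> Uni B = Uni E" "Comult E \<cdot> g = (g \<bullet>\<^sub>a g) \<cdot> Comult B" "Counit E \<cdot> g = Counit B"
    using assms by (auto simp: bimonoid_morphism_def)
  have "(g \<cdot> f) \<cdot> Mult A = (g \<cdot> Mult B) \<cdot> (f \<circle>\<^sub>a f)"
    by (simp add: circ.comp_assoc' F)
  also have "\<dots> = Mult E \<cdot> ((g \<cdot> f) \<circle>\<^sub>a (g \<cdot> f))"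
    by (simp add: G merges)
  finally have 1: "(g \<cdot> f) \<cdot> Mult A = Mult E \<cdot> ((g \<cdot> f) \<circle>\<^sub>a (g \<cdot> f))" .
  have "Comult E \<cdot> g \<cdot> f = (Comult E \<cdot> g) \<cdot> f"
    by (simp add: circ.comp_assoc')
  also have "\<dots> = (g \<bullet>\<^sub>a g) \<cdot> Comult B \<cdot> f"
    by (simp add: G circ.comp_assoc')
  also have "\<dots> = ((g \<cdot> f) \<bullet>\<^sub>a (g \<cdot> f)) \<cdot> Comult A"
    by (simp add: F merges)
  finally have 2: "Comult E \<cdot> g \<cdot> f = ((g \<cdot> f) \<bullet>\<^sub>a (g \<cdot> f)) \<cdot> Comult A" .
  have "Counit E \<cdot> g \<cdot> f = (Counit E \<cdot> g) \<cdot> f"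
    by (simp add: circ.comp_assoc')
  also have "\<dots> = Counit A"
    by (simp add: F G)
  finally have 3: "Counit E \<cdot> g \<cdot> f = Counit A" .
  show ?thesis
    using 1 2 3 by (simp add: bimonoid_morphism_def circ.in_hom_iff circ.comp_assoc' F G)
qed

lemma bimonoid_morphism_inv:
  assumes "bimonoid A" "bimonoid B" "bimonoid_morphism A B f" "iso_arrow (Cat D) f"
  shows "bimonoid_morphism B A (inv\<^sub>a f)"
proof -
  note [simp] = assms(1,2,4)
  have [simp]: "f \<in> Arr (Cat D)" "Dom (Cat D) f = Carrier A" "Cod (Cat D) f = Carrier B"
    using assms bimonoid_morphism_arr by auto
  have F: "f \<cdot> Mult A = Mult B \<cdot> (f \<circle>\<^sub>a f)" "f \<cdot> Uni A = Uni B" "Comult B \<cdot> f = (f \<bullet>\<^sub>a f) \<cdot> Comult A" "Counit B \<cdot> f = Counit A"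
    using assms by (auto simp: bimonoid_morphism_def)
  have 1: "inv\<^sub>a f \<cdot> Mult B = Mult A \<cdot> inv\<^sub>a (f \<circle>\<^sub>a f)"
    by (rule circ.inv_natural) (simp_all add: F)
  have 2: "inv\<^sub>a (f \<bullet>\<^sub>a f) \<cdot> Comult B = Comult A \<cdot> inv\<^sub>a f"
    by (rule circ.inv_natural) (simp_all add: F)
  have 3: "inv\<^sub>a f \<cdot> Uni B = Uni A"
    unfolding F(2)[symmetric] by simp
  have 4: "Counit A \<cdot> inv\<^sub>a f = Counit B"
    unfolding F(4)[symmetric] by (simp add: circ.comp_assoc')
  show ?thesis
    using 1 2 3 4 by (simp add: bimonoid_morphism_def circ.in_hom_iff bul.inv_tensor circ.inv_tensor)
qed

lemma hom_bimonoid_category: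
  "hom bimonoid_category A B = {(A, f, B) |f. bimonoid A \<and> bimonoid B \<and> bimonoid_morphism A B f}"
  by (auto simp: hom_def bimonoid_category_def)

lemma bimonoid_category_simps [simp]:
  "Ob bimonoid_category = {A. bimonoid A}"
  "Dom bimonoid_category (A, f, B) = A" "Cod bimonoid_category (A, f, B) = B"
  "Ident bimonoid_category A = (A, \<langle>Carrier A\<rangle>, A)"
  "Comp bimonoid_category (B', g, E) (A, f, B) = (A, g \<cdot> f, E)"
  by (simp_all add: bimonoid_category_def)

lemma Arr_bimonoid_category:
  "Arr bimonoid_category = {(A, f, B). bimonoid A \<and> bimonoid B \<and> bimonoid_morphism A B f}"
  by (simp add: bimonoid_category_def)

sublocale bimonoids: category bimonoid_category
proof
  show "Ident bimonoid_category X \<in> hom bimonoid_category X X" if "X \<in> Ob bimonoid_category" for X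
    using that bimonoid_morphism_ident by (auto simp: hom_bimonoid_category Arr_bimonoid_category)
  show "Comp bimonoid_category g f \<in> hom bimonoid_category X Z"
    if "f \<in> hom bimonoid_category X Y" "g \<in> hom bimonoid_category Y Z" for X Y Z f g
    using that bimonoid_morphism_comp by (auto simp: hom_bimonoid_category Arr_bimonoid_category)
  show "Comp bimonoid_category (Comp bimonoid_category h g) f = Comp bimonoid_category h (Comp bimonoid_category g f)"
    if "f \<in> hom bimonoid_category X Y" "g \<in> hom bimonoid_category Y Z" "h \<in> hom bimonoid_category Z W" for X Y Z W f g h
    using that bimonoid_morphism_arr by (auto simp: hom_bimonoid_category Arr_bimonoid_category intro!: circ.comp_assoc')
qed (auto simp: hom_bimonoid_category Arr_bimonoid_category dest: bimonoid_morphism_arr)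

text \<open>The forgetful functor reflects isomorphisms, because an inverse of a bimonoid morphism
  is one again; so the constraints of \<open>\<bullet>\<close> stay invertible among
  bimonoids.\<close>

lemma iso_arrow_bimonoid_category:
  assumes "bimonoid A" "bimonoid B" "bimonoid_morphism A B f" "iso_arrow (Cat D) f"
  shows "iso_arrow bimonoid_category (A, f, B)"
proof -
  have "inverse_arrows bimonoid_category (A, f, B) (B, inv\<^sub>a f, A)"
    using assms bimonoid_morphism_inv[OF assms] bimonoid_morphism_arr[OF assms(3)]
    by (auto simp: inverse_arrows_def hom_bimonoid_category Arr_bimonoid_category)
  then show ?thesis
    by (auto simp: iso_arrow_def)
qed

end

section \<open>Tensor products of bimonoids and their coherence constraints\<close>

context bullet_braided_duoidal_category
begin

lemma Comult_bimonoid_tensor [simp]: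
  assumes "bimonoid A" "bimonoid B"
  shows "Comult (bimonoid_tensor A B)
    = bul.mid (Carrier A) (Carrier A) (Carrier B) (Carrier B) \<cdot> (Comult A \<bullet>\<^sub>a Comult B)"
  using assms by (simp add: bimonoid_tensor_def Let_def bul.mid_def circ.comp_assoc')

text \<open>Coassociativity rewrites the fourfold comultiplication of \<open>I\<close> so that the
  two middle factors come out of a single \<open>\<Delta>\<^sub>I\<close>; there
  \<open>braiding_DeltaI\<close> absorbs the crossing.\<close>

lemma mid_DeltaI: "bul.mid I I I I \<cdot> (\<Delta>\<^sub>I \<bullet>\<^sub>a \<Delta>\<^sub>I) \<cdot> \<Delta>\<^sub>I = (\<Delta>\<^sub>I \<bullet>\<^sub>a \<Delta>\<^sub>I) \<cdot> \<Delta>\<^sub>I"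
proof -
  let ?d = "(\<langle>I\<rangle> \<bullet>\<^sub>a ((\<Delta>\<^sub>I \<bullet>\<^sub>a \<langle>I\<rangle>) \<cdot> \<Delta>\<^sub>I)) \<cdot> \<Delta>\<^sub>I"
  have "a\<^sub>b I I (I \<bullet> I) \<cdot> (\<Delta>\<^sub>I \<bullet>\<^sub>a \<Delta>\<^sub>I) \<cdot> \<Delta>\<^sub>I = (a\<^sub>b I I (I \<bullet> I) \<cdot> ((\<langle>I\<rangle> \<bullet>\<^sub>a \<langle>I\<rangle>) \<bullet>\<^sub>a \<Delta>\<^sub>I)) \<cdot> (\<Delta>\<^sub>I \<bullet>\<^sub>a \<langle>I\<rangle>) \<cdot> \<Delta>\<^sub>I"
    by (simp add: merges)
  also have "\<dots> = (\<langle>I\<rangle> \<bullet>\<^sub>a (\<langle>I\<rangle> \<bullet>\<^sub>a \<Delta>\<^sub>I)) \<cdot> a\<^sub>b I I I \<cdot> (\<Delta>\<^sub>I \<bullet>\<^sub>a \<langle>I\<rangle>) \<cdot> \<Delta>\<^sub>I"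
    by (subst bul.assoc_natural') (simp_all add: merges)
  also have "\<dots> = (\<langle>I\<rangle> \<bullet>\<^sub>a ((\<langle>I\<rangle> \<bullet>\<^sub>a \<Delta>\<^sub>I) \<cdot> \<Delta>\<^sub>I)) \<cdot> \<Delta>\<^sub>I"
    by (simp add: DeltaI_coassoc merges)
  also have "\<dots> = (\<langle>I\<rangle> \<bullet>\<^sub>a a\<^sub>b I I I) \<cdot> ?d"
    by (simp add: DeltaI_coassoc[symmetric] merges)
  finally have 1: "a\<^sub>b I I (I \<bullet> I) \<cdot> (\<Delta>\<^sub>I \<bullet>\<^sub>a \<Delta>\<^sub>I) \<cdot> \<Delta>\<^sub>I = (\<langle>I\<rangle> \<bullet>\<^sub>a a\<^sub>b I I I) \<cdot> ?d" .
  have "bul.mid I I I I \<cdot> (\<Delta>\<^sub>I \<bullet>\<^sub>a \<Delta>\<^sub>I) \<cdot> \<Delta>\<^sub>I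
    = inv\<^sub>a (a\<^sub>b I I (I \<bullet> I)) \<cdot> (\<langle>I\<rangle> \<bullet>\<^sub>a a\<^sub>b I I I) \<cdot> (\<langle>I\<rangle> \<bullet>\<^sub>a (\<sigma> I I \<bullet>\<^sub>a \<langle>I\<rangle>)) \<cdot> (\<langle>I\<rangle> \<bullet>\<^sub>a inv\<^sub>a (a\<^sub>b I I I))
      \<cdot> a\<^sub>b I I (I \<bullet> I) \<cdot> (\<Delta>\<^sub>I \<bullet>\<^sub>a \<Delta>\<^sub>I) \<cdot> \<Delta>\<^sub>I"
    by (simp add: bul.mid_def circ.comp_assoc')
  also have "\<dots> = inv\<^sub>a (a\<^sub>b I I (I \<bullet> I)) \<cdot> (\<langle>I\<rangle> \<bullet>\<^sub>a a\<^sub>b I I I) \<cdot> ?d"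
    unfolding 1 by (simp add: merges braiding_DeltaI)
  also have "\<dots> = (\<Delta>\<^sub>I \<bullet>\<^sub>a \<Delta>\<^sub>I) \<cdot> \<Delta>\<^sub>I"
    unfolding 1[symmetric] by simp
  finally show ?thesis .
qed

text \<open>The four compatibilities reduce to the structural parts: \<open>zeta_mid\<close> for
  multiplication and comultiplication, \<open>lunit_mJ\<close> for multiplication and counit,
  \<open>mid_DeltaI\<close> for unit and comultiplication, \<open>epsI_epsI\<close> for unit and
  counit.\<close>

lemma bimonoid_tensor_bimonoid:
  assumes [simp]: "bimonoid A" "bimonoid B"
  shows "bimonoid (bimonoid_tensor A B)"
proof -
  let ?A = "Carrier A" and ?B = "Carrier B"
  let ?AB = "?A \<bullet> ?B" and ?P = "bimonoid_tensor A B"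
  note A = bimonoid_compat[OF assms(1)] and B = bimonoid_compat[OF assms(2)]
  let ?\<zeta>\<zeta> = "\<zeta> ?A ?A ?A ?A \<bullet>\<^sub>a \<zeta> ?B ?B ?B ?B" and ?mid = "bul.mid ?A ?A ?B ?B"
  have "Comult ?P \<cdot> Mult ?P = ?mid \<cdot> ((Comult A \<cdot> Mult A) \<bullet>\<^sub>a (Comult B \<cdot> Mult B)) \<cdot> \<zeta> ?A ?B ?A ?B"
    by (simp add: merges)
  also have "\<dots> = (?mid \<cdot> ((Mult A \<bullet>\<^sub>a Mult A) \<bullet>\<^sub>a (Mult B \<bullet>\<^sub>a Mult B))) \<cdot> ?\<zeta>\<zeta>
      \<cdot> ((Comult A \<circle>\<^sub>a Comult A) \<bullet>\<^sub>a (Comult B \<circle>\<^sub>a Comult B)) \<cdot> \<zeta> ?A ?B ?A ?B"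
    unfolding A B by (simp add: merges)
  also have "((Comult A \<circle>\<^sub>a Comult A) \<bullet>\<^sub>a (Comult B \<circle>\<^sub>a Comult B)) \<cdot> \<zeta> ?A ?B ?A ?B
    = \<zeta> (?A \<bullet> ?A) (?B \<bullet> ?B) (?A \<bullet> ?A) (?B \<bullet> ?B) \<cdot> ((Comult A \<bullet>\<^sub>a Comult B) \<circle>\<^sub>a (Comult A \<bullet>\<^sub>a Comult B))"
    by (subst zeta_natural') simp_all
  also have "?mid \<cdot> ((Mult A \<bullet>\<^sub>a Mult A) \<bullet>\<^sub>a (Mult B \<bullet>\<^sub>a Mult B))
    = ((Mult A \<bullet>\<^sub>a Mult B) \<bullet>\<^sub>a (Mult A \<bullet>\<^sub>a Mult B)) \<cdot> bul.mid (?A \<circle> ?A) (?A \<circle> ?A) (?B \<circle> ?B) (?B \<circle> ?B)"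
    by (subst bul.mid_natural) simp_all
  also have "(((Mult A \<bullet>\<^sub>a Mult B) \<bullet>\<^sub>a (Mult A \<bullet>\<^sub>a Mult B)) \<cdot> bul.mid (?A \<circle> ?A) (?A \<circle> ?A) (?B \<circle> ?B) (?B \<circle> ?B))
      \<cdot> ?\<zeta>\<zeta> \<cdot> \<zeta> (?A \<bullet> ?A) (?B \<bullet> ?B) (?A \<bullet> ?A) (?B \<bullet> ?B) \<cdot> ((Comult A \<bullet>\<^sub>a Comult B) \<circle>\<^sub>a (Comult A \<bullet>\<^sub>a Comult B))
    = ((Mult A \<bullet>\<^sub>a Mult B) \<bullet>\<^sub>a (Mult A \<bullet>\<^sub>a Mult B))
      \<cdot> (bul.mid (?A \<circle> ?A) (?A \<circle> ?A) (?B \<circle> ?B) (?B \<circle> ?B) \<cdot> ?\<zeta>\<zeta> \<cdot> \<zeta> (?A \<bullet> ?A) (?B \<bullet> ?B) (?A \<bullet> ?A) (?B \<bullet> ?B))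
      \<cdot> ((Comult A \<bullet>\<^sub>a Comult B) \<circle>\<^sub>a (Comult A \<bullet>\<^sub>a Comult B))"
    by (simp add: circ.comp_assoc')
  also have "\<dots> = ((Mult A \<bullet>\<^sub>a Mult B) \<bullet>\<^sub>a (Mult A \<bullet>\<^sub>a Mult B))
      \<cdot> (((\<zeta> ?A ?B ?A ?B \<bullet>\<^sub>a \<zeta> ?A ?B ?A ?B) \<cdot> \<zeta> ?AB ?AB ?AB ?AB) \<cdot> (?mid \<circle>\<^sub>a ?mid))
      \<cdot> ((Comult A \<bullet>\<^sub>a Comult B) \<circle>\<^sub>a (Comult A \<bullet>\<^sub>a Comult B))"
    by (subst zeta_mid) simp_all
  also have "\<dots> = (Mult ?P \<bullet>\<^sub>a Mult ?P) \<cdot> \<zeta> ?AB ?AB ?AB ?AB \<cdot> (Comult ?P \<circle>\<^sub>a Comult ?P)"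
    by (simp add: merges)
  finally have 1: "Comult ?P \<cdot> Mult ?P = (Mult ?P \<bullet>\<^sub>a Mult ?P) \<cdot> \<zeta> ?AB ?AB ?AB ?AB \<cdot> (Comult ?P \<circle>\<^sub>a Comult ?P)" .
  have "Counit ?P \<cdot> Mult ?P = l\<^sub>b J \<cdot> ((Counit A \<cdot> Mult A) \<bullet>\<^sub>a (Counit B \<cdot> Mult B)) \<cdot> \<zeta> ?A ?B ?A ?B"
    by (simp add: merges)
  also have "\<dots> = l\<^sub>b J \<cdot> (m\<^sub>J \<bullet>\<^sub>a m\<^sub>J) \<cdot> (((Counit A \<circle>\<^sub>a Counit A) \<bullet>\<^sub>a (Counit B \<circle>\<^sub>a Counit B)) \<cdot> \<zeta> ?A ?B ?A ?B)"
    unfolding A B by (simp add: merges)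
  also have "\<dots> = l\<^sub>b J \<cdot> (m\<^sub>J \<bullet>\<^sub>a m\<^sub>J) \<cdot> \<zeta> J J J J \<cdot> ((Counit A \<bullet>\<^sub>a Counit B) \<circle>\<^sub>a (Counit A \<bullet>\<^sub>a Counit B))"
    by (subst zeta_natural') simp_all
  also have "\<dots> = (m\<^sub>J \<cdot> (l\<^sub>b J \<circle>\<^sub>a l\<^sub>b J)) \<cdot> ((Counit A \<bullet>\<^sub>a Counit B) \<circle>\<^sub>a (Counit A \<bullet>\<^sub>a Counit B))"
    unfolding lunit_mJ by (simp add: circ.comp_assoc')
  also have "\<dots> = m\<^sub>J \<cdot> (Counit ?P \<circle>\<^sub>a Counit ?P)"
    by (simp add: merges)
  finally have 2: "Counit ?P \<cdot> Mult ?P = m\<^sub>J \<cdot> (Counit ?P \<circle>\<^sub>a Counit ?P)" .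
  have "Comult ?P \<cdot> Uni ?P = ?mid \<cdot> ((Comult A \<cdot> Uni A) \<bullet>\<^sub>a (Comult B \<cdot> Uni B)) \<cdot> \<Delta>\<^sub>I"
    by (simp add: merges)
  also have "\<dots> = (?mid \<cdot> ((Uni A \<bullet>\<^sub>a Uni A) \<bullet>\<^sub>a (Uni B \<bullet>\<^sub>a Uni B))) \<cdot> (\<Delta>\<^sub>I \<bullet>\<^sub>a \<Delta>\<^sub>I) \<cdot> \<Delta>\<^sub>I"
    unfolding A B by (simp add: merges)
  also have "\<dots> = ((Uni A \<bullet>\<^sub>a Uni B) \<bullet>\<^sub>a (Uni A \<bullet>\<^sub>a Uni B)) \<cdot> bul.mid I I I I \<cdot> (\<Delta>\<^sub>I \<bullet>\<^sub>a \<Delta>\<^sub>I) \<cdot> \<Delta>\<^sub>I"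
    by (subst bul.mid_natural) (simp_all add: circ.comp_assoc')
  also have "\<dots> = (Uni ?P \<bullet>\<^sub>a Uni ?P) \<cdot> \<Delta>\<^sub>I"
    unfolding mid_DeltaI by (simp add: merges)
  finally have 3: "Comult ?P \<cdot> Uni ?P = (Uni ?P \<bullet>\<^sub>a Uni ?P) \<cdot> \<Delta>\<^sub>I" .
  have "Counit ?P \<cdot> Uni ?P = l\<^sub>b J \<cdot> ((Counit A \<cdot> Uni A) \<bullet>\<^sub>a (Counit B \<cdot> Uni B)) \<cdot> \<Delta>\<^sub>I"
    by (simp add: merges)
  also have "\<dots> = \<epsilon>\<^sub>I"
    unfolding A B by (rule epsI_epsI)
  finally have 4: "Counit ?P \<cdot> Uni ?P = \<epsilon>\<^sub>I" .
  have "monoid_in (Cat D) (Circ D) ?AB (Mult ?P) (Uni ?P)"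
    using assms by (simp add: bimonoid_def monoid_tensor)
  moreover have "comonoid_in (Cat D) (Bul D) ?AB (Comult ?P) (Counit ?P)"
    using assms by (simp only: bimonoid_tensor_simps Comult_bimonoid_tensor) (simp add: bimonoid_def bul.comonoid_tensor)
  ultimately show ?thesis
    using 1 2 3 4 by (simp add: bimonoid_def)
qed

lemma bimonoid_morphism_tensor:
  assumes "bimonoid A" "bimonoid A'" "bimonoid B" "bimonoid B'"
    and f: "bimonoid_morphism A A' f" and g: "bimonoid_morphism B B' g"
  shows "bimonoid_morphism (bimonoid_tensor A B) (bimonoid_tensor A' B') (f \<bullet>\<^sub>a g)"
proof -
  note [simp] = assms(1-4)
  let ?A = "Carrier A" and ?A' = "Carrier A'" and ?B = "Carrier B" and ?B' = "Carrier B'"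
  have [simp]: "f \<in> Arr (Cat D)" "Dom (Cat D) f = ?A" "Cod (Cat D) f = ?A'"
    "g \<in> Arr (Cat D)" "Dom (Cat D) g = ?B" "Cod (Cat D) g = ?B'"
    using f g bimonoid_morphism_arr by auto
  have F: "f \<cdot> Mult A = Mult A' \<cdot> (f \<circle>\<^sub>a f)" "f \<cdot> Uni A = Uni A'" "Comult A' \<cdot> f = (f \<bullet>\<^sub>a f) \<cdot> Comult A" "Counit A' \<cdot> f = Counit A"
    and G: "g \<cdot> Mult B = Mult B' \<cdot> (g \<circle>\<^sub>a g)" "g \<cdot> Uni B = Uni B'" "Comult B' \<cdot> g = (g \<bullet>\<^sub>a g) \<cdot> Comult B" "Counit B' \<cdot> g = Counit B"
    using f g by (auto simp: bimonoid_morphism_def)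
  have 1: "(f \<bullet>\<^sub>a g) \<cdot> (Mult A \<bullet>\<^sub>a Mult B) \<cdot> \<zeta> ?A ?B ?A ?B
      = ((Mult A' \<bullet>\<^sub>a Mult B') \<cdot> \<zeta> ?A' ?B' ?A' ?B') \<cdot> ((f \<bullet>\<^sub>a g) \<circle>\<^sub>a (f \<bullet>\<^sub>a g))"
    by (simp add: merges zeta_natural' F G)
  have 2: "(bul.mid ?A' ?A' ?B' ?B' \<cdot> (Comult A' \<bullet>\<^sub>a Comult B')) \<cdot> (f \<bullet>\<^sub>a g)
      = ((f \<bullet>\<^sub>a g) \<bullet>\<^sub>a (f \<bullet>\<^sub>a g)) \<cdot> bul.mid ?A ?A ?B ?B \<cdot> (Comult A \<bullet>\<^sub>a Comult B)"
  proof -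
    have "(bul.mid ?A' ?A' ?B' ?B' \<cdot> (Comult A' \<bullet>\<^sub>a Comult B')) \<cdot> (f \<bullet>\<^sub>a g)
      = (bul.mid ?A' ?A' ?B' ?B' \<cdot> ((f \<bullet>\<^sub>a f) \<bullet>\<^sub>a (g \<bullet>\<^sub>a g))) \<cdot> (Comult A \<bullet>\<^sub>a Comult B)"
      by (simp add: merges F G)
    also have "\<dots> = ((f \<bullet>\<^sub>a g) \<bullet>\<^sub>a (f \<bullet>\<^sub>a g)) \<cdot> bul.mid ?A ?A ?B ?B \<cdot> (Comult A \<bullet>\<^sub>a Comult B)"
      by (subst bul.mid_natural) (simp_all add: circ.comp_assoc')
    finally show ?thesis .
  qed
  show ?thesis
    using 1 2 by (simp add: bimonoid_morphism_def circ.in_hom_iff merges F G)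
qed

text \<open>Besides naturality of the associator, each of the four conditions uses one coherence
  law: \<open>zeta_bul_assoc\<close> for the multiplication, coassociativity of
  \<open>\<Delta>\<^sub>I\<close> for the unit, \<open>mid_tensor_assoc\<close> for the
  comultiplication, the triangle for the counit.\<close>

lemma assoc_bimonoid_morphism:
  assumes [simp]: "bimonoid A" "bimonoid B" "bimonoid E"
  shows "bimonoid_morphism (bimonoid_tensor (bimonoid_tensor A B) E) (bimonoid_tensor A (bimonoid_tensor B E))
    (a\<^sub>b (Carrier A) (Carrier B) (Carrier E))"
proof -
  let ?A = "Carrier A" and ?B = "Carrier B" and ?E = "Carrier E"
  let ?a = "a\<^sub>b ?A ?B ?E"
  note [simp] = bimonoid_tensor_bimonoid
  have "?a \<cdot> (((Mult A \<bullet>\<^sub>a Mult B) \<cdot> \<zeta> ?A ?B ?A ?B) \<bullet>\<^sub>a Mult E) \<cdot> \<zeta> (?A \<bullet> ?B) ?E (?A \<bullet> ?B) ?E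
    = (?a \<cdot> ((Mult A \<bullet>\<^sub>a Mult B) \<bullet>\<^sub>a Mult E)) \<cdot> (\<zeta> ?A ?B ?A ?B \<bullet>\<^sub>a \<langle>?E \<circle> ?E\<rangle>) \<cdot> \<zeta> (?A \<bullet> ?B) ?E (?A \<bullet> ?B) ?E"
    by (simp add: merges)
  also have "\<dots> = (Mult A \<bullet>\<^sub>a (Mult B \<bullet>\<^sub>a Mult E)) \<cdot> a\<^sub>b (?A \<circle> ?A) (?B \<circle> ?B) (?E \<circle> ?E) \<cdot> (\<zeta> ?A ?B ?A ?B \<bullet>\<^sub>a \<langle>?E \<circle> ?E\<rangle>) \<cdot> \<zeta> (?A \<bullet> ?B) ?E (?A \<bullet> ?B) ?E"
    by (subst bul.assoc_natural') (simp_all add: circ.comp_assoc')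
  also have "\<dots> = (Mult A \<bullet>\<^sub>a (Mult B \<bullet>\<^sub>a Mult E)) \<cdot> (\<langle>?A \<circle> ?A\<rangle> \<bullet>\<^sub>a \<zeta> ?B ?E ?B ?E) \<cdot> \<zeta> ?A (?B \<bullet> ?E) ?A (?B \<bullet> ?E) \<cdot> (?a \<circle>\<^sub>a ?a)"
    by (subst zeta_bul_assoc[symmetric]) simp_all
  finally have 1: "?a \<cdot> (((Mult A \<bullet>\<^sub>a Mult B) \<cdot> \<zeta> ?A ?B ?A ?B) \<bullet>\<^sub>a Mult E) \<cdot> \<zeta> (?A \<bullet> ?B) ?E (?A \<bullet> ?B) ?E
    = ((Mult A \<bullet>\<^sub>a ((Mult B \<bullet>\<^sub>a Mult E) \<cdot> \<zeta> ?B ?E ?B ?E)) \<cdot> \<zeta> ?A (?B \<bullet> ?E) ?A (?B \<bullet> ?E)) \<cdot> (?a \<circle>\<^sub>a ?a)"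
    by (simp add: merges)
  have "?a \<cdot> (((Uni A \<bullet>\<^sub>a Uni B) \<cdot> \<Delta>\<^sub>I) \<bullet>\<^sub>a Uni E) \<cdot> \<Delta>\<^sub>I = (?a \<cdot> ((Uni A \<bullet>\<^sub>a Uni B) \<bullet>\<^sub>a Uni E)) \<cdot> (\<Delta>\<^sub>I \<bullet>\<^sub>a \<langle>I\<rangle>) \<cdot> \<Delta>\<^sub>I"
    by (simp add: merges)
  also have "\<dots> = (Uni A \<bullet>\<^sub>a (Uni B \<bullet>\<^sub>a Uni E)) \<cdot> a\<^sub>b I I I \<cdot> (\<Delta>\<^sub>I \<bullet>\<^sub>a \<langle>I\<rangle>) \<cdot> \<Delta>\<^sub>I"
    by (subst bul.assoc_natural') (simp_all add: circ.comp_assoc')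
  also have "\<dots> = (Uni A \<bullet>\<^sub>a ((Uni B \<bullet>\<^sub>a Uni E) \<cdot> \<Delta>\<^sub>I)) \<cdot> \<Delta>\<^sub>I"
    by (simp add: DeltaI_coassoc merges)
  finally have 2: "?a \<cdot> (((Uni A \<bullet>\<^sub>a Uni B) \<cdot> \<Delta>\<^sub>I) \<bullet>\<^sub>a Uni E) \<cdot> \<Delta>\<^sub>I = (Uni A \<bullet>\<^sub>a ((Uni B \<bullet>\<^sub>a Uni E) \<cdot> \<Delta>\<^sub>I)) \<cdot> \<Delta>\<^sub>I" .
  have "(bul.mid ?A ?A (?B \<bullet> ?E) (?B \<bullet> ?E) \<cdot> (Comult A \<bullet>\<^sub>a (bul.mid ?B ?B ?E ?E \<cdot> (Comult B \<bullet>\<^sub>a Comult E)))) \<cdot> ?a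
    = bul.mid ?A ?A (?B \<bullet> ?E) (?B \<bullet> ?E) \<cdot> (\<langle>?A \<bullet> ?A\<rangle> \<bullet>\<^sub>a bul.mid ?B ?B ?E ?E) \<cdot> ((Comult A \<bullet>\<^sub>a (Comult B \<bullet>\<^sub>a Comult E)) \<cdot> ?a)"
    by (simp add: merges)
  also have "(Comult A \<bullet>\<^sub>a (Comult B \<bullet>\<^sub>a Comult E)) \<cdot> ?a = a\<^sub>b (?A \<bullet> ?A) (?B \<bullet> ?B) (?E \<bullet> ?E) \<cdot> ((Comult A \<bullet>\<^sub>a Comult B) \<bullet>\<^sub>a Comult E)"
    by (subst bul.assoc_natural') simp_all
  also have "bul.mid ?A ?A (?B \<bullet> ?E) (?B \<bullet> ?E) \<cdot> (\<langle>?A \<bullet> ?A\<rangle> \<bullet>\<^sub>a bul.mid ?B ?B ?E ?E) \<cdot> (a\<^sub>b (?A \<bullet> ?A) (?B \<bullet> ?B) (?E \<bullet> ?E) \<cdot> ((Comult A \<bullet>\<^sub>a Comult B) \<bullet>\<^sub>a Comult E))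
    = (bul.mid ?A ?A (?B \<bullet> ?E) (?B \<bullet> ?E) \<cdot> (\<langle>?A \<bullet> ?A\<rangle> \<bullet>\<^sub>a bul.mid ?B ?B ?E ?E) \<cdot> a\<^sub>b (?A \<bullet> ?A) (?B \<bullet> ?B) (?E \<bullet> ?E)) \<cdot> ((Comult A \<bullet>\<^sub>a Comult B) \<bullet>\<^sub>a Comult E)"
    by (simp add: circ.comp_assoc')
  also have "\<dots> = (?a \<bullet>\<^sub>a ?a) \<cdot> bul.mid (?A \<bullet> ?B) (?A \<bullet> ?B) ?E ?E \<cdot> ((bul.mid ?A ?A ?B ?B \<cdot> (Comult A \<bullet>\<^sub>a Comult B)) \<bullet>\<^sub>a Comult E)"
    by (subst bul.mid_tensor_assoc) (simp_all add: merges)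
  finally have 3: "(bul.mid ?A ?A (?B \<bullet> ?E) (?B \<bullet> ?E) \<cdot> (Comult A \<bullet>\<^sub>a (bul.mid ?B ?B ?E ?E \<cdot> (Comult B \<bullet>\<^sub>a Comult E)))) \<cdot> ?a
    = (?a \<bullet>\<^sub>a ?a) \<cdot> bul.mid (?A \<bullet> ?B) (?A \<bullet> ?B) ?E ?E \<cdot> ((bul.mid ?A ?A ?B ?B \<cdot> (Comult A \<bullet>\<^sub>a Comult B)) \<bullet>\<^sub>a Comult E)" .
  have "(l\<^sub>b J \<cdot> (Counit A \<bullet>\<^sub>a (l\<^sub>b J \<cdot> (Counit B \<bullet>\<^sub>a Counit E)))) \<cdot> ?a
    = l\<^sub>b J \<cdot> (\<langle>J\<rangle> \<bullet>\<^sub>a l\<^sub>b J) \<cdot> ((Counit A \<bullet>\<^sub>a (Counit B \<bullet>\<^sub>a Counit E)) \<cdot> ?a)"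
    by (simp add: merges)
  also have "(Counit A \<bullet>\<^sub>a (Counit B \<bullet>\<^sub>a Counit E)) \<cdot> ?a = a\<^sub>b J J J \<cdot> ((Counit A \<bullet>\<^sub>a Counit B) \<bullet>\<^sub>a Counit E)"
    by (subst bul.assoc_natural') simp_all
  also have "l\<^sub>b J \<cdot> (\<langle>J\<rangle> \<bullet>\<^sub>a l\<^sub>b J) \<cdot> (a\<^sub>b J J J \<cdot> ((Counit A \<bullet>\<^sub>a Counit B) \<bullet>\<^sub>a Counit E))
    = l\<^sub>b J \<cdot> ((\<langle>J\<rangle> \<bullet>\<^sub>a l\<^sub>b J) \<cdot> a\<^sub>b J J J) \<cdot> ((Counit A \<bullet>\<^sub>a Counit B) \<bullet>\<^sub>a Counit E)"
    by (simp add: circ.comp_assoc')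
  also have "\<dots> = l\<^sub>b J \<cdot> ((l\<^sub>b J \<cdot> (Counit A \<bullet>\<^sub>a Counit B)) \<bullet>\<^sub>a Counit E)"
    using bul.triangle[of J J] by (simp add: bul.lunit_unit[symmetric] merges)
  finally have 4: "(l\<^sub>b J \<cdot> (Counit A \<bullet>\<^sub>a (l\<^sub>b J \<cdot> (Counit B \<bullet>\<^sub>a Counit E)))) \<cdot> ?a
    = l\<^sub>b J \<cdot> ((l\<^sub>b J \<cdot> (Counit A \<bullet>\<^sub>a Counit B)) \<bullet>\<^sub>a Counit E)" .
  show ?thesis
    using 1 2 3 4 by (simp add: bimonoid_morphism_def circ.in_hom_iff)
qed

text \<open>The coherence laws here are \<open>zeta_bul_lunit\<close> for the multiplication, the
  counit law of \<open>I\<close> for the unit and \<open>mid_units\<close> for the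
  comultiplication.\<close>

lemma lunit_bimonoid_morphism:
  assumes [simp]: "bimonoid A"
  shows "bimonoid_morphism (bimonoid_tensor unit_bimonoid A) A (l\<^sub>b (Carrier A))"
proof -
  let ?A = "Carrier A"
  note [simp] = bimonoid_unit
  have "l\<^sub>b ?A \<cdot> (m\<^sub>J \<bullet>\<^sub>a Mult A) \<cdot> \<zeta> J ?A J ?A = (l\<^sub>b ?A \<cdot> (\<langle>J\<rangle> \<bullet>\<^sub>a Mult A)) \<cdot> (m\<^sub>J \<bullet>\<^sub>a \<langle>?A \<circle> ?A\<rangle>) \<cdot> \<zeta> J ?A J ?A"
    by (simp add: merges)
  also have "\<dots> = Mult A \<cdot> l\<^sub>b (?A \<circle> ?A) \<cdot> (m\<^sub>J \<bullet>\<^sub>a \<langle>?A \<circle> ?A\<rangle>) \<cdot> \<zeta> J ?A J ?A"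
    by (simp add: bul.lunit_natural' circ.comp_assoc')
  also have "\<dots> = Mult A \<cdot> (l\<^sub>b ?A \<circle>\<^sub>a l\<^sub>b ?A)"
    by (simp add: zeta_bul_lunit)
  finally have 1: "l\<^sub>b ?A \<cdot> (m\<^sub>J \<bullet>\<^sub>a Mult A) \<cdot> \<zeta> J ?A J ?A = Mult A \<cdot> (l\<^sub>b ?A \<circle>\<^sub>a l\<^sub>b ?A)" .
  have "l\<^sub>b ?A \<cdot> (\<epsilon>\<^sub>I \<bullet>\<^sub>a Uni A) \<cdot> \<Delta>\<^sub>I = (l\<^sub>b ?A \<cdot> (\<langle>J\<rangle> \<bullet>\<^sub>a Uni A)) \<cdot> (\<epsilon>\<^sub>I \<bullet>\<^sub>a \<langle>I\<rangle>) \<cdot> \<Delta>\<^sub>I"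
    by (simp add: merges)
  also have "\<dots> = Uni A"
    by (simp add: bul.lunit_natural' circ.comp_assoc' DeltaI_counit)
  finally have 2: "l\<^sub>b ?A \<cdot> (\<epsilon>\<^sub>I \<bullet>\<^sub>a Uni A) \<cdot> \<Delta>\<^sub>I = Uni A" .
  have "(l\<^sub>b ?A \<bullet>\<^sub>a l\<^sub>b ?A) \<cdot> bul.mid J J ?A ?A \<cdot> (\<Delta>\<^sub>J \<bullet>\<^sub>a Comult A)
    = ((l\<^sub>b ?A \<bullet>\<^sub>a l\<^sub>b ?A) \<cdot> bul.mid J J ?A ?A \<cdot> (\<Delta>\<^sub>J \<bullet>\<^sub>a \<langle>?A \<bullet> ?A\<rangle>)) \<cdot> (\<langle>J\<rangle> \<bullet>\<^sub>a Comult A)"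
    by (simp add: merges)
  also have "\<dots> = Comult A \<cdot> l\<^sub>b ?A"
    by (subst bul.mid_units) (simp_all add: bul.lunit_natural')
  finally have 3: "(l\<^sub>b ?A \<bullet>\<^sub>a l\<^sub>b ?A) \<cdot> bul.mid J J ?A ?A \<cdot> (\<Delta>\<^sub>J \<bullet>\<^sub>a Comult A) = Comult A \<cdot> l\<^sub>b ?A" .
  show ?thesis
    using 1 2 3 by (simp add: bimonoid_morphism_def circ.in_hom_iff bul.lunit_natural')
qed

lemma runit_bimonoid_morphism:
  assumes [simp]: "bimonoid A"
  shows "bimonoid_morphism (bimonoid_tensor A unit_bimonoid) A (r\<^sub>b (Carrier A))"
proof -
  let ?A = "Carrier A"
  note [simp] = bimonoid_unit
  have "r\<^sub>b ?A \<cdot> (Mult A \<bullet>\<^sub>a m\<^sub>J) \<cdot> \<zeta> ?A J ?A J = (r\<^sub>b ?A \<cdot> (Mult A \<bullet>\<^sub>a \<langle>J\<rangle>)) \<cdot> (\<langle>?A \<circle> ?A\<rangle> \<bullet>\<^sub>a m\<^sub>J) \<cdot> \<zeta> ?A J ?A J"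
    by (simp add: merges)
  also have "\<dots> = Mult A \<cdot> r\<^sub>b (?A \<circle> ?A) \<cdot> (\<langle>?A \<circle> ?A\<rangle> \<bullet>\<^sub>a m\<^sub>J) \<cdot> \<zeta> ?A J ?A J"
    by (simp add: bul.runit_natural' circ.comp_assoc')
  also have "\<dots> = Mult A \<cdot> (r\<^sub>b ?A \<circle>\<^sub>a r\<^sub>b ?A)"
    by (simp add: zeta_bul_runit)
  finally have 1: "r\<^sub>b ?A \<cdot> (Mult A \<bullet>\<^sub>a m\<^sub>J) \<cdot> \<zeta> ?A J ?A J = Mult A \<cdot> (r\<^sub>b ?A \<circle>\<^sub>a r\<^sub>b ?A)" .
  have "r\<^sub>b ?A \<cdot> (Uni A \<bullet>\<^sub>a \<epsilon>\<^sub>I) \<cdot> \<Delta>\<^sub>I = (r\<^sub>b ?A \<cdot> (Uni A \<bullet>\<^sub>a \<langle>J\<rangle>)) \<cdot> (\<langle>I\<rangle> \<bullet>\<^sub>a \<epsilon>\<^sub>I) \<cdot> \<Delta>\<^sub>I"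
    by (simp add: merges)
  also have "\<dots> = Uni A"
    by (simp add: bul.runit_natural' circ.comp_assoc' DeltaI_counit)
  finally have 2: "r\<^sub>b ?A \<cdot> (Uni A \<bullet>\<^sub>a \<epsilon>\<^sub>I) \<cdot> \<Delta>\<^sub>I = Uni A" .
  have "(r\<^sub>b ?A \<bullet>\<^sub>a r\<^sub>b ?A) \<cdot> bul.mid ?A ?A J J \<cdot> (Comult A \<bullet>\<^sub>a \<Delta>\<^sub>J)
    = ((r\<^sub>b ?A \<bullet>\<^sub>a r\<^sub>b ?A) \<cdot> bul.mid ?A ?A J J \<cdot> (\<langle>?A \<bullet> ?A\<rangle> \<bullet>\<^sub>a \<Delta>\<^sub>J)) \<cdot> (Comult A \<bullet>\<^sub>a \<langle>J\<rangle>)"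
    by (simp add: merges)
  also have "\<dots> = Comult A \<cdot> r\<^sub>b ?A"
    by (subst bul.mid_units) (simp_all add: bul.runit_natural')
  finally have 3: "(r\<^sub>b ?A \<bullet>\<^sub>a r\<^sub>b ?A) \<cdot> bul.mid ?A ?A J J \<cdot> (Comult A \<bullet>\<^sub>a \<Delta>\<^sub>J) = Comult A \<cdot> r\<^sub>b ?A" .
  show ?thesis
    using 1 2 3 by (simp add: bimonoid_morphism_def circ.in_hom_iff bul.lunit_unit bul.runit_natural')
qed

text \<open>All equations hold already for \<open>\<bullet>\<close> on underlying arrows; the
  content is that constraints and tensor products of morphisms are morphisms of bimonoids.\<close>

theorem monoidal_bimonoid_category: "monoidal_category bimonoid_category bimonoid_tensor_data"
proof -
  note [simp] = bimonoid_tensor_bimonoid bimonoid_unit bimonoid_morphism_tensor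
    assoc_bimonoid_morphism lunit_bimonoid_morphism runit_bimonoid_morphism
  show ?thesis
  proof
    fix f g f' g' X X' X'' Y Y' Y''
    assume "f \<in> hom bimonoid_category X X'" "f' \<in> hom bimonoid_category X' X''"
      "g \<in> hom bimonoid_category Y Y'" "g' \<in> hom bimonoid_category Y' Y''"
    then show "Tar bimonoid_tensor_data (Comp bimonoid_category f' f) (Comp bimonoid_category g' g)
      = Comp bimonoid_category (Tar bimonoid_tensor_data f' g') (Tar bimonoid_tensor_data f g)"
      by (auto simp: hom_bimonoid_category bimonoid_tensor_data_def dest!: bimonoid_morphism_arr intro!: bul.tensor_comp'[symmetric])
  qed (auto simp: hom_bimonoid_category bimonoid_tensor_data_def
      bul.pentagon bul.triangle
      intro!: iso_arrow_bimonoid_category bul.assoc_natural bul.lunit_natural bul.runit_natural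
      intro: bimonoid_morphism_hom)
qed

end


section \<open>The first antipode equation\<close>

text \<open>The axioms that enter the first antipode equation. Reversing both tensor products exchanges
  R1, R5, R6, R14, R18 with R3, R5, R7, R13, R17 and the first antipode equation with the second.\<close>

locale reversion_fragment = duoidal_category D + reversion_ops D R
  for D :: "('o, 'm) duoidal_data" and R :: "('o, 'm) reversion_data" +
  assumes rev_ob: "ob X \<Longrightarrow> ob (X\<^sup>-)"
    and rev_ident: "ob X \<Longrightarrow> \<langle>X\<rangle>\<^sup>-\<^sub>a = \<langle>X\<^sup>-\<rangle>"
    and phi_circ0_hom: "\<phi>\<^sub>c\<^sub>0 \<in> hm I (I\<^sup>-)"
    and phi_bul0_hom: "\<phi>\<^sub>b\<^sub>0 \<in> hm J (J\<^sup>-)"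
    and phi_bul_hom: "\<lbrakk>ob X; ob Y\<rbrakk> \<Longrightarrow> \<phi>\<^sub>b X Y \<in> hm (X\<^sup>- \<bullet> Y\<^sup>-) ((Y \<bullet> X)\<^sup>-)"
    and gamma_hom: "\<lbrakk>ob X; ob Y; ob Z; ob T\<rbrakk>
      \<Longrightarrow> \<gamma> X Y Z T \<in> hm (((X \<bullet> Y\<^sup>-) \<circle> Z) \<bullet> T) (X \<circle> (Z \<bullet> (Y \<circle> T)))"
    and gamma_natural: "\<lbrakk>x \<in> hm X X'; y \<in> hm Y Y'; z \<in> hm Z Z'; t \<in> hm T T'\<rbrakk>
      \<Longrightarrow> \<gamma> X' Y' Z' T' \<cdot> (((x \<bullet>\<^sub>a y\<^sup>-\<^sub>a) \<circle>\<^sub>a z) \<bullet>\<^sub>a t)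
          = (x \<circle>\<^sub>a (z \<bullet>\<^sub>a (y \<circle>\<^sub>a t))) \<cdot> \<gamma> X Y Z T"
    and delta_hom: "\<lbrakk>ob X; ob Y; ob Z; ob T\<rbrakk>
      \<Longrightarrow> \<delta> X Y Z T \<in> hm (X \<bullet> (Y \<circle> (Z\<^sup>- \<bullet> T))) (((X \<circle> Z) \<bullet> Y) \<circle> T)"
    and delta_natural: "\<lbrakk>x \<in> hm X X'; y \<in> hm Y Y'; z \<in> hm Z Z'; t \<in> hm T T'\<rbrakk>
      \<Longrightarrow> \<delta> X' Y' Z' T' \<cdot> (x \<bullet>\<^sub>a (y \<circle>\<^sub>a (z\<^sup>-\<^sub>a \<bullet>\<^sub>a t)))
          = (((x \<circle>\<^sub>a z) \<bullet>\<^sub>a y) \<circle>\<^sub>a t) \<cdot> \<delta> X Y Z T"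
    and R1: "\<lbrakk>ob X; ob Y; ob Z; ob T; ob U; ob V\<rbrakk> \<Longrightarrow>
      \<gamma> X Y (Z \<circle> U) (T \<circle> V) \<cdot> (a\<^sub>c (X \<bullet> Y\<^sup>-) Z U \<bullet>\<^sub>a \<langle>T \<circle> V\<rangle>) \<cdot> \<zeta> ((X \<bullet> Y\<^sup>-) \<circle> Z) T U V
      = (\<langle>X\<rangle> \<circle>\<^sub>a (\<langle>Z \<circle> U\<rangle> \<bullet>\<^sub>a a\<^sub>c Y T V)) \<cdot> (\<langle>X\<rangle> \<circle>\<^sub>a \<zeta> Z (Y \<circle> T) U V)
          \<cdot> a\<^sub>c X (Z \<bullet> (Y \<circle> T)) (U \<bullet> V) \<cdot> (\<gamma> X Y Z T \<circle>\<^sub>a \<langle>U \<bullet> V\<rangle>)"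
    and R5: "\<lbrakk>ob X; ob Y; ob Z; ob T; ob U; ob V\<rbrakk> \<Longrightarrow>
      \<delta> X Y T (U \<bullet> (Z \<circle> V)) \<cdot> (\<langle>X\<rangle> \<bullet>\<^sub>a (\<langle>Y\<rangle> \<circle>\<^sub>a a\<^sub>b (T\<^sup>-) U (Z \<circle> V)))
          \<cdot> (\<langle>X\<rangle> \<bullet>\<^sub>a \<gamma> Y Z (T\<^sup>- \<bullet> U) V) \<cdot> a\<^sub>b X ((Y \<bullet> Z\<^sup>-) \<circle> (T\<^sup>- \<bullet> U)) V
      = \<gamma> ((X \<circle> T) \<bullet> Y) Z U V \<cdot> ((inv\<^sub>a (a\<^sub>b (X \<circle> T) Y (Z\<^sup>-)) \<circle>\<^sub>a \<langle>U\<rangle>) \<bullet>\<^sub>a \<langle>V\<rangle>)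
          \<cdot> (\<delta> X (Y \<bullet> Z\<^sup>-) T U \<bullet>\<^sub>a \<langle>V\<rangle>)"
    and R6: "l\<^sub>c (I \<bullet> I) \<cdot> (\<langle>I\<rangle> \<circle>\<^sub>a (\<langle>I\<rangle> \<bullet>\<^sub>a l\<^sub>c I)) \<cdot> \<gamma> I I I I
          \<cdot> ((((\<langle>I\<rangle> \<bullet>\<^sub>a \<phi>\<^sub>c\<^sub>0) \<cdot> \<Delta>\<^sub>I) \<circle>\<^sub>a \<langle>I\<rangle>) \<bullet>\<^sub>a \<langle>I\<rangle>)
      = l\<^sub>c I \<bullet>\<^sub>a \<langle>I\<rangle>"
    and R14: "\<lbrakk>ob X; ob Y; ob Z; ob T; ob U; ob V\<rbrakk> \<Longrightarrow>
      \<delta> X ((Y \<circle> T) \<bullet> Z) U V \<cdot> (\<langle>X\<rangle> \<bullet>\<^sub>a \<delta> Y Z T (U\<^sup>- \<bullet> V))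
      = (a\<^sub>b (X \<circle> U) (Y \<circle> T) Z \<circle>\<^sub>a \<langle>V\<rangle>) \<cdot> ((\<zeta> X Y U T \<bullet>\<^sub>a \<langle>Z\<rangle>) \<circle>\<^sub>a \<langle>V\<rangle>)
          \<cdot> \<delta> (X \<bullet> Y) Z (U \<bullet> T) V \<cdot> (\<langle>X \<bullet> Y\<rangle> \<bullet>\<^sub>a (\<langle>Z\<rangle> \<circle>\<^sub>a (\<phi>\<^sub>b T U \<bullet>\<^sub>a \<langle>V\<rangle>)))
          \<cdot> (\<langle>X \<bullet> Y\<rangle> \<bullet>\<^sub>a (\<langle>Z\<rangle> \<circle>\<^sub>a inv\<^sub>a (a\<^sub>b (T\<^sup>-) (U\<^sup>-) V)))
          \<cdot> inv\<^sub>a (a\<^sub>b X Y (Z \<circle> (T\<^sup>- \<bullet> (U\<^sup>- \<bullet> V))))"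
    and R18: "l\<^sub>c J \<cdot> (l\<^sub>b I \<circle>\<^sub>a \<langle>J\<rangle>) \<cdot> ((m\<^sub>J \<bullet>\<^sub>a \<langle>I\<rangle>) \<circle>\<^sub>a \<langle>J\<rangle>) \<cdot> \<delta> J I J J
          \<cdot> (\<langle>J\<rangle> \<bullet>\<^sub>a (\<langle>I\<rangle> \<circle>\<^sub>a ((\<phi>\<^sub>b\<^sub>0 \<bullet>\<^sub>a \<langle>J\<rangle>) \<cdot> \<Delta>\<^sub>J)))
      = l\<^sub>b J \<cdot> (\<langle>J\<rangle> \<bullet>\<^sub>a l\<^sub>c J)"
begin

abbreviation (input) A_ar :: "'m \<Rightarrow> bool" where "A_ar f \<equiv> f \<in> Arr (Cat D)"
abbreviation (input) dm :: "'m \<Rightarrow> 'o" where "dm f \<equiv> Dom (Cat D) f"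
abbreviation (input) cd :: "'m \<Rightarrow> 'o" where "cd f \<equiv> Cod (Cat D) f"

lemmas rev_ob' [simp] = rev_ob

lemma phi_arr [simp]:
  "A_ar \<phi>\<^sub>c\<^sub>0" "dm \<phi>\<^sub>c\<^sub>0 = I" "cd \<phi>\<^sub>c\<^sub>0 = I\<^sup>-" "A_ar \<phi>\<^sub>b\<^sub>0" "dm \<phi>\<^sub>b\<^sub>0 = J" "cd \<phi>\<^sub>b\<^sub>0 = J\<^sup>-"
  "\<lbrakk>ob X; ob Y\<rbrakk> \<Longrightarrow> A_ar (\<phi>\<^sub>b X Y)" "\<lbrakk>ob X; ob Y\<rbrakk> \<Longrightarrow> dm (\<phi>\<^sub>b X Y) = X\<^sup>- \<bullet> Y\<^sup>-" "\<lbrakk>ob X; ob Y\<rbrakk> \<Longrightarrow> cd (\<phi>\<^sub>b X Y) = (Y \<bullet> X)\<^sup>-"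
  using phi_circ0_hom phi_bul0_hom phi_bul_hom by (auto simp: circ.in_hom_iff)

lemma gamma_delta_arr [simp]:
  assumes "ob X" "ob Y" "ob Z" "ob T"
  shows "A_ar (\<gamma> X Y Z T)" "dm (\<gamma> X Y Z T) = ((X \<bullet> Y\<^sup>-) \<circle> Z) \<bullet> T" "cd (\<gamma> X Y Z T) = X \<circle> (Z \<bullet> (Y \<circle> T))"
    "A_ar (\<delta> X Y Z T)" "dm (\<delta> X Y Z T) = X \<bullet> (Y \<circle> (Z\<^sup>- \<bullet> T))" "cd (\<delta> X Y Z T) = ((X \<circle> Z) \<bullet> Y) \<circle> T"
  using gamma_hom[OF assms] delta_hom[OF assms] by (auto simp: circ.in_hom_iff)

lemma gamma_natural':
  assumes "A_ar x" "A_ar z" "A_ar t" "cd x = X" "cd z = Z" "cd t = T" "ob Y"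
  shows "\<gamma> X Y Z T \<cdot> (((x \<bullet>\<^sub>a \<langle>Y\<^sup>-\<rangle>) \<circle>\<^sub>a z) \<bullet>\<^sub>a t) = (x \<circle>\<^sub>a (z \<bullet>\<^sub>a (\<langle>Y\<rangle> \<circle>\<^sub>a t))) \<cdot> \<gamma> (dm x) Y (dm z) (dm t)"
  using gamma_natural[of x "dm x" X "\<langle>Y\<rangle>" Y Y z "dm z" Z t "dm t" T] assms
  by (simp add: rev_ident circ.in_hom_iff)

lemma delta_natural':
  assumes "A_ar x" "A_ar y" "A_ar t" "cd x = X" "cd y = Y" "cd t = T" "ob Z"
  shows "\<delta> X Y Z T \<cdot> (x \<bullet>\<^sub>a (y \<circle>\<^sub>a (\<langle>Z\<^sup>-\<rangle> \<bullet>\<^sub>a t))) = (((x \<circle>\<^sub>a \<langle>Z\<rangle>) \<bullet>\<^sub>a y) \<circle>\<^sub>a t) \<cdot> \<delta> (dm x) (dm y) Z (dm t)"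
  using delta_natural[of x "dm x" X y "dm y" Y "\<langle>Z\<rangle>" Z Z t "dm t" T] assms
  by (simp add: rev_ident circ.in_hom_iff)

text \<open>An arrow from \<open>I\<close> to \<open>I \<bullet> I\<^sup>-\<close>: it creates the
  reversed factor in the domain of \<open>\<gamma>\<close> out of the unit alone.\<close>

abbreviation dI :: 'm where "dI \<equiv> (\<langle>I\<rangle> \<bullet>\<^sub>a \<phi>\<^sub>c\<^sub>0) \<cdot> \<Delta>\<^sub>I"

text \<open>The arrow \<open>\<gamma>\<close> precomposed with \<open>dI\<close> as in R6, with its
  last two objects freed. It turns out to be a composite of constraints.\<close>

definition Gam :: "'o \<Rightarrow> 'o \<Rightarrow> 'm" where
  "Gam U V = \<gamma> I I U V \<cdot> ((dI \<circle>\<^sub>a \<langle>U\<rangle>) \<bullet>\<^sub>a \<langle>V\<rangle>)"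

lemma Gam_arr [simp]:
  assumes "ob U" "ob V"
  shows "A_ar (Gam U V)" "dm (Gam U V) = (I \<circle> U) \<bullet> V" "cd (Gam U V) = I \<circle> (U \<bullet> (I \<circle> V))"
  using assms by (simp_all add: Gam_def)

lemma Gam_natural:
  assumes "A_ar u" "A_ar v" "cd u = U" "cd v = V"
  shows "Gam U V \<cdot> ((\<langle>I\<rangle> \<circle>\<^sub>a u) \<bullet>\<^sub>a v) = (\<langle>I\<rangle> \<circle>\<^sub>a (u \<bullet>\<^sub>a (\<langle>I\<rangle> \<circle>\<^sub>a v))) \<cdot> Gam (dm u) (dm v)"
proof -
  have [simp]: "U = cd u" "V = cd v"
    using assms by auto
  note [simp] = assms(1,2)
  have "Gam U V \<cdot> ((\<langle>I\<rangle> \<circle>\<^sub>a u) \<bullet>\<^sub>a v)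
    = (\<gamma> I I U V \<cdot> (((\<langle>I\<rangle> \<bullet>\<^sub>a \<langle>I\<^sup>-\<rangle>) \<circle>\<^sub>a u) \<bullet>\<^sub>a v)) \<cdot> ((dI \<circle>\<^sub>a \<langle>dm u\<rangle>) \<bullet>\<^sub>a \<langle>dm v\<rangle>)"
    by (simp add: Gam_def merges)
  also have "\<dots> = (\<langle>I\<rangle> \<circle>\<^sub>a (u \<bullet>\<^sub>a (\<langle>I\<rangle> \<circle>\<^sub>a v))) \<cdot> Gam (dm u) (dm v)"
    by (subst gamma_natural') (simp_all add: Gam_def circ.comp_assoc')
  finally show ?thesis .
qed

text \<open>R6 extended from \<open>I\<close> to arbitrary objects by means of R1.\<close>

lemma Gam_lunit:
  assumes [simp]: "ob U" "ob V"
  shows "l\<^sub>c (U \<bullet> V) \<cdot> (\<langle>I\<rangle> \<circle>\<^sub>a (\<langle>U\<rangle> \<bullet>\<^sub>a l\<^sub>c V)) \<cdot> Gam U V = l\<^sub>c U \<bullet>\<^sub>a \<langle>V\<rangle>"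
proof -
  let ?W = "U \<bullet> V"
  let ?il = "inv\<^sub>a (l\<^sub>c I)"
  let ?z = "\<zeta> I I U V \<cdot> (\<Delta>\<^sub>I \<circle>\<^sub>a \<langle>?W\<rangle>)"
  \<comment> \<open>R1 is evaluated with its first four objects equal to \<open>I\<close>:
    \<open>?p\<close> leads from \<open>I \<circle> ?W\<close> to the common domain of its two
    sides, and \<open>?q\<close> below leads from their common codomain back to
    \<open>?W\<close>.\<close>
  let ?p = "((((dI \<circle>\<^sub>a \<langle>I\<rangle>) \<cdot> ?il) \<bullet>\<^sub>a \<langle>I\<rangle>) \<cdot> \<Delta>\<^sub>I) \<circle>\<^sub>a \<langle>?W\<rangle>"
  let ?X = "l\<^sub>c ?W \<cdot> (\<langle>I\<rangle> \<circle>\<^sub>a (\<langle>U\<rangle> \<bullet>\<^sub>a l\<^sub>c V)) \<cdot> Gam U V"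
  let ?q = "l\<^sub>c ?W \<cdot> (\<langle>I\<rangle> \<circle>\<^sub>a (l\<^sub>c U \<bullet>\<^sub>a (l\<^sub>c V \<cdot> l\<^sub>c (I \<circle> V))))"
  have lI: "l\<^sub>c (I \<circle> V) = \<langle>I\<rangle> \<circle>\<^sub>a l\<^sub>c V"
  proof -
    have eq: "l\<^sub>c V \<cdot> l\<^sub>c (I \<circle> V) = l\<^sub>c V \<cdot> (\<langle>I\<rangle> \<circle>\<^sub>a l\<^sub>c V)"
      by (simp add: circ.lunit_natural')
    show ?thesis
      by (rule circ.iso_cancel_left[OF _ eq]) simp_all
  qed
  have Gl: "(\<langle>I\<rangle> \<circle>\<^sub>a (\<langle>U\<rangle> \<bullet>\<^sub>a (\<langle>I\<rangle> \<circle>\<^sub>a l\<^sub>c V))) \<cdot> Gam U (I \<circle> V) = Gam U V \<cdot> (\<langle>I \<circle> U\<rangle> \<bullet>\<^sub>a l\<^sub>c V)"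
    using Gam_natural[of "\<langle>U\<rangle>" "l\<^sub>c V" U V] by simp
  have aI: "a\<^sub>c I I U \<cdot> (?il \<circle>\<^sub>a \<langle>U\<rangle>) = \<langle>I\<rangle> \<circle>\<^sub>a inv\<^sub>a (l\<^sub>c U)"
  proof -
    have "(\<langle>I\<rangle> \<circle>\<^sub>a l\<^sub>c U) \<cdot> a\<^sub>c I I U \<cdot> (?il \<circle>\<^sub>a \<langle>U\<rangle>) = ((\<langle>I\<rangle> \<circle>\<^sub>a l\<^sub>c U) \<cdot> a\<^sub>c I I U) \<cdot> (?il \<circle>\<^sub>a \<langle>U\<rangle>)"
      by (simp add: circ.comp_assoc')
    also have "\<dots> = (\<langle>I\<rangle> \<circle>\<^sub>a l\<^sub>c U) \<cdot> (\<langle>I\<rangle> \<circle>\<^sub>a inv\<^sub>a (l\<^sub>c U))"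
      by (simp add: circ.triangle circ.lunit_unit[symmetric] merges)
    finally have eq: "(\<langle>I\<rangle> \<circle>\<^sub>a l\<^sub>c U) \<cdot> a\<^sub>c I I U \<cdot> (?il \<circle>\<^sub>a \<langle>U\<rangle>) = (\<langle>I\<rangle> \<circle>\<^sub>a l\<^sub>c U) \<cdot> (\<langle>I\<rangle> \<circle>\<^sub>a inv\<^sub>a (l\<^sub>c U))" .
    show ?thesis
      by (rule circ.iso_cancel_left[OF _ eq]) simp_all
  qed
  \<comment> \<open>R6 solved for \<open>\<gamma>\<close>: with \<open>dI\<close> in front, it is a
    composite of constraints at \<open>I\<close>.\<close>
  have Y: "\<gamma> I I I I \<cdot> (((dI \<circle>\<^sub>a \<langle>I\<rangle>) \<cdot> ?il) \<bullet>\<^sub>a \<langle>I\<rangle>) = (\<langle>I\<rangle> \<circle>\<^sub>a (\<langle>I\<rangle> \<bullet>\<^sub>a ?il)) \<cdot> inv\<^sub>a (l\<^sub>c (I \<bullet> I))"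
  proof -
    let ?h = "l\<^sub>c (I \<bullet> I) \<cdot> (\<langle>I\<rangle> \<circle>\<^sub>a (\<langle>I\<rangle> \<bullet>\<^sub>a l\<^sub>c I))"
    have "?h \<cdot> \<gamma> I I I I \<cdot> (((dI \<circle>\<^sub>a \<langle>I\<rangle>) \<cdot> ?il) \<bullet>\<^sub>a \<langle>I\<rangle>)
      = (l\<^sub>c (I \<bullet> I) \<cdot> (\<langle>I\<rangle> \<circle>\<^sub>a (\<langle>I\<rangle> \<bullet>\<^sub>a l\<^sub>c I)) \<cdot> \<gamma> I I I I \<cdot> ((dI \<circle>\<^sub>a \<langle>I\<rangle>) \<bullet>\<^sub>a \<langle>I\<rangle>)) \<cdot> (?il \<bullet>\<^sub>a \<langle>I\<rangle>)"
      by (simp add: merges)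
    also have "\<dots> = ?h \<cdot> (\<langle>I\<rangle> \<circle>\<^sub>a (\<langle>I\<rangle> \<bullet>\<^sub>a ?il)) \<cdot> inv\<^sub>a (l\<^sub>c (I \<bullet> I))"
      unfolding R6 by (simp add: merges)
    finally have eq: "?h \<cdot> \<gamma> I I I I \<cdot> (((dI \<circle>\<^sub>a \<langle>I\<rangle>) \<cdot> ?il) \<bullet>\<^sub>a \<langle>I\<rangle>)
      = ?h \<cdot> (\<langle>I\<rangle> \<circle>\<^sub>a (\<langle>I\<rangle> \<bullet>\<^sub>a ?il)) \<cdot> inv\<^sub>a (l\<^sub>c (I \<bullet> I))" .
    show ?thesis
      by (rule circ.iso_cancel_left[OF _ eq]) simp_all
  qed
  \<comment> \<open>Left side of R1: naturality of \<open>\<zeta>\<close> and of \<open>Gam\<close>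
    isolates \<open>?X\<close>, the arrow to be computed.\<close>
  have "?q \<cdot> (\<gamma> I I (I \<circle> U) (I \<circle> V) \<cdot> (a\<^sub>c (I \<bullet> I\<^sup>-) I U \<bullet>\<^sub>a \<langle>I \<circle> V\<rangle>) \<cdot> \<zeta> ((I \<bullet> I\<^sup>-) \<circle> I) I U V) \<cdot> ?p
    = ?q \<cdot> \<gamma> I I (I \<circle> U) (I \<circle> V) \<cdot> (a\<^sub>c (I \<bullet> I\<^sup>-) I U \<bullet>\<^sub>a \<langle>I \<circle> V\<rangle>)
      \<cdot> (\<zeta> ((I \<bullet> I\<^sup>-) \<circle> I) I U V \<cdot> ((((dI \<circle>\<^sub>a \<langle>I\<rangle>) \<cdot> ?il) \<bullet>\<^sub>a \<langle>I\<rangle>) \<circle>\<^sub>a (\<langle>U\<rangle> \<bullet>\<^sub>a \<langle>V\<rangle>))) \<cdot> (\<Delta>\<^sub>I \<circle>\<^sub>a \<langle>?W\<rangle>)"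
    by (simp add: merges)
  also have "\<dots> = ?q \<cdot> \<gamma> I I (I \<circle> U) (I \<circle> V) \<cdot> ((a\<^sub>c (I \<bullet> I\<^sup>-) I U \<cdot> ((dI \<circle>\<^sub>a \<langle>I\<rangle>) \<circle>\<^sub>a \<langle>U\<rangle>) \<cdot> (?il \<circle>\<^sub>a \<langle>U\<rangle>)) \<bullet>\<^sub>a \<langle>I \<circle> V\<rangle>) \<cdot> ?z"
    by (subst zeta_natural') (simp_all add: merges)
  also have "a\<^sub>c (I \<bullet> I\<^sup>-) I U \<cdot> ((dI \<circle>\<^sub>a \<langle>I\<rangle>) \<circle>\<^sub>a \<langle>U\<rangle>) \<cdot> (?il \<circle>\<^sub>a \<langle>U\<rangle>)
    = (a\<^sub>c (I \<bullet> I\<^sup>-) I U \<cdot> ((dI \<circle>\<^sub>a \<langle>I\<rangle>) \<circle>\<^sub>a \<langle>U\<rangle>)) \<cdot> (?il \<circle>\<^sub>a \<langle>U\<rangle>)"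
    by (simp add: circ.comp_assoc')
  also have "\<dots> = (dI \<circle>\<^sub>a \<langle>I \<circle> U\<rangle>) \<cdot> (\<langle>I\<rangle> \<circle>\<^sub>a inv\<^sub>a (l\<^sub>c U))"
    by (subst circ.assoc_natural') (simp_all add: circ.comp_assoc' aI)
  also have "?q \<cdot> \<gamma> I I (I \<circle> U) (I \<circle> V) \<cdot> (((dI \<circle>\<^sub>a \<langle>I \<circle> U\<rangle>) \<cdot> (\<langle>I\<rangle> \<circle>\<^sub>a inv\<^sub>a (l\<^sub>c U))) \<bullet>\<^sub>a \<langle>I \<circle> V\<rangle>) \<cdot> ?z
    = ?q \<cdot> (Gam (I \<circle> U) (I \<circle> V) \<cdot> ((\<langle>I\<rangle> \<circle>\<^sub>a inv\<^sub>a (l\<^sub>c U)) \<bullet>\<^sub>a \<langle>I \<circle> V\<rangle>)) \<cdot> ?z"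
    by (simp add: merges Gam_def)
  also have "\<dots> = (l\<^sub>c ?W \<cdot> (\<langle>I\<rangle> \<circle>\<^sub>a (\<langle>U\<rangle> \<bullet>\<^sub>a (l\<^sub>c V \<cdot> l\<^sub>c (I \<circle> V))))) \<cdot> Gam U (I \<circle> V) \<cdot> ?z"
    by (subst Gam_natural) (simp_all add: merges)
  also have "\<dots> = l\<^sub>c ?W \<cdot> (\<langle>I\<rangle> \<circle>\<^sub>a (\<langle>U\<rangle> \<bullet>\<^sub>a l\<^sub>c V)) \<cdot> ((\<langle>I\<rangle> \<circle>\<^sub>a (\<langle>U\<rangle> \<bullet>\<^sub>a (\<langle>I\<rangle> \<circle>\<^sub>a l\<^sub>c V))) \<cdot> Gam U (I \<circle> V)) \<cdot> ?z"
    by (simp add: merges lI)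
  also have "\<dots> = ?X \<cdot> (\<langle>I \<circle> U\<rangle> \<bullet>\<^sub>a l\<^sub>c V) \<cdot> ?z"
    unfolding Gl by (simp add: circ.comp_assoc')
  also have "(\<langle>I \<circle> U\<rangle> \<bullet>\<^sub>a l\<^sub>c V) \<cdot> ?z = (inv\<^sub>a (l\<^sub>c U) \<bullet>\<^sub>a \<langle>V\<rangle>) \<cdot> (l\<^sub>c U \<bullet>\<^sub>a l\<^sub>c V) \<cdot> \<zeta> I I U V \<cdot> (\<Delta>\<^sub>I \<circle>\<^sub>a \<langle>?W\<rangle>)"
    by (simp add: merges)
  also have "\<dots> = (inv\<^sub>a (l\<^sub>c U) \<bullet>\<^sub>a \<langle>V\<rangle>) \<cdot> l\<^sub>c ?W"
    by (simp only: zeta_circ_lunit assms)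
  finally have L: "?q \<cdot> (\<gamma> I I (I \<circle> U) (I \<circle> V) \<cdot> (a\<^sub>c (I \<bullet> I\<^sup>-) I U \<bullet>\<^sub>a \<langle>I \<circle> V\<rangle>) \<cdot> \<zeta> ((I \<bullet> I\<^sup>-) \<circle> I) I U V) \<cdot> ?p
    = ?X \<cdot> (inv\<^sub>a (l\<^sub>c U) \<bullet>\<^sub>a \<langle>V\<rangle>) \<cdot> l\<^sub>c ?W" .
  \<comment> \<open>Right side of R1: \<open>Y\<close> removes \<open>\<gamma>\<close>, and the left
    unit axiom of \<open>\<zeta>\<close> leaves only \<open>l\<^sub>c ?W\<close>.\<close>
  have "?q \<cdot> ((\<langle>I\<rangle> \<circle>\<^sub>a (\<langle>I \<circle> U\<rangle> \<bullet>\<^sub>a a\<^sub>c I I V)) \<cdot> (\<langle>I\<rangle> \<circle>\<^sub>a \<zeta> I (I \<circle> I) U V)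
      \<cdot> a\<^sub>c I (I \<bullet> (I \<circle> I)) ?W \<cdot> (\<gamma> I I I I \<circle>\<^sub>a \<langle>?W\<rangle>)) \<cdot> ?p
    = l\<^sub>c ?W \<cdot> (\<langle>I\<rangle> \<circle>\<^sub>a ((l\<^sub>c U \<bullet>\<^sub>a (l\<^sub>c V \<cdot> l\<^sub>c (I \<circle> V) \<cdot> a\<^sub>c I I V)) \<cdot> \<zeta> I (I \<circle> I) U V))
      \<cdot> a\<^sub>c I (I \<bullet> (I \<circle> I)) ?W \<cdot> (((\<gamma> I I I I \<cdot> (((dI \<circle>\<^sub>a \<langle>I\<rangle>) \<cdot> ?il) \<bullet>\<^sub>a \<langle>I\<rangle>)) \<cdot> \<Delta>\<^sub>I) \<circle>\<^sub>a \<langle>?W\<rangle>)"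
    by (simp add: merges)
  also have "\<dots> = l\<^sub>c ?W \<cdot> (\<langle>I\<rangle> \<circle>\<^sub>a ((l\<^sub>c U \<bullet>\<^sub>a l\<^sub>c V) \<cdot> ((\<langle>I\<rangle> \<circle>\<^sub>a \<langle>U\<rangle>) \<bullet>\<^sub>a (l\<^sub>c I \<circle>\<^sub>a \<langle>V\<rangle>)) \<cdot> \<zeta> I (I \<circle> I) U V))
      \<cdot> (a\<^sub>c I (I \<bullet> (I \<circle> I)) ?W \<cdot> ((\<langle>I\<rangle> \<circle>\<^sub>a (\<langle>I\<rangle> \<bullet>\<^sub>a ?il)) \<circle>\<^sub>a \<langle>?W\<rangle>)) \<cdot> ((inv\<^sub>a (l\<^sub>c (I \<bullet> I)) \<cdot> \<Delta>\<^sub>I) \<circle>\<^sub>a \<langle>?W\<rangle>)"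
    unfolding Y by (simp add: merges circ.lunit_tensor)
  also have "((\<langle>I\<rangle> \<circle>\<^sub>a \<langle>U\<rangle>) \<bullet>\<^sub>a (l\<^sub>c I \<circle>\<^sub>a \<langle>V\<rangle>)) \<cdot> \<zeta> I (I \<circle> I) U V = \<zeta> I I U V \<cdot> ((\<langle>I\<rangle> \<bullet>\<^sub>a l\<^sub>c I) \<circle>\<^sub>a (\<langle>U\<rangle> \<bullet>\<^sub>a \<langle>V\<rangle>))"
    by (subst zeta_natural') simp_all
  also have "a\<^sub>c I (I \<bullet> (I \<circle> I)) ?W \<cdot> ((\<langle>I\<rangle> \<circle>\<^sub>a (\<langle>I\<rangle> \<bullet>\<^sub>a ?il)) \<circle>\<^sub>a \<langle>?W\<rangle>) = (\<langle>I\<rangle> \<circle>\<^sub>a ((\<langle>I\<rangle> \<bullet>\<^sub>a ?il) \<circle>\<^sub>a \<langle>?W\<rangle>)) \<cdot> a\<^sub>c I (I \<bullet> I) ?W"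
    by (subst circ.assoc_natural') simp_all
  also have "l\<^sub>c ?W \<cdot> (\<langle>I\<rangle> \<circle>\<^sub>a ((l\<^sub>c U \<bullet>\<^sub>a l\<^sub>c V) \<cdot> (\<zeta> I I U V \<cdot> ((\<langle>I\<rangle> \<bullet>\<^sub>a l\<^sub>c I) \<circle>\<^sub>a (\<langle>U\<rangle> \<bullet>\<^sub>a \<langle>V\<rangle>)))))
      \<cdot> ((\<langle>I\<rangle> \<circle>\<^sub>a ((\<langle>I\<rangle> \<bullet>\<^sub>a ?il) \<circle>\<^sub>a \<langle>?W\<rangle>)) \<cdot> a\<^sub>c I (I \<bullet> I) ?W) \<cdot> ((inv\<^sub>a (l\<^sub>c (I \<bullet> I)) \<cdot> \<Delta>\<^sub>I) \<circle>\<^sub>a \<langle>?W\<rangle>)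
    = (l\<^sub>c ?W \<cdot> (\<langle>I\<rangle> \<circle>\<^sub>a ((l\<^sub>c U \<bullet>\<^sub>a l\<^sub>c V) \<cdot> \<zeta> I I U V))) \<cdot> a\<^sub>c I (I \<bullet> I) ?W \<cdot> ((inv\<^sub>a (l\<^sub>c (I \<bullet> I)) \<cdot> \<Delta>\<^sub>I) \<circle>\<^sub>a \<langle>?W\<rangle>)"
    by (simp add: merges)
  also have "\<dots> = ((l\<^sub>c U \<bullet>\<^sub>a l\<^sub>c V) \<cdot> \<zeta> I I U V) \<cdot> (l\<^sub>c ((I \<bullet> I) \<circle> ?W) \<cdot> a\<^sub>c I (I \<bullet> I) ?W) \<cdot> ((inv\<^sub>a (l\<^sub>c (I \<bullet> I)) \<cdot> \<Delta>\<^sub>I) \<circle>\<^sub>a \<langle>?W\<rangle>)"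
    by (subst circ.lunit_natural') (simp_all add: circ.comp_assoc')
  also have "\<dots> = (l\<^sub>c U \<bullet>\<^sub>a l\<^sub>c V) \<cdot> \<zeta> I I U V \<cdot> (\<Delta>\<^sub>I \<circle>\<^sub>a \<langle>?W\<rangle>)"
    by (subst circ.lunit_tensor) (simp_all add: merges)
  also have "\<dots> = l\<^sub>c ?W"
    by (simp only: zeta_circ_lunit assms)
  finally have "?X \<cdot> (inv\<^sub>a (l\<^sub>c U) \<bullet>\<^sub>a \<langle>V\<rangle>) \<cdot> l\<^sub>c ?W = l\<^sub>c ?W"
    unfolding L[symmetric] by (simp only: R1 circ.unit_ob' assms)
  then have eq: "(?X \<cdot> (inv\<^sub>a (l\<^sub>c U) \<bullet>\<^sub>a \<langle>V\<rangle>)) \<cdot> l\<^sub>c ?W = \<langle>?W\<rangle> \<cdot> l\<^sub>c ?W"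
    by (simp add: circ.comp_assoc')
  have "?X \<cdot> (inv\<^sub>a (l\<^sub>c U) \<bullet>\<^sub>a \<langle>V\<rangle>) = \<langle>?W\<rangle>"
    by (rule circ.iso_cancel_right[OF _ eq]) simp_all
  then have "(?X \<cdot> (inv\<^sub>a (l\<^sub>c U) \<bullet>\<^sub>a \<langle>V\<rangle>)) \<cdot> (l\<^sub>c U \<bullet>\<^sub>a \<langle>V\<rangle>) = \<langle>?W\<rangle> \<cdot> (l\<^sub>c U \<bullet>\<^sub>a \<langle>V\<rangle>)"
    by simp
  then show ?thesis
    by (simp add: merges)
qed

end


section \<open>The first antipode equation in the presence of a spectator\<close>

context reversion_ops
begin

text \<open>Half of \<open>antipode\<close>, split off for arbitrary data so that the other half is
  the same predicate for the reversed data.\<close>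

definition antipode1 :: "('o, 'm) bimonoid_data \<Rightarrow> 'm \<Rightarrow> bool" where
  "antipode1 A S \<longleftrightarrow> S \<in> hm (Carrier A) ((Carrier A)\<^sup>-)
   \<and> ((Mult A \<bullet>\<^sub>a \<langle>I\<rangle>) \<circle>\<^sub>a \<langle>J\<rangle>) \<cdot> \<phi> (Carrier A) (Carrier A) \<cdot> (\<langle>Carrier A\<rangle> \<bullet>\<^sub>a S) \<cdot> Comult A
     = ((Uni A \<bullet>\<^sub>a \<langle>I\<rangle>) \<circle>\<^sub>a \<langle>J\<rangle>) \<cdot> (\<Delta>\<^sub>I \<circle>\<^sub>a \<langle>J\<rangle>) \<cdot> inv\<^sub>a (l\<^sub>c J) \<cdot> Counit A"

end

context reversion_fragment
begin

text \<open>The variant of \<open>\<phi>\<close> with an arbitrary object \<open>V\<close> in place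
  of \<open>J\<close>; up to a right unit constraint, \<open>\<phi> X Y\<close> is
  \<open>Phi X Y J\<close>.\<close>

definition Phi :: "'o \<Rightarrow> 'o \<Rightarrow> 'o \<Rightarrow> 'm" where
  "Phi X Y V = \<delta> X I Y V \<cdot> (\<langle>X\<rangle> \<bullet>\<^sub>a inv\<^sub>a (l\<^sub>c (Y\<^sup>- \<bullet> V)))"

text \<open>Absorbs the spectator \<open>V\<close> into the final \<open>J\<close>. It is the part
  of the right-hand side of R5 that follows \<open>\<delta>\<close>: \<open>dI\<close> supplies the
  factors \<open>I\<close> and \<open>I\<^sup>-\<close> in the domain of \<open>\<gamma>\<close>,
  and unit constraints collapse \<open>J \<bullet> (I \<circle> V)\<close> to
  \<open>V\<close>.\<close>

definition Om :: "'o \<Rightarrow> 'o \<Rightarrow> 'm" where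
  "Om P V = (\<langle>P \<bullet> I\<rangle> \<circle>\<^sub>a (l\<^sub>b V \<cdot> (\<langle>J\<rangle> \<bullet>\<^sub>a l\<^sub>c V))) \<cdot> \<gamma> (P \<bullet> I) I J V
    \<cdot> (((inv\<^sub>a (a\<^sub>b P I (I\<^sup>-)) \<cdot> (\<langle>P\<rangle> \<bullet>\<^sub>a dI)) \<circle>\<^sub>a \<langle>J\<rangle>) \<bullet>\<^sub>a \<langle>V\<rangle>)"

lemma phi_eq: "ob X \<Longrightarrow> ob Y \<Longrightarrow>
    \<phi> X Y = \<delta> X I Y J \<cdot> (\<langle>X\<rangle> \<bullet>\<^sub>a ((\<langle>I\<rangle> \<circle>\<^sub>a inv\<^sub>a (r\<^sub>b (Y\<^sup>-))) \<cdot> inv\<^sub>a (l\<^sub>c (Y\<^sup>-))))"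
  by (simp add: \<phi>_def merges)

lemma phi_Phi_Om_arr [simp]:
  assumes "ob X" "ob Y"
  shows "A_ar (\<phi> X Y)" "dm (\<phi> X Y) = X \<bullet> Y\<^sup>-" "cd (\<phi> X Y) = ((X \<circle> Y) \<bullet> I) \<circle> J"
    "ob V \<Longrightarrow> A_ar (Phi X Y V)" "ob V \<Longrightarrow> dm (Phi X Y V) = X \<bullet> (Y\<^sup>- \<bullet> V)" "ob V \<Longrightarrow> cd (Phi X Y V) = ((X \<circle> Y) \<bullet> I) \<circle> V"
    "A_ar (Om X Y)" "dm (Om X Y) = ((X \<bullet> I) \<circle> J) \<bullet> Y" "cd (Om X Y) = (X \<bullet> I) \<circle> Y"
  using assms by (simp_all add: phi_eq Phi_def Om_def)

lemma Gam_eq: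
  assumes [simp]: "ob U" "ob V"
  shows "Gam U V = (\<langle>I\<rangle> \<circle>\<^sub>a (\<langle>U\<rangle> \<bullet>\<^sub>a inv\<^sub>a (l\<^sub>c V))) \<cdot> inv\<^sub>a (l\<^sub>c (U \<bullet> V)) \<cdot> (l\<^sub>c U \<bullet>\<^sub>a \<langle>V\<rangle>)"
  unfolding Gam_lunit[OF assms, symmetric] by (simp add: merges)

text \<open>By R5, \<open>\<delta>\<close> at an arbitrary last argument factorises through \<open>\<phi>\<close>, which is its value at \<open>J\<close>.\<close>

lemma Phi_factor:
  assumes [simp]: "ob X" "ob Y" "ob V"
  shows "Phi X Y V \<cdot> a\<^sub>b X (Y\<^sup>-) V = Om (X \<circle> Y) V \<cdot> (\<phi> X Y \<bullet>\<^sub>a \<langle>V\<rangle>)"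
proof -
  let ?W = "Y\<^sup>- \<bullet> J"
  \<comment> \<open>R5 is taken with its variables \<open>X, Y, Z, T, U, V\<close> set to
    \<open>X, I, I, Y, J, V\<close>; \<open>?p\<close> inserts \<open>dI\<close> before it, and
    \<open>?q\<close> collapses \<open>J \<bullet> (I \<circle> V)\<close> after it.\<close>
  let ?p = "(\<langle>X\<rangle> \<bullet>\<^sub>a (dI \<circle>\<^sub>a \<langle>?W\<rangle>)) \<bullet>\<^sub>a \<langle>V\<rangle>"
  let ?k = "l\<^sub>b V \<cdot> (\<langle>J\<rangle> \<bullet>\<^sub>a l\<^sub>c V)"
  let ?q = "\<langle>(X \<circle> Y) \<bullet> I\<rangle> \<circle>\<^sub>a ?k"
  let ?e = "r\<^sub>b (Y\<^sup>-) \<cdot> l\<^sub>c ?W"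
  have "?q \<cdot> (\<gamma> ((X \<circle> Y) \<bullet> I) I J V \<cdot> ((inv\<^sub>a (a\<^sub>b (X \<circle> Y) I (I\<^sup>-)) \<circle>\<^sub>a \<langle>J\<rangle>) \<bullet>\<^sub>a \<langle>V\<rangle>) \<cdot> (\<delta> X (I \<bullet> I\<^sup>-) Y J \<bullet>\<^sub>a \<langle>V\<rangle>)) \<cdot> ?p
    = ?q \<cdot> \<gamma> ((X \<circle> Y) \<bullet> I) I J V \<cdot> ((inv\<^sub>a (a\<^sub>b (X \<circle> Y) I (I\<^sup>-)) \<circle>\<^sub>a \<langle>J\<rangle>) \<bullet>\<^sub>a \<langle>V\<rangle>)
      \<cdot> ((\<delta> X (I \<bullet> I\<^sup>-) Y J \<cdot> (\<langle>X\<rangle> \<bullet>\<^sub>a (dI \<circle>\<^sub>a (\<langle>Y\<^sup>-\<rangle> \<bullet>\<^sub>a \<langle>J\<rangle>)))) \<bullet>\<^sub>a \<langle>V\<rangle>)"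
    by (simp add: merges)
  also have "\<dots> = Om (X \<circle> Y) V \<cdot> (\<delta> X I Y J \<bullet>\<^sub>a \<langle>V\<rangle>)"
    by (subst delta_natural') (simp_all add: Om_def merges)
  finally have Rr: "?q \<cdot> (\<gamma> ((X \<circle> Y) \<bullet> I) I J V \<cdot> ((inv\<^sub>a (a\<^sub>b (X \<circle> Y) I (I\<^sup>-)) \<circle>\<^sub>a \<langle>J\<rangle>) \<bullet>\<^sub>a \<langle>V\<rangle>) \<cdot> (\<delta> X (I \<bullet> I\<^sup>-) Y J \<bullet>\<^sub>a \<langle>V\<rangle>)) \<cdot> ?p
    = Om (X \<circle> Y) V \<cdot> (\<delta> X I Y J \<bullet>\<^sub>a \<langle>V\<rangle>)" .
  have n1: "a\<^sub>b X ((I \<bullet> I\<^sup>-) \<circle> ?W) V \<cdot> ?p = (\<langle>X\<rangle> \<bullet>\<^sub>a ((dI \<circle>\<^sub>a \<langle>?W\<rangle>) \<bullet>\<^sub>a \<langle>V\<rangle>)) \<cdot> a\<^sub>b X (I \<circle> ?W) V"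
    by (subst bul.assoc_natural') simp_all
  have n2: "?q \<cdot> \<delta> X I Y (J \<bullet> (I \<circle> V)) = \<delta> X I Y V \<cdot> (\<langle>X\<rangle> \<bullet>\<^sub>a (\<langle>I\<rangle> \<circle>\<^sub>a (\<langle>Y\<^sup>-\<rangle> \<bullet>\<^sub>a ?k)))"
    by (subst delta_natural') simp_all
  have n3: "(\<langle>Y\<^sup>-\<rangle> \<bullet>\<^sub>a ?k) \<cdot> a\<^sub>b (Y\<^sup>-) J (I \<circle> V) \<cdot> (\<langle>?W\<rangle> \<bullet>\<^sub>a inv\<^sub>a (l\<^sub>c V)) = r\<^sub>b (Y\<^sup>-) \<bullet>\<^sub>a \<langle>V\<rangle>"
  proof -
    have "(\<langle>Y\<^sup>-\<rangle> \<bullet>\<^sub>a ?k) \<cdot> a\<^sub>b (Y\<^sup>-) J (I \<circle> V) \<cdot> (\<langle>?W\<rangle> \<bullet>\<^sub>a inv\<^sub>a (l\<^sub>c V))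
      = (\<langle>Y\<^sup>-\<rangle> \<bullet>\<^sub>a ?k) \<cdot> (a\<^sub>b (Y\<^sup>-) J (I \<circle> V) \<cdot> ((\<langle>Y\<^sup>-\<rangle> \<bullet>\<^sub>a \<langle>J\<rangle>) \<bullet>\<^sub>a inv\<^sub>a (l\<^sub>c V)))"
      by simp
    also have "\<dots> = (\<langle>Y\<^sup>-\<rangle> \<bullet>\<^sub>a l\<^sub>b V) \<cdot> a\<^sub>b (Y\<^sup>-) J V"
      by (subst bul.assoc_natural') (simp_all add: merges)
    also have "\<dots> = r\<^sub>b (Y\<^sup>-) \<bullet>\<^sub>a \<langle>V\<rangle>"
      by (simp add: bul.triangle)
    finally show ?thesis .
  qed
  have "?q \<cdot> (\<delta> X I Y (J \<bullet> (I \<circle> V)) \<cdot> (\<langle>X\<rangle> \<bullet>\<^sub>a (\<langle>I\<rangle> \<circle>\<^sub>a a\<^sub>b (Y\<^sup>-) J (I \<circle> V)))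
      \<cdot> (\<langle>X\<rangle> \<bullet>\<^sub>a \<gamma> I I ?W V) \<cdot> a\<^sub>b X ((I \<bullet> I\<^sup>-) \<circle> ?W) V) \<cdot> ?p
    = (?q \<cdot> \<delta> X I Y (J \<bullet> (I \<circle> V))) \<cdot> (\<langle>X\<rangle> \<bullet>\<^sub>a (\<langle>I\<rangle> \<circle>\<^sub>a a\<^sub>b (Y\<^sup>-) J (I \<circle> V)))
      \<cdot> (\<langle>X\<rangle> \<bullet>\<^sub>a \<gamma> I I ?W V) \<cdot> (a\<^sub>b X ((I \<bullet> I\<^sup>-) \<circle> ?W) V \<cdot> ?p)"
    by (simp add: circ.comp_assoc')
  also have "\<dots> = \<delta> X I Y V \<cdot> (\<langle>X\<rangle> \<bullet>\<^sub>a ((\<langle>I\<rangle> \<circle>\<^sub>a ((\<langle>Y\<^sup>-\<rangle> \<bullet>\<^sub>a ?k) \<cdot> a\<^sub>b (Y\<^sup>-) J (I \<circle> V))) \<cdot> Gam ?W V)) \<cdot> a\<^sub>b X (I \<circle> ?W) V"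
    unfolding n1 n2 by (simp add: merges Gam_def)
  \<comment> \<open>On this side of R5 the arrow \<open>\<gamma>\<close> has become
    \<open>Gam\<close>, hence a composite of constraints; only \<open>Phi\<close> and rebracketings
    remain.\<close>
  also have "(\<langle>I\<rangle> \<circle>\<^sub>a ((\<langle>Y\<^sup>-\<rangle> \<bullet>\<^sub>a ?k) \<cdot> a\<^sub>b (Y\<^sup>-) J (I \<circle> V))) \<cdot> Gam ?W V
    = (\<langle>I\<rangle> \<circle>\<^sub>a ((\<langle>Y\<^sup>-\<rangle> \<bullet>\<^sub>a ?k) \<cdot> a\<^sub>b (Y\<^sup>-) J (I \<circle> V) \<cdot> (\<langle>?W\<rangle> \<bullet>\<^sub>a inv\<^sub>a (l\<^sub>c V)))) \<cdot> inv\<^sub>a (l\<^sub>c (?W \<bullet> V)) \<cdot> (l\<^sub>c ?W \<bullet>\<^sub>a \<langle>V\<rangle>)"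
    unfolding Gam_eq[OF bul.tensor_ob'[OF rev_ob'[OF assms(2)] bul.unit_ob'] assms(3)] by (simp add: merges)
  also have "\<dots> = ((\<langle>I\<rangle> \<circle>\<^sub>a (r\<^sub>b (Y\<^sup>-) \<bullet>\<^sub>a \<langle>V\<rangle>)) \<cdot> inv\<^sub>a (l\<^sub>c (?W \<bullet> V))) \<cdot> (l\<^sub>c ?W \<bullet>\<^sub>a \<langle>V\<rangle>)"
    unfolding n3 by (simp add: circ.comp_assoc')
  also have "(\<langle>I\<rangle> \<circle>\<^sub>a (r\<^sub>b (Y\<^sup>-) \<bullet>\<^sub>a \<langle>V\<rangle>)) \<cdot> inv\<^sub>a (l\<^sub>c (?W \<bullet> V)) = inv\<^sub>a (l\<^sub>c (Y\<^sup>- \<bullet> V)) \<cdot> (r\<^sub>b (Y\<^sup>-) \<bullet>\<^sub>a \<langle>V\<rangle>)"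
    by (subst circ.lunit_inv_natural) simp_all
  also have "\<delta> X I Y V \<cdot> (\<langle>X\<rangle> \<bullet>\<^sub>a ((inv\<^sub>a (l\<^sub>c (Y\<^sup>- \<bullet> V)) \<cdot> (r\<^sub>b (Y\<^sup>-) \<bullet>\<^sub>a \<langle>V\<rangle>)) \<cdot> (l\<^sub>c ?W \<bullet>\<^sub>a \<langle>V\<rangle>))) \<cdot> a\<^sub>b X (I \<circle> ?W) V
    = Phi X Y V \<cdot> ((\<langle>X\<rangle> \<bullet>\<^sub>a (?e \<bullet>\<^sub>a \<langle>V\<rangle>)) \<cdot> a\<^sub>b X (I \<circle> ?W) V)"
    by (simp add: Phi_def merges)
  also have "(\<langle>X\<rangle> \<bullet>\<^sub>a (?e \<bullet>\<^sub>a \<langle>V\<rangle>)) \<cdot> a\<^sub>b X (I \<circle> ?W) V = a\<^sub>b X (Y\<^sup>-) V \<cdot> ((\<langle>X\<rangle> \<bullet>\<^sub>a ?e) \<bullet>\<^sub>a \<langle>V\<rangle>)"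
    by (subst bul.assoc_natural') simp_all
  finally have L: "?q \<cdot> (\<delta> X I Y (J \<bullet> (I \<circle> V)) \<cdot> (\<langle>X\<rangle> \<bullet>\<^sub>a (\<langle>I\<rangle> \<circle>\<^sub>a a\<^sub>b (Y\<^sup>-) J (I \<circle> V)))
      \<cdot> (\<langle>X\<rangle> \<bullet>\<^sub>a \<gamma> I I ?W V) \<cdot> a\<^sub>b X ((I \<bullet> I\<^sup>-) \<circle> ?W) V) \<cdot> ?p
    = Phi X Y V \<cdot> a\<^sub>b X (Y\<^sup>-) V \<cdot> ((\<langle>X\<rangle> \<bullet>\<^sub>a ?e) \<bullet>\<^sub>a \<langle>V\<rangle>)" .
  have LR: "Phi X Y V \<cdot> a\<^sub>b X (Y\<^sup>-) V \<cdot> ((\<langle>X\<rangle> \<bullet>\<^sub>a ?e) \<bullet>\<^sub>a \<langle>V\<rangle>) = Om (X \<circle> Y) V \<cdot> (\<delta> X I Y J \<bullet>\<^sub>a \<langle>V\<rangle>)"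
    unfolding L[symmetric] Rr[symmetric] by (simp only: R5 circ.unit_ob' bul.unit_ob' assms)
  let ?f = "(\<langle>I\<rangle> \<circle>\<^sub>a inv\<^sub>a (r\<^sub>b (Y\<^sup>-))) \<cdot> inv\<^sub>a (l\<^sub>c (Y\<^sup>-))"
  have f: "?f = inv\<^sub>a (l\<^sub>c ?W) \<cdot> inv\<^sub>a (r\<^sub>b (Y\<^sup>-))"
    by (subst circ.lunit_inv_natural) simp_all
  \<comment> \<open>\<open>?f\<close> is inverse to \<open>?e\<close>, so precomposing with it
    strips \<open>?e\<close> from the equation just obtained.\<close>
  have "Phi X Y V \<cdot> a\<^sub>b X (Y\<^sup>-) V = (Phi X Y V \<cdot> a\<^sub>b X (Y\<^sup>-) V \<cdot> ((\<langle>X\<rangle> \<bullet>\<^sub>a ?e) \<bullet>\<^sub>a \<langle>V\<rangle>)) \<cdot> ((\<langle>X\<rangle> \<bullet>\<^sub>a ?f) \<bullet>\<^sub>a \<langle>V\<rangle>)"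
    unfolding f by (simp add: merges)
  also have "\<dots> = Om (X \<circle> Y) V \<cdot> (\<phi> X Y \<bullet>\<^sub>a \<langle>V\<rangle>)"
    unfolding LR by (simp add: phi_eq merges)
  finally show ?thesis .
qed

text \<open>Lets the multiplication and the unit of a bimonoid slide through the absorption of the
  spectator.\<close>

lemma Om_natural:
  assumes [simp]: "A_ar p" "ob V" and cd: "cd p = P"
  shows "Om P V \<cdot> (((p \<bullet>\<^sub>a \<langle>I\<rangle>) \<circle>\<^sub>a \<langle>J\<rangle>) \<bullet>\<^sub>a \<langle>V\<rangle>) = ((p \<bullet>\<^sub>a \<langle>I\<rangle>) \<circle>\<^sub>a \<langle>V\<rangle>) \<cdot> Om (dm p) V"
proof -
  have [simp]: "P = cd p"
    using cd by simp
  have "inv\<^sub>a (a\<^sub>b P I (I\<^sup>-)) \<cdot> (\<langle>P\<rangle> \<bullet>\<^sub>a dI) \<cdot> (p \<bullet>\<^sub>a \<langle>I\<rangle>)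
    = (inv\<^sub>a (a\<^sub>b P I (I\<^sup>-)) \<cdot> (p \<bullet>\<^sub>a (\<langle>I\<rangle> \<bullet>\<^sub>a \<langle>I\<^sup>-\<rangle>))) \<cdot> (\<langle>dm p\<rangle> \<bullet>\<^sub>a dI)"
    by (simp add: merges)
  also have "\<dots> = ((p \<bullet>\<^sub>a \<langle>I\<rangle>) \<bullet>\<^sub>a \<langle>I\<^sup>-\<rangle>) \<cdot> inv\<^sub>a (a\<^sub>b (dm p) I (I\<^sup>-)) \<cdot> (\<langle>dm p\<rangle> \<bullet>\<^sub>a dI)"
    by (subst bul.assoc_inv_natural) (simp_all add: circ.comp_assoc')
  finally have n: "inv\<^sub>a (a\<^sub>b P I (I\<^sup>-)) \<cdot> (\<langle>P\<rangle> \<bullet>\<^sub>a dI) \<cdot> (p \<bullet>\<^sub>a \<langle>I\<rangle>)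
    = ((p \<bullet>\<^sub>a \<langle>I\<rangle>) \<bullet>\<^sub>a \<langle>I\<^sup>-\<rangle>) \<cdot> inv\<^sub>a (a\<^sub>b (dm p) I (I\<^sup>-)) \<cdot> (\<langle>dm p\<rangle> \<bullet>\<^sub>a dI)" .
  let ?k = "l\<^sub>b V \<cdot> (\<langle>J\<rangle> \<bullet>\<^sub>a l\<^sub>c V)"
  have "Om P V \<cdot> (((p \<bullet>\<^sub>a \<langle>I\<rangle>) \<circle>\<^sub>a \<langle>J\<rangle>) \<bullet>\<^sub>a \<langle>V\<rangle>)
    = (\<langle>P \<bullet> I\<rangle> \<circle>\<^sub>a ?k) \<cdot> \<gamma> (P \<bullet> I) I J V \<cdot> (((inv\<^sub>a (a\<^sub>b P I (I\<^sup>-)) \<cdot> (\<langle>P\<rangle> \<bullet>\<^sub>a dI) \<cdot> (p \<bullet>\<^sub>a \<langle>I\<rangle>)) \<circle>\<^sub>a \<langle>J\<rangle>) \<bullet>\<^sub>a \<langle>V\<rangle>)"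
    by (simp add: Om_def merges)
  also have "\<dots> = (\<langle>P \<bullet> I\<rangle> \<circle>\<^sub>a ?k) \<cdot> (\<gamma> (P \<bullet> I) I J V \<cdot> ((((p \<bullet>\<^sub>a \<langle>I\<rangle>) \<bullet>\<^sub>a \<langle>I\<^sup>-\<rangle>) \<circle>\<^sub>a \<langle>J\<rangle>) \<bullet>\<^sub>a \<langle>V\<rangle>))
      \<cdot> (((inv\<^sub>a (a\<^sub>b (dm p) I (I\<^sup>-)) \<cdot> (\<langle>dm p\<rangle> \<bullet>\<^sub>a dI)) \<circle>\<^sub>a \<langle>J\<rangle>) \<bullet>\<^sub>a \<langle>V\<rangle>)"
    unfolding n by (simp add: merges)
  also have "\<dots> = ((p \<bullet>\<^sub>a \<langle>I\<rangle>) \<circle>\<^sub>a \<langle>V\<rangle>) \<cdot> Om (dm p) V"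
    by (subst gamma_natural') (simp_all add: Om_def merges)
  finally show ?thesis .
qed

text \<open>Coassociativity moves \<open>\<Delta>\<^sub>I\<close> past the comultiplication inside
  \<open>dI\<close>, so that \<open>\<gamma>\<close> appears as \<open>Gam J V\<close> and dissolves
  into constraints. This evaluates \<open>Om\<close> on the right-hand side of an antipode
  equation.\<close>

lemma Om_DeltaI:
  assumes [simp]: "ob V"
  shows "Om I V \<cdot> ((\<Delta>\<^sub>I \<circle>\<^sub>a \<langle>J\<rangle>) \<bullet>\<^sub>a \<langle>V\<rangle>) = (\<Delta>\<^sub>I \<circle>\<^sub>a \<langle>V\<rangle>) \<cdot> inv\<^sub>a (l\<^sub>c V) \<cdot> l\<^sub>b V \<cdot> (l\<^sub>c J \<bullet>\<^sub>a \<langle>V\<rangle>)"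
proof -
  let ?k = "l\<^sub>b V \<cdot> (\<langle>J\<rangle> \<bullet>\<^sub>a l\<^sub>c V)"
  have "inv\<^sub>a (a\<^sub>b I I (I\<^sup>-)) \<cdot> (\<langle>I\<rangle> \<bullet>\<^sub>a dI) \<cdot> \<Delta>\<^sub>I = (inv\<^sub>a (a\<^sub>b I I (I\<^sup>-)) \<cdot> (\<langle>I\<rangle> \<bullet>\<^sub>a (\<langle>I\<rangle> \<bullet>\<^sub>a \<phi>\<^sub>c\<^sub>0))) \<cdot> (\<langle>I\<rangle> \<bullet>\<^sub>a \<Delta>\<^sub>I) \<cdot> \<Delta>\<^sub>I"
    by (simp add: merges)
  also have "\<dots> = ((\<langle>I\<rangle> \<bullet>\<^sub>a \<langle>I\<rangle>) \<bullet>\<^sub>a \<phi>\<^sub>c\<^sub>0) \<cdot> inv\<^sub>a (a\<^sub>b I I I) \<cdot> (\<langle>I\<rangle> \<bullet>\<^sub>a \<Delta>\<^sub>I) \<cdot> \<Delta>\<^sub>I"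
    by (subst bul.assoc_inv_natural) (simp_all add: circ.comp_assoc')
  also have "\<dots> = (\<Delta>\<^sub>I \<bullet>\<^sub>a \<langle>I\<^sup>-\<rangle>) \<cdot> dI"
    by (simp add: DeltaI_coassoc[symmetric] merges)
  finally have n: "inv\<^sub>a (a\<^sub>b I I (I\<^sup>-)) \<cdot> (\<langle>I\<rangle> \<bullet>\<^sub>a dI) \<cdot> \<Delta>\<^sub>I = (\<Delta>\<^sub>I \<bullet>\<^sub>a \<langle>I\<^sup>-\<rangle>) \<cdot> dI" .
  have "Om I V \<cdot> ((\<Delta>\<^sub>I \<circle>\<^sub>a \<langle>J\<rangle>) \<bullet>\<^sub>a \<langle>V\<rangle>)
    = (\<langle>I \<bullet> I\<rangle> \<circle>\<^sub>a ?k) \<cdot> \<gamma> (I \<bullet> I) I J V \<cdot> (((inv\<^sub>a (a\<^sub>b I I (I\<^sup>-)) \<cdot> (\<langle>I\<rangle> \<bullet>\<^sub>a dI) \<cdot> \<Delta>\<^sub>I) \<circle>\<^sub>a \<langle>J\<rangle>) \<bullet>\<^sub>a \<langle>V\<rangle>)"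
    by (simp add: Om_def merges)
  also have "\<dots> = (\<langle>I \<bullet> I\<rangle> \<circle>\<^sub>a ?k) \<cdot> (\<gamma> (I \<bullet> I) I J V \<cdot> (((\<Delta>\<^sub>I \<bullet>\<^sub>a \<langle>I\<^sup>-\<rangle>) \<circle>\<^sub>a \<langle>J\<rangle>) \<bullet>\<^sub>a \<langle>V\<rangle>)) \<cdot> ((dI \<circle>\<^sub>a \<langle>J\<rangle>) \<bullet>\<^sub>a \<langle>V\<rangle>)"
    unfolding n by (simp add: merges)
  also have "\<dots> = (\<Delta>\<^sub>I \<circle>\<^sub>a \<langle>V\<rangle>) \<cdot> (\<langle>I\<rangle> \<circle>\<^sub>a ?k) \<cdot> Gam J V"
    by (subst gamma_natural') (simp_all add: Gam_def merges)
  also have "(\<langle>I\<rangle> \<circle>\<^sub>a ?k) \<cdot> Gam J V = ((\<langle>I\<rangle> \<circle>\<^sub>a l\<^sub>b V) \<cdot> inv\<^sub>a (l\<^sub>c (J \<bullet> V))) \<cdot> (l\<^sub>c J \<bullet>\<^sub>a \<langle>V\<rangle>)"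
    by (simp add: Gam_eq merges)
  also have "(\<langle>I\<rangle> \<circle>\<^sub>a l\<^sub>b V) \<cdot> inv\<^sub>a (l\<^sub>c (J \<bullet> V)) = inv\<^sub>a (l\<^sub>c V) \<cdot> l\<^sub>b V"
    by (subst circ.lunit_inv_natural) simp_all
  finally show ?thesis
    by (simp add: circ.comp_assoc')
qed

text \<open>The antipode equation, which ends in \<open>J\<close>, is tensored with \<open>V\<close>
  and pushed through \<open>Om\<close>. For a tensor product it is applied with
  \<open>V = A\<^sup>- \<bullet> J\<close>, the last argument of the inner
  \<open>\<delta>\<close>.\<close>

lemma antipode1_extend:
  assumes B: "bimonoid B" and S: "antipode1 B S" and V [simp]: "ob V"
  defines "b \<equiv> Carrier B"
  shows "((Mult B \<bullet>\<^sub>a \<langle>I\<rangle>) \<circle>\<^sub>a \<langle>V\<rangle>) \<cdot> Phi b b V \<cdot> a\<^sub>b b (b\<^sup>-) V \<cdot> (((\<langle>b\<rangle> \<bullet>\<^sub>a S) \<cdot> Comult B) \<bullet>\<^sub>a \<langle>V\<rangle>)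
    = (((Uni B \<bullet>\<^sub>a \<langle>I\<rangle>) \<cdot> \<Delta>\<^sub>I) \<circle>\<^sub>a \<langle>V\<rangle>) \<cdot> inv\<^sub>a (l\<^sub>c V) \<cdot> l\<^sub>b V \<cdot> (Counit B \<bullet>\<^sub>a \<langle>V\<rangle>)"
proof -
  note [simp] = bimonoid_simps[OF B, folded b_def]
  have [simp]: "A_ar S" "dm S = b" "cd S = b\<^sup>-"
    using S by (auto simp: antipode1_def b_def circ.in_hom_iff)
  have eq: "((Mult B \<bullet>\<^sub>a \<langle>I\<rangle>) \<circle>\<^sub>a \<langle>J\<rangle>) \<cdot> \<phi> b b \<cdot> (\<langle>b\<rangle> \<bullet>\<^sub>a S) \<cdot> Comult B
     = ((Uni B \<bullet>\<^sub>a \<langle>I\<rangle>) \<circle>\<^sub>a \<langle>J\<rangle>) \<cdot> (\<Delta>\<^sub>I \<circle>\<^sub>a \<langle>J\<rangle>) \<cdot> inv\<^sub>a (l\<^sub>c J) \<cdot> Counit B"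
    using S by (simp add: antipode1_def b_def)
  let ?s = "(\<langle>b\<rangle> \<bullet>\<^sub>a S) \<cdot> Comult B"
  have "((Mult B \<bullet>\<^sub>a \<langle>I\<rangle>) \<circle>\<^sub>a \<langle>V\<rangle>) \<cdot> Phi b b V \<cdot> a\<^sub>b b (b\<^sup>-) V \<cdot> (?s \<bullet>\<^sub>a \<langle>V\<rangle>)
    = ((Mult B \<bullet>\<^sub>a \<langle>I\<rangle>) \<circle>\<^sub>a \<langle>V\<rangle>) \<cdot> (Phi b b V \<cdot> a\<^sub>b b (b\<^sup>-) V) \<cdot> (?s \<bullet>\<^sub>a \<langle>V\<rangle>)"
    by (simp add: circ.comp_assoc')
  also have "\<dots> = (((Mult B \<bullet>\<^sub>a \<langle>I\<rangle>) \<circle>\<^sub>a \<langle>V\<rangle>) \<cdot> Om (b \<circle> b) V) \<cdot> (\<phi> b b \<bullet>\<^sub>a \<langle>V\<rangle>) \<cdot> (?s \<bullet>\<^sub>a \<langle>V\<rangle>)"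
    by (simp add: Phi_factor circ.comp_assoc')
  also have "((Mult B \<bullet>\<^sub>a \<langle>I\<rangle>) \<circle>\<^sub>a \<langle>V\<rangle>) \<cdot> Om (b \<circle> b) V = Om b V \<cdot> (((Mult B \<bullet>\<^sub>a \<langle>I\<rangle>) \<circle>\<^sub>a \<langle>J\<rangle>) \<bullet>\<^sub>a \<langle>V\<rangle>)"
    by (subst Om_natural) simp_all
  also have "(Om b V \<cdot> (((Mult B \<bullet>\<^sub>a \<langle>I\<rangle>) \<circle>\<^sub>a \<langle>J\<rangle>) \<bullet>\<^sub>a \<langle>V\<rangle>)) \<cdot> (\<phi> b b \<bullet>\<^sub>a \<langle>V\<rangle>) \<cdot> (?s \<bullet>\<^sub>a \<langle>V\<rangle>)
    = Om b V \<cdot> ((((Mult B \<bullet>\<^sub>a \<langle>I\<rangle>) \<circle>\<^sub>a \<langle>J\<rangle>) \<cdot> \<phi> b b \<cdot> ?s) \<bullet>\<^sub>a \<langle>V\<rangle>)"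
    by (simp add: merges)
  also have "\<dots> = (Om b V \<cdot> (((Uni B \<bullet>\<^sub>a \<langle>I\<rangle>) \<circle>\<^sub>a \<langle>J\<rangle>) \<bullet>\<^sub>a \<langle>V\<rangle>)) \<cdot> ((\<Delta>\<^sub>I \<circle>\<^sub>a \<langle>J\<rangle>) \<bullet>\<^sub>a \<langle>V\<rangle>) \<cdot> ((inv\<^sub>a (l\<^sub>c J) \<cdot> Counit B) \<bullet>\<^sub>a \<langle>V\<rangle>)"
    unfolding eq by (simp add: merges)
  also have "\<dots> = ((Uni B \<bullet>\<^sub>a \<langle>I\<rangle>) \<circle>\<^sub>a \<langle>V\<rangle>) \<cdot> (Om I V \<cdot> ((\<Delta>\<^sub>I \<circle>\<^sub>a \<langle>J\<rangle>) \<bullet>\<^sub>a \<langle>V\<rangle>)) \<cdot> ((inv\<^sub>a (l\<^sub>c J) \<cdot> Counit B) \<bullet>\<^sub>a \<langle>V\<rangle>)"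
    by (subst Om_natural) (simp_all add: circ.comp_assoc')
  also have "\<dots> = (((Uni B \<bullet>\<^sub>a \<langle>I\<rangle>) \<cdot> \<Delta>\<^sub>I) \<circle>\<^sub>a \<langle>V\<rangle>) \<cdot> inv\<^sub>a (l\<^sub>c V) \<cdot> l\<^sub>b V \<cdot> (Counit B \<bullet>\<^sub>a \<langle>V\<rangle>)"
    by (simp add: Om_DeltaI merges)
  finally show ?thesis .
qed

text \<open>R14 at \<open>Z = I\<close> and \<open>V = J\<close>, relating \<open>\<phi>\<close> at
  \<open>A \<bullet> B\<close> to a nested pair of \<open>\<delta>\<close>. The rest is coherence:
  the units inserted for the inner arrow are traded for those that \<open>\<phi>\<close>
  inserts.\<close>

lemma delta_Phi:
  assumes [simp]: "ob A" "ob B"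
  shows "\<delta> A ((B \<circle> B) \<bullet> I) A J \<cdot> (\<langle>A\<rangle> \<bullet>\<^sub>a Phi B B (A\<^sup>- \<bullet> J)) \<cdot> (\<langle>A\<rangle> \<bullet>\<^sub>a (\<langle>B\<rangle> \<bullet>\<^sub>a (\<langle>B\<^sup>-\<rangle> \<bullet>\<^sub>a inv\<^sub>a (r\<^sub>b (A\<^sup>-)))))
    = ((a\<^sub>b (A \<circle> A) (B \<circle> B) I \<cdot> (\<zeta> A B A B \<bullet>\<^sub>a \<langle>I\<rangle>)) \<circle>\<^sub>a \<langle>J\<rangle>) \<cdot> \<phi> (A \<bullet> B) (A \<bullet> B)
      \<cdot> (\<langle>A \<bullet> B\<rangle> \<bullet>\<^sub>a \<phi>\<^sub>b B A) \<cdot> inv\<^sub>a (a\<^sub>b A B (B\<^sup>- \<bullet> A\<^sup>-))"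
proof -
  let ?V = "A\<^sup>- \<bullet> J" and ?AB = "A \<bullet> B" and ?BA = "B\<^sup>- \<bullet> A\<^sup>-"
  let ?i = "inv\<^sub>a (l\<^sub>c (B\<^sup>- \<bullet> ?V))" and ?r = "\<langle>B\<^sup>-\<rangle> \<bullet>\<^sub>a inv\<^sub>a (r\<^sub>b (A\<^sup>-))"
  let ?u = "(\<phi>\<^sub>b B A \<bullet>\<^sub>a \<langle>J\<rangle>) \<cdot> inv\<^sub>a (a\<^sub>b (B\<^sup>-) (A\<^sup>-) J)"
  let ?z = "(a\<^sub>b (A \<circle> A) (B \<circle> B) I \<circle>\<^sub>a \<langle>J\<rangle>) \<cdot> ((\<zeta> A B A B \<bullet>\<^sub>a \<langle>I\<rangle>) \<circle>\<^sub>a \<langle>J\<rangle>)"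
  have ia: "inv\<^sub>a (a\<^sub>b A B X) \<cdot> (\<langle>A\<rangle> \<bullet>\<^sub>a (\<langle>B\<rangle> \<bullet>\<^sub>a f)) = (\<langle>?AB\<rangle> \<bullet>\<^sub>a f) \<cdot> inv\<^sub>a (a\<^sub>b A B (dm f))"
    if "A_ar f" "cd f = X" for f X
    using that by (subst bul.assoc_inv_natural) auto
  have "\<delta> A ((B \<circle> B) \<bullet> I) A J \<cdot> (\<langle>A\<rangle> \<bullet>\<^sub>a Phi B B ?V) \<cdot> (\<langle>A\<rangle> \<bullet>\<^sub>a (\<langle>B\<rangle> \<bullet>\<^sub>a ?r))
    = (\<delta> A ((B \<circle> B) \<bullet> I) A J \<cdot> (\<langle>A\<rangle> \<bullet>\<^sub>a \<delta> B I B ?V)) \<cdot> (\<langle>A\<rangle> \<bullet>\<^sub>a (\<langle>B\<rangle> \<bullet>\<^sub>a (?i \<cdot> ?r)))"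
    by (simp add: Phi_def merges)
  also have "\<dots> = ?z \<cdot> \<delta> ?AB I ?AB J \<cdot> (\<langle>?AB\<rangle> \<bullet>\<^sub>a (\<langle>I\<rangle> \<circle>\<^sub>a ?u))
      \<cdot> (inv\<^sub>a (a\<^sub>b A B (I \<circle> (B\<^sup>- \<bullet> ?V))) \<cdot> (\<langle>A\<rangle> \<bullet>\<^sub>a (\<langle>B\<rangle> \<bullet>\<^sub>a (?i \<cdot> ?r))))"
    by (subst R14) (simp_all add: merges)
  also have "\<dots> = ?z \<cdot> \<delta> ?AB I ?AB J \<cdot> (\<langle>?AB\<rangle> \<bullet>\<^sub>a (((\<langle>I\<rangle> \<circle>\<^sub>a ?u) \<cdot> ?i) \<cdot> ?r)) \<cdot> inv\<^sub>a (a\<^sub>b A B ?BA)"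
    by (subst ia) (simp_all add: merges)
  also have "(\<langle>I\<rangle> \<circle>\<^sub>a ?u) \<cdot> ?i = inv\<^sub>a (l\<^sub>c (?AB\<^sup>- \<bullet> J)) \<cdot> ?u"
    by (subst circ.lunit_inv_natural) simp_all
  also have "(inv\<^sub>a (l\<^sub>c (?AB\<^sup>- \<bullet> J)) \<cdot> ?u) \<cdot> ?r = inv\<^sub>a (l\<^sub>c (?AB\<^sup>- \<bullet> J)) \<cdot> inv\<^sub>a (r\<^sub>b (?AB\<^sup>-)) \<cdot> \<phi>\<^sub>b B A"
  proof -
    have "r\<^sub>b ?BA = (\<langle>B\<^sup>-\<rangle> \<bullet>\<^sub>a r\<^sub>b (A\<^sup>-)) \<cdot> a\<^sub>b (B\<^sup>-) (A\<^sup>-) J"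
      by (simp add: bul.runit_tensor)
    then have "inv\<^sub>a (r\<^sub>b ?BA) = inv\<^sub>a (a\<^sub>b (B\<^sup>-) (A\<^sup>-) J) \<cdot> ?r"
      by (simp add: circ.inv_comp bul.inv_tensor)
    moreover have "(\<phi>\<^sub>b B A \<bullet>\<^sub>a \<langle>J\<rangle>) \<cdot> inv\<^sub>a (r\<^sub>b ?BA) = inv\<^sub>a (r\<^sub>b (?AB\<^sup>-)) \<cdot> \<phi>\<^sub>b B A"
      by (subst bul.runit_inv_natural) simp_all
    ultimately show ?thesis
      by (simp add: circ.comp_assoc')
  qed
  also have "inv\<^sub>a (l\<^sub>c (?AB\<^sup>- \<bullet> J)) \<cdot> inv\<^sub>a (r\<^sub>b (?AB\<^sup>-)) \<cdot> \<phi>\<^sub>b B A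
    = ((\<langle>I\<rangle> \<circle>\<^sub>a inv\<^sub>a (r\<^sub>b (?AB\<^sup>-))) \<cdot> inv\<^sub>a (l\<^sub>c (?AB\<^sup>-))) \<cdot> \<phi>\<^sub>b B A"
    using circ.lunit_inv_natural[of "inv\<^sub>a (r\<^sub>b (?AB\<^sup>-))" "?AB\<^sup>- \<bullet> J"] by (simp add: circ.comp_assoc'[symmetric])
  finally show ?thesis
    by (simp add: phi_eq merges)
qed

text \<open>Once the unit constraints in \<open>\<phi>\<close> have been moved past
  \<open>\<phi>\<^sub>b\<^sub>0\<close>, R18 evaluates this equation followed by the isomorphism
  \<open>?h\<close>.\<close>

lemma antipode1_unit: "antipode1 unit_bimonoid \<phi>\<^sub>b\<^sub>0"
proof -
  let ?h = "l\<^sub>c J \<cdot> (l\<^sub>b I \<circle>\<^sub>a \<langle>J\<rangle>)"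
  have n: "((\<langle>I\<rangle> \<circle>\<^sub>a inv\<^sub>a (r\<^sub>b (J\<^sup>-))) \<cdot> inv\<^sub>a (l\<^sub>c (J\<^sup>-))) \<cdot> \<phi>\<^sub>b\<^sub>0 = (\<langle>I\<rangle> \<circle>\<^sub>a ((\<phi>\<^sub>b\<^sub>0 \<bullet>\<^sub>a \<langle>J\<rangle>) \<cdot> \<Delta>\<^sub>J)) \<cdot> inv\<^sub>a (l\<^sub>c J)"
  proof -
    have "(\<phi>\<^sub>b\<^sub>0 \<bullet>\<^sub>a \<langle>J\<rangle>) \<cdot> \<Delta>\<^sub>J = inv\<^sub>a (r\<^sub>b (J\<^sup>-)) \<cdot> \<phi>\<^sub>b\<^sub>0"
      unfolding bul.lunit_unit by (subst bul.runit_inv_natural) simp_all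
    moreover have "inv\<^sub>a (l\<^sub>c (J\<^sup>-)) \<cdot> \<phi>\<^sub>b\<^sub>0 = (\<langle>I\<rangle> \<circle>\<^sub>a \<phi>\<^sub>b\<^sub>0) \<cdot> inv\<^sub>a (l\<^sub>c J)"
      by (subst circ.lunit_inv_natural) simp_all
    ultimately show ?thesis
      by (simp add: merges)
  qed
  have "?h \<cdot> ((m\<^sub>J \<bullet>\<^sub>a \<langle>I\<rangle>) \<circle>\<^sub>a \<langle>J\<rangle>) \<cdot> \<phi> J J \<cdot> (\<langle>J\<rangle> \<bullet>\<^sub>a \<phi>\<^sub>b\<^sub>0) \<cdot> \<Delta>\<^sub>J
    = ?h \<cdot> ((m\<^sub>J \<bullet>\<^sub>a \<langle>I\<rangle>) \<circle>\<^sub>a \<langle>J\<rangle>) \<cdot> \<delta> J I J J \<cdot> (\<langle>J\<rangle> \<bullet>\<^sub>a (((\<langle>I\<rangle> \<circle>\<^sub>a inv\<^sub>a (r\<^sub>b (J\<^sup>-))) \<cdot> inv\<^sub>a (l\<^sub>c (J\<^sup>-))) \<cdot> \<phi>\<^sub>b\<^sub>0)) \<cdot> \<Delta>\<^sub>J"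
    by (simp add: phi_eq merges)
  also have "\<dots> = (l\<^sub>c J \<cdot> (l\<^sub>b I \<circle>\<^sub>a \<langle>J\<rangle>) \<cdot> ((m\<^sub>J \<bullet>\<^sub>a \<langle>I\<rangle>) \<circle>\<^sub>a \<langle>J\<rangle>) \<cdot> \<delta> J I J J
      \<cdot> (\<langle>J\<rangle> \<bullet>\<^sub>a (\<langle>I\<rangle> \<circle>\<^sub>a ((\<phi>\<^sub>b\<^sub>0 \<bullet>\<^sub>a \<langle>J\<rangle>) \<cdot> \<Delta>\<^sub>J)))) \<cdot> (\<langle>J\<rangle> \<bullet>\<^sub>a inv\<^sub>a (l\<^sub>c J)) \<cdot> \<Delta>\<^sub>J"
    unfolding n by (simp add: merges)
  also have "\<dots> = \<langle>J\<rangle>"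
    unfolding R18 by (simp add: merges)
  also have "\<dots> = (l\<^sub>c J \<cdot> ((l\<^sub>b I \<cdot> (\<epsilon>\<^sub>I \<bullet>\<^sub>a \<langle>I\<rangle>) \<cdot> \<Delta>\<^sub>I) \<circle>\<^sub>a \<langle>J\<rangle>)) \<cdot> inv\<^sub>a (l\<^sub>c J)"
    unfolding DeltaI_counit by simp
  also have "\<dots> = ?h \<cdot> ((\<epsilon>\<^sub>I \<bullet>\<^sub>a \<langle>I\<rangle>) \<circle>\<^sub>a \<langle>J\<rangle>) \<cdot> (\<Delta>\<^sub>I \<circle>\<^sub>a \<langle>J\<rangle>) \<cdot> inv\<^sub>a (l\<^sub>c J)"
    by (simp add: merges)
  finally have eq: "?h \<cdot> ((m\<^sub>J \<bullet>\<^sub>a \<langle>I\<rangle>) \<circle>\<^sub>a \<langle>J\<rangle>) \<cdot> \<phi> J J \<cdot> (\<langle>J\<rangle> \<bullet>\<^sub>a \<phi>\<^sub>b\<^sub>0) \<cdot> \<Delta>\<^sub>J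
    = ?h \<cdot> ((\<epsilon>\<^sub>I \<bullet>\<^sub>a \<langle>I\<rangle>) \<circle>\<^sub>a \<langle>J\<rangle>) \<cdot> (\<Delta>\<^sub>I \<circle>\<^sub>a \<langle>J\<rangle>) \<cdot> inv\<^sub>a (l\<^sub>c J)" .
  have "((m\<^sub>J \<bullet>\<^sub>a \<langle>I\<rangle>) \<circle>\<^sub>a \<langle>J\<rangle>) \<cdot> \<phi> J J \<cdot> (\<langle>J\<rangle> \<bullet>\<^sub>a \<phi>\<^sub>b\<^sub>0) \<cdot> \<Delta>\<^sub>J
    = ((\<epsilon>\<^sub>I \<bullet>\<^sub>a \<langle>I\<rangle>) \<circle>\<^sub>a \<langle>J\<rangle>) \<cdot> (\<Delta>\<^sub>I \<circle>\<^sub>a \<langle>J\<rangle>) \<cdot> inv\<^sub>a (l\<^sub>c J)"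
    by (rule circ.iso_cancel_left[OF _ eq]) simp_all
  then show ?thesis
    by (simp add: antipode1_def phi_bul0_hom)
qed

end

section \<open>The first antipode equation for a tensor product\<close>

locale braided_reversion_fragment = bullet_braided_duoidal_category D \<sigma> + reversion_fragment D R
  for D :: "('o, 'm) duoidal_data" and \<sigma> :: "'o \<Rightarrow> 'o \<Rightarrow> 'm" and R :: "('o, 'm) reversion_data"
begin

theorem antipode1_tensor:
  assumes A: "bimonoid A" "antipode1 A S" and B: "bimonoid B" "antipode1 B U"
  defines "a \<equiv> Carrier A" and "b \<equiv> Carrier B"
  shows "antipode1 (bimonoid_tensor A B) (\<phi>\<^sub>b b a \<cdot> \<sigma> (a\<^sup>-) (b\<^sup>-) \<cdot> (S \<bullet>\<^sub>a U))"
proof -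
  note [simp] = A(1) B(1) bimonoid_simps[OF A(1), folded a_def] bimonoid_simps[OF B(1), folded b_def]
  have [simp]: "Carrier A = a" "Carrier B = b"
    by (simp_all add: a_def b_def)
  have [simp]: "A_ar S" "dm S = a" "cd S = a\<^sup>-" "A_ar U" "dm U = b" "cd U = b\<^sup>-"
    using A B by (auto simp: antipode1_def circ.in_hom_iff)
  have eqA: "((Mult A \<bullet>\<^sub>a \<langle>I\<rangle>) \<circle>\<^sub>a \<langle>J\<rangle>) \<cdot> \<phi> a a \<cdot> (\<langle>a\<rangle> \<bullet>\<^sub>a S) \<cdot> Comult A
     = ((Uni A \<bullet>\<^sub>a \<langle>I\<rangle>) \<circle>\<^sub>a \<langle>J\<rangle>) \<cdot> (\<Delta>\<^sub>I \<circle>\<^sub>a \<langle>J\<rangle>) \<cdot> inv\<^sub>a (l\<^sub>c J) \<cdot> Counit A"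
    using A(2) by (simp add: antipode1_def)
  let ?ab = "a \<bullet> b" and ?V = "a\<^sup>- \<bullet> J"
  let ?P = "bimonoid_tensor A B"
  define fa where "fa = (\<langle>a\<rangle> \<bullet>\<^sub>a S) \<cdot> Comult A"
  define fb where "fb = (\<langle>b\<rangle> \<bullet>\<^sub>a U) \<cdot> Comult B"
  define ir where "ir = inv\<^sub>a (r\<^sub>b (a\<^sup>-))"
  define iV where "iV = inv\<^sub>a (l\<^sub>c ?V)"
  \<comment> \<open>What the antipode equation of \<open>B\<close> leaves behind: the unit of
    \<open>B\<close> beside a spare copy of \<open>I\<close>.\<close>
  define w where "w = (Uni B \<bullet>\<^sub>a \<langle>I\<rangle>) \<cdot> \<Delta>\<^sub>I"
  have [simp]: "A_ar fa" "dm fa = a" "cd fa = a \<bullet> a\<^sup>-" "A_ar fb" "dm fb = b" "cd fb = b \<bullet> b\<^sup>-"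
    "A_ar ir" "dm ir = a\<^sup>-" "cd ir = ?V" "A_ar iV" "dm iV = ?V" "cd iV = I \<circle> ?V"
    "A_ar w" "dm w = I" "cd w = b \<bullet> I"
    by (simp_all add: fa_def fb_def ir_def iV_def w_def)
  \<comment> \<open>\<open>mid_braiding\<close> fuses the two crossings, so that
    \<open>a\<^sup>-\<close> passes over all of \<open>b \<bullet> b\<^sup>-\<close> at once; by
    naturality \<open>fb\<close> can then be applied after the crossing, with
    \<open>a\<^sup>-\<close> as spectator.\<close>
  have Q: "a\<^sub>b a b (b\<^sup>- \<bullet> a\<^sup>-) \<cdot> (\<langle>?ab\<rangle> \<bullet>\<^sub>a (\<sigma> (a\<^sup>-) (b\<^sup>-) \<cdot> (S \<bullet>\<^sub>a U))) \<cdot> Comult ?P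
    = (\<langle>a\<rangle> \<bullet>\<^sub>a (a\<^sub>b b (b\<^sup>-) (a\<^sup>-) \<cdot> (fb \<bullet>\<^sub>a \<langle>a\<^sup>-\<rangle>) \<cdot> \<sigma> (a\<^sup>-) b)) \<cdot> a\<^sub>b a (a\<^sup>-) b \<cdot> (fa \<bullet>\<^sub>a \<langle>b\<rangle>)"
  proof -
    have "a\<^sub>b a b (b\<^sup>- \<bullet> a\<^sup>-) \<cdot> (\<langle>?ab\<rangle> \<bullet>\<^sub>a (\<sigma> (a\<^sup>-) (b\<^sup>-) \<cdot> (S \<bullet>\<^sub>a U))) \<cdot> Comult ?P
      = a\<^sub>b a b (b\<^sup>- \<bullet> a\<^sup>-) \<cdot> (\<langle>?ab\<rangle> \<bullet>\<^sub>a \<sigma> (a\<^sup>-) (b\<^sup>-)) \<cdot> (((\<langle>a\<rangle> \<bullet>\<^sub>a \<langle>b\<rangle>) \<bullet>\<^sub>a (S \<bullet>\<^sub>a U)) \<cdot> bul.mid a a b b) \<cdot> (Comult A \<bullet>\<^sub>a Comult B)"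
      by (simp add: merges)
    also have "((\<langle>a\<rangle> \<bullet>\<^sub>a \<langle>b\<rangle>) \<bullet>\<^sub>a (S \<bullet>\<^sub>a U)) \<cdot> bul.mid a a b b = bul.mid a (a\<^sup>-) b (b\<^sup>-) \<cdot> ((\<langle>a\<rangle> \<bullet>\<^sub>a S) \<bullet>\<^sub>a (\<langle>b\<rangle> \<bullet>\<^sub>a U))"
      by (subst bul.mid_natural) simp_all
    also have "a\<^sub>b a b (b\<^sup>- \<bullet> a\<^sup>-) \<cdot> (\<langle>?ab\<rangle> \<bullet>\<^sub>a \<sigma> (a\<^sup>-) (b\<^sup>-)) \<cdot> (bul.mid a (a\<^sup>-) b (b\<^sup>-) \<cdot> ((\<langle>a\<rangle> \<bullet>\<^sub>a S) \<bullet>\<^sub>a (\<langle>b\<rangle> \<bullet>\<^sub>a U))) \<cdot> (Comult A \<bullet>\<^sub>a Comult B)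
      = (a\<^sub>b a b (b\<^sup>- \<bullet> a\<^sup>-) \<cdot> (\<langle>?ab\<rangle> \<bullet>\<^sub>a \<sigma> (a\<^sup>-) (b\<^sup>-)) \<cdot> bul.mid a (a\<^sup>-) b (b\<^sup>-)) \<cdot> (fa \<bullet>\<^sub>a fb)"
      by (simp add: merges fa_def fb_def)
    also have "\<dots> = (\<langle>a\<rangle> \<bullet>\<^sub>a a\<^sub>b b (b\<^sup>-) (a\<^sup>-)) \<cdot> (\<langle>a\<rangle> \<bullet>\<^sub>a \<sigma> (a\<^sup>-) (b \<bullet> b\<^sup>-))
        \<cdot> (a\<^sub>b a (a\<^sup>-) (b \<bullet> b\<^sup>-) \<cdot> ((\<langle>a\<rangle> \<bullet>\<^sub>a \<langle>a\<^sup>-\<rangle>) \<bullet>\<^sub>a fb)) \<cdot> (fa \<bullet>\<^sub>a \<langle>b\<rangle>)"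
      by (subst bul.mid_braiding) (simp_all add: merges)
    also have "\<dots> = (\<langle>a\<rangle> \<bullet>\<^sub>a (a\<^sub>b b (b\<^sup>-) (a\<^sup>-) \<cdot> (\<sigma> (a\<^sup>-) (b \<bullet> b\<^sup>-) \<cdot> (\<langle>a\<^sup>-\<rangle> \<bullet>\<^sub>a fb)))) \<cdot> a\<^sub>b a (a\<^sup>-) b \<cdot> (fa \<bullet>\<^sub>a \<langle>b\<rangle>)"
      by (subst bul.assoc_natural') (simp_all add: merges)
    also have "\<sigma> (a\<^sup>-) (b \<bullet> b\<^sup>-) \<cdot> (\<langle>a\<^sup>-\<rangle> \<bullet>\<^sub>a fb) = (fb \<bullet>\<^sub>a \<langle>a\<^sup>-\<rangle>) \<cdot> \<sigma> (a\<^sup>-) b"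
      by (subst bul.braiding_natural') simp_all
    finally show ?thesis .
  qed
  \<comment> \<open>Once the counit has turned \<open>b\<close> into \<open>J\<close>, the crossing
    with \<open>a\<^sup>-\<close> is one with the unit and vanishes.\<close>
  have unit: "l\<^sub>b ?V \<cdot> (Counit B \<bullet>\<^sub>a \<langle>?V\<rangle>) \<cdot> (\<langle>b\<rangle> \<bullet>\<^sub>a ir) \<cdot> \<sigma> (a\<^sup>-) b = ir \<cdot> r\<^sub>b (a\<^sup>-) \<cdot> (\<langle>a\<^sup>-\<rangle> \<bullet>\<^sub>a Counit B)"
  proof -
    have "l\<^sub>b ?V \<cdot> (Counit B \<bullet>\<^sub>a \<langle>?V\<rangle>) \<cdot> (\<langle>b\<rangle> \<bullet>\<^sub>a ir) \<cdot> \<sigma> (a\<^sup>-) b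
      = (l\<^sub>b ?V \<cdot> (\<langle>J\<rangle> \<bullet>\<^sub>a ir)) \<cdot> ((Counit B \<bullet>\<^sub>a \<langle>a\<^sup>-\<rangle>) \<cdot> \<sigma> (a\<^sup>-) b)"
      by (simp add: merges)
    also have "(Counit B \<bullet>\<^sub>a \<langle>a\<^sup>-\<rangle>) \<cdot> \<sigma> (a\<^sup>-) b = \<sigma> (a\<^sup>-) J \<cdot> (\<langle>a\<^sup>-\<rangle> \<bullet>\<^sub>a Counit B)"
      by (subst bul.braiding_natural') simp_all
    also have "l\<^sub>b ?V \<cdot> (\<langle>J\<rangle> \<bullet>\<^sub>a ir) = ir \<cdot> l\<^sub>b (a\<^sup>-)"
      unfolding ir_def by (subst bul.lunit_natural') simp_all
    also have "(ir \<cdot> l\<^sub>b (a\<^sup>-)) \<cdot> (\<sigma> (a\<^sup>-) J \<cdot> (\<langle>a\<^sup>-\<rangle> \<bullet>\<^sub>a Counit B)) = ir \<cdot> (l\<^sub>b (a\<^sup>-) \<cdot> \<sigma> (a\<^sup>-) J) \<cdot> (\<langle>a\<^sup>-\<rangle> \<bullet>\<^sub>a Counit B)"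
      by (simp add: circ.comp_assoc')
    finally show ?thesis
      by (simp add: bul.braiding_unit)
  qed
  let ?m = "inv\<^sub>a (a\<^sub>b a b I) \<cdot> (Mult A \<bullet>\<^sub>a (Mult B \<bullet>\<^sub>a \<langle>I\<rangle>))"
  let ?\<Sigma> = "\<phi>\<^sub>b b a \<cdot> \<sigma> (a\<^sup>-) (b\<^sup>-) \<cdot> (S \<bullet>\<^sub>a U)"
  \<comment> \<open>Splits off the associator and the \<open>\<zeta>\<close> that stand in front of
    \<open>\<phi>\<close> in \<open>delta_Phi\<close>.\<close>
  have m: "Mult ?P \<bullet>\<^sub>a \<langle>I\<rangle> = ?m \<cdot> a\<^sub>b (a \<circle> a) (b \<circle> b) I \<cdot> (\<zeta> a b a b \<bullet>\<^sub>a \<langle>I\<rangle>)"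
  proof -
    have "?m \<cdot> a\<^sub>b (a \<circle> a) (b \<circle> b) I \<cdot> (\<zeta> a b a b \<bullet>\<^sub>a \<langle>I\<rangle>)
      = inv\<^sub>a (a\<^sub>b a b I) \<cdot> ((Mult A \<bullet>\<^sub>a (Mult B \<bullet>\<^sub>a \<langle>I\<rangle>)) \<cdot> a\<^sub>b (a \<circle> a) (b \<circle> b) I) \<cdot> (\<zeta> a b a b \<bullet>\<^sub>a \<langle>I\<rangle>)"
      by (simp add: circ.comp_assoc')
    also have "(Mult A \<bullet>\<^sub>a (Mult B \<bullet>\<^sub>a \<langle>I\<rangle>)) \<cdot> a\<^sub>b (a \<circle> a) (b \<circle> b) I = a\<^sub>b a b I \<cdot> ((Mult A \<bullet>\<^sub>a Mult B) \<bullet>\<^sub>a \<langle>I\<rangle>)"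
      by (subst bul.assoc_natural') simp_all
    finally show ?thesis
      by (simp add: merges)
  qed
  have "((Mult ?P \<bullet>\<^sub>a \<langle>I\<rangle>) \<circle>\<^sub>a \<langle>J\<rangle>) \<cdot> \<phi> ?ab ?ab \<cdot> (\<langle>?ab\<rangle> \<bullet>\<^sub>a ?\<Sigma>) \<cdot> Comult ?P
    = (?m \<circle>\<^sub>a \<langle>J\<rangle>) \<cdot> (((a\<^sub>b (a \<circle> a) (b \<circle> b) I \<cdot> (\<zeta> a b a b \<bullet>\<^sub>a \<langle>I\<rangle>)) \<circle>\<^sub>a \<langle>J\<rangle>) \<cdot> \<phi> ?ab ?ab \<cdot> (\<langle>?ab\<rangle> \<bullet>\<^sub>a \<phi>\<^sub>b b a) \<cdot> inv\<^sub>a (a\<^sub>b a b (b\<^sup>- \<bullet> a\<^sup>-)))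
      \<cdot> (a\<^sub>b a b (b\<^sup>- \<bullet> a\<^sup>-) \<cdot> (\<langle>?ab\<rangle> \<bullet>\<^sub>a (\<sigma> (a\<^sup>-) (b\<^sup>-) \<cdot> (S \<bullet>\<^sub>a U))) \<cdot> Comult ?P)"
    unfolding m by (simp add: merges)
  also have "\<dots> = (?m \<circle>\<^sub>a \<langle>J\<rangle>)
      \<cdot> (\<delta> a ((b \<circle> b) \<bullet> I) a J \<cdot> (\<langle>a\<rangle> \<bullet>\<^sub>a Phi b b ?V) \<cdot> (\<langle>a\<rangle> \<bullet>\<^sub>a (\<langle>b\<rangle> \<bullet>\<^sub>a (\<langle>b\<^sup>-\<rangle> \<bullet>\<^sub>a ir))))
      \<cdot> ((\<langle>a\<rangle> \<bullet>\<^sub>a (a\<^sub>b b (b\<^sup>-) (a\<^sup>-) \<cdot> (fb \<bullet>\<^sub>a \<langle>a\<^sup>-\<rangle>) \<cdot> \<sigma> (a\<^sup>-) b)) \<cdot> a\<^sub>b a (a\<^sup>-) b \<cdot> (fa \<bullet>\<^sub>a \<langle>b\<rangle>))"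
    unfolding Q ir_def by (subst delta_Phi) simp_all
  also have "\<dots> = (inv\<^sub>a (a\<^sub>b a b I) \<circle>\<^sub>a \<langle>J\<rangle>) \<cdot> ((Mult A \<bullet>\<^sub>a \<langle>b \<bullet> I\<rangle>) \<circle>\<^sub>a \<langle>J\<rangle>)
      \<cdot> ((((\<langle>a\<rangle> \<circle>\<^sub>a \<langle>a\<rangle>) \<bullet>\<^sub>a (Mult B \<bullet>\<^sub>a \<langle>I\<rangle>)) \<circle>\<^sub>a \<langle>J\<rangle>) \<cdot> \<delta> a ((b \<circle> b) \<bullet> I) a J)
      \<cdot> (\<langle>a\<rangle> \<bullet>\<^sub>a (Phi b b ?V \<cdot> ((\<langle>b\<rangle> \<bullet>\<^sub>a (\<langle>b\<^sup>-\<rangle> \<bullet>\<^sub>a ir)) \<cdot> a\<^sub>b b (b\<^sup>-) (a\<^sup>-)) \<cdot> (fb \<bullet>\<^sub>a \<langle>a\<^sup>-\<rangle>) \<cdot> \<sigma> (a\<^sup>-) b))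
      \<cdot> a\<^sub>b a (a\<^sup>-) b \<cdot> (fa \<bullet>\<^sub>a \<langle>b\<rangle>)"
    by (simp add: merges)
  \<comment> \<open>Naturality of the outer \<open>\<delta>\<close> in its second argument lets
    \<open>Mult B\<close> reach the inner arrow.\<close>
  also have "(((\<langle>a\<rangle> \<circle>\<^sub>a \<langle>a\<rangle>) \<bullet>\<^sub>a (Mult B \<bullet>\<^sub>a \<langle>I\<rangle>)) \<circle>\<^sub>a \<langle>J\<rangle>) \<cdot> \<delta> a ((b \<circle> b) \<bullet> I) a J
    = \<delta> a (b \<bullet> I) a J \<cdot> (\<langle>a\<rangle> \<bullet>\<^sub>a ((Mult B \<bullet>\<^sub>a \<langle>I\<rangle>) \<circle>\<^sub>a (\<langle>a\<^sup>-\<rangle> \<bullet>\<^sub>a \<langle>J\<rangle>)))"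
    by (subst delta_natural') simp_all
  also have "(\<langle>b\<rangle> \<bullet>\<^sub>a (\<langle>b\<^sup>-\<rangle> \<bullet>\<^sub>a ir)) \<cdot> a\<^sub>b b (b\<^sup>-) (a\<^sup>-) = a\<^sub>b b (b\<^sup>-) ?V \<cdot> ((\<langle>b\<rangle> \<bullet>\<^sub>a \<langle>b\<^sup>-\<rangle>) \<bullet>\<^sub>a ir)"
    by (subst bul.assoc_natural') simp_all
  also have "(inv\<^sub>a (a\<^sub>b a b I) \<circle>\<^sub>a \<langle>J\<rangle>) \<cdot> ((Mult A \<bullet>\<^sub>a \<langle>b \<bullet> I\<rangle>) \<circle>\<^sub>a \<langle>J\<rangle>)
      \<cdot> (\<delta> a (b \<bullet> I) a J \<cdot> (\<langle>a\<rangle> \<bullet>\<^sub>a ((Mult B \<bullet>\<^sub>a \<langle>I\<rangle>) \<circle>\<^sub>a (\<langle>a\<^sup>-\<rangle> \<bullet>\<^sub>a \<langle>J\<rangle>))))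
      \<cdot> (\<langle>a\<rangle> \<bullet>\<^sub>a (Phi b b ?V \<cdot> (a\<^sub>b b (b\<^sup>-) ?V \<cdot> ((\<langle>b\<rangle> \<bullet>\<^sub>a \<langle>b\<^sup>-\<rangle>) \<bullet>\<^sub>a ir)) \<cdot> (fb \<bullet>\<^sub>a \<langle>a\<^sup>-\<rangle>) \<cdot> \<sigma> (a\<^sup>-) b))
      \<cdot> a\<^sub>b a (a\<^sup>-) b \<cdot> (fa \<bullet>\<^sub>a \<langle>b\<rangle>)
    = (inv\<^sub>a (a\<^sub>b a b I) \<circle>\<^sub>a \<langle>J\<rangle>) \<cdot> ((Mult A \<bullet>\<^sub>a \<langle>b \<bullet> I\<rangle>) \<circle>\<^sub>a \<langle>J\<rangle>) \<cdot> \<delta> a (b \<bullet> I) a J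
      \<cdot> (\<langle>a\<rangle> \<bullet>\<^sub>a ((((Mult B \<bullet>\<^sub>a \<langle>I\<rangle>) \<circle>\<^sub>a \<langle>?V\<rangle>) \<cdot> Phi b b ?V \<cdot> a\<^sub>b b (b\<^sup>-) ?V \<cdot> (fb \<bullet>\<^sub>a \<langle>?V\<rangle>)) \<cdot> (\<langle>b\<rangle> \<bullet>\<^sub>a ir) \<cdot> \<sigma> (a\<^sup>-) b))
      \<cdot> a\<^sub>b a (a\<^sup>-) b \<cdot> (fa \<bullet>\<^sub>a \<langle>b\<rangle>)"
    by (simp add: merges)
  \<comment> \<open>The inner arrow is now the left side of the antipode equation of
    \<open>B\<close> with spectator \<open>?V\<close>.\<close>
  also have "((Mult B \<bullet>\<^sub>a \<langle>I\<rangle>) \<circle>\<^sub>a \<langle>?V\<rangle>) \<cdot> Phi b b ?V \<cdot> a\<^sub>b b (b\<^sup>-) ?V \<cdot> (fb \<bullet>\<^sub>a \<langle>?V\<rangle>)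
    = (w \<circle>\<^sub>a \<langle>?V\<rangle>) \<cdot> iV \<cdot> l\<^sub>b ?V \<cdot> (Counit B \<bullet>\<^sub>a \<langle>?V\<rangle>)"
    using antipode1_extend[OF B, of ?V] by (simp add: fb_def w_def iV_def)
  also have "((w \<circle>\<^sub>a \<langle>?V\<rangle>) \<cdot> iV \<cdot> l\<^sub>b ?V \<cdot> (Counit B \<bullet>\<^sub>a \<langle>?V\<rangle>)) \<cdot> (\<langle>b\<rangle> \<bullet>\<^sub>a ir) \<cdot> \<sigma> (a\<^sup>-) b
    = (w \<circle>\<^sub>a \<langle>?V\<rangle>) \<cdot> iV \<cdot> (l\<^sub>b ?V \<cdot> (Counit B \<bullet>\<^sub>a \<langle>?V\<rangle>) \<cdot> (\<langle>b\<rangle> \<bullet>\<^sub>a ir) \<cdot> \<sigma> (a\<^sup>-) b)"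
    by (simp add: circ.comp_assoc')
  also have "\<dots> = (w \<circle>\<^sub>a \<langle>?V\<rangle>) \<cdot> (iV \<cdot> ir) \<cdot> r\<^sub>b (a\<^sup>-) \<cdot> (\<langle>a\<^sup>-\<rangle> \<bullet>\<^sub>a Counit B)"
    unfolding unit by (simp add: circ.comp_assoc')
  also have "iV \<cdot> ir = (\<langle>I\<rangle> \<circle>\<^sub>a ir) \<cdot> inv\<^sub>a (l\<^sub>c (a\<^sup>-))"
    unfolding iV_def by (subst circ.lunit_inv_natural) simp_all
  also have "(inv\<^sub>a (a\<^sub>b a b I) \<circle>\<^sub>a \<langle>J\<rangle>) \<cdot> ((Mult A \<bullet>\<^sub>a \<langle>b \<bullet> I\<rangle>) \<circle>\<^sub>a \<langle>J\<rangle>) \<cdot> \<delta> a (b \<bullet> I) a J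
      \<cdot> (\<langle>a\<rangle> \<bullet>\<^sub>a ((w \<circle>\<^sub>a \<langle>?V\<rangle>) \<cdot> ((\<langle>I\<rangle> \<circle>\<^sub>a ir) \<cdot> inv\<^sub>a (l\<^sub>c (a\<^sup>-))) \<cdot> r\<^sub>b (a\<^sup>-) \<cdot> (\<langle>a\<^sup>-\<rangle> \<bullet>\<^sub>a Counit B)))
      \<cdot> a\<^sub>b a (a\<^sup>-) b \<cdot> (fa \<bullet>\<^sub>a \<langle>b\<rangle>)
    = (inv\<^sub>a (a\<^sub>b a b I) \<circle>\<^sub>a \<langle>J\<rangle>) \<cdot> ((Mult A \<bullet>\<^sub>a \<langle>b \<bullet> I\<rangle>) \<circle>\<^sub>a \<langle>J\<rangle>)
      \<cdot> (\<delta> a (b \<bullet> I) a J \<cdot> (\<langle>a\<rangle> \<bullet>\<^sub>a (w \<circle>\<^sub>a (\<langle>a\<^sup>-\<rangle> \<bullet>\<^sub>a \<langle>J\<rangle>))))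
      \<cdot> (\<langle>a\<rangle> \<bullet>\<^sub>a ((\<langle>I\<rangle> \<circle>\<^sub>a ir) \<cdot> inv\<^sub>a (l\<^sub>c (a\<^sup>-)))) \<cdot> (\<langle>a\<rangle> \<bullet>\<^sub>a r\<^sub>b (a\<^sup>-))
      \<cdot> ((\<langle>a\<rangle> \<bullet>\<^sub>a (\<langle>a\<^sup>-\<rangle> \<bullet>\<^sub>a Counit B)) \<cdot> a\<^sub>b a (a\<^sup>-) b) \<cdot> (fa \<bullet>\<^sub>a \<langle>b\<rangle>)"
    by (simp add: merges)
  \<comment> \<open>\<open>w\<close> leaves the outer \<open>\<delta>\<close> again; with second
    argument \<open>I\<close> and the units already in place, that \<open>\<delta>\<close> becomes
    \<open>\<phi> a a\<close>.\<close>
  also have "\<delta> a (b \<bullet> I) a J \<cdot> (\<langle>a\<rangle> \<bullet>\<^sub>a (w \<circle>\<^sub>a (\<langle>a\<^sup>-\<rangle> \<bullet>\<^sub>a \<langle>J\<rangle>))) = ((\<langle>a \<circle> a\<rangle> \<bullet>\<^sub>a w) \<circle>\<^sub>a \<langle>J\<rangle>) \<cdot> \<delta> a I a J"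
    by (subst delta_natural') simp_all
  also have "(\<langle>a\<rangle> \<bullet>\<^sub>a (\<langle>a\<^sup>-\<rangle> \<bullet>\<^sub>a Counit B)) \<cdot> a\<^sub>b a (a\<^sup>-) b = a\<^sub>b a (a\<^sup>-) J \<cdot> ((\<langle>a\<rangle> \<bullet>\<^sub>a \<langle>a\<^sup>-\<rangle>) \<bullet>\<^sub>a Counit B)"
    by (subst bul.assoc_natural') simp_all
  also have "(inv\<^sub>a (a\<^sub>b a b I) \<circle>\<^sub>a \<langle>J\<rangle>) \<cdot> ((Mult A \<bullet>\<^sub>a \<langle>b \<bullet> I\<rangle>) \<circle>\<^sub>a \<langle>J\<rangle>)
      \<cdot> (((\<langle>a \<circle> a\<rangle> \<bullet>\<^sub>a w) \<circle>\<^sub>a \<langle>J\<rangle>) \<cdot> \<delta> a I a J)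
      \<cdot> (\<langle>a\<rangle> \<bullet>\<^sub>a ((\<langle>I\<rangle> \<circle>\<^sub>a ir) \<cdot> inv\<^sub>a (l\<^sub>c (a\<^sup>-)))) \<cdot> (\<langle>a\<rangle> \<bullet>\<^sub>a r\<^sub>b (a\<^sup>-))
      \<cdot> (a\<^sub>b a (a\<^sup>-) J \<cdot> ((\<langle>a\<rangle> \<bullet>\<^sub>a \<langle>a\<^sup>-\<rangle>) \<bullet>\<^sub>a Counit B)) \<cdot> (fa \<bullet>\<^sub>a \<langle>b\<rangle>)
    = ((inv\<^sub>a (a\<^sub>b a b I) \<cdot> (Mult A \<bullet>\<^sub>a w)) \<circle>\<^sub>a \<langle>J\<rangle>) \<cdot> \<phi> a a
      \<cdot> ((\<langle>a\<rangle> \<bullet>\<^sub>a r\<^sub>b (a\<^sup>-)) \<cdot> a\<^sub>b a (a\<^sup>-) J) \<cdot> (fa \<bullet>\<^sub>a Counit B)"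
    by (simp add: merges phi_eq ir_def)
  also have "\<dots> = ((inv\<^sub>a (a\<^sub>b a b I) \<cdot> (Mult A \<bullet>\<^sub>a w)) \<circle>\<^sub>a \<langle>J\<rangle>) \<cdot> \<phi> a a
      \<cdot> (r\<^sub>b (a \<bullet> a\<^sup>-) \<cdot> (fa \<bullet>\<^sub>a \<langle>J\<rangle>)) \<cdot> (\<langle>a\<rangle> \<bullet>\<^sub>a Counit B)"
    by (simp add: bul.runit_tensor merges)
  also have "\<dots> = ((inv\<^sub>a (a\<^sub>b a b I) \<cdot> (\<langle>a\<rangle> \<bullet>\<^sub>a w)) \<circle>\<^sub>a \<langle>J\<rangle>)
      \<cdot> ((((Mult A \<bullet>\<^sub>a \<langle>I\<rangle>) \<circle>\<^sub>a \<langle>J\<rangle>) \<cdot> \<phi> a a \<cdot> (\<langle>a\<rangle> \<bullet>\<^sub>a S) \<cdot> Comult A) \<cdot> r\<^sub>b a \<cdot> (\<langle>a\<rangle> \<bullet>\<^sub>a Counit B))"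
    by (subst bul.runit_natural') (simp_all add: merges fa_def)
  \<comment> \<open>The antipode equation of \<open>A\<close>; afterwards only units and counits of
    the two factors have to be combined into those of \<open>?P\<close>.\<close>
  also have "\<dots> = ((inv\<^sub>a (a\<^sub>b a b I) \<cdot> (Uni A \<bullet>\<^sub>a (Uni B \<bullet>\<^sub>a \<langle>I\<rangle>)) \<cdot> (\<langle>I\<rangle> \<bullet>\<^sub>a \<Delta>\<^sub>I) \<cdot> \<Delta>\<^sub>I) \<circle>\<^sub>a \<langle>J\<rangle>)
      \<cdot> inv\<^sub>a (l\<^sub>c J) \<cdot> (Counit A \<cdot> r\<^sub>b a) \<cdot> (\<langle>a\<rangle> \<bullet>\<^sub>a Counit B)"
    unfolding eqA by (simp add: merges w_def)
  also have "Counit A \<cdot> r\<^sub>b a = l\<^sub>b J \<cdot> (Counit A \<bullet>\<^sub>a \<langle>J\<rangle>)"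
    unfolding bul.lunit_unit by (subst bul.runit_natural') simp_all
  also have "inv\<^sub>a (a\<^sub>b a b I) \<cdot> (Uni A \<bullet>\<^sub>a (Uni B \<bullet>\<^sub>a \<langle>I\<rangle>)) \<cdot> (\<langle>I\<rangle> \<bullet>\<^sub>a \<Delta>\<^sub>I) \<cdot> \<Delta>\<^sub>I
    = (inv\<^sub>a (a\<^sub>b a b I) \<cdot> (Uni A \<bullet>\<^sub>a (Uni B \<bullet>\<^sub>a \<langle>I\<rangle>))) \<cdot> a\<^sub>b I I I \<cdot> (\<Delta>\<^sub>I \<bullet>\<^sub>a \<langle>I\<rangle>) \<cdot> \<Delta>\<^sub>I"
    by (simp add: DeltaI_coassoc circ.comp_assoc')
  also have "\<dots> = (Uni ?P \<bullet>\<^sub>a \<langle>I\<rangle>) \<cdot> \<Delta>\<^sub>I"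
    by (subst bul.assoc_inv_natural) (simp_all add: merges)
  finally have "((Mult ?P \<bullet>\<^sub>a \<langle>I\<rangle>) \<circle>\<^sub>a \<langle>J\<rangle>) \<cdot> \<phi> ?ab ?ab \<cdot> (\<langle>?ab\<rangle> \<bullet>\<^sub>a ?\<Sigma>) \<cdot> Comult ?P
    = ((Uni ?P \<bullet>\<^sub>a \<langle>I\<rangle>) \<circle>\<^sub>a \<langle>J\<rangle>) \<cdot> (\<Delta>\<^sub>I \<circle>\<^sub>a \<langle>J\<rangle>) \<cdot> inv\<^sub>a (l\<^sub>c J) \<cdot> Counit ?P"
    by (simp add: merges)
  then show ?thesis
    by (simp add: antipode1_def circ.in_hom_iff)
qed

end


section \<open>Reversing both tensor products\<close>

lemma rev_tensor_simps [simp]: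
  "Tob (rev_tensor C T) X Y = Tob T Y X" "Tar (rev_tensor C T) f g = Tar T g f"
  "Unit (rev_tensor C T) = Unit T" "Assoc (rev_tensor C T) X Y Z = inv_arrow C (Assoc T Z Y X)"
  "LUnit (rev_tensor C T) = RUnit T" "RUnit (rev_tensor C T) = LUnit T"
  by (simp_all add: rev_tensor_def)

context monoidal_category
begin

text \<open>Pentagon and triangle for the inverse associators involve constraints only, so the words
  on both sides are empty.\<close>

lemma monoidal_rev_tensor: "monoidal_category C (rev_tensor C T)"
proof
  fix X Y Z W
  assume [simp]: "X \<in> Ob C" "Y \<in> Ob C" "Z \<in> Ob C" "W \<in> Ob C"
  let ?x = "Lf X" and ?y = "Lf Y" and ?z = "Lf Z" and ?w = "Lf W"
  have "tm_ar (AsI ?w ?z ?y \<otimes>\<^sub>t IdT ?x \<oslash> AsI ?w (Nd ?z ?y) ?x \<oslash> IdT ?w \<otimes>\<^sub>t AsI ?z ?y ?x)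
    = tm_ar (AsI (Nd ?w ?z) ?y ?x \<oslash> AsI ?w ?z (Nd ?y ?x))"
    by (subst tm_eq_iff_word_eq) (simp_all add: word_eq_refl)
  then show "Comp C (Tar (rev_tensor C T) (Ident C X) (Assoc (rev_tensor C T) Y Z W))
      (Comp C (Assoc (rev_tensor C T) X (Tob (rev_tensor C T) Y Z) W)
        (Tar (rev_tensor C T) (Assoc (rev_tensor C T) X Y Z) (Ident C W)))
    = Comp C (Assoc (rev_tensor C T) X Y (Tob (rev_tensor C T) Z W)) (Assoc (rev_tensor C T) (Tob (rev_tensor C T) X Y) Z W)"
    by simp
next
  fix X Y
  assume [simp]: "X \<in> Ob C" "Y \<in> Ob C"
  have "tm_ar (RU (Lf Y) \<otimes>\<^sub>t IdT (Lf X) \<oslash> AsI (Lf Y) Em (Lf X)) = tm_ar (IdT (Lf Y) \<otimes>\<^sub>t LU (Lf X))"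
    by (subst tm_eq_iff_word_eq) (simp_all add: word_eq_refl)
  then show "Comp C (Tar (rev_tensor C T) (Ident C X) (LUnit (rev_tensor C T) Y)) (Assoc (rev_tensor C T) X (Unit (rev_tensor C T)) Y)
    = Tar (rev_tensor C T) (RUnit (rev_tensor C T) X) (Ident C Y)"
    by simp
qed (auto simp: in_hom_iff tensor_comp' assoc_inv_natural lunit_natural' runit_natural')

lemma monoid_in_rev_tensor:
  assumes "monoid_in C T M m u"
  shows "monoid_in C (rev_tensor C T) M m u"
proof -
  have [simp]: "M \<in> Ob C" "m \<in> Arr C" "Dom C m = M \<otimes>\<^sub>o M" "Cod C m = M"
    using assms by (auto simp: monoid_in_def in_hom_iff)
  have "m \<odot> (idt M \<otimes>\<^sub>a m) = (m \<odot> (idt M \<otimes>\<^sub>a m) \<odot> Assoc T M M M) \<odot> inv_of (Assoc T M M M)"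
    by (simp add: comp_assoc')
  also have "\<dots> = m \<odot> (m \<otimes>\<^sub>a idt M) \<odot> inv_of (Assoc T M M M)"
    using assms by (simp add: monoid_in_def flip: comp_assoc')
  finally show ?thesis
    using assms by (simp add: monoid_in_def)
qed

lemma comonoid_in_rev_tensor:
  assumes "comonoid_in C T M d e"
  shows "comonoid_in C (rev_tensor C T) M d e"
proof -
  have [simp]: "M \<in> Ob C" "d \<in> Arr C" "Dom C d = M" "Cod C d = M \<otimes>\<^sub>o M"
    using assms by (auto simp: comonoid_in_def in_hom_iff)
  have "inv_of (Assoc T M M M) \<odot> (idt M \<otimes>\<^sub>a d) \<odot> d
    = inv_of (Assoc T M M M) \<odot> Assoc T M M M \<odot> (d \<otimes>\<^sub>a idt M) \<odot> d"
    using assms by (simp add: comonoid_in_def)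
  also have "\<dots> = (d \<otimes>\<^sub>a idt M) \<odot> d"
    by simp
  finally have "inv_of (Assoc T M M M) \<odot> (idt M \<otimes>\<^sub>a d) \<odot> d = (d \<otimes>\<^sub>a idt M) \<odot> d" .
  then show ?thesis
    using assms by (simp add: comonoid_in_def)
qed

end

context braided_monoidal_category
begin

text \<open>Reversal exchanges the two hexagons. The given braiding with its arguments swapped
  already has the right type, so no inverse braiding enters.\<close>

lemma braided_rev_tensor: "braided_monoidal_category C (rev_tensor C T) (\<lambda>X Y. s Y X)"
proof -
  interpret R: monoidal_category C "rev_tensor C T"
    by (rule monoidal_rev_tensor)
  show ?thesis
  proof
    fix X Y Z
    assume [simp]: "X \<in> Ob C" "Y \<in> Ob C" "Z \<in> Ob C"
    show "Assoc (rev_tensor C T) Y Z X \<odot> s (Tob (rev_tensor C T) Y Z) X \<odot> Assoc (rev_tensor C T) X Y Z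
      = Tar (rev_tensor C T) (idt Y) (s Z X) \<odot> Assoc (rev_tensor C T) Y X Z \<odot> Tar (rev_tensor C T) (s Y X) (idt Z)"
      using hexagon2[of Z Y X] by simp
    show "inv_of (Assoc (rev_tensor C T) Z X Y) \<odot> s Z (Tob (rev_tensor C T) X Y) \<odot> inv_of (Assoc (rev_tensor C T) X Y Z)
      = Tar (rev_tensor C T) (s Z X) (idt Y) \<odot> inv_of (Assoc (rev_tensor C T) X Z Y) \<odot> Tar (rev_tensor C T) (idt X) (s Z Y)"
      using hexagon1[of Z Y X] by simp
  qed (auto simp: in_hom_iff braiding_natural')
qed

text \<open>The two interchanges contain the same crossing and differ by rebracketing only, so they
  have the same word.\<close>

lemma mid_rev_tensor:
  assumes [simp]: "P \<in> Ob C" "P' \<in> Ob C" "Q \<in> Ob C" "Q' \<in> Ob C"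
  shows "braided_monoidal_category.mid C (rev_tensor C T) (\<lambda>X Y. s Y X) P P' Q Q' = mid Q' Q P' P"
proof -
  interpret R: braided_monoidal_category C "rev_tensor C T" "\<lambda>X Y. s Y X"
    by (rule braided_rev_tensor)
  let ?p = "Lf P" and ?p' = "Lf P'" and ?q = "Lf Q" and ?q' = "Lf Q'"
  have "tm_ar (As (Nd ?q' ?p') ?q ?p \<oslash> AsI ?q' ?p' ?q \<otimes>\<^sub>t IdT ?p \<oslash> (IdT ?q' \<otimes>\<^sub>t br ?q ?p') \<otimes>\<^sub>t IdT ?p
      \<oslash> As ?q' ?q ?p' \<otimes>\<^sub>t IdT ?p \<oslash> AsI (Nd ?q' ?q) ?p' ?p)
    = tm_ar (midt ?q' ?q ?p' ?p)"
    by (subst tm_eq_iff_word_eq) (simp_all add: word_eq_refl)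
  then show ?thesis
    by (simp add: R.mid_def)
qed

end

definition rev_duoidal :: "('o, 'm) duoidal_data \<Rightarrow> ('o, 'm) duoidal_data" where
  "rev_duoidal D = \<lparr>Cat = Cat D, Circ = rev_tensor (Cat D) (Circ D), Bul = rev_tensor (Cat D) (Bul D),
     Zeta = (\<lambda>A B C E. Zeta D E C B A), DeltaI = DeltaI D, MJ = MJ D, EpsI = EpsI D\<rparr>"

text \<open>The domain of \<open>\<gamma>\<close> read backwards is the domain of
  \<open>\<delta>\<close> with its four objects in reverse order, and likewise for the codomains;
  hence the two families change places while the functor stays the same.\<close>

definition rev_reversion :: "('o, 'm) reversion_data \<Rightarrow> ('o, 'm) reversion_data" where
  "rev_reversion R = \<lparr>Rob = Rob R, Rar = Rar R,
     PhiCirc = (\<lambda>X Y. PhiCirc R Y X), PhiCirc0 = PhiCirc0 R,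
     PhiBul = (\<lambda>X Y. PhiBul R Y X), PhiBul0 = PhiBul0 R,
     Gamma = (\<lambda>X Y Z T. Delta R T Z Y X), Delta = (\<lambda>X Y Z T. Gamma R T Z Y X),
     GammaTilde = (\<lambda>X Y Z T. DeltaTilde R T Z Y X), DeltaTilde = (\<lambda>X Y Z T. GammaTilde R T Z Y X)\<rparr>"

lemma rev_duoidal_simps [simp]:
  "Cat (rev_duoidal D) = Cat D" "Circ (rev_duoidal D) = rev_tensor (Cat D) (Circ D)"
  "Bul (rev_duoidal D) = rev_tensor (Cat D) (Bul D)" "Zeta (rev_duoidal D) A B C E = Zeta D E C B A"
  "DeltaI (rev_duoidal D) = DeltaI D" "MJ (rev_duoidal D) = MJ D" "EpsI (rev_duoidal D) = EpsI D"
  by (simp_all add: rev_duoidal_def)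

lemma rev_reversion_simps [simp]:
  "Rob (rev_reversion R) = Rob R" "Rar (rev_reversion R) = Rar R"
  "PhiCirc (rev_reversion R) X Y = PhiCirc R Y X" "PhiCirc0 (rev_reversion R) = PhiCirc0 R"
  "PhiBul (rev_reversion R) X Y = PhiBul R Y X" "PhiBul0 (rev_reversion R) = PhiBul0 R"
  "Gamma (rev_reversion R) X Y Z T = Delta R T Z Y X" "Delta (rev_reversion R) X Y Z T = Gamma R T Z Y X"
  by (simp_all add: rev_reversion_def)

context duoidal_category
begin

text \<open>Reversal inverts associators, so associativity of \<open>\<zeta>\<close> is required in
  this transposed form.\<close>

lemma zeta_circ_assoc_inv:
  assumes [simp]: "ob A" "ob B" "ob C" "ob E" "ob F" "ob G"
  shows "\<zeta> (A \<circle> C) (B \<circle> E) F G \<cdot> (\<zeta> A B C E \<circle>\<^sub>a \<langle>F \<bullet> G\<rangle>) \<cdot> inv\<^sub>a (a\<^sub>c (A \<bullet> B) (C \<bullet> E) (F \<bullet> G))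
    = (inv\<^sub>a (a\<^sub>c A C F) \<bullet>\<^sub>a inv\<^sub>a (a\<^sub>c B E G)) \<cdot> \<zeta> A B (C \<circle> F) (E \<circle> G) \<cdot> (\<langle>A \<bullet> B\<rangle> \<circle>\<^sub>a \<zeta> C E F G)"
proof -
  have "inv\<^sub>a (a\<^sub>c A C F \<bullet>\<^sub>a a\<^sub>c B E G) \<cdot> \<zeta> A B (C \<circle> F) (E \<circle> G) \<cdot> (\<langle>A \<bullet> B\<rangle> \<circle>\<^sub>a \<zeta> C E F G)
    = (\<zeta> (A \<circle> C) (B \<circle> E) F G \<cdot> (\<zeta> A B C E \<circle>\<^sub>a \<langle>F \<bullet> G\<rangle>)) \<cdot> inv\<^sub>a (a\<^sub>c (A \<bullet> B) (C \<bullet> E) (F \<bullet> G))"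
    by (rule circ.inv_natural) (simp_all add: circ.comp_assoc' zeta_circ_assoc)
  then show ?thesis
    by (simp add: bul.inv_tensor circ.comp_assoc')
qed

lemma duoidal_rev: "duoidal_category (rev_duoidal D)"
  using J_monoid I_comonoid
  by (intro duoidal_category.intro)
    (auto simp: circ.monoidal_rev_tensor bul.monoidal_rev_tensor circ.monoid_in_rev_tensor
      bul.comonoid_in_rev_tensor circ.in_hom_iff zeta_natural' zeta_circ_assoc_inv zeta_assoc_inv
      circ.comp_assoc' zeta_circ_lunit zeta_circ_runit zeta_bul_lunit zeta_bul_runit)

lemma bimonoid_rev:
  assumes [simp]: "bimonoid A"
  shows "duoidal_ops.bimonoid (rev_duoidal D) A"
proof -
  have "monoid_in (Cat D) (Circ D) (Carrier A) (Mult A) (Uni A)"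
    "comonoid_in (Cat D) (Bul D) (Carrier A) (Comult A) (Counit A)"
    using assms by (simp_all add: bimonoid_def)
  then show ?thesis
    by (simp add: duoidal_ops.bimonoid_def[of "rev_duoidal D"] circ.monoid_in_rev_tensor bul.comonoid_in_rev_tensor bimonoid_compat)
qed

text \<open>Reversal replaces \<open>l\<^sub>b J\<close> by \<open>r\<^sub>b J\<close> in
  \<open>\<Delta>\<^sub>J\<close>, and these two constraints agree.\<close>

lemma unit_bimonoid_rev: "duoidal_ops.unit_bimonoid (rev_duoidal D) = unit_bimonoid"
  by (simp add: duoidal_ops.unit_bimonoid_def bul.lunit_unit)

end

context bullet_braided_duoidal_category
begin

lemma bullet_braided_rev: "bullet_braided_duoidal_category (rev_duoidal D) (\<lambda>X Y. \<sigma> Y X)"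
  by (intro bullet_braided_duoidal_category.intro bullet_braided_duoidal_category_axioms.intro duoidal_rev)
    (simp_all add: bul.braided_rev_tensor braiding_zeta braiding_DeltaI)

text \<open>\<open>mid_rev_tensor\<close> identifies the structural parts of the two
  comultiplications once the factors are exchanged. Both antipode equations of a tensor product
  therefore concern the same structure maps.\<close>

lemma bimonoid_tensor_rev:
  assumes [simp]: "bimonoid A" "bimonoid B"
  shows "duoidal_braiding_ops.bimonoid_tensor (rev_duoidal D) (\<lambda>X Y. \<sigma> Y X) B A = bimonoid_tensor A B"
proof -
  interpret R: bullet_braided_duoidal_category "rev_duoidal D" "\<lambda>X Y. \<sigma> Y X"
    by (rule bullet_braided_rev)
  have "Comult (R.bimonoid_tensor B A) = Comult (bimonoid_tensor A B)"
    by (simp add: R.Comult_bimonoid_tensor[OF bimonoid_rev bimonoid_rev] bul.mid_rev_tensor)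
  moreover have "Counit (R.bimonoid_tensor B A) = Counit (bimonoid_tensor A B)"
    by (simp add: bul.lunit_unit)
  ultimately show ?thesis
    by (intro bimonoid_data.equality) simp_all
qed

end


section \<open>Tensor products of Hopf monoids\<close>

locale braided_duoidal_reversion = bullet_braided_duoidal_category D \<sigma> + duoidal_reversion D R
  for D :: "('o, 'm) duoidal_data" and \<sigma> :: "'o \<Rightarrow> 'o \<Rightarrow> 'm" and R :: "('o, 'm) reversion_data"

context duoidal_reversion
begin

sublocale circ_lax: lax_monoidal_endofunctor "Cat D" "Rob R" "Rar R" "rev_tensor (Cat D) (Circ D)" "Circ D" \<phi>\<^sub>c \<phi>\<^sub>c\<^sub>0
  by (rule rev_lax_circ)

sublocale bul_lax: lax_monoidal_endofunctor "Cat D" "Rob R" "Rar R" "rev_tensor (Cat D) (Bul D)" "Bul D" \<phi>\<^sub>b \<phi>\<^sub>b\<^sub>0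
  by (rule rev_lax_bul)

sublocale frag: reversion_fragment D R
  using circ_lax.lax_unit_hom bul_lax.lax_unit_hom bul_lax.lax_hom
  by unfold_locales
    (auto simp: circ_lax.map_ob circ_lax.map_ident
      intro: gamma_hom delta_hom gamma_natural delta_natural R1 R5 R6 R14 R18)

text \<open>Associators are inverted by reversal, so R3, R5 and R13 are restated here with some of
  them moved to the other side, in the form that R1, R5 and R14 take for the reversed data. R7 and
  R17 contain no associators and can be taken as they are.\<close>

lemma R3_inv:
  assumes [simp]: "ob X" "ob Y" "ob Z" "ob T" "ob U" "ob V"
  shows "\<delta> (X \<circle> Z) (Y \<circle> T) U V \<cdot> (\<langle>X \<circle> Z\<rangle> \<bullet>\<^sub>a inv\<^sub>a (a\<^sub>c Y T (U\<^sup>- \<bullet> V))) \<cdot> \<zeta> X Y Z (T \<circle> (U\<^sup>- \<bullet> V))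
    = ((inv\<^sub>a (a\<^sub>c X Z U) \<bullet>\<^sub>a \<langle>Y \<circle> T\<rangle>) \<circle>\<^sub>a \<langle>V\<rangle>) \<cdot> (\<zeta> X Y (Z \<circle> U) T \<circle>\<^sub>a \<langle>V\<rangle>) \<cdot> inv\<^sub>a (a\<^sub>c (X \<bullet> Y) ((Z \<circle> U) \<bullet> T) V)
      \<cdot> (\<langle>X \<bullet> Y\<rangle> \<circle>\<^sub>a \<delta> Z T U V)"
  unfolding R3[OF assms, symmetric] by (simp add: merges)

lemma R5_inv:
  assumes [simp]: "ob X" "ob Y" "ob Z" "ob T" "ob U" "ob V"
  shows "\<gamma> ((X \<circle> T) \<bullet> Y) Z U V \<cdot> ((inv\<^sub>a (a\<^sub>b (X \<circle> T) Y (Z\<^sup>-)) \<circle>\<^sub>a \<langle>U\<rangle>) \<bullet>\<^sub>a \<langle>V\<rangle>)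
      \<cdot> (\<delta> X (Y \<bullet> Z\<^sup>-) T U \<bullet>\<^sub>a \<langle>V\<rangle>) \<cdot> inv\<^sub>a (a\<^sub>b X ((Y \<bullet> Z\<^sup>-) \<circle> (T\<^sup>- \<bullet> U)) V)
    = \<delta> X Y T (U \<bullet> (Z \<circle> V)) \<cdot> (\<langle>X\<rangle> \<bullet>\<^sub>a (\<langle>Y\<rangle> \<circle>\<^sub>a a\<^sub>b (T\<^sup>-) U (Z \<circle> V))) \<cdot> (\<langle>X\<rangle> \<bullet>\<^sub>a \<gamma> Y Z (T\<^sup>- \<bullet> U) V)"
    (is "?l = ?r")
proof -
  let ?a = "a\<^sub>b X ((Y \<bullet> Z\<^sup>-) \<circle> (T\<^sup>- \<bullet> U)) V"
  have "?l = (\<gamma> ((X \<circle> T) \<bullet> Y) Z U V \<cdot> ((inv\<^sub>a (a\<^sub>b (X \<circle> T) Y (Z\<^sup>-)) \<circle>\<^sub>a \<langle>U\<rangle>) \<bullet>\<^sub>a \<langle>V\<rangle>)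
      \<cdot> (\<delta> X (Y \<bullet> Z\<^sup>-) T U \<bullet>\<^sub>a \<langle>V\<rangle>)) \<cdot> inv\<^sub>a ?a"
    by (simp add: circ.comp_assoc')
  also have "\<dots> = ?r"
    unfolding R5[OF assms, symmetric] by (simp add: circ.comp_assoc')
  finally show ?thesis .
qed

lemma R13_inv:
  assumes [simp]: "ob X" "ob Y" "ob Z" "ob T" "ob U" "ob V"
  shows "\<gamma> X Y (T \<bullet> (Z \<circle> U)) V \<cdot> (\<gamma> (X \<bullet> Y\<^sup>-) Z T U \<bullet>\<^sub>a \<langle>V\<rangle>)
    = (\<langle>X\<rangle> \<circle>\<^sub>a inv\<^sub>a (a\<^sub>b T (Z \<circle> U) (Y \<circle> V))) \<cdot> (\<langle>X\<rangle> \<circle>\<^sub>a (\<langle>T\<rangle> \<bullet>\<^sub>a \<zeta> Z Y U V)) \<cdot> \<gamma> X (Z \<bullet> Y) T (U \<bullet> V)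
        \<cdot> (((\<langle>X\<rangle> \<bullet>\<^sub>a \<phi>\<^sub>b Y Z) \<circle>\<^sub>a \<langle>T\<rangle>) \<bullet>\<^sub>a \<langle>U \<bullet> V\<rangle>)
        \<cdot> ((a\<^sub>b X (Y\<^sup>-) (Z\<^sup>-) \<circle>\<^sub>a \<langle>T\<rangle>) \<bullet>\<^sub>a \<langle>U \<bullet> V\<rangle>) \<cdot> a\<^sub>b (((X \<bullet> Y\<^sup>-) \<bullet> Z\<^sup>-) \<circle> T) U V"
  unfolding R13[OF assms, symmetric] by (simp add: merges)

lemma fragment_rev: "reversion_fragment (rev_duoidal D) (rev_reversion R)"
proof -
  interpret R: duoidal_category "rev_duoidal D"
    by (rule duoidal_rev)
  show ?thesis
    using circ_lax.lax_unit_hom bul_lax.lax_unit_hom bul_lax.lax_hom R7 R17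
    by unfold_locales
      (auto simp: circ_lax.map_ident R3_inv R5_inv R13_inv bul.lunit_unit
        intro: gamma_hom delta_hom gamma_natural delta_natural)
qed

lemma phi_rev: "reversion_ops.\<phi> (rev_duoidal D) (rev_reversion R) X Y = \<psi> Y X"
  by (simp add: reversion_ops.\<phi>_def \<psi>_def)

lemma antipode_iff:
  "antipode A S \<longleftrightarrow> antipode1 A S \<and> reversion_ops.antipode1 (rev_duoidal D) (rev_reversion R) A S"
  by (auto simp: antipode_def Let_def antipode1_def reversion_ops.antipode1_def phi_rev)

lemma hopf_unit: "hopf_monoid unit_bimonoid"
proof -
  interpret R: reversion_fragment "rev_duoidal D" "rev_reversion R"
    by (rule fragment_rev)
  have "antipode unit_bimonoid \<phi>\<^sub>b\<^sub>0"
    using frag.antipode1_unit R.antipode1_unit by (simp add: antipode_iff unit_bimonoid_rev)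
  then show ?thesis
    using bimonoid_unit by (auto simp: hopf_monoid_def)
qed

end

context braided_duoidal_reversion
begin

lemma hopf_tensor:
  assumes "hopf_monoid A" "hopf_monoid B"
  shows "hopf_monoid (bimonoid_tensor A B)"
proof -
  interpret F: braided_reversion_fragment D \<sigma> R ..
  interpret R0: bullet_braided_duoidal_category "rev_duoidal D" "\<lambda>X Y. \<sigma> Y X"
    by (rule bullet_braided_rev)
  interpret R1: reversion_fragment "rev_duoidal D" "rev_reversion R"
    by (rule fragment_rev)
  interpret R: braided_reversion_fragment "rev_duoidal D" "\<lambda>X Y. \<sigma> Y X" "rev_reversion R" ..
  obtain S U where A: "bimonoid A" "antipode A S" and B: "bimonoid B" "antipode B U"
    using assms by (auto simp: hopf_monoid_def)
  \<comment> \<open>The reversed instance takes \<open>B\<close> before \<open>A\<close>. Since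
    \<open>\<phi>\<^sub>b\<close>, \<open>\<sigma>\<close> and the tensor product of arrows are
    reversed as well, it yields the same arrow as the direct instance, so a single arrow satisfies
    both equations.\<close>
  have "antipode (bimonoid_tensor A B)
    (\<phi>\<^sub>b (Carrier B) (Carrier A) \<cdot> \<sigma> ((Carrier A)\<^sup>-) ((Carrier B)\<^sup>-) \<cdot> (S \<bullet>\<^sub>a U))"
    using F.antipode1_tensor[of A S B U] R.antipode1_tensor[of B U A S] A B
    by (simp add: antipode_iff bimonoid_rev bimonoid_tensor_rev)
  then show ?thesis
    using bimonoid_tensor_bimonoid[OF A(1) B(1)] by (auto simp: hopf_monoid_def)
qed

lemma monoidal_hopf_category: "monoidal_category hopf_category bimonoid_tensor_data"
proof -
  interpret M: monoidal_category bimonoid_category bimonoid_tensor_data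
    by (rule monoidal_bimonoid_category)
  show ?thesis
    unfolding hopf_category_def
    by (rule M.monoidal_full_subcategory) (simp_all add: bimonoid_tensor_data_def hopf_tensor hopf_unit)
qed

end

theorem proposition3p2:
  fixes D :: "('o, 'm) duoidal_data"
    and \<sigma> :: "'o \<Rightarrow> 'o \<Rightarrow> 'm"
    and R :: "('o, 'm) reversion_data"
  assumes "bullet_braided_duoidal_category D \<sigma>"
    and "duoidal_reversion D R"
  shows "(\<forall>A B. reversion_ops.hopf_monoid D R A \<and> reversion_ops.hopf_monoid D R B
            \<longrightarrow> reversion_ops.hopf_monoid D R (duoidal_braiding_ops.bimonoid_tensor D \<sigma> A B))
       \<and> monoidal_category (reversion_ops.hopf_category D R)
           (duoidal_braiding_ops.bimonoid_tensor_data D \<sigma>)"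
proof -
  interpret braided_duoidal_reversion D \<sigma> R
    using assms by (rule braided_duoidal_reversion.intro)
  show ?thesis
    using hopf_tensor monoidal_hopf_category by blast
qed

end
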